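(* Let $\Bbbk$ be an algebraically closed field of characteristic $0$, and let $X\subset\mathbb{P}^{n+e}_{\Bbbk}$ be a non-degenerate algebraic set of dimension $n$ (so of codimension $e$). Suppose that $X$ satisfies property $\mathbf{N}_{d,e}$ for some $d\ge2$. Then $$\deg(X)\le\binom{d-1+e}{e},$$ and the following are equivalent: (a) $\deg(X)=\binom{d-1+e}{e}$; (b) $X$ is arithmetically Cohen-Macaulay with $d$-linear resolution.
   Context: An algebraic set is a reduced closed subscheme of projective space, possibly reducible; non-degenerate means not contained in a hyperplane. Let $R=\Bbbk[x_0,\dots,x_{n+e}]$ and $I_X=\bigoplus_{m\ge0}H^0(\mathcal{I}_{X/\mathbb{P}^{n+e}}(m))\subset R$; dimension and degree are defined via the Hilbert polynomial of $R/I_X$. Graded Betti numbers: $\beta_{i,j}(X):=\dim_{\Bbbk}\operatorname{Tor}^R_i(R/I_X,\Bbbk)_{i+j}$. $X$ satisfies property $\mathbf{N}_{d,p}$ ($d\ge2$, $p\ge1$) if $\beta_{i,j}(X)=0$ for all $i\le p$ and all $j\ge d$. $X$ is arithmetically Cohen-Macaulay if $\operatorname{depth}(R/I_X)=\dim X+1$, and has $d$-linear resolution if $\beta_{i,j}(X)=0$ for all $i\ge1$ and $j\ne d-1$. *)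

theory Defs
  imports
    "HOL-Library.Poly_Mapping"
    "HOL-Library.Function_Algebras"
    "HOL-Library.Extended_Nat"
    "HOL-Computational_Algebra.Polynomial"
begin

section \<open>The graded polynomial ring\<close>

type_synonym 'k mpoly = "(nat \<Rightarrow>\<^sub>0 nat) \<Rightarrow>\<^sub>0 'k"

definition mon_degree :: "(nat \<Rightarrow>\<^sub>0 nat) \<Rightarrow> nat" where
  "mon_degree t = (\<Sum>i\<in>Poly_Mapping.keys t. Poly_Mapping.lookup t i)"

text \<open>The type \<^typ>\<open>'k mpoly\<close> has variables \<open>x\<^sub>i\<close> for all naturals \<open>i\<close>. The ring
  \<open>R = k[x\<^sub>0, \<dots>, x\<^sub>N]\<close> is carved out as a subset.\<close>

definition poly_ring :: "nat \<Rightarrow> 'k::comm_ring_1 mpoly set" where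
  "poly_ring N = {p. \<forall>t\<in>Poly_Mapping.keys p. Poly_Mapping.keys t \<subseteq> {..N}}"

text \<open>Degrees are integers, so that twists \<open>R(-a)\<close> by arbitrary integers \<open>a\<close> can be used below.
  The zero polynomial is homogeneous of every degree, and it is the only homogeneous
  polynomial of negative degree.\<close>

definition homogeneous :: "'k::comm_ring_1 mpoly \<Rightarrow> int \<Rightarrow> bool" where
  "homogeneous p m \<longleftrightarrow> (\<forall>t\<in>Poly_Mapping.keys p. int (mon_degree t) = m)"

definition hom_component :: "nat \<Rightarrow> 'k::comm_ring_1 mpoly \<Rightarrow> 'k mpoly" where
  "hom_component m p =
    (\<Sum>t\<in>{t\<in>Poly_Mapping.keys p. mon_degree t = m}. Poly_Mapping.single t (Poly_Mapping.lookup p t))"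

definition const_coeff :: "'k::comm_ring_1 mpoly \<Rightarrow> 'k" where
  "const_coeff p = Poly_Mapping.lookup p 0"

definition poly_eval :: "(nat \<Rightarrow> 'k) \<Rightarrow> 'k::comm_ring_1 mpoly \<Rightarrow> 'k" where
  "poly_eval v p = (\<Sum>t\<in>Poly_Mapping.keys p.
     Poly_Mapping.lookup p t * (\<Prod>i\<in>Poly_Mapping.keys t. v i ^ Poly_Mapping.lookup t i))"

definition poly_scale :: "'k \<Rightarrow> 'k::comm_ring_1 mpoly \<Rightarrow> 'k mpoly" where
  "poly_scale c p = Poly_Mapping.single 0 c * p"

definition fun_scale :: "'k \<Rightarrow> (nat \<Rightarrow> 'k::comm_ring_1) \<Rightarrow> nat \<Rightarrow> 'k" where
  "fun_scale c v = (\<lambda>i. c * v i)"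

lemma vector_space_poly_scale:
  "vector_space (poly_scale :: 'k::field \<Rightarrow> 'k mpoly \<Rightarrow> 'k mpoly)"
proof
  fix a b :: 'k and x y :: "'k mpoly"
  show "poly_scale a (x + y) = poly_scale a x + poly_scale a y"
    by (simp add: poly_scale_def distrib_left)
  show "poly_scale (a + b) x = poly_scale a x + poly_scale b x"
    by (simp add: poly_scale_def single_add distrib_right)
  show "poly_scale a (poly_scale b x) = poly_scale (a * b) x"
    by (simp add: poly_scale_def mult_single mult.assoc[symmetric])
  show "poly_scale 1 x = x"
    by (simp add: poly_scale_def)
qed

lemma vector_space_fun_scale:
  "vector_space (fun_scale :: 'k::field \<Rightarrow> (nat \<Rightarrow> 'k) \<Rightarrow> nat \<Rightarrow> 'k)"
  by standard (auto simp: fun_scale_def fun_eq_iff algebra_simps)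


section \<open>Algebraic sets in projective space\<close>

text \<open>A point of \<open>P\<^sup>N\<close> is the class of its homogeneous coordinate vectors, which are
  functions on \<open>nat\<close> extended by zero beyond the index \<open>N\<close>.\<close>

definition coord_vectors :: "nat \<Rightarrow> (nat \<Rightarrow> 'k::field) set" where
  "coord_vectors N = {v. (\<forall>i>N. v i = 0) \<and> (\<exists>i. v i \<noteq> 0)}"

definition proj_rel :: "nat \<Rightarrow> ((nat \<Rightarrow> 'k::field) \<times> (nat \<Rightarrow> 'k)) set" where
  "proj_rel N = {(v, w). v \<in> coord_vectors N \<and> w \<in> coord_vectors N \<and>
     (\<exists>c. c \<noteq> 0 \<and> w = fun_scale c v)}"

definition proj_space :: "nat \<Rightarrow> (nat \<Rightarrow> 'k::field) set set" where
  "proj_space N = coord_vectors N // proj_rel N"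

lemma equiv_proj_rel:
  "equiv (coord_vectors N) (proj_rel N :: ((nat \<Rightarrow> 'k::field) \<times> (nat \<Rightarrow> 'k)) set)"
    (is "equiv ?V ?r")
proof (rule equivI)
  show "?r \<subseteq> ?V \<times> ?V"
    by (auto simp: proj_rel_def)
  show "refl_on ?V ?r"
    by (auto simp: refl_on_def proj_rel_def fun_scale_def intro!: exI[of _ 1])
  show "sym ?r"
  proof (rule symI)
    fix v w :: "nat \<Rightarrow> 'k"
    assume "(v, w) \<in> ?r"
    then obtain c where "v \<in> coord_vectors N" "w \<in> coord_vectors N" "c \<noteq> 0" "w = fun_scale c v"
      by (auto simp: proj_rel_def)
    moreover from this have "v = fun_scale (inverse c) w"
      by (simp add: fun_scale_def fun_eq_iff mult.assoc[symmetric])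
    ultimately show "(w, v) \<in> ?r"
      unfolding proj_rel_def using nonzero_imp_inverse_nonzero by blast
  qed
  show "trans ?r"
  proof (rule transI)
    fix u v w :: "nat \<Rightarrow> 'k"
    assume "(u, v) \<in> ?r" "(v, w) \<in> ?r"
    then obtain c d where "u \<in> coord_vectors N" "w \<in> coord_vectors N" "c \<noteq> 0" "d \<noteq> 0"
      "v = fun_scale c u" "w = fun_scale d v"
      by (auto simp: proj_rel_def)
    moreover from this have "w = fun_scale (d * c) u"
      by (simp add: fun_scale_def fun_eq_iff mult.assoc)
    moreover from calculation have "d * c \<noteq> 0"
      by simp
    ultimately show "(u, w) \<in> ?r"
      unfolding proj_rel_def by blast
  qed
qed

definition vanishes_at :: "'k::field mpoly \<Rightarrow> (nat \<Rightarrow> 'k) set \<Rightarrow> bool" where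
  "vanishes_at f P \<longleftrightarrow> (\<forall>v\<in>P. poly_eval v f = 0)"

definition zero_locus :: "nat \<Rightarrow> 'k::field mpoly set \<Rightarrow> (nat \<Rightarrow> 'k) set set" where
  "zero_locus N S = {P \<in> proj_space N. \<forall>f\<in>S. vanishes_at f P}"

text \<open>Over an algebraically closed field, a reduced closed subscheme of \<open>P\<^sup>N\<close> is the same as a
  closed set of \<open>k\<close>-points.\<close>

definition algebraic_set :: "nat \<Rightarrow> (nat \<Rightarrow> 'k::field) set set \<Rightarrow> bool" where
  "algebraic_set N X \<longleftrightarrow>
    (\<exists>S. S \<subseteq> poly_ring N \<and> (\<forall>f\<in>S. \<exists>m. homogeneous f m) \<and> X = zero_locus N S)"

definition hyperplane :: "nat \<Rightarrow> (nat \<Rightarrow> 'k::field) set set \<Rightarrow> bool" where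
  "hyperplane N H \<longleftrightarrow>
    (\<exists>l. l \<in> poly_ring N \<and> homogeneous l 1 \<and> l \<noteq> 0 \<and> H = zero_locus N {l})"

definition nondegenerate :: "nat \<Rightarrow> (nat \<Rightarrow> 'k::field) set set \<Rightarrow> bool" where
  "nondegenerate N X \<longleftrightarrow> (\<nexists>H. hyperplane N H \<and> X \<subseteq> H)"

text \<open>Since \<open>X\<close> is reduced, the global sections of its ideal sheaf twisted by \<open>m\<close> are the forms of
  degree \<open>m\<close> vanishing at the points of \<open>X\<close>.\<close>

definition ideal_sections :: "nat \<Rightarrow> (nat \<Rightarrow> 'k::field) set set \<Rightarrow> nat \<Rightarrow> 'k mpoly set" where
  "ideal_sections N X m =
    {f \<in> poly_ring N. homogeneous f (int m) \<and> (\<forall>P\<in>X. vanishes_at f P)}"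

definition vanishing_ideal :: "nat \<Rightarrow> (nat \<Rightarrow> 'k::field) set set \<Rightarrow> 'k mpoly set" where
  "vanishing_ideal N X = {f \<in> poly_ring N. \<forall>m. hom_component m f \<in> ideal_sections N X m}"


section \<open>Hilbert polynomial, dimension and degree\<close>

definition hilbert_function :: "nat \<Rightarrow> 'k::field mpoly set \<Rightarrow> nat \<Rightarrow> nat" where
  "hilbert_function N I m =
    vector_space.dim poly_scale {f :: 'k mpoly. f \<in> poly_ring N \<and> homogeneous f (int m)}
    - vector_space.dim poly_scale {f \<in> I. homogeneous f (int m)}"

definition hilbert_poly :: "nat \<Rightarrow> 'k::field mpoly set \<Rightarrow> rat poly" where
  "hilbert_poly N I =
    (THE P. \<exists>m0. \<forall>m\<ge>m0. poly P (of_nat m) = of_nat (hilbert_function N I m))"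

text \<open>The Hilbert polynomial is zero exactly for the empty set, which gets dimension \<open>-1\<close>.\<close>

definition proj_dim :: "nat \<Rightarrow> (nat \<Rightarrow> 'k::field) set set \<Rightarrow> int" where
  "proj_dim N X = (let P = hilbert_poly N (vanishing_ideal N X)
     in if P = 0 then -1 else int (Polynomial.degree P))"

definition proj_degree :: "nat \<Rightarrow> (nat \<Rightarrow> 'k::field) set set \<Rightarrow> rat" where
  "proj_degree N X = (let P = hilbert_poly N (vanishing_ideal N X)
     in fact (Polynomial.degree P) * lead_coeff P)"


section \<open>Graded free resolutions and graded Betti numbers\<close>

text \<open>Vectors are functions on \<open>nat\<close> that vanish from the index \<open>r\<close> on; \<open>mat_vec r s A\<close> is
  multiplication by the \<open>r \<times> s\<close> block of \<open>A\<close>.\<close>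

definition mat_vec ::
  "nat \<Rightarrow> nat \<Rightarrow> (nat \<Rightarrow> nat \<Rightarrow> 'r::comm_ring_1) \<Rightarrow> (nat \<Rightarrow> 'r) \<Rightarrow> nat \<Rightarrow> 'r" where
  "mat_vec r s A c = (\<lambda>l. if l < r then \<Sum>m<s. A l m * c m else 0)"

definition free_module :: "nat \<Rightarrow> nat \<Rightarrow> (nat \<Rightarrow> 'k::comm_ring_1 mpoly) set" where
  "free_module N r = {c. (\<forall>l<r. c l \<in> poly_ring N) \<and> (\<forall>l\<ge>r. c l = 0)}"

text \<open>The data of a complex \<open>\<dots> \<rightarrow> F\<^sub>2 \<rightarrow> F\<^sub>1 \<rightarrow> F\<^sub>0 \<rightarrow> R/I\<close> of graded free modules: \<open>F\<^sub>i\<close> has rank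
  \<open>rnk F i\<close> and its \<open>l\<close>-th basis vector has degree \<open>shift F i l\<close>; \<open>diff F i\<close> is the matrix of
  \<open>F\<^bsub>i+1\<^esub> \<rightarrow> F\<^sub>i\<close>; and \<open>aug F l\<close> represents the image in \<open>R/I\<close> of the \<open>l\<close>-th basis vector
  of \<open>F\<^sub>0\<close>.\<close>

record (overloaded) 'k free_complex =
  rnk :: "nat \<Rightarrow> nat"
  shift :: "nat \<Rightarrow> nat \<Rightarrow> int"
  diff :: "nat \<Rightarrow> nat \<Rightarrow> nat \<Rightarrow> 'k mpoly"
  aug :: "nat \<Rightarrow> 'k mpoly"

definition graded_free_resolution ::
  "nat \<Rightarrow> 'k::field mpoly set \<Rightarrow> 'k free_complex \<Rightarrow> bool" where
  "graded_free_resolution N I F \<longleftrightarrow>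
    (\<forall>l<rnk F 0. aug F l \<in> poly_ring N \<and> homogeneous (aug F l) (shift F 0 l)) \<and>
    (\<forall>i. \<forall>l<rnk F i. \<forall>m<rnk F (Suc i). diff F i l m \<in> poly_ring N \<and>
       homogeneous (diff F i l m) (shift F (Suc i) m - shift F i l)) \<and>
    (\<forall>f\<in>poly_ring N. \<exists>c\<in>free_module N (rnk F 0). f - (\<Sum>l<rnk F 0. c l * aug F l) \<in> I) \<and>
    {c \<in> free_module N (rnk F 0). (\<Sum>l<rnk F 0. c l * aug F l) \<in> I}
      = mat_vec (rnk F 0) (rnk F 1) (diff F 0) ` free_module N (rnk F 1) \<and>
    (\<forall>i. {c \<in> free_module N (rnk F (Suc i)). mat_vec (rnk F i) (rnk F (Suc i)) (diff F i) c = 0}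
      = mat_vec (rnk F (Suc i)) (rnk F (Suc (Suc i))) (diff F (Suc i))
          ` free_module N (rnk F (Suc (Suc i))))"

text \<open>The complex \<open>F \<otimes>\<^sub>R k\<close>: here \<open>k = R/(x\<^sub>0, \<dots>, x\<^sub>N)\<close>, so \<open>(F\<^sub>i \<otimes>\<^sub>R k)\<^sub>m\<close> is the \<open>k\<close>-vector space
  on the basis vectors of degree \<open>m\<close>, and the matrix entries of the differentials are replaced by
  their constant coefficients.\<close>

definition tensor_piece :: "'k::field free_complex \<Rightarrow> nat \<Rightarrow> int \<Rightarrow> (nat \<Rightarrow> 'k) set" where
  "tensor_piece F i m = {v. \<forall>l. v l \<noteq> 0 \<longrightarrow> l < rnk F i \<and> shift F i l = m}"

definition tensor_diff :: "'k::field free_complex \<Rightarrow> nat \<Rightarrow> (nat \<Rightarrow> 'k) \<Rightarrow> nat \<Rightarrow> 'k" where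
  "tensor_diff F i = mat_vec (rnk F i) (rnk F (Suc i)) (\<lambda>l m. const_coeff (diff F i l m))"

definition tensor_cycles :: "'k::field free_complex \<Rightarrow> nat \<Rightarrow> int \<Rightarrow> (nat \<Rightarrow> 'k) set" where
  "tensor_cycles F i m =
    (case i of 0 \<Rightarrow> tensor_piece F 0 m
     | Suc i' \<Rightarrow> {v \<in> tensor_piece F (Suc i') m. tensor_diff F i' v = 0})"

definition tensor_boundaries :: "'k::field free_complex \<Rightarrow> nat \<Rightarrow> int \<Rightarrow> (nat \<Rightarrow> 'k) set" where
  "tensor_boundaries F i m = tensor_diff F i ` tensor_piece F (Suc i) m"

text \<open>The dimension of \<open>Tor\<^sub>i(R/I, k)\<^sub>m\<close>, computed as the degree \<open>m\<close> part of the \<open>i\<close>-th homology of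
  \<open>F \<otimes>\<^sub>R k\<close> for a graded free resolution \<open>F\<close> of \<open>R/I\<close> by modules of finite rank. Such an \<open>F\<close>
  exists for every homogeneous ideal \<open>I\<close> because \<open>R\<close> is noetherian, and the result does not
  depend on it.\<close>

definition tor_dim :: "nat \<Rightarrow> 'k::field mpoly set \<Rightarrow> nat \<Rightarrow> int \<Rightarrow> nat" where
  "tor_dim N I i m = (let F = (SOME F. graded_free_resolution N I F)
     in vector_space.dim fun_scale (tensor_cycles F i m)
        - vector_space.dim fun_scale (tensor_boundaries F i m))"

definition betti :: "nat \<Rightarrow> (nat \<Rightarrow> 'k::field) set set \<Rightarrow> nat \<Rightarrow> int \<Rightarrow> nat" where
  "betti N X i j = tor_dim N (vanishing_ideal N X) i (int i + j)"

definition property_N :: "nat \<Rightarrow> (nat \<Rightarrow> 'k::field) set set \<Rightarrow> nat \<Rightarrow> nat \<Rightarrow> bool" where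
  "property_N N X d p \<longleftrightarrow> (\<forall>i\<le>p. \<forall>j\<ge>int d. betti N X i j = 0)"

definition linear_resolution :: "nat \<Rightarrow> (nat \<Rightarrow> 'k::field) set set \<Rightarrow> nat \<Rightarrow> bool" where
  "linear_resolution N X d \<longleftrightarrow> (\<forall>i\<ge>1. \<forall>j. j \<noteq> int d - 1 \<longrightarrow> betti N X i j = 0)"


section \<open>Depth and arithmetic Cohen-Macaulayness\<close>

definition ideal_plus :: "nat \<Rightarrow> 'k::field mpoly set \<Rightarrow> 'k mpoly list \<Rightarrow> 'k mpoly set" where
  "ideal_plus N I fs =
    {g + (\<Sum>i<length fs. c i * fs ! i) | g c. g \<in> I \<and> (\<forall>i. c i \<in> poly_ring N)}"

text \<open>Regular sequences on \<open>R/I\<close> in the irrelevant ideal \<open>(x\<^sub>0, \<dots>, x\<^sub>N)\<close>.\<close>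

definition regular_sequence :: "nat \<Rightarrow> 'k::field mpoly set \<Rightarrow> 'k mpoly list \<Rightarrow> bool" where
  "regular_sequence N I fs \<longleftrightarrow>
    (\<forall>f\<in>set fs. f \<in> poly_ring N \<and> const_coeff f = 0) \<and>
    (\<forall>k<length fs. \<forall>g\<in>poly_ring N.
       fs ! k * g \<in> ideal_plus N I (take k fs) \<longrightarrow> g \<in> ideal_plus N I (take k fs)) \<and>
    ideal_plus N I fs \<noteq> poly_ring N"

definition quotient_depth :: "nat \<Rightarrow> 'k::field mpoly set \<Rightarrow> enat" where
  "quotient_depth N I = (SUP fs\<in>{fs. regular_sequence N I fs}. enat (length fs))"

definition arith_CM :: "nat \<Rightarrow> (nat \<Rightarrow> 'k::field) set set \<Rightarrow> bool" where
  "arith_CM N X \<longleftrightarrow>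
    quotient_depth N (vanishing_ideal N X) = enat (nat (proj_dim N X + 1))"

end

theory Submission imports Defs begin

text \<open>Let \<open>N = n + e\<close>. The vanishing of \<open>Tor\<^sub>i(R/I, k)\<^sub>m\<close> is expressed by exactness of the Koszul
  complex of \<open>R/I\<close> in degree \<open>m\<close>. After a linear change of coordinates \<open>R/I\<close> is finite over
  \<open>S = k[x\<^sub>0, \<dots>, x\<^sub>n]\<close>. Property \<open>N\<^bsub>d,e\<^esub>\<close> is used only for \<open>i = e\<close>: multiplying a form of degree at
  least \<open>d\<close> by \<open>e\<close> Koszul factors in the remaining variables gives a Koszul \<open>e\<close>-cycle, whose
  vanishing in homology puts the form into \<open>I + (x\<^sub>0, \<dots>, x\<^sub>n)\<close>. Hence \<open>R/I\<close> is generated over \<open>S\<close> by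
  the monomials of degree less than \<open>d\<close> in the other \<open>e\<close> variables, and the degree is at most
  their number. Equality makes these monomials an \<open>S\<close>-basis, so that \<open>x\<^sub>0, \<dots>, x\<^sub>n\<close> is a regular
  sequence modulo which \<open>R/I\<close> lives in degrees less than \<open>d\<close>. Conversely, depth \<open>n + 1\<close> and a linear
  resolution determine enough of the numerator of the Hilbert series to read off the degree.\<close>

section \<open>The Koszul complex\<close>

text \<open>Tor is defined through an arbitrary resolution, which gives no hold on elements. The
  Koszul complex of \<open>R/I\<close> detects the same vanishing without choices, and it can be
  altered: a regular element can be removed, and a variable can be replaced by a power. The second
  move is the crux. The relations that finiteness supplies express powers \<open>x_j^t\<close>
  modulo \<open>I\<close> through \<open>x_0, ..., x_n\<close>, so the cycle built from them lives
  on powers, while the hypothesis speaks of the variables themselves. Raising the exponents to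
  \<open>q j\<close> moves the degree bound by the sum of the \<open>q j - 1\<close>, and this is
  exactly what the degree of the cycle requires. Numerical information is read off backward
  differences of the Hilbert function: the \<open>n\<close>-th is eventually the degree of
  \<open>X\<close>, and the \<open>(N+1)\<close>-th gives the coefficients of the numerator of the
  Hilbert series. Inequalities between Hilbert functions thus become inequalities between degrees.
  Regular sequences in the definition of depth may be inhomogeneous, so the quotients by them carry
  no grading; they enter through an ungraded Koszul complex.\<close>

definition sgn_at :: "nat \<Rightarrow> nat set \<Rightarrow> 'v::ab_group_add \<Rightarrow> 'v" where
  "sgn_at j S v = (if even (card {i\<in>S. i < j}) then v else - v)"

text \<open>A function \<open>c\<close> on index sets stands for the chain with coefficient
  \<open>c S\<close> at the exterior monomial \<open>e_S\<close>. \<open>iota j\<close> is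
  contraction with the dual of \<open>e_j\<close> and \<open>eps j\<close> is multiplication by
  \<open>e_j\<close>; working with these operators avoids sums over ordered index lists.\<close>

definition iota :: "nat \<Rightarrow> (nat set \<Rightarrow> 'v::ab_group_add) \<Rightarrow> nat set \<Rightarrow> 'v" where
  "iota j c S = (if j \<in> S then 0 else sgn_at j S (c (insert j S)))"

definition eps :: "nat \<Rightarrow> (nat set \<Rightarrow> 'v::ab_group_add) \<Rightarrow> nat set \<Rightarrow> 'v" where
  "eps j c S = (if j \<in> S then sgn_at j S (c (S - {j})) else 0)"

text \<open>The operators act on an arbitrary abelian group, so that \<open>R\<close>, free modules,
  syzygies and powers of the variables are all covered by one definition.\<close>

definition kd :: "(nat \<Rightarrow> 'v \<Rightarrow> 'v) \<Rightarrow> nat set \<Rightarrow> (nat set \<Rightarrow> 'v::ab_group_add) \<Rightarrow> nat set \<Rightarrow> 'v" where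
  "kd x L c S = (\<Sum>j\<in>L. x j (iota j c S))"

definition app :: "('v \<Rightarrow> 'w) \<Rightarrow> (nat set \<Rightarrow> 'v) \<Rightarrow> nat set \<Rightarrow> 'w" where
  "app f c S = f (c S)"

lemma sum_fun_app: "(\<Sum>a\<in>A. f a) y = (\<Sum>a\<in>A. f a y)" for f :: "'a \<Rightarrow> 'b \<Rightarrow> 'c::comm_monoid_add"
  by (induction A rule: infinite_finite_induct) auto

lemma card_less_insert:
  "card {i \<in> insert k S. i < (j::nat)} = (if k < j \<and> k \<notin> S then Suc (card {i\<in>S. i < j}) else card {i\<in>S. i < j})"
proof -
  have fin: "finite {i\<in>S. i < j}" by (rule finite_subset[of _ "{..<j}"]) auto
  show ?thesis
  proof (cases "k < j \<and> k \<notin> S")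
    case True
    then have "{i \<in> insert k S. i < j} = insert k {i\<in>S. i < j}" by auto
    with True fin show ?thesis by simp
  next
    case False
    then have "{i \<in> insert k S. i < j} = {i\<in>S. i < j}" by auto
    with False show ?thesis by simp
  qed
qed

lemma sgn_at_insert:
  "k \<notin> S \<Longrightarrow> sgn_at j (insert k S) v = (if k < j then - sgn_at j S v else sgn_at j S v)"
  unfolding sgn_at_def card_less_insert by simp

lemma sgn_at_remove:
  assumes "k \<in> S" shows "sgn_at j (S - {k}) v = (if k < j then - sgn_at j S v else sgn_at j S v)"
proof -
  have "sgn_at j (insert k (S - {k})) v = (if k < j then - sgn_at j (S - {k}) v else sgn_at j (S - {k}) v)"
    by (rule sgn_at_insert) simp
  with assms show ?thesis by (simp add: insert_absorb split: if_splits)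
qed

lemma sgn_at_simps [simp]:
  "sgn_at j S 0 = 0" "sgn_at j S (sgn_at j S v) = v" "sgn_at j S (- v) = - sgn_at j S v"
  by (auto simp: sgn_at_def)

lemma sgn_at_add: "sgn_at j S (v + w) = sgn_at j S v + sgn_at j S w"
  by (auto simp: sgn_at_def)

lemma sgn_at_comm: "sgn_at j S (sgn_at k T v) = sgn_at k T (sgn_at j S v)"
  by (auto simp: sgn_at_def)

lemma sgn_at_additive:
  assumes "\<And>a b. f (a + b) = f a + f b"
  shows "f (sgn_at j S v) = sgn_at j S (f v :: 'w::ab_group_add)"
proof -
  interpret f: additive f by standard (rule assms)
  show ?thesis by (simp add: sgn_at_def f.minus)
qed

lemma iota_add: "iota j (c + c') = iota j c + iota j c'"
  by (auto simp: iota_def fun_eq_iff sgn_at_add)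

lemma eps_add: "eps j (c + c') = eps j c + eps j c'"
  by (auto simp: eps_def fun_eq_iff sgn_at_add)

global_interpretation iota: additive "iota j" for j by standard (rule iota_add)
global_interpretation eps: additive "eps j" for j by standard (rule eps_add)

lemma iota_zero [simp]: "iota j 0 = 0" by (rule iota.zero)
lemma eps_zero [simp]: "eps j 0 = 0" by (rule eps.zero)

lemma iota_iota_same [simp]: "iota j (iota j c) = 0"
  by (auto simp: iota_def fun_eq_iff)

lemma eps_eps_same [simp]: "eps j (eps j c) = 0"
  by (auto simp: eps_def fun_eq_iff)

text \<open>Together with \<open>iota_iota\<close> and \<open>iota_eps\<close> these are the
  anticommutation relations of the exterior algebra, to which the later sign computations reduce. At
  each \<open>S\<close> one of the two summands vanishes, depending on whether \<open>j\<close>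
  belongs to \<open>S\<close>.\<close>

lemma iota_eps_same: "iota j (eps j c) + eps j (iota j c) = c"
proof
  fix S show "(iota j (eps j c) + eps j (iota j c)) S = c S"
    by (cases "j \<in> S") (auto simp: iota_def eps_def sgn_at_insert sgn_at_remove insert_absorb)
qed

lemma iota_iota: "iota j (iota k c) = - iota k (iota j c)"
proof (cases "j = k")
  case False
  show ?thesis
  proof
    fix S show "iota j (iota k c) S = (- iota k (iota j c)) S"
    proof (cases "j \<in> S \<or> k \<in> S")
      case True then show ?thesis by (auto simp: iota_def)
    next
      case F2: False
      have "insert k (insert j S) = insert j (insert k S)" by auto
      with F2 False show ?thesis
        by (cases "j < k") (auto simp: iota_def sgn_at_insert sgn_at_comm[of j _ k])
    qed
  qed
qed simp

lemma iota_eps: assumes "j \<noteq> k" shows "iota j (eps k c) = - eps k (iota j c)"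
proof
  fix S show "iota j (eps k c) S = (- eps k (iota j c)) S"
  proof (cases "k \<in> S \<and> j \<notin> S")
    case True
    have "insert j S - {k} = insert j (S - {k})" using assms by auto
    with True assms show ?thesis
      by (cases "j < k") (auto simp: eps_def iota_def sgn_at_insert sgn_at_remove sgn_at_comm[of j _ k])
  qed (use assms in \<open>auto simp: eps_def iota_def\<close>)
qed

lemma iota_app: assumes "\<And>a b. f (a + b) = f a + f b"
  shows "iota j (app f c) = app f (iota j c)"
proof -
  interpret f: additive f by standard (rule assms)
  show ?thesis by (auto simp: app_def iota_def fun_eq_iff f.zero sgn_at_additive[of f, OF assms])
qed

lemma eps_app: assumes "\<And>a b. f (a + b) = f a + f b"
  shows "eps j (app f c) = app f (eps j c)"
proof -
  interpret f: additive f by standard (rule assms)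
  show ?thesis by (auto simp: app_def eps_def fun_eq_iff f.zero sgn_at_additive[of f, OF assms])
qed

section \<open>Koszul differentials of commuting additive operators\<close>

locale kops =
  fixes x :: "nat \<Rightarrow> 'v::ab_group_add \<Rightarrow> 'v" and L :: "nat set"
  assumes op_add: "j \<in> L \<Longrightarrow> x j (a + b) = x j a + x j b"
    and op_comm: "j \<in> L \<Longrightarrow> k \<in> L \<Longrightarrow> x j (x k a) = x k (x j a)"
    and fin: "finite L"
begin

lemma op_zero: "j \<in> L \<Longrightarrow> x j 0 = 0"
  using op_add[of j 0 0] by simp

lemma op_minus: "j \<in> L \<Longrightarrow> x j (- a) = - x j a"
  using op_add[of j a "- a"] by (simp add: op_zero eq_neg_iff_add_eq_0 add.commute)

lemma op_sum: "j \<in> L \<Longrightarrow> x j (sum f A) = (\<Sum>a\<in>A. x j (f a))"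
  by (induction A rule: infinite_finite_induct) (auto simp: op_zero op_add)

lemma kd_add: "kd x L (c + c') = kd x L c + kd x L c'"
  by (auto simp: kd_def fun_eq_iff iota_add op_add sum.distrib)

lemma kd_zero [simp]: "kd x L 0 = 0"
  using kd_add[of 0 0] by simp

lemma kd_minus: "kd x L (- c) = - kd x L c"
  using kd_add[of c "- c"] by (simp add: eq_neg_iff_add_eq_0 add.commute)

lemma kd_diff: "kd x L (c - c') = kd x L c - kd x L c'"
  using kd_add[of c "- c'"] by (simp add: kd_minus)

lemma kd_alt: "kd x L c = (\<Sum>j\<in>L. app (x j) (iota j c))"
  by (auto simp: kd_def fun_eq_iff app_def sum_fun_app)

lemma iota_kd: "iota j (kd x L c) = - kd x L (iota j c)"
proof -
  have "iota j (kd x L c) = (\<Sum>k\<in>L. iota j (app (x k) (iota k c)))"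
    by (simp add: kd_alt iota.sum)
  also have "\<dots> = (\<Sum>k\<in>L. app (x k) (iota j (iota k c)))"
    by (intro sum.cong refl iota_app op_add)
  also have "\<dots> = (\<Sum>k\<in>L. - app (x k) (iota k (iota j c)))"
    by (intro sum.cong refl, subst iota_iota) (auto simp: app_def fun_eq_iff op_minus)
  finally show ?thesis by (simp add: kd_alt sum_negf)
qed

end

lemma kops_subset: "kops x L \<Longrightarrow> L' \<subseteq> L \<Longrightarrow> kops x L'"
  unfolding kops_def by (meson finite_subset subsetD)

lemma kd_insert: "finite L \<Longrightarrow> j \<notin> L \<Longrightarrow> kd x (insert j L) c = app (x j) (iota j c) + kd x L c"
  by (auto simp: kd_def fun_eq_iff app_def)

lemma kd_app:
  assumes "kops x L" "\<And>a b. f (a + b) = f a + f b" "\<And>j a. j \<in> L \<Longrightarrow> y j (f a) = f (x j a)"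
  shows "kd y L (app f c) = app f (kd x L c)"
proof -
  interpret f: additive f by standard (rule assms)
  show ?thesis
    by (auto simp: kd_def fun_eq_iff iota_app[of f, OF assms(2)] app_def f.sum assms(3))
qed

text \<open>A new operator contributes \<open>x j\<close> after \<open>iota j\<close>. Its square
  vanishes because \<open>iota j\<close> squares to zero, and the mixed terms cancel because
  \<open>iota j\<close> anticommutes with the differential on the other operators.\<close>

lemma kd_kd:
  assumes "kops x L" shows "kd x L (kd x L c) = 0"
proof -
  from assms have "finite L" by (simp add: kops_def)
  then show ?thesis using assms
  proof (induction L)
    case empty then show ?case by (auto simp: kd_def)
  next
    case (insert j L)
    interpret J: kops x "insert j L" by fact
    interpret L: kops x L by (rule kops_subset[OF insert.prems]) auto
    have dd: "kd x L (kd x L c) = 0" by (rule insert.IH) unfold_locales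
    have 1: "iota j (app (x j) (iota j c)) = 0"
      by (subst iota_app) (auto simp: J.op_add J.op_zero app_def fun_eq_iff)
    have 2: "kd x L (app (x j) (iota j c)) = app (x j) (kd x L (iota j c))"
      by (rule kd_app) (use J.op_add J.op_comm in \<open>auto intro: L.kops_axioms\<close>)
    have 3: "app (x j) (iota j (kd x L c)) = - app (x j) (kd x L (iota j c))"
      by (simp add: L.iota_kd) (simp add: app_def fun_eq_iff J.op_minus)
    have 4: "app (x j) (iota j (app (x j) (iota j c))) = 0"
      by (simp add: 1) (simp add: app_def fun_eq_iff J.op_zero)
    have 5: "app (x j) (a + b) = app (x j) a + app (x j) b" for a b
      by (simp add: app_def fun_eq_iff J.op_add)
    let ?a = "app (x j) (iota j c)" and ?b = "kd x L c"
    have "kd x (insert j L) (kd x (insert j L) c)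
        = app (x j) (iota j (?a + ?b)) + kd x L (?a + ?b)"
      unfolding kd_insert[OF insert.hyps] ..
    also have "\<dots> = app (x j) (iota j ?a) + app (x j) (iota j ?b) + (kd x L ?a + kd x L ?b)"
      unfolding iota.add 5 L.kd_add ..
    also have "\<dots> = 0"
      unfolding 4 3 2 dd by simp
    finally show ?case .
  qed
qed

context kops begin

text \<open>Cartan's formula: \<open>eps j\<close> is a homotopy between multiplication by
  \<open>x j\<close> and zero. By the anticommutation relations the sum over \<open>k\<close>
  collapses to the term \<open>k = j\<close>.\<close>

lemma kd_eps: assumes "j \<in> L" shows "kd x L (eps j c) = app (x j) c - eps j (kd x L c)"
proof -
  have "eps j (kd x L c) = (\<Sum>k\<in>L. eps j (app (x k) (iota k c)))"
    by (simp add: kd_alt eps.sum)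
  also have "\<dots> = (\<Sum>k\<in>L. app (x k) (eps j (iota k c)))"
    by (intro sum.cong refl eps_app op_add)
  finally have "kd x L (eps j c) + eps j (kd x L c)
     = (\<Sum>k\<in>L. app (x k) (iota k (eps j c)) + app (x k) (eps j (iota k c)))"
    by (simp add: kd_alt sum.distrib)
  also have "\<dots> = (\<Sum>k\<in>L. if k = j then app (x j) c else 0)"
  proof (intro sum.cong refl)
    fix k assume k: "k \<in> L"
    have "app (x k) (iota k (eps j c)) + app (x k) (eps j (iota k c))
        = app (x k) (iota k (eps j c) + eps j (iota k c))"
      using k by (simp add: app_def fun_eq_iff op_add)
    also have "\<dots> = (if k = j then app (x j) c else 0)"
      using k by (cases "k = j") (simp_all add: iota_eps_same iota_eps, simp add: app_def fun_eq_iff op_zero)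
    finally show "app (x k) (iota k (eps j c)) + app (x k) (eps j (iota k c)) = (if k = j then app (x j) c else 0)" .
  qed
  also have "\<dots> = app (x j) c" using assms fin by simp
  finally show ?thesis by (simp add: eq_diff_eq)
qed

lemma kd_eps_notin: assumes "j \<notin> L" shows "kd x L (eps j c) = - eps j (kd x L c)"
proof -
  have "eps j (kd x L c) = (\<Sum>k\<in>L. eps j (app (x k) (iota k c)))"
    by (simp add: kd_alt eps.sum)
  also have "\<dots> = (\<Sum>k\<in>L. app (x k) (eps j (iota k c)))"
    by (intro sum.cong refl eps_app op_add)
  also have "\<dots> = (\<Sum>k\<in>L. - app (x k) (iota k (eps j c)))"
    using assms by (intro sum.cong refl, subst iota_eps) (auto simp: app_def fun_eq_iff op_minus)
  finally show ?thesis by (simp add: kd_alt sum_negf)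
qed

end

section \<open>Graded Koszul chains and exactness modulo a submodule\<close>

definition chn :: "nat set \<Rightarrow> (nat \<Rightarrow> int) \<Rightarrow> (int \<Rightarrow> 'v set) \<Rightarrow> nat \<Rightarrow> int \<Rightarrow> (nat set \<Rightarrow> 'v::ab_group_add) set" where
  "chn L w P i m = {c. \<forall>S. (S \<subseteq> L \<and> card S = i \<and> c S \<in> P (m - sum w S)) \<or> c S = 0}"

text \<open>Exactness of the Koszul complex of \<open>P/Q\<close> at homological degree
  \<open>i\<close> and internal degree \<open>m\<close>, phrased on representatives so that no
  quotient has to be formed. In \<open>chn\<close> the monomial \<open>e_S\<close> carries the
  degree \<open>sum w S\<close>. At \<open>i = 0\<close> the truncated \<open>i - 1\<close> is
  harmless, since by \<open>kd_chn_0\<close> the boundary is zero.\<close>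

definition KH0 :: "(nat \<Rightarrow> 'v \<Rightarrow> 'v) \<Rightarrow> nat set \<Rightarrow> (nat \<Rightarrow> int) \<Rightarrow> (int \<Rightarrow> 'v set) \<Rightarrow> (int \<Rightarrow> 'v::ab_group_add set) \<Rightarrow> nat \<Rightarrow> int \<Rightarrow> bool" where
  "KH0 x L w P Q i m \<longleftrightarrow> (\<forall>z\<in>chn L w P i m. kd x L z \<in> chn L w Q (i - 1) m \<longrightarrow>
     (\<exists>v\<in>chn L w P (Suc i) m. z - kd x L v \<in> chn L w Q i m))"

definition subgrp :: "'v::ab_group_add set \<Rightarrow> bool" where
  "subgrp A \<longleftrightarrow> 0 \<in> A \<and> (\<forall>a\<in>A. \<forall>b\<in>A. a - b \<in> A)"

lemma subgrpD:
  assumes "subgrp A"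
  shows "0 \<in> A" "a \<in> A \<Longrightarrow> b \<in> A \<Longrightarrow> a - b \<in> A" "a \<in> A \<Longrightarrow> - a \<in> A" "a \<in> A \<Longrightarrow> b \<in> A \<Longrightarrow> a + b \<in> A"
proof -
  show 0: "0 \<in> A" and d: "\<And>a b. a \<in> A \<Longrightarrow> b \<in> A \<Longrightarrow> a - b \<in> A" using assms by (auto simp: subgrp_def)
  show n: "\<And>a. a \<in> A \<Longrightarrow> - a \<in> A" using d[OF 0] by simp
  show "a \<in> A \<Longrightarrow> b \<in> A \<Longrightarrow> a + b \<in> A" using d[OF _ n, of a b] by simp
qed

lemma subgrp_sum: "subgrp A \<Longrightarrow> (\<And>i. i \<in> I \<Longrightarrow> f i \<in> A) \<Longrightarrow> sum f I \<in> A"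
  by (induction I rule: infinite_finite_induct) (auto simp: subgrpD)

lemma chnD: "c \<in> chn L w P i m \<Longrightarrow> c S = 0 \<or> S \<subseteq> L \<and> card S = i \<and> c S \<in> P (m - sum w S)"
  by (auto simp: chn_def)

lemma chn_in: "c \<in> chn L w P i m \<Longrightarrow> subgrp (P (m - sum w S)) \<Longrightarrow> c S \<in> P (m - sum w S)"
  using chnD[of c L w P i m S] by (auto simp: subgrpD)

lemma subgrp_chn: assumes "\<And>m. subgrp (P m)" shows "subgrp (chn L w P i m)"
  unfolding subgrp_def
proof (intro conjI ballI)
  show "0 \<in> chn L w P i m" by (simp add: chn_def)
  fix a b assume ab: "a \<in> chn L w P i m" "b \<in> chn L w P i m"
  show "a - b \<in> chn L w P i m"
    unfolding chn_def mem_Collect_eq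
  proof
    fix S
    have sg: "subgrp (P (m - sum w S))" by (rule assms)
    from ab[THEN chnD, of S] subgrpD[OF sg]
    show "S \<subseteq> L \<and> card S = i \<and> (a - b) S \<in> P (m - sum w S) \<or> (a - b) S = 0"
      by (cases "a S = 0"; cases "b S = 0") simp_all
  qed
qed

lemma chn_mono: "(\<And>m. P m \<subseteq> Q m) \<Longrightarrow> chn L w P i m \<subseteq> chn L w Q i m"
  unfolding chn_def by blast

lemma chn_mono_set: "L \<subseteq> L' \<Longrightarrow> chn L w P i m \<subseteq> chn L' w P i m"
  unfolding chn_def by blast

lemma chn_app:
  assumes "c \<in> chn L w P i m" "f 0 = 0" "\<And>m a. a \<in> P m \<Longrightarrow> f a \<in> P' (m + n)"
  shows "app f c \<in> chn L w P' i (m + n)"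
  unfolding chn_def mem_Collect_eq
proof
  fix S show "S \<subseteq> L \<and> card S = i \<and> app f c S \<in> P' (m + n - sum w S) \<or> app f c S = 0"
    using chnD[OF assms(1), of S] assms(2) assms(3)[of "c S" "m - sum w S"]
    by (auto simp: app_def algebra_simps)
qed

lemma sgn_at_in: "subgrp A \<Longrightarrow> a \<in> A \<Longrightarrow> sgn_at j S a \<in> A"
  by (auto simp: sgn_at_def subgrpD)

lemma iota_chn:
  assumes "c \<in> chn L w P (Suc i) m" "\<And>m. subgrp (P m)" "finite L"
  shows "iota j c \<in> chn (L - {j}) w P i (m - w j)"
  unfolding chn_def mem_Collect_eq
proof
  fix S
  show "S \<subseteq> L - {j} \<and> card S = i \<and> iota j c S \<in> P (m - w j - sum w S) \<or> iota j c S = 0"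
  proof (cases "j \<in> S \<or> c (insert j S) = 0")
    case False
    with chnD[OF assms(1), of "insert j S"] have *: "insert j S \<subseteq> L" "card (insert j S) = Suc i" "c (insert j S) \<in> P (m - sum w (insert j S))" by auto
    with assms(3) have "finite S" by (meson finite_subset subset_insertI)
    with * False show ?thesis by (auto simp: iota_def intro!: sgn_at_in assms(2) simp: algebra_simps)
  qed (auto simp: iota_def)
qed

lemma iota_chn_0:
  assumes "c \<in> chn L w P 0 m" "finite L"
  shows "iota j c = 0"
proof
  fix S
  from chnD[OF assms(1), of "insert j S"] assms(2) have "c (insert j S) = 0"
    by (metis card_0_eq finite_subset insert_not_empty)
  then show "iota j c S = 0 S" by (simp add: iota_def)
qed

lemma eps_chn:
  assumes "c \<in> chn L w P i (m - w j)" "\<And>m. subgrp (P m)" "finite L"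
  shows "eps j c \<in> chn (insert j L) w P (Suc i) m"
  unfolding chn_def mem_Collect_eq
proof
  fix S
  show "S \<subseteq> insert j L \<and> card S = Suc i \<and> eps j c S \<in> P (m - sum w S) \<or> eps j c S = 0"
  proof (cases "j \<notin> S \<or> c (S - {j}) = 0")
    case False
    with chnD[OF assms(1), of "S - {j}"] have *: "S - {j} \<subseteq> L" "card (S - {j}) = i" "c (S - {j}) \<in> P (m - w j - sum w (S - {j}))" by auto
    with assms(3) have "finite S" by (metis finite_Diff_insert finite_subset finite.emptyI Diff_empty)
    with False have "sum w S = w j + sum w (S - {j})" "card S = Suc (card (S - {j}))"
      using sum.remove[of S j w] card.remove[of S j] by auto
    with * False show ?thesis by (auto simp: eps_def intro!: sgn_at_in assms(2) simp: algebra_simps)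
  qed (auto simp: eps_def)
qed

lemma kd_chn:
  assumes "kops x L" "c \<in> chn L w P (Suc i) m" "\<And>m. subgrp (P m)"
    and "\<And>j m a. j \<in> L \<Longrightarrow> a \<in> P m \<Longrightarrow> x j a \<in> P (m + w j)"
  shows "kd x L c \<in> chn L w P i m"
proof -
  interpret kops x L by fact
  show ?thesis unfolding kd_alt
  proof (intro subgrp_sum subgrp_chn assms(3))
    fix j assume j: "j \<in> L"
    have "iota j c \<in> chn L w P i (m - w j)"
      using iota_chn[OF assms(2,3) fin, of j] chn_mono_set[of "L - {j}" L] by blast
    from chn_app[OF this, of "x j" P "w j"] show "app (x j) (iota j c) \<in> chn L w P i m"
      using j by (auto simp: op_zero assms(4))
  qed
qed

lemma kd_chn_0: "kops x L \<Longrightarrow> c \<in> chn L w P 0 m \<Longrightarrow> kd x L c = 0"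
  by (auto simp: kd_def fun_eq_iff iota_chn_0 kops.fin kops.op_zero intro!: sum.neutral)

lemma zero_chn [simp]: "0 \<in> chn L w P i m"
  by (simp add: chn_def)

lemma iota_eps_chn:
  assumes "c \<in> chn (insert j L) w P i m" "j \<notin> L"
  shows "iota j (eps j c) \<in> chn L w P i m"
  unfolding chn_def mem_Collect_eq
proof
  fix S
  show "S \<subseteq> L \<and> card S = i \<and> iota j (eps j c) S \<in> P (m - sum w S) \<or> iota j (eps j c) S = 0"
    using chnD[OF assms(1), of S] by (auto simp: iota_def eps_def sgn_at_insert)
qed

locale kmod = kops x L for x :: "nat \<Rightarrow> 'v::ab_group_add \<Rightarrow> 'v" and L +
  fixes w :: "nat \<Rightarrow> int" and P Q :: "int \<Rightarrow> 'v set"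
  assumes P_grp: "subgrp (P m)" and Q_grp: "subgrp (Q m)" and QP: "Q m \<subseteq> P m"
    and xP: "j \<in> L \<Longrightarrow> a \<in> P m \<Longrightarrow> x j a \<in> P (m + w j)"
    and xQ: "j \<in> L \<Longrightarrow> a \<in> Q m \<Longrightarrow> x j a \<in> Q (m + w j)"
begin

lemmas chnP = subgrpD[OF subgrp_chn[of P, OF P_grp]]
lemmas chnQ = subgrpD[OF subgrp_chn[of Q, OF Q_grp]]

lemma chnQP: "c \<in> chn L w Q i m \<Longrightarrow> c \<in> chn L w P i m"
  using chn_mono[of Q P] QP by blast

lemma kd_chnP: "c \<in> chn L w P (Suc i) m \<Longrightarrow> kd x L c \<in> chn L w P i m"
  using kd_chn[OF kops_axioms _ P_grp xP] .

lemma kd_chnQ: "c \<in> chn L w Q (Suc i) m \<Longrightarrow> kd x L c \<in> chn L w Q i m"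
  using kd_chn[OF kops_axioms _ Q_grp xQ] .

lemma kd_kd0 [simp]: "kd x L (kd x L c) = 0"
  by (rule kd_kd) (rule kops_axioms)

end

section \<open>Regular elements, products of operators, and depth\<close>

lemma chn_refine:
  assumes "c \<in> chn L w P i m" "\<And>S. c S \<in> A (m - sum w S)"
  shows "c \<in> chn L w A i m"
  using assms unfolding chn_def by blast

text \<open>The decomposition is chosen coefficient by coefficient, with zeros where the chain
  vanishes, so that both parts have the support of a chain.\<close>

lemma chn_split:
  assumes c: "c \<in> chn L w (\<lambda>m. {q + f p | q p. q \<in> Q m \<and> p \<in> P (m - n)}) i m"
    and f0: "f 0 = 0"
  obtains q p where "q \<in> chn L w Q i m" "p \<in> chn L w P i (m - n)" "c = q + app f p"
proof -
  have "\<exists>qp. c S = fst qp + f (snd qp) \<and>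
      (S \<subseteq> L \<and> card S = i \<and> fst qp \<in> Q (m - sum w S) \<or> fst qp = 0) \<and>
      (S \<subseteq> L \<and> card S = i \<and> snd qp \<in> P (m - n - sum w S) \<or> snd qp = 0)" for S
    using chnD[OF c, of S]
  proof
    assume "c S = 0" then show ?thesis by (intro exI[of _ "(0, 0)"]) (simp add: f0)
  next
    assume *: "S \<subseteq> L \<and> card S = i \<and> c S \<in> {q + f p | q p. q \<in> Q (m - sum w S) \<and> p \<in> P (m - sum w S - n)}"
    then obtain q p where "c S = q + f p" "q \<in> Q (m - sum w S)" "p \<in> P (m - sum w S - n)" by blast
    moreover have "m - sum w S - n = m - n - sum w S" by simp
    ultimately show ?thesis using * by (intro exI[of _ "(q, p)"]) simp
  qed
  then obtain F where F: "\<And>S. c S = fst (F S) + f (snd (F S)) \<and>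
      (S \<subseteq> L \<and> card S = i \<and> fst (F S) \<in> Q (m - sum w S) \<or> fst (F S) = 0) \<and>
      (S \<subseteq> L \<and> card S = i \<and> snd (F S) \<in> P (m - n - sum w S) \<or> snd (F S) = 0)" by metis
  show ?thesis
    by (rule that[of "fst \<circ> F" "snd \<circ> F"]) (use F in \<open>auto simp: chn_def app_def fun_eq_iff\<close>)
qed

lemma decomp: "c = iota j (eps j c) + eps j (iota j c)"
  by (rule iota_eps_same[symmetric])

text \<open>If \<open>x\<^sub>j\<close> is a nonzerodivisor on \<open>P/Q\<close>, it can be eliminated from the Koszul complex.\<close>

lemma KH0_regular:
  assumes km: "kmod x (insert j L) w P Q" and j: "j \<notin> L"
    and reg: "\<And>g m. g \<in> P m \<Longrightarrow> x j g \<in> Q (m + w j) \<Longrightarrow> g \<in> Q m"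
    and H: "KH0 x L w P (\<lambda>m. {q + x j p | q p. q \<in> Q m \<and> p \<in> P (m - w j)}) (Suc i) m"
  shows "KH0 x (insert j L) w P Q (Suc i) m"
proof -
  interpret J: kmod x "insert j L" w P Q by fact
  let ?J = "insert j L" and ?Q' = "\<lambda>m. {q + x j p | q p. q \<in> Q m \<and> p \<in> P (m - w j)}"
  interpret L: kmod x L w P Q
    using kops_subset[OF J.kops_axioms, of L] J.kmod_axioms unfolding kmod_def kmod_axioms_def by auto
  have finJ: "finite ?J" and finL: "finite L" using J.fin by auto
  have kdJ: "kd x ?J c = app (x j) (iota j c) + kd x L c" for c
    using kd_insert[OF finL j] .
  have jj: "j \<in> ?J" by simp
  have mono: "c \<in> chn L w A k n \<Longrightarrow> c \<in> chn ?J w A k n" for c k n and A :: "int \<Rightarrow> 'a set"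
    using chn_mono_set[of L ?J] by blast
  have iota_L: "iota j c \<in> chn L w A k (n - w j)" if "c \<in> chn ?J w A (Suc k) n" "\<And>m. subgrp (A m)" for c k n and A :: "int \<Rightarrow> 'a set"
    using iota_chn[OF that finJ, of j] j by simp
  have kdJ0: "kd x ?J c = kd x L c" if "iota j c = 0" for c
    by (simp add: kdJ that) (auto simp: app_def fun_eq_iff J.op_zero)
  show ?thesis unfolding KH0_def
  proof (intro ballI impI)
    fix z assume z: "z \<in> chn ?J w P (Suc i) m" and "kd x ?J z \<in> chn ?J w Q (Suc i - 1) m"
    then have dz: "kd x ?J z \<in> chn ?J w Q i m" by simp
    \<comment> \<open>Split \<open>z\<close> into the part \<open>a\<close> without
      \<open>e_j\<close> and the part \<open>e_j\<close> times \<open>b\<close>.\<close>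
    define a where "a = iota j (eps j z)"
    define b where "b = iota j z"
    have zab: "z = a + eps j b" unfolding a_def b_def by (rule decomp)
    have a: "a \<in> chn L w P (Suc i) m" unfolding a_def using iota_eps_chn[OF z j] .
    have b: "b \<in> chn L w P i (m - w j)" unfolding b_def using iota_L[OF z J.P_grp] .
    have ia: "iota j a = 0" and ib: "iota j b = 0" by (simp_all add: a_def b_def)
    have e: "kd x ?J z = kd x L a + app (x j) b - eps j (kd x L b)"
      unfolding zab J.kd_add J.kd_eps[OF jj] kdJ0[OF ia] kdJ0[OF ib] by (simp add: algebra_simps)
    have ib': "iota j (kd x ?J z) = - kd x L b"
      unfolding J.iota_kd b_def[symmetric] kdJ0[OF ib] ..
    have edb: "eps j (kd x L b) \<in> chn ?J w Q i m"
    proof (cases i)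
      case 0
      with b have "kd x L b = 0" by (simp add: kd_chn_0[OF L.kops_axioms])
      then show ?thesis by simp
    next
      case (Suc k)
      with iota_L[of "kd x ?J z" Q k m] dz have "- kd x L b \<in> chn L w Q k (m - w j)"
        unfolding ib' using J.Q_grp by simp
      from L.chnQ(3)[OF this] have "kd x L b \<in> chn L w Q k (m - w j)" by simp
      from eps_chn[OF this J.Q_grp finL] show ?thesis unfolding Suc .
    qed
    \<comment> \<open>Modulo \<open>Q\<close> the boundary of \<open>a\<close> is
      \<open>- x j b\<close>, so \<open>a\<close> becomes a cycle once \<open>x j\<close> is divided
      out.\<close>
    have da: "kd x L a \<in> chn L w ?Q' i m"
    proof (rule chn_refine[OF L.kd_chnP[OF a]])
      fix S
      let ?n = "m - sum w S"
      have 1: "(kd x ?J z + eps j (kd x L b)) S \<in> Q ?n"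
        by (rule chn_in[OF J.chnQ(4)[OF dz edb] J.Q_grp])
      have 2: "- b S \<in> P (?n - w j)"
        using subgrpD(3)[OF J.P_grp chn_in[OF b J.P_grp, of S]] by (simp add: algebra_simps)
      have "kd x L a S = (kd x ?J z + eps j (kd x L b)) S + x j (- b S)"
        using e by (simp add: app_def J.op_minus)
      with 1 2 show "kd x L a S \<in> ?Q' ?n" by blast
    qed
    have "\<exists>v\<in>chn L w P (Suc (Suc i)) m. a - kd x L v \<in> chn L w ?Q' (Suc i) m"
      by (rule H[unfolded KH0_def, rule_format, OF a]) (simp only: diff_Suc_1 da)
    then obtain v where v: "v \<in> chn L w P (Suc (Suc i)) m" and "a - kd x L v \<in> chn L w ?Q' (Suc i) m" ..
    then obtain q p where q: "q \<in> chn L w Q (Suc i) m" and p: "p \<in> chn L w P (Suc i) (m - w j)"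
      and apq: "a - kd x L v = q + app (x j) p"
      by (elim chn_split) (use J.op_zero in auto)
    have off: "iota j c = 0" if "c \<in> chn L w A k n" for c k n and A :: "int \<Rightarrow> 'a set"
    proof
      fix S from chnD[OF that, of "insert j S"] j show "iota j c S = 0 S" by (auto simp: iota_def)
    qed
    \<comment> \<open>Subtracting the boundary of \<open>v + e_j p\<close> removes \<open>a\<close>
      up to \<open>Q\<close> and turns \<open>b\<close> into \<open>b + d p\<close>. What remains
      still has its boundary in \<open>Q\<close>; its coefficients at sets without \<open>j\<close>
      say that \<open>x j b'\<close> lies in \<open>Q\<close>, and regularity applies.\<close>
    define b' where "b' = b + kd x L p"
    have b': "b' \<in> chn L w P i (m - w j)" unfolding b'_def by (intro L.chnP(4) b L.kd_chnP p)
    have dv: "kd x ?J (v + eps j p) = kd x L v + app (x j) p - eps j (kd x L p)"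
      unfolding J.kd_add J.kd_eps[OF jj] kdJ0[OF off[OF v]] kdJ0[OF off[OF p]] by (simp add: algebra_simps)
    have zq: "z - kd x ?J (v + eps j p) = q + eps j b'"
      unfolding dv b'_def eps.add zab using apq by (simp add: algebra_simps)
    have "kd x ?J q + kd x ?J (eps j b') = kd x ?J z"
      unfolding J.kd_add[symmetric] zq[symmetric] J.kd_diff J.kd_kd0 by simp
    then have "kd x ?J (eps j b') = kd x ?J z - kd x ?J q"
      by (simp add: eq_diff_eq add.commute)
    then have Qin: "kd x ?J (eps j b') \<in> chn ?J w Q i m"
      using J.chnQ(2)[OF dz J.kd_chnQ[OF mono[OF q]]] by simp
    have eb': "kd x ?J (eps j b') = app (x j) b' - eps j (kd x L b')"
      unfolding J.kd_eps[OF jj] kdJ0[OF off[OF b']] ..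
    have b'Q: "b' \<in> chn L w Q i (m - w j)"
    proof (rule chn_refine[OF b'])
      fix S
      show "b' S \<in> Q (m - w j - sum w S)"
      proof (cases "j \<in> S")
        case True
        with chnD[OF b', of S] j have "b' S = 0" by auto
        then show ?thesis by (simp add: subgrpD(1)[OF J.Q_grp])
      next
        case False
        have "kd x ?J (eps j b') S \<in> Q (m - sum w S)" by (rule chn_in[OF Qin J.Q_grp])
        then have "x j (b' S) \<in> Q ((m - w j - sum w S) + w j)"
          unfolding eb' using False by (simp add: app_def eps_def)
        moreover have "b' S \<in> P (m - w j - sum w S)" by (rule chn_in[OF b' J.P_grp])
        ultimately show ?thesis using reg by blast
      qed
    qed
    have "z - kd x ?J (v + eps j p) \<in> chn ?J w Q (Suc i) m"
      unfolding zq by (intro J.chnQ(4) mono[OF q] eps_chn b'Q J.Q_grp finL)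
    moreover have "v + eps j p \<in> chn ?J w P (Suc (Suc i)) m"
      by (intro J.chnP(4) mono[OF v] eps_chn p J.P_grp finL)
    ultimately show "\<exists>v\<in>chn ?J w P (Suc (Suc i)) m. z - kd x ?J v \<in> chn ?J w Q (Suc i) m" by blast
  qed
qed

text \<open>Sending \<open>a + e_j b\<close> to \<open>a + e_j (v b)\<close> is a chain map from the
  complex on \<open>u \<circ> v\<close> to the complex on \<open>u\<close>. A cycle whose image
  bounds there is corrected by means of the complex on \<open>v\<close>, which appears shifted by
  \<open>wu\<close>. The proof is this diagram chase on components.\<close>

lemma KH0_compose:
  fixes x :: "nat \<Rightarrow> 'v::ab_group_add \<Rightarrow> 'v"
  assumes kmu: "kmod (x(j := u)) (insert j L) (w(j := wu)) P Q"
    and kmv: "kmod (x(j := v)) (insert j L) (w(j := wv)) P Q"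
    and uv: "\<And>a. u (v a) = v (u a)" and j: "j \<notin> L"
    and Hu: "KH0 (x(j := u)) (insert j L) (w(j := wu)) P Q i m"
    and Hv: "KH0 (x(j := v)) (insert j L) (w(j := wv)) P Q i (m - wu)"
  shows "KH0 (x(j := u \<circ> v)) (insert j L) (w(j := wu + wv)) P Q i m"
proof -
  let ?J = "insert j L"
  interpret U: kmod "x(j := u)" ?J "w(j := wu)" P Q by fact
  interpret V: kmod "x(j := v)" ?J "w(j := wv)" P Q by fact
  have jj: "j \<in> ?J" by simp
  have u_add: "u (a + b) = u a + u b" for a b using U.op_add[OF jj] by simp
  have v_add: "v (a + b) = v a + v b" for a b using V.op_add[OF jj] by simp
  have uP: "a \<in> P n \<Longrightarrow> u a \<in> P (n + wu)" for a n using U.xP[OF jj] by simp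
  have uQ: "a \<in> Q n \<Longrightarrow> u a \<in> Q (n + wu)" for a n using U.xQ[OF jj] by simp
  have vP: "a \<in> P n \<Longrightarrow> v a \<in> P (n + wv)" for a n using V.xP[OF jj] by simp
  have vQ: "a \<in> Q n \<Longrightarrow> v a \<in> Q (n + wv)" for a n using V.xQ[OF jj] by simp
  have ne: "k \<in> L \<Longrightarrow> k \<noteq> j" for k using j by auto
  have x_add: "x k (a + b) = x k a + x k b" if "k \<in> L" for k a b
    using U.op_add[of k a b] that ne by auto
  have x_comm: "x k (x l a) = x l (x k a)" if "k \<in> L" "l \<in> L" for k l a
    using U.op_comm[of k l a] that ne by auto
  have xu: "x k (u a) = u (x k a)" if "k \<in> L" for k a
    using U.op_comm[of k j a] that ne by auto
  have xv: "x k (v a) = v (x k a)" if "k \<in> L" for k a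
    using V.op_comm[of k j a] that ne by auto
  have xP: "a \<in> P n \<Longrightarrow> x k a \<in> P (n + w k)" if "k \<in> L" for k a n
    using U.xP[of k a n] that ne by auto
  have xQ: "a \<in> Q n \<Longrightarrow> x k a \<in> Q (n + w k)" if "k \<in> L" for k a n
    using U.xQ[of k a n] that ne by auto
  interpret M: kmod "x(j := u \<circ> v)" ?J "w(j := wu + wv)" P Q
  proof
    fix k a b assume "k \<in> ?J" then show "(x(j := u \<circ> v)) k (a + b) = (x(j := u \<circ> v)) k a + (x(j := u \<circ> v)) k b"
      using ne by (auto simp: u_add v_add x_add)
  next
    fix k l a assume "k \<in> ?J" "l \<in> ?J"
    then show "(x(j := u \<circ> v)) k ((x(j := u \<circ> v)) l a) = (x(j := u \<circ> v)) l ((x(j := u \<circ> v)) k a)"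
      using ne by (auto simp: x_comm xu xv)
  next
    show "finite ?J" by (rule U.fin)
  next
    fix k a n assume "k \<in> ?J" "a \<in> P n"
    then show "(x(j := u \<circ> v)) k a \<in> P (n + (w(j := wu + wv)) k)"
      using ne xP uP[OF vP, of a n] by (auto simp: algebra_simps)
  next
    fix k a n assume "k \<in> ?J" "a \<in> Q n"
    then show "(x(j := u \<circ> v)) k a \<in> Q (n + (w(j := wu + wv)) k)"
      using ne xQ uQ[OF vQ, of a n] by (auto simp: algebra_simps)
  qed (use U.P_grp U.Q_grp U.QP in auto)
  interpret L: kmod x L w P Q
  proof
    show "finite L" using U.fin by simp
  qed (use U.P_grp U.Q_grp U.QP x_add x_comm xP xQ in auto)
  have finL: "finite L" by (rule L.fin)
  have kdL: "kd (x(j := f)) L c = kd x L c" for f c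
    using j by (auto simp: kd_def fun_eq_iff intro!: sum.cong)
  have kdJ: "kd (x(j := f)) ?J c = app f (iota j c) + kd x L c" for f c
    unfolding kd_insert[OF finL j] kdL by simp
  have chnL: "chn L (w(j := k)) A = chn L w A" for k and A :: "int \<Rightarrow> 'v set"
  proof -
    have "S \<subseteq> L \<Longrightarrow> sum (w(j := k)) S = sum w S" for S using j by (intro sum.cong) auto
    then show ?thesis by (auto simp: chn_def fun_eq_iff) metis+
  qed
  have mono: "c \<in> chn L w A k n \<Longrightarrow> c \<in> chn ?J (w(j := r)) A k n" for c k n r and A :: "int \<Rightarrow> 'v set"
    using chn_mono_set[of L ?J "w(j := r)" A k n] unfolding chnL by blast
  have eps_in: "eps j c \<in> chn ?J (w(j := r)) A k n" if "c \<in> chn L w A (k - 1) (n - r)" "k = 0 \<Longrightarrow> c = 0"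
      "\<And>m. subgrp (A m)" for c k n r and A :: "int \<Rightarrow> 'v set"
  proof (cases k)
    case 0 with that show ?thesis by simp
  next
    case (Suc l)
    with that have "c \<in> chn L (w(j := r)) A l (n - (w(j := r)) j)" by (simp add: chnL)
    from eps_chn[OF this that(3) finL] Suc show ?thesis by simp
  qed
  have iota_in: "iota j c \<in> chn L w A (k - 1) (n - r)" "k = 0 \<Longrightarrow> iota j c = 0" if "c \<in> chn ?J (w(j := r)) A k n"
      "\<And>m. subgrp (A m)" for c k n r and A :: "int \<Rightarrow> 'v set"
  proof -
    show "iota j c \<in> chn L w A (k - 1) (n - r)"
    proof (cases k)
      case 0 with that U.fin show ?thesis by (simp add: iota_chn_0)
    next
      case (Suc l)
      with iota_chn[of c ?J "w(j := r)" A l n j] that U.fin j show ?thesis by (simp add: chnL)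
    qed
    show "k = 0 \<Longrightarrow> iota j c = 0" using that U.fin by (simp add: iota_chn_0)
  qed
  have dec: "iota j (eps j c) \<in> chn L w A k n" if "c \<in> chn ?J (w(j := r)) A k n" for c k n r and A :: "int \<Rightarrow> 'v set"
    using iota_eps_chn[OF that j] by (simp add: chnL)
  have kd1: "kd (x(j := f)) ?J (a + eps j b) = kd x L a + app f b - eps j (kd x L b)"
    if "iota j a = 0" "iota j b = 0" "f 0 = 0" for a b f
  proof -
    have "iota j (a + eps j b) = b"
      using that iota_eps_same[of j b] by (simp add: iota.add)
    then show ?thesis
      unfolding kdJ L.kd_add L.kd_eps_notin[OF j] by simp
  qed
  have zeros: "u 0 = 0" "v 0 = 0" "(u \<circ> v) 0 = 0"
    using u_add[of 0 0] v_add[of 0 0] by auto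
  have ekQ: "eps j c \<in> chn ?J (w(j := r)) Q k n \<Longrightarrow> iota j c = 0 \<Longrightarrow> c \<in> chn L w Q (k - 1) (n - r)" for c k n r
    using iota_in(1)[of "eps j c" r Q k n] U.Q_grp iota_eps_same[of j c] by simp
  have split: "a \<in> chn L w Q k n \<and> b \<in> chn L w Q (k - 1) (n - r)"
    if "a + eps j b \<in> chn ?J (w(j := r)) Q k n" "iota j a = 0" "iota j b = 0" for a b k n r
  proof -
    have "iota j (a + eps j b) = b" using that iota_eps_same[of j b] by (simp add: iota.add)
    moreover from this have "iota j (eps j (a + eps j b)) = a"
      using decomp[of "a + eps j b" j] by simp
    ultimately show ?thesis using iota_in(1)[OF that(1) U.Q_grp] dec[OF that(1)] by simp
  qed
  show ?thesis unfolding KH0_def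
  proof (intro ballI impI)
    fix z assume z: "z \<in> chn ?J (w(j := wu + wv)) P i m"
      and dz: "kd (x(j := u \<circ> v)) ?J z \<in> chn ?J (w(j := wu + wv)) Q (i - 1) m"
    define a where "a = iota j (eps j z)"
    define b where "b = iota j z"
    have zab: "z = a + eps j b" unfolding a_def b_def by (rule decomp)
    have a: "a \<in> chn L w P i m" unfolding a_def using dec[OF z] .
    have b: "b \<in> chn L w P (i - 1) (m - (wu + wv))" and b0: "i = 0 \<Longrightarrow> b = 0"
      unfolding b_def using iota_in[OF z U.P_grp] by auto
    have ia: "iota j a = 0" and ib: "iota j b = 0" by (simp_all add: a_def b_def)
    have ik: "iota j (kd x L c) = 0" if "iota j c = 0" for c by (simp add: L.iota_kd that)
    have iap: "iota j (app f c) = 0" if "iota j c = 0" "\<And>a b. f (a + b) = f a + f b" "f 0 = 0" for f c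
      using that by (simp add: iota_app) (simp add: app_def fun_eq_iff)
    note iu = iap[OF _ u_add zeros(1)] note iv = iap[OF _ v_add zeros(2)]
    note izs = ia ib ik iu iv iota.add iota.diff iota.minus
    have dz2: "kd (x(j := u \<circ> v)) ?J z = (kd x L a + app u (app v b)) + eps j (- kd x L b)"
      unfolding zab kd1[of _ _ "u \<circ> v", OF ia ib zeros(3)] eps.minus by (simp add: app_def comp_def fun_eq_iff)
    have s1: "kd x L a + app u (app v b) \<in> chn L w Q (i - 1) m"
      and s2': "- kd x L b \<in> chn L w Q (i - 1 - 1) (m - (wu + wv))"
      using split[OF dz[unfolded dz2]] by (simp_all add: izs)
    from s2' have s2: "kd x L b \<in> chn L w Q (i - 1 - 1) (m - (wu + wv))" using L.chnQ(3)[OF s2'] by simp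
    have k0: "i - 1 = 0 \<Longrightarrow> kd x L b = 0" using b kd_chn_0[OF L.kops_axioms, of b] by simp
    have vb: "app v b \<in> chn L w P (i - 1) (m - wu)"
      using chn_app[where f=v and P'=P and n=wv, OF b zeros(2)] vP by (simp add: algebra_simps)
    \<comment> \<open>The image of \<open>z\<close> in the complex on \<open>u\<close>. Exactness
      there produces \<open>b'\<close> with \<open>v b + d b'\<close> in \<open>Q\<close>.\<close>
    define z' where "z' = a + eps j (app v b)"
    have z': "z' \<in> chn ?J (w(j := wu)) P i m" unfolding z'_def
      by (intro U.chnP(4) mono a eps_in vb U.P_grp) (use b0 zeros in \<open>auto simp: app_def fun_eq_iff\<close>)
    have kv: "kd x L (app v c) = app v (kd x L c)" for c
      by (rule kd_app[OF L.kops_axioms]) (auto simp: v_add xv)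
    have ku: "kd x L (app u c) = app u (kd x L c)" for c
      by (rule kd_app[OF L.kops_axioms]) (auto simp: u_add xu)
    have dz': "kd (x(j := u)) ?J z' = (kd x L a + app u (app v b)) + eps j (- app v (kd x L b))"
      unfolding z'_def kd1[of _ _ u, OF ia iv[OF ib] zeros(1)] eps.minus kv by simp
    have vkb: "- app v (kd x L b) \<in> chn L w Q (i - 1 - 1) (m - wu)"
      using chn_app[where f=v and P'=Q and n=wv, OF s2 zeros(2)] vQ L.chnQ(3) by (simp add: algebra_simps)
    have "kd (x(j := u)) ?J z' \<in> chn ?J (w(j := wu)) Q (i - 1) m" unfolding dz'
      by (intro U.chnQ(4) mono s1 eps_in vkb U.Q_grp) (use k0 zeros in \<open>auto simp: app_def fun_eq_iff\<close>)
    with Hu z' obtain y where y: "y \<in> chn ?J (w(j := wu)) P (Suc i) m"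
      and zy: "z' - kd (x(j := u)) ?J y \<in> chn ?J (w(j := wu)) Q i m" unfolding KH0_def by blast
    define a' where "a' = iota j (eps j y)"
    define b' where "b' = iota j y"
    have yab: "y = a' + eps j b'" unfolding a'_def b'_def by (rule decomp)
    have a': "a' \<in> chn L w P (Suc i) m" unfolding a'_def using dec[OF y] .
    have b': "b' \<in> chn L w P i (m - wu)" unfolding b'_def using iota_in(1)[OF y U.P_grp] by simp
    have ia': "iota j a' = 0" and ib': "iota j b' = 0" by (simp_all add: a'_def b'_def)
    have "z' - kd (x(j := u)) ?J y = (a - kd x L a' - app u b') + eps j (app v b + kd x L b')"
      unfolding z'_def yab kd1[of _ _ u, OF ia' ib' zeros(1)] eps.add by (simp add: algebra_simps)
    with zy have t: "(a - kd x L a' - app u b') \<in> chn L w Q i m \<and> (app v b + kd x L b') \<in> chn L w Q (i - 1) (m - wu)"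
      by (intro split) (auto simp: izs ia' ib')
    \<comment> \<open>The relation just obtained makes \<open>b' + e_j b\<close> a cycle for
      \<open>v\<close>. Its degree is lower by \<open>wu\<close>, which is where the second
      exactness hypothesis is stated.\<close>
    define z2 where "z2 = b' + eps j b"
    have z2: "z2 \<in> chn ?J (w(j := wv)) P i (m - wu)" unfolding z2_def
      by (intro V.chnP(4) mono b' eps_in U.P_grp) (use b b0 in \<open>auto simp: algebra_simps\<close>)
    have "kd (x(j := v)) ?J z2 = (app v b + kd x L b') + eps j (- kd x L b)"
      unfolding z2_def kd1[of _ _ v, OF ib' ib zeros(2)] eps.minus by simp
    moreover have "\<dots> \<in> chn ?J (w(j := wv)) Q (i - 1) (m - wu)"
      by (intro V.chnQ(4)[OF mono eps_in] U.Q_grp) (use t s2' k0 in \<open>auto simp: algebra_simps\<close>)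
    ultimately obtain y2 where y2: "y2 \<in> chn ?J (w(j := wv)) P (Suc i) (m - wu)"
      and zy2: "z2 - kd (x(j := v)) ?J y2 \<in> chn ?J (w(j := wv)) Q i (m - wu)"
      using Hv z2 unfolding KH0_def by metis
    define a2 where "a2 = iota j (eps j y2)"
    define b2 where "b2 = iota j y2"
    have yab2: "y2 = a2 + eps j b2" unfolding a2_def b2_def by (rule decomp)
    have a2: "a2 \<in> chn L w P (Suc i) (m - wu)" unfolding a2_def using dec[OF y2] .
    have b2: "b2 \<in> chn L w P i (m - wu - wv)" unfolding b2_def using iota_in(1)[OF y2 U.P_grp] by simp
    have ia2: "iota j a2 = 0" and ib2: "iota j b2 = 0" by (simp_all add: a2_def b2_def)
    have "z2 - kd (x(j := v)) ?J y2 = (b' - kd x L a2 - app v b2) + eps j (b + kd x L b2)"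
      unfolding z2_def yab2 kd1[of _ _ v, OF ia2 ib2 zeros(2)] eps.add by (simp add: algebra_simps)
    with zy2 have t2: "(b' - kd x L a2 - app v b2) \<in> chn L w Q i (m - wu) \<and> (b + kd x L b2) \<in> chn L w Q (i - 1) (m - wu - wv)"
      by (intro split) (auto simp: izs ia2 ib2 ib')
    \<comment> \<open>Modulo \<open>Q\<close>, \<open>a\<close> is \<open>d a' + u b'\<close> and
      \<open>b'\<close> is \<open>d a2 + v b2\<close>; substituting the second into the first gives
      the primitive for the composite.\<close>
    define y3 where "y3 = (a' + app u a2) + eps j b2"
    have ua2: "app u a2 \<in> chn L w P (Suc i) m" using chn_app[where f=u and P'=P and n=wu, OF a2 zeros(1)] uP by simp
    have y3: "y3 \<in> chn ?J (w(j := wu + wv)) P (Suc i) m" unfolding y3_def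
      by (intro M.chnP(4) mono L.chnP(4) a' ua2 eps_in U.P_grp) (use b2 in \<open>auto simp: algebra_simps\<close>)
    have i3: "iota j (a' + app u a2) = 0" by (simp add: izs ia' ia2)
    have app_u: "app u (c + c') = app u c + app u c'" "app u (c - c') = app u c - app u c'" for c c'
    proof -
      interpret additive u by standard (rule u_add)
      show "app u (c + c') = app u c + app u c'" "app u (c - c') = app u c - app u c'"
        by (auto simp: app_def fun_eq_iff add diff)
    qed
    have uv_app: "app (u \<circ> v) c = app u (app v c)" for c by (simp add: app_def fun_eq_iff)
    have fin_eq: "z - kd (x(j := u \<circ> v)) ?J y3 = ((a - kd x L a' - app u b') + app u (b' - kd x L a2 - app v b2)) + eps j (b + kd x L b2)"
      unfolding zab y3_def kd1[of _ _ "u \<circ> v", OF i3 ib2 zeros(3)] eps.add L.kd_add ku uv_app app_u by (simp add: algebra_simps)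
    have ut2: "app u (b' - kd x L a2 - app v b2) \<in> chn L w Q i m"
      using chn_app[where f=u and P'=Q and n=wu, OF conjunct1[OF t2] zeros(1)] uQ by simp
    have l0: "i = 0 \<Longrightarrow> b + kd x L b2 = 0" using b0 b2 kd_chn_0[OF L.kops_axioms, of b2] by simp
    have "z - kd (x(j := u \<circ> v)) ?J y3 \<in> chn ?J (w(j := wu + wv)) Q i m" unfolding fin_eq
      by (intro M.chnQ(4)[OF mono[OF L.chnQ(4)[OF _ ut2]] eps_in] U.Q_grp) (use t t2 l0 in \<open>auto simp: algebra_simps\<close>)
    with y3 show "\<exists>v'\<in>chn ?J (w(j := wu + wv)) P (Suc i) m. z - kd (x(j := u \<circ> v)) ?J v' \<in> chn ?J (w(j := wu + wv)) Q i m"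
      by blast
  qed
qed

lemma kd_cong: "(\<And>j. j \<in> L \<Longrightarrow> x j = y j) \<Longrightarrow> kd x L = kd y L"
  by (auto simp: kd_def fun_eq_iff intro!: sum.cong)

lemma chn_cong:
  assumes "\<And>j. j \<in> L \<Longrightarrow> w j = w' j" shows "chn L w = chn L w'"
proof -
  have "S \<subseteq> L \<Longrightarrow> sum w S = sum w' S" for S using assms by (intro sum.cong) auto
  then show ?thesis by (auto simp: chn_def fun_eq_iff) metis+
qed

lemma KH0_cong:
  fixes x y :: "nat \<Rightarrow> 'a \<Rightarrow> 'a::ab_group_add"
  assumes "\<And>j. j \<in> L \<Longrightarrow> x j = y j" "\<And>j. j \<in> L \<Longrightarrow> w j = w' j"
  shows "KH0 x L w = KH0 y L w'"
proof (intro ext)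
  fix P Q :: "int \<Rightarrow> 'a set" and i m
  have 1: "kd x L = kd y L" by (rule kd_cong) (rule assms(1))
  have 2: "(chn L w :: (int \<Rightarrow> 'a set) \<Rightarrow> _) = chn L w'" by (rule chn_cong) (rule assms(2))
  show "KH0 x L w P Q i m = KH0 y L w' P Q i m" unfolding KH0_def 1 2 ..
qed

lemma app_diff: "app f (c - c') = app f c - app f c'" if "\<And>a b. f (a + b) = f a + f b"
  for f :: "'a::ab_group_add \<Rightarrow> 'b::ab_group_add"
proof -
  interpret additive f by standard (rule that)
  show ?thesis by (simp add: app_def fun_eq_iff diff)
qed

lemma (in kops) kd_sum: "kd x L (sum f A) = (\<Sum>a\<in>A. kd x L (f a))"
  by (induction A rule: infinite_finite_induct) (simp_all only: sum.infinite sum.empty sum.insert kd_zero kd_add not_False_eq_True)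

text \<open>As a combination of the \<open>x j\<close>, the element \<open>f\<close> acts as zero on
  Koszul homology, through the homotopy \<open>s\<close> built from the \<open>eps j\<close>. Hence
  in the long exact sequence of multiplication by \<open>f\<close> on \<open>A/I\<close> the
  connecting map from degree \<open>i + 1\<close> of \<open>A/(I + f A)\<close> to degree
  \<open>i\<close> of \<open>A/I\<close> is onto. The modules are constant in the internal degree
  because \<open>f\<close> may be inhomogeneous.\<close>

lemma KH0_depth:
  assumes km: "kmod x L w (\<lambda>_. A) (\<lambda>_. I)"
    and r_add: "\<And>j a b. j \<in> L \<Longrightarrow> r j (a + b) = r j a + r j b"
    and r_comm: "\<And>j k a. j \<in> L \<Longrightarrow> k \<in> L \<Longrightarrow> r j (x k a) = x k (r j a)"
    and rA: "\<And>j a. j \<in> L \<Longrightarrow> a \<in> A \<Longrightarrow> r j a \<in> A" and rI: "\<And>j a. j \<in> L \<Longrightarrow> a \<in> I \<Longrightarrow> r j a \<in> I"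
    and f: "\<And>a. f a = (\<Sum>j\<in>L. r j (x j a))"
    and reg: "\<And>a. a \<in> A \<Longrightarrow> f a \<in> I \<Longrightarrow> a \<in> I"
    and H: "KH0 x L w (\<lambda>_. A) (\<lambda>_. {q + f p | q p. q \<in> I \<and> p \<in> A}) (Suc i) m"
  shows "KH0 x L w (\<lambda>_. A) (\<lambda>_. I) i m"
proof -
  interpret kmod x L w "\<lambda>_. A" "\<lambda>_. I" by fact
  have r_zero: "r j 0 = 0" if "j \<in> L" for j using r_add[OF that, of 0 0] by simp
  have r_sum: "r j (sum g B) = (\<Sum>b\<in>B. r j (g b))" if "j \<in> L" for j g and B :: "'c set"
    by (induction B rule: infinite_finite_induct) (auto simp: r_add r_zero that)
  define s where "s = (\<lambda>c. \<Sum>j\<in>L. app (r j) (eps j c))"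
  have f_add: "f (a + b) = f a + f b" for a b
    by (simp add: f op_add r_add sum.distrib)
  have f0: "f 0 = 0" using f_add[of 0 0] by simp
  have fx: "f (x k a) = x k (f a)" if "k \<in> L" for k a
    using that by (auto simp: f op_sum r_comm op_comm intro!: sum.cong)
  have kf: "kd x L (app f c) = app f (kd x L c)" for c
    by (rule kd_app[OF kops_axioms]) (auto simp: f_add fx)
  have ks: "kd x L (s c) = app f c - s (kd x L c)" for c
  proof -
    have "kd x L (s c) = (\<Sum>j\<in>L. kd x L (app (r j) (eps j c)))"
      unfolding s_def by (rule kd_sum)
    also have "\<dots> = (\<Sum>j\<in>L. app (r j) (kd x L (eps j c)))"
      by (intro sum.cong refl kd_app[OF kops_axioms]) (auto simp: r_add r_comm)
    also have "\<dots> = (\<Sum>j\<in>L. app (r j) (app (x j) c) - app (r j) (eps j (kd x L c)))"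
      by (intro sum.cong refl) (simp add: kd_eps app_diff r_add)
    finally show ?thesis
      unfolding s_def by (simp add: sum_subtractf) (auto simp: app_def fun_eq_iff sum_fun_app f)
  qed
  have s_in: "s c \<in> chn L w (\<lambda>_. B) (Suc k) n" if "c \<in> chn L w (\<lambda>_. B) k n" "subgrp B" "\<And>j a. j \<in> L \<Longrightarrow> a \<in> B \<Longrightarrow> r j a \<in> B" for c B k n
    unfolding s_def
  proof (intro subgrp_sum subgrp_chn that(2))
    fix j assume j: "j \<in> L"
    have c: "c \<in> chn L w (\<lambda>_. B) k (n - w j)" using that(1) by (simp add: chn_def)
    have "eps j c \<in> chn L w (\<lambda>_. B) (Suc k) n"
      using eps_chn[OF c that(2) fin] j by (simp add: insert_absorb)
    from chn_app[where f = "r j" and P' = "\<lambda>_. B" and n = 0, OF this r_zero[OF j]] show "app (r j) (eps j c) \<in> chn L w (\<lambda>_. B) (Suc k) n"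
      using that(3) j by simp
  qed
  show ?thesis unfolding KH0_def
  proof (intro ballI impI)
    fix z assume z: "z \<in> chn L w (\<lambda>_. A) i m" and dz: "kd x L z \<in> chn L w (\<lambda>_. I) (i - 1) m"
    have sz: "s z \<in> chn L w (\<lambda>_. A) (Suc i) m" by (rule s_in[OF z P_grp rA])
    have sdz: "s (kd x L z) \<in> chn L w (\<lambda>_. I) i m"
    proof (cases i)
      case 0 with z have "kd x L z = 0" by (simp add: kd_chn_0[OF kops_axioms])
      moreover have "s 0 = 0" unfolding s_def by (auto simp: app_def fun_eq_iff sum_fun_app r_zero)
      ultimately show ?thesis by simp
    next
      case (Suc k) with s_in[OF dz Q_grp rI] show ?thesis by simp
    qed
    \<comment> \<open>The boundary of \<open>s z\<close> is \<open>f z\<close> up to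
      \<open>I\<close>. So \<open>s z\<close> is a cycle modulo \<open>I + f A\<close>, and the
      connecting map takes its class to that of \<open>z\<close>.\<close>
    have "kd x L (s z) \<in> chn L w (\<lambda>_. {q + f p | q p. q \<in> I \<and> p \<in> A}) i m"
    proof (rule chn_refine[OF kd_chnP[OF sz]])
      fix S
      have "- s (kd x L z) S \<in> I" using chn_in[OF chnQ(3)[OF sdz] Q_grp, of S] by simp
      moreover have "z S \<in> A" using chn_in[OF z P_grp] .
      moreover have "kd x L (s z) S = - s (kd x L z) S + f (z S)" by (simp add: ks app_def)
      ultimately show "kd x L (s z) S \<in> {q + f p | q p. q \<in> I \<and> p \<in> A}" by blast
    qed
    then have "\<exists>v\<in>chn L w (\<lambda>_. A) (Suc (Suc i)) m. s z - kd x L v \<in> chn L w (\<lambda>_. {q + f p | q p. q \<in> I \<and> p \<in> A}) (Suc i) m"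
      by (intro H[unfolded KH0_def, rule_format, OF sz]) simp
    then obtain u where u: "u \<in> chn L w (\<lambda>_. A) (Suc (Suc i)) m"
      and su: "s z - kd x L u \<in> chn L w (\<lambda>_. {q + f p | q p. q \<in> I \<and> p \<in> A}) (Suc i) m" ..
    from chn_split[where n = 0 and Q = "\<lambda>_. I" and P = "\<lambda>_. A", OF su f0]
    obtain q v where q: "q \<in> chn L w (\<lambda>_. I) (Suc i) m" and v: "v \<in> chn L w (\<lambda>_. A) (Suc i) m"
      and e: "s z - kd x L u = q + app f v" by auto
    have "kd x L (s z - kd x L u) = kd x L q + app f (kd x L v)" unfolding e kd_add kf ..
    then have "app f z - s (kd x L z) = kd x L q + app f (kd x L v)"
      by (simp only: kd_diff kd_kd0 diff_zero ks)
    then have "app f (z - kd x L v) = kd x L q + s (kd x L z)"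
      by (simp add: app_diff f_add diff_eq_eq algebra_simps)
    then have I: "app f (z - kd x L v) \<in> chn L w (\<lambda>_. I) i m"
      using chnQ(4)[OF kd_chnQ[OF q] sdz] by simp
    have "z - kd x L v \<in> chn L w (\<lambda>_. I) i m"
    proof (rule chn_refine[OF chnP(2)[OF z kd_chnP[OF v]]])
      fix S
      show "(z - kd x L v) S \<in> I"
        using reg[of "(z - kd x L v) S"] chn_in[OF I Q_grp, of S] chn_in[OF chnP(2)[OF z kd_chnP[OF v]] P_grp, of S]
        by (simp add: app_def)
    qed
    with v show "\<exists>v\<in>chn L w (\<lambda>_. A) (Suc i) m. z - kd x L v \<in> chn L w (\<lambda>_. I) i m" by blast
  qed
qed

section \<open>Comparison of Koszul complexes: isomorphisms and dimension shifting\<close>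

lemma KH0_iso:
  fixes \<pi> :: "'v::ab_group_add \<Rightarrow> 'u::ab_group_add"
  assumes km: "kmod x L w P K" and km': "kmod y L w P' Q"
    and add: "\<And>a b. \<pi> (a + b) = \<pi> a + \<pi> b" and comm: "\<And>j a. j \<in> L \<Longrightarrow> y j (\<pi> a) = \<pi> (x j a)"
    and PP': "\<And>m a. a \<in> P m \<Longrightarrow> \<pi> a \<in> P' m"
    and surj: "\<And>m b. b \<in> P' m \<Longrightarrow> \<exists>q\<in>Q m. \<exists>a\<in>P m. b = q + \<pi> a"
    and ker: "\<And>m a. a \<in> P m \<Longrightarrow> \<pi> a \<in> Q m \<longleftrightarrow> a \<in> K m"
  shows "KH0 x L w P K i m \<longleftrightarrow> KH0 y L w P' Q i m"
proof -
  interpret V: kmod x L w P K by fact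
  interpret U: kmod y L w P' Q by fact
  have zero: "\<pi> 0 = 0" using add[of 0 0] by simp
  have kpi: "kd y L (app \<pi> c) = app \<pi> (kd x L c)" for c
    by (rule kd_app[OF V.kops_axioms]) (auto simp: add comm)
  have pP: "c \<in> chn L w P k n \<Longrightarrow> app \<pi> c \<in> chn L w P' k n" for c k n
    using chn_app[of c L w P k n \<pi> P' 0] zero PP' by simp
  have pK: "c \<in> chn L w K k n \<Longrightarrow> app \<pi> c \<in> chn L w Q k n" for c k n
    using chn_app[of c L w K k n \<pi> Q 0] zero ker V.QP by auto
  have inK: "c \<in> chn L w K k n" if "c \<in> chn L w P k n" "app \<pi> c \<in> chn L w Q k n" for c k n
    using that(1)
  proof (rule chn_refine)
    fix S show "c S \<in> K (n - sum w S)"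
      using ker[OF chn_in[OF that(1) V.P_grp], of S] chn_in[OF that(2) U.Q_grp, of S] by (simp add: app_def)
  qed
  have spl: "\<exists>q\<in>chn L w Q k n. \<exists>a\<in>chn L w P k n. b = q + app \<pi> a" if b: "b \<in> chn L w P' k n" for b k n
  proof -
    have "b \<in> chn L w (\<lambda>m. {q + \<pi> p | q p. q \<in> Q m \<and> p \<in> P (m - 0)}) k n"
    proof (rule chn_refine[OF b])
      fix S
      from surj[OF chn_in[OF b U.P_grp, of S]] obtain q a where "q \<in> Q (n - sum w S)" "a \<in> P (n - sum w S)" "b S = q + \<pi> a" by blast
      then show "b S \<in> {q + \<pi> p | q p. q \<in> Q (n - sum w S) \<and> p \<in> P (n - sum w S - 0)}" by auto
    qed
    from chn_split[OF this zero] show ?thesis by (metis diff_zero)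
  qed
  show ?thesis
  proof
    assume H: "KH0 x L w P K i m"
    show "KH0 y L w P' Q i m" unfolding KH0_def
    proof (intro ballI impI)
      fix u assume u: "u \<in> chn L w P' i m" and du: "kd y L u \<in> chn L w Q (i - 1) m"
      from spl[OF u] obtain q z where q: "q \<in> chn L w Q i m" and z: "z \<in> chn L w P i m" and uq: "u = q + app \<pi> z" by blast
      have dq: "kd y L q \<in> chn L w Q (i - 1) m"
        using q by (cases i) (auto simp: kd_chn_0[OF U.kops_axioms] U.kd_chnQ)
      have dzP: "kd x L z \<in> chn L w P (i - 1) m"
        using z by (cases i) (auto simp: kd_chn_0[OF V.kops_axioms] V.kd_chnP)
      have "app \<pi> (kd x L z) = kd y L u - kd y L q" by (simp add: uq U.kd_add kpi)
      then have "app \<pi> (kd x L z) \<in> chn L w Q (i - 1) m" using U.chnQ(2)[OF du dq] by simp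
      from inK[OF dzP this] H z obtain v where v: "v \<in> chn L w P (Suc i) m" and zv: "z - kd x L v \<in> chn L w K i m"
        unfolding KH0_def by blast
      have "u - kd y L (app \<pi> v) = q + app \<pi> (z - kd x L v)"
        by (simp add: uq kpi app_diff add)
      then have "u - kd y L (app \<pi> v) \<in> chn L w Q i m" using U.chnQ(4)[OF q pK[OF zv]] by simp
      with pP[OF v] show "\<exists>v\<in>chn L w P' (Suc i) m. u - kd y L v \<in> chn L w Q i m" by blast
    qed
  next
    assume H: "KH0 y L w P' Q i m"
    show "KH0 x L w P K i m" unfolding KH0_def
    proof (intro ballI impI)
      fix z assume z: "z \<in> chn L w P i m" and dz: "kd x L z \<in> chn L w K (i - 1) m"
      have "kd y L (app \<pi> z) \<in> chn L w Q (i - 1) m" unfolding kpi by (rule pK[OF dz])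
      with H pP[OF z] obtain u where u: "u \<in> chn L w P' (Suc i) m" and zu: "app \<pi> z - kd y L u \<in> chn L w Q i m"
        unfolding KH0_def by blast
      from spl[OF u] obtain q v where q: "q \<in> chn L w Q (Suc i) m" and v: "v \<in> chn L w P (Suc i) m" and uq: "u = q + app \<pi> v" by blast
      have "app \<pi> (z - kd x L v) = (app \<pi> z - kd y L u) + kd y L q"
        by (simp add: uq U.kd_add kpi app_diff add)
      then have "app \<pi> (z - kd x L v) \<in> chn L w Q i m" using U.chnQ(4)[OF zu U.kd_chnQ[OF q]] by simp
      from inK[OF V.chnP(2)[OF z V.kd_chnP[OF v]] this] v
      show "\<exists>v\<in>chn L w P (Suc i) m. z - kd x L v \<in> chn L w K i m" by blast
    qed
  qed
qed

text \<open>Over an exact \<open>F\<close>, chains with equal boundary differ by a boundary, so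
  exactness of \<open>F/K\<close> is a question about boundaries lying in \<open>K\<close>.\<close>

lemma KH0_shift_aux:
  assumes km: "kmod x L w F K" and acyc: "KH0 x L w F (\<lambda>_. {0}) (Suc i) m"
  shows "KH0 x L w F K (Suc i) m \<longleftrightarrow>
    (\<forall>z\<in>chn L w F (Suc i) m. kd x L z \<in> chn L w K i m \<longrightarrow> (\<exists>\<kappa>\<in>chn L w K (Suc i) m. kd x L z = kd x L \<kappa>))"
proof -
  interpret kmod x L w F K by fact
  have ch0: "chn L w (\<lambda>_. {0}) k n = {0}" for k n
    by (auto simp: chn_def fun_eq_iff)
  show ?thesis
  proof
    assume H: "KH0 x L w F K (Suc i) m"
    show "\<forall>z\<in>chn L w F (Suc i) m. kd x L z \<in> chn L w K i m \<longrightarrow> (\<exists>\<kappa>\<in>chn L w K (Suc i) m. kd x L z = kd x L \<kappa>)"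
    proof (intro ballI impI)
      fix z assume z: "z \<in> chn L w F (Suc i) m" and dz: "kd x L z \<in> chn L w K i m"
      with H obtain v where "v \<in> chn L w F (Suc (Suc i)) m" "z - kd x L v \<in> chn L w K (Suc i) m"
        unfolding KH0_def by (metis diff_Suc_1)
      moreover have "kd x L (z - kd x L v) = kd x L z" unfolding kd_diff kd_kd0 by simp
      ultimately show "\<exists>\<kappa>\<in>chn L w K (Suc i) m. kd x L z = kd x L \<kappa>" by metis
    qed
  next
    assume H: "\<forall>z\<in>chn L w F (Suc i) m. kd x L z \<in> chn L w K i m \<longrightarrow> (\<exists>\<kappa>\<in>chn L w K (Suc i) m. kd x L z = kd x L \<kappa>)"
    show "KH0 x L w F K (Suc i) m" unfolding KH0_def
    proof (intro ballI impI)
      fix z assume z: "z \<in> chn L w F (Suc i) m" and "kd x L z \<in> chn L w K (Suc i - 1) m"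
      with H obtain \<kappa> where k: "\<kappa> \<in> chn L w K (Suc i) m" and e: "kd x L z = kd x L \<kappa>" by auto
      have "kd x L (z - \<kappa>) = 0" unfolding kd_diff e by simp
      moreover have "z - \<kappa> \<in> chn L w F (Suc i) m" by (rule chnP(2)[OF z chnQP[OF k]])
      ultimately obtain v where v: "v \<in> chn L w F (Suc (Suc i)) m" and "z - \<kappa> - kd x L v = 0"
        using acyc unfolding KH0_def ch0 by blast
      then have "z - kd x L v = \<kappa>" by (simp add: algebra_simps)
      with v k show "\<exists>v\<in>chn L w F (Suc (Suc i)) m. z - kd x L v \<in> chn L w K (Suc i) m" by metis
    qed
  qed
qed

text \<open>The long exact sequence of \<open>K\<close>, \<open>F\<close> and \<open>F/K\<close>:
  with \<open>F\<close> exact in both degrees the connecting map is an isomorphism.\<close>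

lemma KH0_shift:
  assumes km: "kmod x L w F K"
    and acyc: "KH0 x L w F (\<lambda>_. {0}) (Suc i) m" and acyc0: "KH0 x L w F (\<lambda>_. {0}) i m"
  shows "KH0 x L w F K (Suc i) m \<longleftrightarrow> KH0 x L w K (\<lambda>_. {0}) i m"
proof -
  interpret kmod x L w F K by fact
  have ch0: "chn L w (\<lambda>_. {0}) k n = {0}" for k n
    by (auto simp: chn_def fun_eq_iff)
  have *: "(\<exists>z\<in>chn L w F (Suc i) m. y = kd x L z) \<longleftrightarrow> kd x L y = 0" if "y \<in> chn L w F i m" for y
  proof
    assume "kd x L y = 0"
    with acyc0 that obtain v where "v \<in> chn L w F (Suc i) m" "y - kd x L v = 0" unfolding KH0_def ch0 by blast
    then show "\<exists>z\<in>chn L w F (Suc i) m. y = kd x L z" by auto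
  qed auto
  show ?thesis unfolding KH0_shift_aux[OF km acyc]
  proof
    assume H: "\<forall>z\<in>chn L w F (Suc i) m. kd x L z \<in> chn L w K i m \<longrightarrow> (\<exists>\<kappa>\<in>chn L w K (Suc i) m. kd x L z = kd x L \<kappa>)"
    show "KH0 x L w K (\<lambda>_. {0}) i m" unfolding KH0_def ch0
    proof (intro ballI impI)
      fix y assume y: "y \<in> chn L w K i m" and "kd x L y \<in> {0}"
      with *[OF chnQP[OF y]] H obtain \<kappa> where "\<kappa>\<in>chn L w K (Suc i) m" "y = kd x L \<kappa>" by auto
      then show "\<exists>v\<in>chn L w K (Suc i) m. y - kd x L v \<in> {0}" by auto
    qed
  next
    assume H: "KH0 x L w K (\<lambda>_. {0}) i m"
    show "\<forall>z\<in>chn L w F (Suc i) m. kd x L z \<in> chn L w K i m \<longrightarrow> (\<exists>\<kappa>\<in>chn L w K (Suc i) m. kd x L z = kd x L \<kappa>)"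
    proof (intro ballI impI)
      fix z assume "kd x L z \<in> chn L w K i m"
      moreover have "kd x L (kd x L z) \<in> {0}" by simp
      ultimately obtain v where "v\<in>chn L w K (Suc i) m" "kd x L z - kd x L v \<in> {0}"
        using H unfolding KH0_def ch0 by blast
      then show "\<exists>\<kappa>\<in>chn L w K (Suc i) m. kd x L z = kd x L \<kappa>" by auto
    qed
  qed
qed

section \<open>Homogeneous polynomials\<close>

abbreviation "mkeys \<equiv> Poly_Mapping.keys"
abbreviation "lk \<equiv> Poly_Mapping.lookup"
abbreviation "sng \<equiv> Poly_Mapping.single"

lemma mkeys_add: "mkeys (s + t) = mkeys s \<union> mkeys (t :: nat \<Rightarrow>\<^sub>0 nat)"
  by (auto simp: in_keys_iff lookup_add)

lemma mon_degree_superset: "finite A \<Longrightarrow> mkeys t \<subseteq> A \<Longrightarrow> mon_degree t = (\<Sum>i\<in>A. lk t i)"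
  unfolding mon_degree_def by (rule sum.mono_neutral_left) (auto simp: in_keys_iff)

lemma mon_degree_add: "mon_degree (s + t) = mon_degree s + mon_degree t"
proof -
  let ?A = "mkeys s \<union> mkeys t"
  show ?thesis
    using mon_degree_superset[of ?A s] mon_degree_superset[of ?A t] mon_degree_superset[of ?A "s + t"]
    by (simp add: mkeys_add lookup_add sum.distrib)
qed

lemma mon_degree_zero [simp]: "mon_degree 0 = 0"
  by (simp add: mon_degree_def)

lemma mon_degree_single [simp]: "mon_degree (sng i n) = n"
  by (cases "n = 0") (simp_all add: mon_degree_def)

lemma mon_degree_eq_0 [simp]: "mon_degree t = 0 \<longleftrightarrow> t = 0"
proof
  assume "mon_degree t = 0"
  then have "\<forall>i. lk t i = 0" by (auto simp: mon_degree_def in_keys_iff)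
  then show "t = 0" by (intro poly_mapping_eqI) simp
qed simp

text \<open>Graded components and all later splittings by divisibility are restrictions of this
  kind.\<close>

definition pres :: "(nat \<Rightarrow>\<^sub>0 nat) set \<Rightarrow> 'k::comm_ring_1 mpoly \<Rightarrow> 'k mpoly" where
  "pres A p = (\<Sum>t\<in>mkeys p \<inter> A. sng t (lk p t))"

lemma lookup_pres: "lk (pres A p) t = (if t \<in> A then lk p t else 0)"
  by (auto simp: pres_def lookup_sum lookup_single when_def in_keys_iff)

lemma keys_pres: "mkeys (pres A p) = mkeys p \<inter> A"
  by (auto simp: in_keys_iff lookup_pres split: if_splits)

lemma pres_add: "pres A (p + q) = pres A p + pres A q"
  by (rule poly_mapping_eqI) (simp add: lookup_pres lookup_add)

lemma pres_split: "p = pres A p + pres (- A) p"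
  by (rule poly_mapping_eqI) (simp add: lookup_pres lookup_add)

lemma pres_UNIV: "pres UNIV p = p"
  by (rule poly_mapping_eqI) (simp add: lookup_pres)

lemma pres_id: "mkeys p \<subseteq> A \<Longrightarrow> pres A p = p"
  by (rule poly_mapping_eqI) (auto simp: lookup_pres in_keys_iff)

lemma poly_sum_monomials: fixes p :: "'k::comm_ring_1 mpoly" shows "p = (\<Sum>t\<in>mkeys p. sng t (lk p t))"
  using pres_UNIV[of p] by (simp add: pres_def)

definition Xv :: "nat \<Rightarrow> 'k::comm_ring_1 mpoly" where "Xv j = sng (sng j 1) 1"

text \<open>Taking a set of degrees treats graded pieces (\<open>{m}\<close>) and the whole subring
  (\<open>UNIV\<close>) together, so closure properties are proved once.\<close>

definition forms :: "nat set \<Rightarrow> int set \<Rightarrow> 'k::comm_ring_1 mpoly set" where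
  "forms V D = {p. \<forall>t\<in>mkeys p. mkeys t \<subseteq> V \<and> int (mon_degree t) \<in> D}"

lemma poly_ring_forms: "poly_ring N = forms {..N} UNIV"
  by (simp add: poly_ring_def forms_def)

lemma forms_homogeneous: "{p \<in> poly_ring N. homogeneous p m} = forms {..N} {m}"
  by (auto simp: poly_ring_def forms_def homogeneous_def)

lemma subgrp_forms: "subgrp (forms V D)"
  unfolding subgrp_def
proof (intro conjI ballI)
  fix a b :: "'a mpoly" assume "a \<in> forms V D" "b \<in> forms V D"
  moreover have "mkeys (a - b) \<subseteq> mkeys a \<union> mkeys b" by (auto simp: in_keys_iff lookup_minus)
  ultimately show "a - b \<in> forms V D" unfolding forms_def by blast
qed (simp add: forms_def)

lemmas formsI = subgrpD[OF subgrp_forms]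

lemma forms_mono: "V \<subseteq> W \<Longrightarrow> D \<subseteq> E \<Longrightarrow> forms V D \<subseteq> forms W E"
  unfolding forms_def by blast

lemma forms_mult:
  assumes "p \<in> forms V D" "q \<in> forms V E" "\<And>a b. a \<in> D \<Longrightarrow> b \<in> E \<Longrightarrow> a + b \<in> G"
  shows "p * q \<in> forms V G"
  unfolding forms_def
proof (intro CollectI ballI)
  fix t assume "t \<in> mkeys (p * q)"
  then obtain a b where "a \<in> mkeys p" "b \<in> mkeys q" "t = a + b" using keys_mult[of p q] by blast
  with assms show "mkeys t \<subseteq> V \<and> int (mon_degree t) \<in> G"
    by (auto simp: forms_def mkeys_add mon_degree_add)
qed

lemma forms_mult1: "p \<in> forms V {a} \<Longrightarrow> q \<in> forms V {b} \<Longrightarrow> p * q \<in> forms V {a + b}"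
  by (rule forms_mult) auto

lemma forms_single: "mkeys t \<subseteq> V \<Longrightarrow> int (mon_degree t) \<in> D \<Longrightarrow> sng t c \<in> forms V D"
  by (auto simp: forms_def)

lemma forms_Xv: "j \<in> V \<Longrightarrow> Xv j \<in> forms V {1}"
  unfolding Xv_def by (rule forms_single) auto

lemma forms_const: "0 \<in> D \<Longrightarrow> sng 0 c \<in> forms V D"
  by (rule forms_single) auto

lemma forms_pres: "p \<in> forms V D \<Longrightarrow> pres A p \<in> forms V D"
  by (auto simp: forms_def keys_pres)

lemma forms_power: "p \<in> forms V {a} \<Longrightarrow> p ^ n \<in> forms V {int n * a}"
proof (induction n)
  case 0 show ?case using forms_const[of "{0}" 1 V] by simp
next
  case (Suc n)
  from forms_mult1[OF Suc.prems Suc.IH[OF Suc.prems]] show ?case by (simp add: algebra_simps)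
qed

lemma keys_times_single: "mkeys (sng s 1 * p) = (+) s ` mkeys (p :: 'k::comm_ring_1 mpoly)"
  and lookup_times_single: "lk (sng s 1 * p) (s + t) = lk (p :: 'k::comm_ring_1 mpoly) t"
proof -
  have *: "sng s 1 * p = (\<Sum>t\<in>mkeys p. sng (s + t) (lk p t))"
    by (subst poly_sum_monomials[of p]) (simp add: sum_distrib_left mult_single)
  show l: "lk (sng s 1 * p) (s + t) = lk p t" for t
    unfolding * by (simp add: lookup_sum lookup_single when_def in_keys_iff)
  have "u \<in> (+) s ` mkeys p" if "u \<in> mkeys (sng s 1 * p)" for u
    using that keys_mult[of "sng s 1" p] by (auto split: if_splits)
  moreover have "s + t \<in> mkeys (sng s 1 * p)" if "t \<in> mkeys p" for t
    using that l[of t] by (simp add: in_keys_iff)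
  ultimately show "mkeys (sng s 1 * p) = (+) s ` mkeys p" by blast
qed

lemma divide_Xv:
  assumes "p \<in> forms V D" "\<And>t. t \<in> mkeys p \<Longrightarrow> k \<in> mkeys t"
  obtains p' where "p = Xv k * p'" "p' \<in> forms V ((\<lambda>d. d - 1) ` D)"
proof
  define p' where "p' = (\<Sum>t\<in>mkeys p. sng (t - sng k 1) (lk p t))"
  have t: "sng k 1 + (t - sng k 1) = t" if "t \<in> mkeys p" for t
    using assms(2)[OF that] by (intro poly_mapping_eqI) (auto simp: lookup_add lookup_minus lookup_single when_def in_keys_iff)
  have "Xv k * p' = (\<Sum>t\<in>mkeys p. sng (sng k 1 + (t - sng k 1)) (lk p t))"
    by (simp add: Xv_def p'_def sum_distrib_left mult_single)
  also have "\<dots> = (\<Sum>t\<in>mkeys p. sng t (lk p t))" by (intro sum.cong refl) (simp only: t)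
  finally show "p = Xv k * p'" using poly_sum_monomials[of p] by simp
  show "p' \<in> forms V ((\<lambda>d. d - 1) ` D)" unfolding p'_def
  proof (intro subgrp_sum subgrp_forms forms_single)
    fix s assume s: "s \<in> mkeys p"
    have d: "int (mon_degree s) = 1 + int (mon_degree (s - sng k 1))"
      using mon_degree_add[of "sng k 1" "s - sng k 1"] unfolding t[OF s] by simp
    have "int (mon_degree s) \<in> D" "mkeys s \<subseteq> V" using assms(1) s by (auto simp: forms_def)
    with d show "int (mon_degree (s - sng k 1)) \<in> (\<lambda>d. d - 1) ` D" by force
    show "mkeys (s - sng k 1) \<subseteq> V" using \<open>mkeys s \<subseteq> V\<close> mkeys_add[of "sng k 1" "s - sng k 1"] unfolding t[OF s] by auto
  qed
qed

definition cmp :: "int \<Rightarrow> 'k::comm_ring_1 mpoly \<Rightarrow> 'k mpoly" where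
  "cmp m = pres {t. int (mon_degree t) = m}"

lemma hom_component_cmp: "hom_component m p = cmp (int m) p"
  unfolding hom_component_def cmp_def pres_def by (intro sum.cong) auto

lemma cmp_add: "cmp m (p + q) = cmp m p + cmp m q"
  by (simp add: cmp_def pres_add)

global_interpretation cmp: additive "cmp m" for m by standard (rule cmp_add)

lemma cmp_forms: "p \<in> forms V D \<Longrightarrow> cmp m p \<in> forms V {m}"
  by (auto simp: cmp_def forms_def keys_pres)

lemma cmp_forms_same: "p \<in> forms V {m} \<Longrightarrow> cmp m p = p"
  unfolding cmp_def by (rule pres_id) (auto simp: forms_def)

lemma cmp_forms_other: "p \<in> forms V {n} \<Longrightarrow> m \<noteq> n \<Longrightarrow> cmp m p = 0"
  by (rule poly_mapping_eqI) (auto simp: cmp_def lookup_pres forms_def in_keys_iff)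

lemma cmp_forms_if: "p \<in> forms V {n} \<Longrightarrow> cmp m p = (if m = n then p else 0)"
  using cmp_forms_same cmp_forms_other by metis

lemma cmp_neg: "m < 0 \<Longrightarrow> cmp m p = 0"
  by (rule poly_mapping_eqI) (auto simp: cmp_def lookup_pres)

lemma forms_neg: "p \<in> forms V {m} \<Longrightarrow> m < 0 \<Longrightarrow> p = 0"
  using cmp_neg cmp_forms_same by metis

definition degs :: "'k::comm_ring_1 mpoly \<Rightarrow> int set" where "degs p = (\<lambda>t. int (mon_degree t)) ` mkeys p"

lemma sum_cmp: assumes "finite D" "degs p \<subseteq> D" shows "p = (\<Sum>m\<in>D. cmp m p)"
  by (rule poly_mapping_eqI) (use assms in \<open>auto simp: lookup_sum cmp_def lookup_pres degs_def image_subset_iff in_keys_iff\<close>)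

lemma finite_degs: "finite (degs p)" by (simp add: degs_def)

lemma cmp_notin_degs: "m \<notin> degs p \<Longrightarrow> cmp m p = 0"
  by (rule poly_mapping_eqI) (auto simp: cmp_def lookup_pres degs_def in_keys_iff)

lemma forms_UNIV: "p \<in> forms V D \<Longrightarrow> p \<in> forms V UNIV"
  by (auto simp: forms_def)

lemma cmp_mult:
  assumes q: "q \<in> forms V {d}" and p: "p \<in> forms V UNIV"
  shows "cmp (m + d) (q * p) = q * cmp m p"
proof -
  have "q * p = (\<Sum>m\<in>degs p. q * cmp m p)"
    by (subst sum_cmp[OF finite_degs order_refl]) (simp add: sum_distrib_left)
  then have "cmp (m + d) (q * p) = (\<Sum>n\<in>degs p. cmp (m + d) (q * cmp n p))"
    by (simp add: cmp.sum)
  also have "\<dots> = (\<Sum>n\<in>degs p. if n = m then q * cmp m p else 0)"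
  proof (intro sum.cong refl)
    fix n
    have "q * cmp n p \<in> forms V {d + n}" by (rule forms_mult1[OF q cmp_forms[OF p]])
    from cmp_forms_if[OF this, of "m + d"]
    show "cmp (m + d) (q * cmp n p) = (if n = m then q * cmp m p else 0)" by auto
  qed
  also have "\<dots> = q * cmp m p"
    by (simp add: finite_degs cmp_notin_degs)
  finally show ?thesis .
qed

lemma forms_0_const: assumes "p \<in> forms V {0}" shows "p = sng 0 (const_coeff p)"
proof (rule poly_mapping_eqI)
  fix t show "lk p t = lk (sng 0 (const_coeff p)) t"
    using assms by (auto simp: forms_def const_coeff_def lookup_single when_def in_keys_iff)
qed

section \<open>Homogeneous ideals and the Koszul complex of \<open>R/I\<close>\<close>

definition gideal :: "nat \<Rightarrow> 'k::comm_ring_1 mpoly set \<Rightarrow> bool" where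
  "gideal N I \<longleftrightarrow> I \<subseteq> poly_ring N \<and> subgrp I \<and> (\<forall>a\<in>poly_ring N. \<forall>f\<in>I. a * f \<in> I) \<and> (\<forall>f\<in>I. \<forall>m. cmp m f \<in> I)"

abbreviation mulX :: "nat \<Rightarrow> 'k::comm_ring_1 mpoly \<Rightarrow> 'k mpoly" where "mulX \<equiv> \<lambda>j p. Xv j * p"
abbreviation one_wt :: "nat \<Rightarrow> int" where "one_wt \<equiv> \<lambda>_. 1"
abbreviation fP :: "nat \<Rightarrow> int \<Rightarrow> 'k::comm_ring_1 mpoly set" where "fP N m \<equiv> forms {..N} {m}"
abbreviation fI :: "nat \<Rightarrow> 'k::comm_ring_1 mpoly set \<Rightarrow> int \<Rightarrow> 'k mpoly set" where "fI N I m \<equiv> I \<inter> forms {..N} {m}"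

text \<open>Stands for the vanishing of \<open>Tor_i(R/I, k)_m\<close>; for positive
  \<open>i\<close> the agreement with \<open>tor_dim\<close> is \<open>tor_dim_kz\<close>.\<close>

definition kz :: "nat \<Rightarrow> 'k::comm_ring_1 mpoly set \<Rightarrow> nat \<Rightarrow> int \<Rightarrow> bool" where
  "kz N I i m \<longleftrightarrow> KH0 mulX {..N} one_wt (fP N) (fI N I) i m"

lemma kops_mulX: "finite L \<Longrightarrow> kops mulX L"
  by standard (auto simp: algebra_simps)

lemma kmod_mulX:
  assumes "L \<subseteq> {..N}" "\<And>m. subgrp (Q m)" "\<And>m. Q m \<subseteq> fP N m"
    "\<And>j a m. j \<in> L \<Longrightarrow> a \<in> Q m \<Longrightarrow> Xv j * a \<in> Q (m + 1)"
  shows "kmod mulX L one_wt (fP N) Q"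
proof -
  interpret kops mulX L by (rule kops_mulX) (use assms(1) finite_subset in blast)
  show ?thesis
  proof
    fix j a m assume "j \<in> L" "a \<in> fP N m"
    with assms(1) show "Xv j * a \<in> fP N (m + 1)"
      using forms_mult1[OF forms_Xv, of j "{..N}" a m] by (auto simp: add.commute)
  qed (use assms subgrp_forms in auto)
qed

lemma subgrp_Int: "subgrp A \<Longrightarrow> subgrp B \<Longrightarrow> subgrp (A \<inter> B)"
  by (auto simp: subgrp_def)

lemma gidealD:
  assumes "gideal N I"
  shows "f \<in> I \<Longrightarrow> f \<in> forms {..N} UNIV" "subgrp I" "a \<in> forms {..N} UNIV \<Longrightarrow> f \<in> I \<Longrightarrow> a * f \<in> I" "f \<in> I \<Longrightarrow> cmp m f \<in> I"
  using assms by (auto simp: gideal_def poly_ring_forms)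

lemma Xv_mult_fI:
  assumes "gideal N I" "j \<le> N" "a \<in> fI N I m" shows "Xv j * a \<in> fI N I (m + 1)"
  using assms forms_mult1[OF forms_Xv, of j "{..N}" a m] gidealD(3)[OF assms(1) forms_UNIV[OF forms_Xv]]
  by (auto simp: add.commute)

lemma kmod_gideal: "gideal N I \<Longrightarrow> kmod mulX {..N} one_wt (fP N) (fI N I)"
proof (rule kmod_mulX)
  fix j a m assume "gideal N I" "j \<in> {..N}" "a \<in> fI N I m"
  then show "Xv j * a \<in> fI N I (m + 1)" using Xv_mult_fI[of N I j a m] by simp
qed (auto intro: subgrp_Int subgrp_forms gidealD(2))

text \<open>The ideal \<open>(x_0, ..., x_(k-1))\<close> through its monomials, a form in which
  \<open>x_k\<close> is visibly a nonzerodivisor modulo it.\<close>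

definition monid :: "nat \<Rightarrow> nat \<Rightarrow> int set \<Rightarrow> 'k::comm_ring_1 mpoly set" where
  "monid N k D = {p \<in> forms {..N} D. \<forall>t\<in>mkeys p. \<exists>i<k. i \<in> mkeys t}"

lemma subgrp_monid: "subgrp (monid N k D)"
proof -
  have "subgrp {p :: 'k::comm_ring_1 mpoly. \<forall>t\<in>mkeys p. \<exists>i<k. i \<in> mkeys t}"
    by (auto simp: subgrp_def in_keys_iff lookup_minus)
  from subgrp_Int[OF subgrp_forms this] show ?thesis by (simp add: monid_def Int_def)
qed

lemma monid_mulX: "j \<le> N \<Longrightarrow> a \<in> monid N k {m} \<Longrightarrow> Xv j * a \<in> monid N k {m + 1}"
  using forms_mult1[OF forms_Xv, of j "{..N}" a m]
  by (auto simp: monid_def Xv_def keys_times_single mkeys_add add.commute)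

lemma monid_Suc:
  assumes "k \<le> N"
  shows "monid N (Suc k) {m} = {q + Xv k * p | q p. q \<in> monid N k {m} \<and> p \<in> fP N (m - 1)}"
proof (intro equalityI subsetI)
  fix p :: "'a mpoly" assume p: "p \<in> monid N (Suc k) {m}"
  let ?A = "{t. \<exists>i<k. i \<in> mkeys t}"
  have 1: "pres ?A p \<in> monid N k {m}" using p by (auto simp: monid_def keys_pres intro!: forms_pres)
  have 2: "pres (- ?A) p \<in> fP N m" "\<And>t. t \<in> mkeys (pres (- ?A) p) \<Longrightarrow> k \<in> mkeys t"
    using p by (auto simp: monid_def keys_pres less_Suc_eq intro!: forms_pres)
  from divide_Xv[OF 2] obtain p' where p': "pres (- ?A) p = Xv k * p'" "p' \<in> fP N (m - 1)" by auto
  have "p = pres ?A p + Xv k * p'" using pres_split[of p ?A] unfolding p'(1) .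
  with 1 p'(2) show "p \<in> {q + Xv k * p | q p. q \<in> monid N k {m} \<and> p \<in> fP N (m - 1)}" by blast
next
  fix p :: "'a mpoly" assume "p \<in> {q + Xv k * p | q p. q \<in> monid N k {m} \<and> p \<in> fP N (m - 1)}"
  then obtain q r where p: "p = q + Xv k * r" and q: "q \<in> monid N k {m}" and r: "r \<in> fP N (m - 1)" by blast
  have "q \<in> monid N (Suc k) {m}" using q by (auto simp: monid_def less_Suc_eq)
  moreover have "Xv k * r \<in> monid N (Suc k) {m}"
    using forms_mult1[OF forms_Xv r, of k] assms by (auto simp: monid_def Xv_def keys_times_single mkeys_add)
  ultimately show "p \<in> monid N (Suc k) {m}" unfolding p by (rule subgrpD(4)[OF subgrp_monid])
qed

lemma chn_empty_Suc: "chn {} w P (Suc i) m = {0}"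
  by (auto simp: chn_def fun_eq_iff) (metis card.empty nat.distinct(1))

text \<open>The variables are put back one at a time by \<open>KH0_regular\<close>, as
  \<open>x_k\<close> is regular modulo \<open>(x_0, ..., x_(k-1))\<close>. The start is the complex
  on no variables over \<open>R/(x_0, ..., x_N)\<close>, which has no chains in positive degree; at
  \<open>k = 0\<close> the ideal is zero.\<close>

lemma koszul_acyclic:
  "KH0 mulX {..N} one_wt (fP N :: int \<Rightarrow> 'k::comm_ring_1 mpoly set) (\<lambda>_. {0}) (Suc i) m"
proof -
  have "KH0 mulX {k..N} one_wt (fP N :: int \<Rightarrow> 'k mpoly set) (\<lambda>m. monid N k {m}) (Suc i) m" if "k \<le> Suc N" for k
    using that
  proof (induction "Suc N - k" arbitrary: k)
    case 0
    then have "{k..N} = {}" by auto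
    then show ?case by (auto simp: KH0_def chn_empty_Suc kd_def fun_eq_iff)
  next
    case (Suc l)
    then have k: "k \<le> N" by simp
    have ins: "{k..N} = insert k {Suc k..N}" using k by auto
    have IH: "KH0 mulX {Suc k..N} one_wt (fP N :: int \<Rightarrow> 'k mpoly set) (\<lambda>m. monid N (Suc k) {m}) (Suc i) m"
      by (rule Suc.hyps(1)) (use Suc.hyps(2) k in auto)
    show ?case unfolding ins
    proof (rule KH0_regular)
      show "kmod mulX (insert k {Suc k..N}) one_wt (fP N :: int \<Rightarrow> 'k mpoly set) (\<lambda>m. monid N k {m})"
      proof (rule kmod_mulX)
        show "monid N k {m} \<subseteq> (fP N m :: 'k mpoly set)" for m by (auto simp: monid_def)
      qed (use k in \<open>auto intro: subgrp_monid monid_mulX\<close>)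
      show "KH0 mulX {Suc k..N} one_wt (fP N :: int \<Rightarrow> 'k mpoly set)
         (\<lambda>m. {q + Xv k * p | q p. q \<in> monid N k {m} \<and> p \<in> fP N (m - 1)}) (Suc i) m"
        using IH unfolding monid_Suc[OF k] .
    next
      fix g :: "'k mpoly" and m assume g: "g \<in> fP N m" and x: "Xv k * g \<in> monid N k {m + 1}"
      have "\<exists>i<k. i \<in> mkeys t" if "t \<in> mkeys g" for t
      proof -
        from that have "sng k 1 + t \<in> mkeys (Xv k * g)" by (simp add: Xv_def keys_times_single)
        with x obtain i where "i < k" "i \<in> mkeys (sng k 1 + t)" unfolding monid_def by blast
        then show ?thesis by (auto simp: mkeys_add)
      qed
      with g show "g \<in> monid N k {m}" by (simp add: monid_def)
    qed simp
  qed
  from this[of 0] have "KH0 mulX {0..N} one_wt (fP N :: int \<Rightarrow> 'k mpoly set) (\<lambda>m. monid N 0 {m}) (Suc i) m" by simp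
  moreover have "monid N 0 {m} = {0 :: 'k mpoly}" for m
    by (auto simp: monid_def formsI)
  ultimately show ?thesis by (simp add: atLeast0AtMost)
qed

section \<open>Subspaces of finite dimension\<close>

context vector_space
begin

text \<open>\<open>dim\<close> carries no information for a space without a finite basis, so these
  statements come with a finite set \<open>S\<close> whose span contains the space.\<close>

lemma finite_basis:
  assumes "subspace V" "V \<subseteq> span S" "finite S"
  obtains B where "B \<subseteq> V" "independent B" "finite B" "span B = V" "card B = dim V"
proof -
  obtain B where B: "B \<subseteq> V" "independent B" "V \<subseteq> span B" "card B = dim V" using basis_exists by blast
  have "finite B" using independent_span_bound[OF assms(3) B(2)] B(1) assms(2) by blast
  moreover have "span B = V" using B assms(1) by (metis span_subspace)
  ultimately show ?thesis using B that by blast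
qed

lemma extend_basis:
  assumes "independent B" "B \<subseteq> V" "subspace V" "V \<subseteq> span S" "finite S"
  obtains C where "B \<subseteq> C" "C \<subseteq> V" "independent C" "finite C" "span C = V" "card C = dim V"
proof -
  obtain C where C: "B \<subseteq> C" "C \<subseteq> V" "independent C" "V \<subseteq> span C"
    using maximal_independent_subset_extend[OF assms(2,1)] by blast
  have "finite C" using independent_span_bound[OF assms(5) C(3)] C(2) assms(4) by blast
  moreover have sp: "span C = V" using C assms(3) by (metis span_subspace)
  moreover have "card C = dim V" using dim_span_eq_card_independent[OF C(3)] sp by simp
  ultimately show ?thesis using C that by blast
qed

lemma dim_subset_fin:
  assumes "subspace U" "subspace V" "U \<subseteq> V" "V \<subseteq> span S" "finite S"
  shows "dim U \<le> dim V"
proof -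
  obtain B where B: "B \<subseteq> U" "independent B" "finite B" "span B = U" "card B = dim U"
    using finite_basis[OF assms(1) _ assms(5)] assms(3,4) by (metis subset_trans)
  obtain C where "B \<subseteq> C" "finite C" "card C = dim V"
    using extend_basis[OF B(2) _ assms(2,4,5)] B(1) assms(3) by (metis subset_trans)
  with B(5) show ?thesis by (metis card_mono)
qed

lemma subspace_dim_equal_fin:
  assumes "subspace U" "subspace V" "U \<subseteq> V" "V \<subseteq> span S" "finite S" "dim V \<le> dim U"
  shows "U = V"
proof -
  obtain B where B: "B \<subseteq> U" "independent B" "finite B" "span B = U" "card B = dim U"
    using finite_basis[OF assms(1) _ assms(5)] assms(3,4) by (metis subset_trans)
  obtain C where C: "B \<subseteq> C" "finite C" "card C = dim V" "span C = V"
    using extend_basis[OF B(2) _ assms(2,4,5)] B(1) assms(3) by (metis subset_trans)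
  have "B = C" using C B(5) assms(6) by (metis card_seteq)
  with B C show ?thesis by simp
qed

end

section \<open>Constant coefficients and the irrelevant ideal\<close>

lemma const_coeff_mult: "const_coeff (p * q) = const_coeff p * const_coeff (q :: 'k::comm_ring_1 mpoly)"
proof -
  define p' where "p' = pres (- {0}) p"
  define q' where "q' = pres (- {0}) q"
  have c: "pres {0} r = sng 0 (const_coeff r)" for r :: "'k mpoly"
    by (rule poly_mapping_eqI) (auto simp: lookup_pres const_coeff_def lookup_single when_def)
  have p: "p = sng 0 (const_coeff p) + p'" and q: "q = sng 0 (const_coeff q) + q'"
    unfolding p'_def q'_def c[symmetric] by (rule pres_split)+
  have z: "lk (a * b) 0 = 0" if "0 \<notin> mkeys a \<or> 0 \<notin> mkeys b" for a b :: "'k mpoly"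
  proof (rule ccontr)
    assume "lk (a * b) 0 \<noteq> 0"
    then have "0 \<in> mkeys (a * b)" by (simp add: in_keys_iff)
    then obtain s t where st: "s \<in> mkeys a" "t \<in> mkeys b" "s + t = 0" using keys_mult[of a b] by auto
    then have "mon_degree s + mon_degree t = 0" by (simp flip: mon_degree_add)
    then have "s = 0" "t = 0" by auto
    with st that show False by auto
  qed
  have 0: "0 \<notin> mkeys p'" "0 \<notin> mkeys q'" by (auto simp: p'_def q'_def keys_pres)
  have "p * q = sng 0 (const_coeff p * const_coeff q) + sng 0 (const_coeff p) * q' + p' * q"
  proof -
    have "p * q = sng 0 (const_coeff p) * q + p' * q" by (subst (1) p) (simp add: algebra_simps)
    also have "sng 0 (const_coeff p) * q = sng 0 (const_coeff p * const_coeff q) + sng 0 (const_coeff p) * q'"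
      by (subst (1) q) (simp add: algebra_simps mult_single)
    finally show ?thesis .
  qed
  then show ?thesis using z[of p' q] z[of "sng 0 (const_coeff p)" q'] 0
    by (simp add: const_coeff_def lookup_add)
qed

lemma const_coeff_0 [simp]: "const_coeff 0 = 0"
  by (simp add: const_coeff_def)

lemma const_coeff_sum: "const_coeff (sum f A) = (\<Sum>a\<in>A. const_coeff (f a))"
  by (simp add: const_coeff_def lookup_sum)

lemma const_coeff_diff: "const_coeff (p - q) = const_coeff p - const_coeff q"
  by (simp add: const_coeff_def lookup_minus)

lemma const_coeff_single [simp]: "const_coeff (sng 0 c) = c"
  by (simp add: const_coeff_def)

lemma const_coeff_Xv [simp]: "const_coeff (Xv j) = 0"
proof -
  have "sng j (1::nat) \<noteq> 0" by (metis lookup_single_eq lookup_zero one_neq_zero)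
  then show ?thesis by (simp add: const_coeff_def Xv_def lookup_single when_def)
qed

lemma const_coeff_forms: "p \<in> forms V {m} \<Longrightarrow> m \<noteq> 0 \<Longrightarrow> const_coeff p = 0"
  by (auto simp: forms_def const_coeff_def in_keys_iff)

lemma monid_decomp:
  assumes "p \<in> monid N k {m}" "k \<le> Suc N"
  shows "\<exists>z. (\<forall>j. z j \<in> fP N (m - 1)) \<and> p = (\<Sum>j<k. Xv j * z j)"
  using assms
proof (induction k arbitrary: p)
  case 0
  then show ?case by (intro exI[of _ "\<lambda>_. 0"]) (auto simp: monid_def formsI)
next
  case (Suc k)
  then have "p \<in> {q + Xv k * r | q r. q \<in> monid N k {m} \<and> r \<in> fP N (m - 1)}"
    using Suc.prems(1) monid_Suc[of k N m, where 'a = 'a] by auto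
  then obtain q r where p: "p = q + Xv k * r" and q: "q \<in> monid N k {m}" and r: "r \<in> fP N (m - 1)" by blast
  from Suc.IH[OF q] Suc.prems obtain z where z: "\<forall>j. z j \<in> fP N (m - 1)" "q = (\<Sum>j<k. Xv j * z j)" by auto
  show ?case
    by (rule exI[of _ "z(k := r)"]) (use z r p in \<open>auto intro!: sum.cong\<close>)
qed

lemma irrelevant_decomp:
  assumes p: "p \<in> fP N m" and c: "const_coeff p = 0"
  obtains z where "\<And>j. z j \<in> fP N (m - 1)" "p = (\<Sum>j\<le>N. Xv j * z j)"
proof -
  have "\<exists>i<Suc N. i \<in> mkeys t" if "t \<in> mkeys p" for t
  proof -
    have "t \<noteq> 0" using that c by (auto simp: const_coeff_def in_keys_iff)
    then obtain i where "i \<in> mkeys t" by (metis ex_in_conv mon_degree_def mon_degree_eq_0 sum.empty)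
    moreover have "mkeys t \<subseteq> {..N}" using p that by (auto simp: forms_def)
    ultimately show ?thesis by (intro exI[of _ i]) auto
  qed
  with p have "p \<in> monid N (Suc N) {m}" by (simp add: monid_def)
  from monid_decomp[OF this] that show ?thesis by (auto simp: lessThan_Suc_atMost)
qed

section \<open>Graded free modules\<close>

definition vX :: "nat \<Rightarrow> (nat \<Rightarrow> 'k::comm_ring_1 mpoly) \<Rightarrow> nat \<Rightarrow> 'k mpoly" where
  "vX j v = (\<lambda>l. Xv j * v l)"

text \<open>The degree \<open>m\<close> part of the direct sum of the twists \<open>R(- a l)\<close>
  for \<open>l < r\<close>.\<close>

definition vP :: "nat \<Rightarrow> nat \<Rightarrow> (nat \<Rightarrow> int) \<Rightarrow> int \<Rightarrow> (nat \<Rightarrow> 'k::comm_ring_1 mpoly) set" where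
  "vP N r a m = {c. (\<forall>l<r. c l \<in> fP N (m - a l)) \<and> (\<forall>l\<ge>r. c l = 0)}"

lemma subgrp_vP: "subgrp (vP N r a m)"
  by (auto simp: subgrp_def vP_def formsI)

lemma vX_vP: "j \<le> N \<Longrightarrow> c \<in> vP N r a m \<Longrightarrow> vX j c \<in> vP N r a (m + 1)"
  using forms_mult1[OF forms_Xv, of j "{..N}"] by (fastforce simp: vP_def vX_def algebra_simps)

lemma vX_add: "vX j (a + b) = vX j a + vX j b"
  by (simp add: vX_def fun_eq_iff algebra_simps)

lemma vX_comm: "vX j (vX k a) = vX k (vX j a)"
  by (simp add: vX_def fun_eq_iff algebra_simps)

lemma kops_vX: "finite L \<Longrightarrow> kops vX L"
  by standard (auto simp: vX_add vX_comm)

lemma kmod_vX: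
  assumes "\<And>m. subgrp (P m)" "\<And>m. subgrp (Q m)" "\<And>m. Q m \<subseteq> P m"
    "\<And>j a m. j \<le> N \<Longrightarrow> a \<in> P m \<Longrightarrow> vX j a \<in> P (m + 1)"
    "\<And>j a m. j \<le> N \<Longrightarrow> a \<in> Q m \<Longrightarrow> vX j a \<in> Q (m + 1)"
  shows "kmod vX {..N} one_wt P Q"
proof -
  interpret kops vX "{..N}" by (rule kops_vX) simp
  show ?thesis by standard (use assms in auto)
qed

text \<open>The Koszul complex of a direct sum splits into those of the summands, each a shifted
  copy of the complex in \<open>koszul_acyclic\<close>.\<close>

lemma vP_acyclic:
  "KH0 vX {..N} one_wt (vP N r a :: int \<Rightarrow> (nat \<Rightarrow> 'a::comm_ring_1 mpoly) set) (\<lambda>_. {0}) (Suc i) m"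
proof -
  have ch0: "chn {..N} one_wt (\<lambda>_. {0}) k n = {0}" for k n and A :: "'v::ab_group_add set"
    by (auto simp: chn_def fun_eq_iff)
  have comp: "(\<lambda>S. kd vX {..N} z S l) = kd mulX {..N} (\<lambda>S. z S l)" for z :: "nat set \<Rightarrow> nat \<Rightarrow> 'a mpoly" and l
    by (auto simp: fun_eq_iff kd_def vX_def iota_def sgn_at_def sum_fun_app intro!: sum.cong)
  show ?thesis unfolding KH0_def ch0
  proof (intro ballI impI)
    fix z :: "nat set \<Rightarrow> nat \<Rightarrow> 'a mpoly"
    assume z: "z \<in> chn {..N} one_wt (vP N r a) (Suc i) m" and dz: "kd vX {..N} z \<in> {0}"
    have "\<exists>y\<in>chn {..N} one_wt (fP N) (Suc (Suc i)) (m - a l). (\<lambda>S. z S l) = kd mulX {..N} y" if l: "l < r" for l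
    proof -
      have 1: "(\<lambda>S. z S l) \<in> chn {..N} one_wt (fP N) (Suc i) (m - a l)"
        unfolding chn_def mem_Collect_eq
      proof
        fix S from chnD[OF z, of S] l show "S \<subseteq> {..N} \<and> card S = Suc i \<and> z S l \<in> fP N (m - a l - sum one_wt S) \<or> z S l = 0"
          by (auto simp: vP_def algebra_simps)
      qed
      have "kd mulX {..N} (\<lambda>S. z S l) = 0" using comp[of z l] dz by (simp add: fun_eq_iff zero_fun_def)
      then have "kd mulX {..N} (\<lambda>S. z S l) \<in> chn {..N} one_wt (\<lambda>_. {0}) (Suc i - 1) (m - a l)" by simp
      from koszul_acyclic[unfolded KH0_def, rule_format, OF 1 this]
      obtain v where "v \<in> chn {..N} one_wt (fP N) (Suc (Suc i)) (m - a l)" "(\<lambda>S. z S l) - kd mulX {..N} v \<in> {0}"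
        unfolding ch0 by blast
      then show ?thesis by (intro bexI[of _ v]) auto
    qed
    then obtain y where y: "\<And>l. l < r \<Longrightarrow> y l \<in> chn {..N} one_wt (fP N) (Suc (Suc i)) (m - a l)"
      "\<And>l. l < r \<Longrightarrow> (\<lambda>S. z S l) = kd mulX {..N} (y l)" by metis
    define Y where "Y = (\<lambda>S l. if l < r then y l S else 0)"
    have "Y \<in> chn {..N} one_wt (vP N r a) (Suc (Suc i)) m"
      unfolding chn_def mem_Collect_eq
    proof
      fix S
      show "S \<subseteq> {..N} \<and> card S = Suc (Suc i) \<and> Y S \<in> vP N r a (m - sum one_wt S) \<or> Y S = 0"
      proof (cases "S \<subseteq> {..N} \<and> card S = Suc (Suc i)")
        case True
        have "Y S l \<in> fP N (m - sum one_wt S - a l)" if "l < r" for l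
          using chn_in[OF y(1)[OF that] subgrp_forms, of S] that by (simp add: Y_def algebra_simps)
        with True show ?thesis by (simp add: vP_def) (simp add: Y_def)
      next
        case False
        then have "Y S l = 0" for l using chnD[OF y(1), of l S] by (auto simp: Y_def)
        then show ?thesis by (auto simp: fun_eq_iff)
      qed
    qed
    moreover have "z = kd vX {..N} Y"
    proof (intro ext)
      fix S l
      have c: "kd vX {..N} Y S l = kd mulX {..N} (\<lambda>S. Y S l) S" using comp[of Y l] by (simp add: fun_eq_iff)
      show "z S l = kd vX {..N} Y S l"
      proof (cases "l < r")
        case True
        then have "(\<lambda>S. Y S l) = y l" by (simp add: Y_def)
        with c y(2)[OF True] show ?thesis by (simp add: fun_eq_iff)
      next
        case False
        then have "(\<lambda>S. Y S l) = 0" by (auto simp: Y_def)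
        moreover have "kd mulX {..N} (0 :: nat set \<Rightarrow> 'a mpoly) = 0" by (simp add: kops.kd_zero[OF kops_mulX])
        moreover have "z S l = 0" using chnD[OF z, of S] False by (auto simp: vP_def)
        ultimately show ?thesis using c by simp
      qed
    qed
    ultimately show "\<exists>v\<in>chn {..N} one_wt (vP N r a) (Suc (Suc i)) m. z - kd vX {..N} v \<in> {0}"
      by (intro bexI[of _ Y]) auto
  qed
qed

text \<open>First Koszul homology of \<open>F/K\<close> measures the gap between
  \<open>K \<inter> (x_0, ..., x_N) F\<close> and \<open>(x_0, ..., x_N) K\<close>; the sums over
  \<open>j\<close> spell out membership in the two products.\<close>

lemma KH1_iff:
  assumes "\<And>m. subgrp (K m)" "\<And>m. K m \<subseteq> vP N r a m" "\<And>j a m. j \<le> N \<Longrightarrow> a \<in> K m \<Longrightarrow> vX j a \<in> K (m + 1)"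
  shows "KH0 vX {..N} one_wt (vP N r a) K 1 m \<longleftrightarrow>
    (\<forall>z. (\<forall>j. z j \<in> vP N r a (m - 1)) \<and> (\<Sum>j\<le>N. vX j (z j)) \<in> K m \<longrightarrow>
      (\<exists>\<kappa>. (\<forall>j. \<kappa> j \<in> K (m - 1)) \<and> (\<Sum>j\<le>N. vX j (z j)) = (\<Sum>j\<le>N. vX j (\<kappa> j))))"
proof -
  have km: "kmod vX {..N} one_wt (vP N r a) K"
    by (rule kmod_vX) (use assms in \<open>auto intro: subgrp_vP vX_vP\<close>)
  interpret kmod vX "{..N}" one_wt "vP N r a" K by fact
  \<comment> \<open>The 1-chain with coefficient \<open>z j\<close> at \<open>{j}\<close>;
    \<open>THE\<close> recovers the index from the singleton.\<close>
  define C where "C = (\<lambda>(z :: nat \<Rightarrow> nat \<Rightarrow> 'a mpoly) S. if \<exists>j\<le>N. S = {j} then z (THE j. S = {j}) else 0)"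
  have C1: "C z {j} = z j" if "j \<le> N" for z j using that by (auto simp: C_def)
  have C0: "C z S = 0" if "\<And>j. j \<le> N \<Longrightarrow> S \<noteq> {j}" for z S using that by (auto simp: C_def)
  have kd0: "kd vX {..N} z {} = (\<Sum>j\<le>N. vX j (z {j}))" for z
    by (simp add: kd_def iota_def sgn_at_def)
  have Cin: "C z \<in> chn {..N} one_wt A (Suc 0) m" if "\<forall>j. z j \<in> A (m - 1)" for z A
    unfolding chn_def mem_Collect_eq
  proof
    fix S
    show "S \<subseteq> {..N} \<and> card S = Suc 0 \<and> C z S \<in> A (m - sum one_wt S) \<or> C z S = 0"
    proof (cases "\<exists>j\<le>N. S = {j}")
      case True then show ?thesis using that C1 by auto
    next
      case False then show ?thesis using C0[of S z] by auto
    qed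
  qed
  have det: "u = v" if "u \<in> chn {..N} one_wt (vP N r a) 0 m" "v \<in> chn {..N} one_wt (vP N r a) 0 m" "u {} = v {}" for u v
  proof
    fix S show "u S = v S"
      using chnD[OF that(1), of S] chnD[OF that(2), of S] that(3) by (metis card_0_eq finite_atMost finite_subset)
  qed
  have in0: "u \<in> chn {..N} one_wt K 0 m \<longleftrightarrow> u {} \<in> K m" if "u \<in> chn {..N} one_wt (vP N r a) 0 m" for u
  proof
    assume "u \<in> chn {..N} one_wt K 0 m" from chn_in[OF this assms(1), of "{}"] show "u {} \<in> K m" by simp
  next
    assume u: "u {} \<in> K m"
    show "u \<in> chn {..N} one_wt K 0 m"
      unfolding chn_def mem_Collect_eq
    proof
      fix S show "S \<subseteq> {..N} \<and> card S = 0 \<and> u S \<in> K (m - sum one_wt S) \<or> u S = 0"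
        using chnD[OF that, of S] u by (cases "S = {}") (auto dest: finite_subset)
    qed
  qed
  have sh: "KH0 vX {..N} one_wt (vP N r a) K (Suc 0) m \<longleftrightarrow>
    (\<forall>z\<in>chn {..N} one_wt (vP N r a) (Suc 0) m. kd vX {..N} z \<in> chn {..N} one_wt K 0 m \<longrightarrow>
      (\<exists>\<kappa>\<in>chn {..N} one_wt K (Suc 0) m. kd vX {..N} z = kd vX {..N} \<kappa>))"
    by (rule KH0_shift_aux[OF km vP_acyclic])
  show ?thesis unfolding One_nat_def sh
  proof (intro iffI allI ballI impI; (elim conjE)?)
    fix z assume H: "\<forall>z\<in>chn {..N} one_wt (vP N r a) (Suc 0) m. kd vX {..N} z \<in> chn {..N} one_wt K 0 m \<longrightarrow>
      (\<exists>\<kappa>\<in>chn {..N} one_wt K (Suc 0) m. kd vX {..N} z = kd vX {..N} \<kappa>)"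
      and z: "\<forall>j. z j \<in> vP N r a (m - 1)" and s: "(\<Sum>j\<le>N. vX j (z j)) \<in> K m"
    have e: "kd vX {..N} (C z) {} = (\<Sum>j\<le>N. vX j (z j))" unfolding kd0 by (intro sum.cong refl) (simp add: C1)
    have "kd vX {..N} (C z) \<in> chn {..N} one_wt K 0 m"
      using in0[OF kd_chnP[OF Cin[of z "vP N r a", OF z]]] s e by simp
    with H Cin[of z "vP N r a", OF z] obtain \<kappa> where k: "\<kappa>\<in>chn {..N} one_wt K (Suc 0) m" and ek: "kd vX {..N} (C z) = kd vX {..N} \<kappa>" by blast
    have "(\<Sum>j\<le>N. vX j (z j)) = (\<Sum>j\<le>N. vX j (\<kappa> {j}))" using e kd0[of \<kappa>] ek by simp
    moreover have "\<forall>j. \<kappa> {j} \<in> K (m - 1)" using chn_in[OF k assms(1), of "{_}"] by simp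
    ultimately show "\<exists>\<kappa>. (\<forall>j. \<kappa> j \<in> K (m - 1)) \<and> (\<Sum>j\<le>N. vX j (z j)) = (\<Sum>j\<le>N. vX j (\<kappa> j))"
      by (intro exI[of _ "\<lambda>j. \<kappa> {j}"]) simp
  next
    fix z assume H: "\<forall>z. (\<forall>j. z j \<in> vP N r a (m - 1)) \<and> (\<Sum>j\<le>N. vX j (z j)) \<in> K m \<longrightarrow>
      (\<exists>\<kappa>. (\<forall>j. \<kappa> j \<in> K (m - 1)) \<and> (\<Sum>j\<le>N. vX j (z j)) = (\<Sum>j\<le>N. vX j (\<kappa> j)))"
      and z: "z \<in> chn {..N} one_wt (vP N r a) (Suc 0) m" and dz: "kd vX {..N} z \<in> chn {..N} one_wt K 0 m"
    have "\<forall>j. z {j} \<in> vP N r a (m - 1)" using chn_in[OF z subgrp_vP, of "{_}"] by simp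
    moreover have "(\<Sum>j\<le>N. vX j (z {j})) \<in> K m"
      using in0[OF kd_chnP[OF z]] dz unfolding kd0 by simp
    ultimately obtain \<kappa> where k: "\<forall>j. \<kappa> j \<in> K (m - 1)" and e: "(\<Sum>j\<le>N. vX j (z {j})) = (\<Sum>j\<le>N. vX j (\<kappa> j))"
      using H[rule_format, of "\<lambda>j. z {j}"] by blast
    have kin: "C \<kappa> \<in> chn {..N} one_wt K (Suc 0) m" by (rule Cin[of \<kappa> K, OF k])
    have "kd vX {..N} z = kd vX {..N} (C \<kappa>)"
    proof (rule det[OF kd_chnP[OF z] kd_chnP[OF chnQP[OF kin]]])
      show "kd vX {..N} z {} = kd vX {..N} (C \<kappa>) {}" unfolding kd0 e by (intro sum.cong refl) (simp add: C1)
    qed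
    with kin show "\<exists>\<kappa>\<in>chn {..N} one_wt K (Suc 0) m. kd vX {..N} z = kd vX {..N} \<kappa>" by blast
  qed
qed

section \<open>Tor from a free resolution and Tor from the Koszul complex\<close>

locale gres =
  fixes N :: nat and I :: "'k::field mpoly set" and F :: "'k free_complex"
  assumes gI: "gideal N I" and res: "graded_free_resolution N I F"
begin

abbreviation FP :: "nat \<Rightarrow> int \<Rightarrow> (nat \<Rightarrow> 'k mpoly) set" where
  "FP p \<equiv> vP N (rnk F p) (shift F p)"

definition dif :: "nat \<Rightarrow> (nat \<Rightarrow> 'k mpoly) \<Rightarrow> nat \<Rightarrow> 'k mpoly" where
  "dif p = mat_vec (rnk F p) (rnk F (Suc p)) (diff F p)"

definition au :: "(nat \<Rightarrow> 'k mpoly) \<Rightarrow> 'k mpoly" where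
  "au c = (\<Sum>l<rnk F 0. c l * aug F l)"

text \<open>The graded syzygy modules: kernels of the maps out of \<open>F_p\<close>, where the map
  out of \<open>F_0\<close> goes to \<open>R/I\<close>.\<close>

definition KK :: "nat \<Rightarrow> int \<Rightarrow> (nat \<Rightarrow> 'k mpoly) set" where
  "KK p m = (case p of 0 \<Rightarrow> {c \<in> FP 0 m. au c \<in> I} | Suc q \<Rightarrow> {c \<in> FP (Suc q) m. dif q c = 0})"

definition vcmp :: "nat \<Rightarrow> int \<Rightarrow> (nat \<Rightarrow> 'k mpoly) \<Rightarrow> nat \<Rightarrow> 'k mpoly" where
  "vcmp p m c l = (if l < rnk F p then cmp (m - shift F p l) (c l) else 0)"

lemma aug_in: "l < rnk F 0 \<Longrightarrow> aug F l \<in> fP N (shift F 0 l)"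
  using res by (auto simp: graded_free_resolution_def forms_homogeneous[symmetric])

lemma diff_in: "l < rnk F p \<Longrightarrow> m < rnk F (Suc p) \<Longrightarrow> diff F p l m \<in> fP N (shift F (Suc p) m - shift F p l)"
  using res by (auto simp: graded_free_resolution_def forms_homogeneous[symmetric])

lemma ex0: "{c \<in> free_module N (rnk F 0). au c \<in> I} = dif 0 ` free_module N (rnk F 1)"
  using res by (auto simp: graded_free_resolution_def au_def dif_def)

lemma ex1: "{c \<in> free_module N (rnk F (Suc p)). dif p c = 0} = dif (Suc p) ` free_module N (rnk F (Suc (Suc p)))"
  using res by (simp add: graded_free_resolution_def dif_def)

lemma aug_surj: "f \<in> poly_ring N \<Longrightarrow> \<exists>c\<in>free_module N (rnk F 0). f - au c \<in> I"
  using res by (simp add: graded_free_resolution_def au_def)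

lemma FP_free: "c \<in> FP p m \<Longrightarrow> c \<in> free_module N (rnk F p)"
  by (auto simp: vP_def free_module_def poly_ring_forms intro: forms_UNIV)

lemma vcmp_in: "c \<in> free_module N (rnk F p) \<Longrightarrow> vcmp p m c \<in> FP p m"
  by (auto simp: vP_def free_module_def poly_ring_forms vcmp_def intro: cmp_forms)

lemma vcmp_id: "c \<in> FP p m \<Longrightarrow> vcmp p m c = c"
  by (auto simp: vP_def vcmp_def fun_eq_iff cmp_forms_same)

lemma dif_add: "dif p (a + b) = dif p a + dif p b"
  by (auto simp: dif_def mat_vec_def fun_eq_iff sum.distrib algebra_simps)

lemma dif_vX: "vX j (dif p a) = dif p (vX j a)"
  by (auto simp: dif_def mat_vec_def vX_def fun_eq_iff sum_distrib_left algebra_simps)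

lemma dif_in: "c \<in> FP (Suc p) m \<Longrightarrow> dif p c \<in> FP p m"
proof -
  assume c: "c \<in> FP (Suc p) m"
  have "diff F p l j * c j \<in> fP N (m - shift F p l)" if "l < rnk F p" "j < rnk F (Suc p)" for l j
  proof -
    have "c j \<in> fP N (m - shift F (Suc p) j)" using c that by (auto simp: vP_def)
    from forms_mult1[OF diff_in[OF that] this] show ?thesis by simp
  qed
  then show ?thesis by (auto simp: vP_def dif_def mat_vec_def intro!: subgrp_sum subgrp_forms)
qed

text \<open>Exactness in the definition of a resolution is stated for ungraded modules; homogeneity
  of the matrices transfers it to each graded piece.\<close>

lemma dif_vcmp: assumes "c \<in> free_module N (rnk F (Suc p))"
  shows "dif p (vcmp (Suc p) m c) = vcmp p m (dif p c)"
proof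
  fix l
  have "diff F p l j * cmp (m - shift F (Suc p) j) (c j) = cmp (m - shift F p l) (diff F p l j * c j)"
    if "l < rnk F p" "j < rnk F (Suc p)" for j
  proof -
    have "c j \<in> forms {..N} UNIV" using assms that by (auto simp: free_module_def poly_ring_forms)
    from cmp_mult[OF diff_in[OF that] this, of "m - shift F (Suc p) j"] show ?thesis by simp
  qed
  then show "dif p (vcmp (Suc p) m c) l = vcmp p m (dif p c) l"
    by (auto simp: dif_def mat_vec_def vcmp_def cmp.sum intro!: sum.cong)
qed

interpretation dif: additive "dif p" for p by standard (rule dif_add)

lemma au_add: "au (a + b) = au a + au b"
  by (simp add: au_def sum.distrib algebra_simps)

lemma au_vX: "Xv j * au a = au (vX j a)"
  by (simp add: au_def vX_def sum_distrib_left algebra_simps)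

lemma au_in: "c \<in> FP 0 m \<Longrightarrow> au c \<in> fP N m"
proof -
  assume c: "c \<in> FP 0 m"
  have "c l * aug F l \<in> fP N m" if "l < rnk F 0" for l
  proof -
    have "c l \<in> fP N (m - shift F 0 l)" using c that by (auto simp: vP_def)
    from forms_mult1[OF this aug_in[OF that]] show ?thesis by simp
  qed
  then show ?thesis unfolding au_def by (auto intro!: subgrp_sum subgrp_forms)
qed

lemma au_vcmp: assumes "c \<in> free_module N (rnk F 0)" shows "au (vcmp 0 m c) = cmp m (au c)"
proof -
  have "cmp (m - shift F 0 l) (c l) * aug F l = cmp m (c l * aug F l)" if "l < rnk F 0" for l
  proof -
    have "c l \<in> forms {..N} UNIV" using assms that by (auto simp: free_module_def poly_ring_forms)
    from cmp_mult[OF aug_in[OF that] this, of "m - shift F 0 l"] show ?thesis by (simp add: mult.commute)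
  qed
  then show ?thesis by (simp add: au_def vcmp_def cmp.sum)
qed

interpretation au: additive au by standard (rule au_add)

lemma KK_0: "KK 0 m = {c \<in> FP 0 m. au c \<in> I}" by (simp add: KK_def)
lemma KK_Suc: "KK (Suc q) m = {c \<in> FP (Suc q) m. dif q c = 0}" by (simp add: KK_def)

lemma KK_FP: "KK p m \<subseteq> FP p m" by (cases p) (auto simp: KK_def)

lemma KK_free: assumes "c \<in> KK p m" obtains c' where "c' \<in> free_module N (rnk F (Suc p))" "c = dif p c'"
proof -
  have "c \<in> dif p ` free_module N (rnk F (Suc p))"
  proof (cases p)
    case 0 with assms ex0 FP_free[of c 0 m] show ?thesis by (auto simp: KK_0)
  next
    case (Suc q) with assms ex1[of q] FP_free[of c p m] show ?thesis by (auto simp: KK_Suc)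
  qed
  with that show ?thesis by blast
qed

lemma KK_image: "KK p m = dif p ` FP (Suc p) m"
proof (intro equalityI subsetI)
  fix c assume c: "c \<in> KK p m"
  then obtain c' where c': "c' \<in> free_module N (rnk F (Suc p))" "c = dif p c'" by (rule KK_free)
  have "c = vcmp p m (dif p c')" using vcmp_id[OF subsetD[OF KK_FP c]] c'(2) by simp
  also have "\<dots> = dif p (vcmp (Suc p) m c')" using dif_vcmp[OF c'(1)] by simp
  finally show "c \<in> dif p ` FP (Suc p) m" using vcmp_in[OF c'(1)] by blast
next
  fix c assume "c \<in> dif p ` FP (Suc p) m"
  then obtain b where b: "b \<in> FP (Suc p) m" "c = dif p b" by blast
  show "c \<in> KK p m"
  proof (cases p)
    case 0 with b ex0 FP_free[OF b(1)] dif_in[OF b(1)] show ?thesis by (auto simp: KK_0)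
  next
    case (Suc q) with b ex1[of q] FP_free[OF b(1)] dif_in[OF b(1)] show ?thesis by (auto simp: KK_Suc)
  qed
qed

lemma subgrp_KK: "subgrp (KK p m)"
proof (cases p)
  case 0
  have "subgrp I" using gI by (rule gidealD)
  then show ?thesis using subgrp_vP[of N "rnk F 0" "shift F 0" m]
    by (auto simp: 0 KK_0 subgrp_def au.diff au.zero)
next
  case (Suc q)
  then show ?thesis using subgrp_vP[of N "rnk F p" "shift F p" m]
    by (auto simp: KK_Suc subgrp_def dif.diff dif.zero)
qed

lemma KK_vX: "j \<le> N \<Longrightarrow> a \<in> KK p m \<Longrightarrow> vX j a \<in> KK p (m + 1)"
  unfolding KK_image using dif_vX vX_vP by fastforce

lemma kmod_FK: "kmod vX {..N} one_wt (FP p) (KK p)"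
  by (rule kmod_vX) (use KK_FP KK_vX in \<open>auto intro: subgrp_vP subgrp_KK vX_vP\<close>)

lemma kmod_K0: "kmod vX {..N} one_wt (KK p) (\<lambda>_. {0})"
proof (rule kmod_vX)
  show "vX j a \<in> {0}" if "a \<in> {0}" for j and a :: "nat \<Rightarrow> 'k mpoly" using that by (simp add: vX_def fun_eq_iff)
qed (use KK_vX in \<open>auto intro: subgrp_KK simp: subgrpD(1)[OF subgrp_KK] subgrp_def[of "{0}"]\<close>)

text \<open>The augmentation identifies \<open>F_0/K_0\<close> with \<open>R/I\<close>, degree by
  degree.\<close>

lemma kz_FK: "kz N I i m \<longleftrightarrow> KH0 vX {..N} one_wt (FP 0) (KK 0) i m"
  unfolding kz_def
proof (rule KH0_iso[symmetric, where \<pi> = au])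
  show "kmod vX {..N} one_wt (FP 0) (KK 0)" by (rule kmod_FK)
  show "kmod mulX {..N} one_wt (fP N) (fI N I)" by (rule kmod_gideal[OF gI])
  show "au (a + b) = au a + au b" for a b by (rule au_add)
  show "Xv j * au a = au (vX j a)" for j a by (rule au_vX)
  show "au a \<in> fP N m" if "a \<in> FP 0 m" for a m using that by (rule au_in)
  show "au a \<in> fI N I m \<longleftrightarrow> a \<in> KK 0 m" if "a \<in> FP 0 m" for a m using that au_in[OF that] by (simp add: KK_0)
  show "\<exists>q\<in>fI N I m. \<exists>a\<in>FP 0 m. b = q + au a" if b: "b \<in> fP N m" for b m
  proof -
    from aug_surj[of b] forms_UNIV[OF b] obtain c where c: "c \<in> free_module N (rnk F 0)" "b - au c \<in> I"
      by (auto simp: poly_ring_forms)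
    have "cmp m (b - au c) = b - au (vcmp 0 m c)"
      by (simp add: cmp.diff cmp_forms_same[OF b] au_vcmp[OF c(1)])
    with gidealD(4)[OF gI c(2), of m] have "b - au (vcmp 0 m c) \<in> I" by simp
    moreover have "b - au (vcmp 0 m c) \<in> fP N m" by (intro formsI b au_in vcmp_in c(1))
    ultimately show ?thesis using vcmp_in[OF c(1), of m] by (metis Int_iff diff_add_cancel)
  qed
qed

lemma KK_next: "KH0 vX {..N} one_wt (FP (Suc p)) (KK (Suc p)) i m \<longleftrightarrow> KH0 vX {..N} one_wt (KK p) (\<lambda>_. {0}) i m"
proof (rule KH0_iso[where \<pi> = "dif p"])
  show "kmod vX {..N} one_wt (FP (Suc p)) (KK (Suc p))" by (rule kmod_FK)
  show "kmod vX {..N} one_wt (KK p) (\<lambda>_. {0})" by (rule kmod_K0)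
  show "dif p (a + b) = dif p a + dif p b" for a b by (rule dif_add)
  show "vX j (dif p a) = dif p (vX j a)" for j a by (rule dif_vX)
  show "dif p a \<in> KK p m" if "a \<in> FP (Suc p) m" for a m using that by (auto simp: KK_image)
  show "dif p a \<in> {0} \<longleftrightarrow> a \<in> KK (Suc p) m" if "a \<in> FP (Suc p) m" for a m using that by (simp add: KK_Suc)
  show "\<exists>q\<in>{0}. \<exists>a\<in>FP (Suc p) m. b = q + dif p a" if b: "b \<in> KK p m" for b m
    using b by (auto simp: KK_image)
qed

text \<open>Exactness of the Koszul complex of \<open>F_p\<close> trades \<open>F_p/K_p\<close> for
  \<open>K_p\<close> one degree lower, and \<open>K_p\<close> is isomorphic to
  \<open>F_(p+1)/K_(p+1)\<close>. Iteration reduces every positive degree to first homology of one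
  such quotient.\<close>

lemma KH_shift: "KH0 vX {..N} one_wt (FP p) (KK p) (Suc (Suc i)) m \<longleftrightarrow> KH0 vX {..N} one_wt (FP (Suc p)) (KK (Suc p)) (Suc i) m"
  unfolding KK_next by (rule KH0_shift[OF kmod_FK]) (auto intro: vP_acyclic)

lemma KH_shift_all: "KH0 vX {..N} one_wt (FP p) (KK p) (Suc i) m \<longleftrightarrow> KH0 vX {..N} one_wt (FP (p + i)) (KK (p + i)) 1 m"
  by (induction i arbitrary: p) (simp_all add: KH_shift)

definition cc :: "(nat \<Rightarrow> 'k mpoly) \<Rightarrow> nat \<Rightarrow> 'k" where "cc c l = const_coeff (c l)"
definition lift0 :: "(nat \<Rightarrow> 'k) \<Rightarrow> nat \<Rightarrow> 'k mpoly" where "lift0 v l = sng 0 (v l)"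

lemma cc_piece: "c \<in> FP p m \<Longrightarrow> cc c \<in> tensor_piece F p m"
  unfolding tensor_piece_def vP_def cc_def
  by (auto, metis const_coeff_0 not_le) (metis const_coeff_0 const_coeff_forms diff_eq_eq add_0 not_le)

lemma lift_FP: "v \<in> tensor_piece F p m \<Longrightarrow> lift0 v \<in> FP p m"
proof -
  assume v: "v \<in> tensor_piece F p m"
  have "lift0 v l \<in> fP N (m - shift F p l)" if "l < rnk F p" for l
  proof (cases "v l = 0")
    case True then show ?thesis by (simp add: lift0_def formsI)
  next
    case False with v have "shift F p l = m" by (auto simp: tensor_piece_def)
    then show ?thesis by (auto simp: lift0_def intro: forms_const)
  qed
  moreover have "lift0 v l = 0" if "l \<ge> rnk F p" for l
  proof -
    have "v l = 0" using v that by (force simp: tensor_piece_def)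
    then show ?thesis by (simp add: lift0_def)
  qed
  ultimately show ?thesis by (auto simp: vP_def)
qed

lemma cc_lift: "cc (lift0 v) = v" by (simp add: cc_def lift0_def fun_eq_iff)

lemma cc_dif: "cc (dif p c) = tensor_diff F p (cc c)"
  by (auto simp: fun_eq_iff cc_def dif_def tensor_diff_def mat_vec_def const_coeff_sum const_coeff_mult)

lemma cc_diff: "cc (a - b) = cc a - cc b" by (simp add: cc_def fun_eq_iff const_coeff_diff)

lemma cc_0_decomp:
  assumes c: "c \<in> FP p m" and 0: "cc c = 0"
  obtains z where "\<And>j. z j \<in> FP p (m - 1)" "c = (\<Sum>j\<le>N. vX j (z j))"
proof -
  have "\<exists>z. (\<forall>j. z j \<in> fP N (m - shift F p l - 1)) \<and> c l = (\<Sum>j\<le>N. Xv j * z j)" if "l < rnk F p" for l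
  proof -
    have 1: "c l \<in> fP N (m - shift F p l)" using c that by (auto simp: vP_def)
    have 2: "const_coeff (c l) = 0" using fun_cong[OF 0, of l] by (simp add: cc_def)
    show ?thesis by (rule irrelevant_decomp[OF 1 2]) blast
  qed
  then obtain z where z: "\<And>l j. l < rnk F p \<Longrightarrow> z l j \<in> fP N (m - shift F p l - 1)"
    "\<And>l. l < rnk F p \<Longrightarrow> c l = (\<Sum>j\<le>N. Xv j * z l j)" by metis
  show ?thesis
  proof (rule that[of "\<lambda>j l. if l < rnk F p then z l j else 0"])
    show "(\<lambda>l. if l < rnk F p then z l j else 0) \<in> FP p (m - 1)" for j
      using z(1) by (auto simp: vP_def algebra_simps)
    show "c = (\<Sum>j\<le>N. vX j (\<lambda>l. if l < rnk F p then z l j else 0))"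
    proof
      fix l
      show "c l = (\<Sum>j\<le>N. vX j (\<lambda>l. if l < rnk F p then z l j else 0)) l"
        using c z(2)[of l] by (cases "l < rnk F p") (simp_all add: sum_fun_app vX_def vP_def)
    qed
  qed
qed

lemma cc_vX_sum: "cc (\<Sum>j\<le>N. vX j (z j)) = 0"
  by (simp add: cc_def fun_eq_iff sum_fun_app vX_def const_coeff_sum const_coeff_mult)

text \<open>Here the two computations of Tor meet. The kernel of \<open>cc\<close> is
  \<open>(x_0, ..., x_N) F\<close>, so a cycle of the tensored complex lifts to an element of
  \<open>F_(p+1)\<close> whose image lies in both \<open>K_p\<close> and
  \<open>(x_0, ..., x_N) F_p\<close>. The criterion of \<open>KH1_iff\<close> is what allows this
  lift to be corrected to a syzygy without changing its constant coefficients.\<close>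

lemma KH1_tensor:
  "KH0 vX {..N} one_wt (FP p) (KK p) 1 m \<longleftrightarrow> tensor_cycles F (Suc p) m \<subseteq> tensor_boundaries F (Suc p) m"
proof -
  have eq: "KH0 vX {..N} one_wt (FP p) (KK p) 1 m \<longleftrightarrow>
    (\<forall>z. (\<forall>j. z j \<in> FP p (m - 1)) \<and> (\<Sum>j\<le>N. vX j (z j)) \<in> KK p m \<longrightarrow>
      (\<exists>\<kappa>. (\<forall>j. \<kappa> j \<in> KK p (m - 1)) \<and> (\<Sum>j\<le>N. vX j (z j)) = (\<Sum>j\<le>N. vX j (\<kappa> j))))"
    by (rule KH1_iff) (use KK_FP KK_vX in \<open>auto intro: subgrp_KK\<close>)
  show ?thesis unfolding eq
  proof (intro iffI allI subsetI impI; (elim conjE)?)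
    fix v assume H: "\<forall>z. (\<forall>j. z j \<in> FP p (m - 1)) \<and> (\<Sum>j\<le>N. vX j (z j)) \<in> KK p m \<longrightarrow>
      (\<exists>\<kappa>. (\<forall>j. \<kappa> j \<in> KK p (m - 1)) \<and> (\<Sum>j\<le>N. vX j (z j)) = (\<Sum>j\<le>N. vX j (\<kappa> j)))"
      and "v \<in> tensor_cycles F (Suc p) m"
    then have v: "v \<in> tensor_piece F (Suc p) m" and tv: "tensor_diff F p v = 0" by (auto simp: tensor_cycles_def)
    let ?c = "lift0 v"
    have c: "?c \<in> FP (Suc p) m" by (rule lift_FP[OF v])
    have y: "dif p ?c \<in> KK p m" using c by (auto simp: KK_image)
    have "cc (dif p ?c) = 0" by (simp add: cc_dif cc_lift tv)
    have "\<exists>z. (\<forall>j. z j \<in> FP p (m - 1)) \<and> dif p ?c = (\<Sum>j\<le>N. vX j (z j))"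
      by (rule cc_0_decomp[OF subsetD[OF KK_FP y] \<open>cc (dif p ?c) = 0\<close>]) blast
    then obtain z where z: "\<forall>j. z j \<in> FP p (m - 1)" "dif p ?c = (\<Sum>j\<le>N. vX j (z j))" by blast
    from H[rule_format, of z] z y obtain \<kappa> where k: "\<forall>j. \<kappa> j \<in> KK p (m - 1)" "dif p ?c = (\<Sum>j\<le>N. vX j (\<kappa> j))" by auto
    from k(1) have "\<forall>j. \<exists>u\<in>FP (Suc p) (m - 1). \<kappa> j = dif p u" by (auto simp: KK_image)
    then obtain u where u: "\<And>j. u j \<in> FP (Suc p) (m - 1)" "\<And>j. \<kappa> j = dif p (u j)" by metis
    let ?s = "\<Sum>j\<le>N. vX j (u j)"
    have s: "?s \<in> FP (Suc p) m"
    proof (intro subgrp_sum subgrp_vP)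
      fix j assume "j \<in> {..N}" then show "vX j (u j) \<in> FP (Suc p) m" using vX_vP[OF _ u(1), of j] by simp
    qed
    have "dif p ?c = dif p ?s" unfolding k(2) u(2) dif_vX dif.sum ..
    \<comment> \<open>Subtracting \<open>?s\<close> leaves the constant coefficients alone and turns
      the lift into a syzygy, hence into an image from the next module.\<close>
    then have "dif p (?c - ?s) = 0" by (simp add: dif.diff)
    then have "?c - ?s \<in> KK (Suc p) m" using subgrpD(2)[OF subgrp_vP c s] by (simp add: KK_Suc)
    then obtain b where b: "b \<in> FP (Suc (Suc p)) m" "?c - ?s = dif (Suc p) b" unfolding KK_image by blast
    have "v = cc (?c - ?s)" unfolding cc_diff cc_vX_sum cc_lift by simp
    also have "\<dots> = tensor_diff F (Suc p) (cc b)" unfolding b(2) cc_dif ..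
    finally show "v \<in> tensor_boundaries F (Suc p) m" using cc_piece[OF b(1)] by (auto simp: tensor_boundaries_def)
  next
    fix z assume H: "tensor_cycles F (Suc p) m \<subseteq> tensor_boundaries F (Suc p) m"
      and z: "\<forall>j. z j \<in> FP p (m - 1)" and y: "(\<Sum>j\<le>N. vX j (z j)) \<in> KK p m"
    let ?y = "\<Sum>j\<le>N. vX j (z j)"
    from y obtain c where c: "c \<in> FP (Suc p) m" "?y = dif p c" unfolding KK_image by blast
    have "tensor_diff F p (cc c) = 0" using cc_vX_sum[of z] unfolding c(2) cc_dif .
    with cc_piece[OF c(1)] H have "cc c \<in> tensor_boundaries F (Suc p) m" by (auto simp: tensor_cycles_def)
    then obtain w where w: "w \<in> tensor_piece F (Suc (Suc p)) m" "cc c = tensor_diff F (Suc p) w"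
      by (auto simp: tensor_boundaries_def)
    let ?b = "lift0 w"
    have b: "?b \<in> FP (Suc (Suc p)) m" by (rule lift_FP[OF w(1)])
    have db: "dif (Suc p) ?b \<in> KK (Suc p) m" using b by (auto simp: KK_image)
    have "cc (c - dif (Suc p) ?b) = 0" by (simp add: cc_diff cc_dif cc_lift w(2))
    moreover have "c - dif (Suc p) ?b \<in> FP (Suc p) m" using subgrpD(2)[OF subgrp_vP c(1)] db KK_FP by blast
    ultimately have "\<exists>u. (\<forall>j. u j \<in> FP (Suc p) (m - 1)) \<and> c - dif (Suc p) ?b = (\<Sum>j\<le>N. vX j (u j))"
      by (elim cc_0_decomp[rotated]) blast
    then obtain u where u: "\<And>j. u j \<in> FP (Suc p) (m - 1)" "c - dif (Suc p) ?b = (\<Sum>j\<le>N. vX j (u j))" by blast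
    have "dif p (c - dif (Suc p) ?b) = ?y" using db by (simp add: dif.diff KK_Suc c(2))
    then have "?y = (\<Sum>j\<le>N. vX j (dif p (u j)))" unfolding u(2) dif.sum dif_vX by simp
    moreover have "\<forall>j. dif p (u j) \<in> KK p (m - 1)" using u(1) by (auto simp: KK_image)
    ultimately show "\<exists>\<kappa>. (\<forall>j. \<kappa> j \<in> KK p (m - 1)) \<and> ?y = (\<Sum>j\<le>N. vX j (\<kappa> j))"
      by (intro exI[of _ "\<lambda>j. dif p (u j)"]) simp
  qed
qed

lemma kz_tensor: "kz N I (Suc i) m \<longleftrightarrow> tensor_cycles F (Suc i) m \<subseteq> tensor_boundaries F (Suc i) m"
  unfolding kz_FK KH_shift_all KH1_tensor by simp

lemma tensor_bc: "tensor_boundaries F (Suc i) m \<subseteq> tensor_cycles F (Suc i) m"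
proof
  fix v assume "v \<in> tensor_boundaries F (Suc i) m"
  then obtain w where w: "w \<in> tensor_piece F (Suc (Suc i)) m" "v = tensor_diff F (Suc i) w"
    by (auto simp: tensor_boundaries_def)
  have b: "lift0 w \<in> FP (Suc (Suc i)) m" by (rule lift_FP[OF w(1)])
  then have k: "dif (Suc i) (lift0 w) \<in> KK (Suc i) m" by (auto simp: KK_image)
  have v: "v = cc (dif (Suc i) (lift0 w))" by (simp add: cc_dif cc_lift w(2))
  have "tensor_diff F i v = 0" unfolding v cc_dif[symmetric] using k by (simp add: KK_Suc) (simp add: cc_def fun_eq_iff)
  moreover have "v \<in> tensor_piece F (Suc i) m" unfolding v using k KK_FP by (blast intro: cc_piece)
  ultimately show "v \<in> tensor_cycles F (Suc i) m" by (simp add: tensor_cycles_def)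
qed

lemma tensor_diff_add: "tensor_diff F i (a + b) = tensor_diff F i a + tensor_diff F i b"
  by (auto simp: tensor_diff_def mat_vec_def fun_eq_iff sum.distrib algebra_simps)

lemma tensor_diff_scale: "tensor_diff F i (fun_scale c a) = fun_scale c (tensor_diff F i a)"
  by (auto simp: tensor_diff_def mat_vec_def fun_eq_iff fun_scale_def sum_distrib_left algebra_simps)

text \<open>The truncated difference vanishes as soon as the cycles have dimension at most that of
  the boundaries. Since boundaries are cycles, the two finite-dimensional spaces then
  coincide.\<close>

lemma kz_betti:
  "kz N I (Suc i) m \<longleftrightarrow> vector_space.dim fun_scale (tensor_cycles F (Suc i) m)
        - vector_space.dim fun_scale (tensor_boundaries F (Suc i) m) = 0"
proof -
  interpret vs: vector_space "fun_scale :: 'k \<Rightarrow> _" by (rule vector_space_fun_scale)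
  have sp: "vs.subspace (tensor_piece F j m)" for j
    by (auto simp: vs.subspace_def tensor_piece_def fun_scale_def) (metis add.right_neutral)+
  have td0: "tensor_diff F i 0 = 0" for i using tensor_diff_add[of i 0 0] by simp
  have sc: "vs.subspace (tensor_cycles F (Suc i) m)"
    using sp[of "Suc i"] by (auto simp: vs.subspace_def tensor_cycles_def td0 tensor_diff_add tensor_diff_scale)
  have sb: "vs.subspace (tensor_boundaries F (Suc i) m)"
    unfolding tensor_boundaries_def vs.subspace_def
  proof (intro conjI ballI allI)
    show "0 \<in> tensor_diff F (Suc i) ` tensor_piece F (Suc (Suc i)) m"
      using td0[of "Suc i"] vs.subspace_0[OF sp[of "Suc (Suc i)"]] by force
  qed (use vs.subspace_add[OF sp[of "Suc (Suc i)"]] vs.subspace_scale[OF sp[of "Suc (Suc i)"]] in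
      \<open>auto simp: tensor_diff_add[symmetric] tensor_diff_scale[symmetric]\<close>)
  define B where "B = (\<lambda>l. \<lambda>k. if k = l then 1 else 0 :: 'k) ` {..<rnk F (Suc i)}"
  have "tensor_piece F (Suc i) m \<subseteq> vs.span B"
  proof
    fix v assume v: "v \<in> tensor_piece F (Suc i) m"
    have "v = (\<Sum>l<rnk F (Suc i). fun_scale (v l) (\<lambda>k. if k = l then 1 else 0))"
    proof
      fix x
      have "(\<Sum>l<rnk F (Suc i). v l * (if x = l then 1 else 0)) = (\<Sum>l<rnk F (Suc i). if x = l then v l else 0)"
        by (intro sum.cong) auto
      also have "\<dots> = v x" using v by (auto simp: tensor_piece_def)
      finally show "v x = (\<Sum>l<rnk F (Suc i). fun_scale (v l) (\<lambda>k. if k = l then 1 else 0)) x"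
        by (simp add: sum_fun_app fun_scale_def)
    qed
    also have "\<dots> \<in> vs.span B"
      by (intro vs.span_sum vs.span_scale vs.span_base) (auto simp: B_def)
    finally show "v \<in> vs.span B" .
  qed
  then have "tensor_cycles F (Suc i) m \<subseteq> vs.span B" by (auto simp: tensor_cycles_def)
  from vs.subspace_dim_equal_fin[OF sb sc tensor_bc this] show ?thesis unfolding kz_tensor
    using tensor_bc by (auto simp: B_def) (metis subset_antisym order_refl)
qed

text \<open>\<open>F_(i+1)\<close> has finite rank, so above the degrees of its basis vectors the
  tensored module is zero.\<close>

lemma kz_large: "\<exists>m0. \<forall>m\<ge>m0. kz N I (Suc i) m"
proof (intro exI allI impI)
  fix m assume m: "m \<ge> 1 + (\<Sum>l<rnk F (Suc i). \<bar>shift F (Suc i) l\<bar>)"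
  have "shift F (Suc i) l < m" if "l < rnk F (Suc i)" for l
  proof -
    have "\<bar>shift F (Suc i) l\<bar> \<le> (\<Sum>l<rnk F (Suc i). \<bar>shift F (Suc i) l\<bar>)"
      using that by (intro member_le_sum) auto
    with m show ?thesis by linarith
  qed
  then have "tensor_piece F (Suc i) m = {0}" by (force simp: tensor_piece_def fun_eq_iff)
  then have "tensor_cycles F (Suc i) m \<subseteq> {0}" by (auto simp: tensor_cycles_def)
  moreover have "0 \<in> tensor_boundaries F (Suc i) m"
  proof -
    have "tensor_diff F (Suc i) 0 = 0" using tensor_diff_add[of "Suc i" 0 0] by simp
    moreover have "0 \<in> tensor_piece F (Suc (Suc i)) m" by (simp add: tensor_piece_def)
    ultimately show ?thesis by (force simp: tensor_boundaries_def)
  qed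
  ultimately show "kz N I (Suc i) m" unfolding kz_tensor by blast
qed

end

section \<open>From the variables to their powers\<close>

lemma kmod_powers:
  fixes I :: "'k::comm_ring_1 mpoly set"
  assumes "gideal N I"
  shows "kmod (\<lambda>j p. Xv j ^ q j * p) {..N} (\<lambda>j. int (q j)) (fP N) (fI N I)"
proof
  fix j m and a :: "'k mpoly" assume j: "j \<in> {..N}"
  have x: "(Xv j ^ q j :: 'k mpoly) \<in> fP N (int (q j))" using forms_power[OF forms_Xv, of j "{..N}" "q j"] j by simp
  { assume "a \<in> fP N m"
    from forms_mult1[OF x this] show "Xv j ^ q j * a \<in> fP N (m + int (q j))" by (simp add: add.commute) }
  note 1 = this
  { assume a: "a \<in> fI N I m"
    then have "Xv j ^ q j * a \<in> I" using gidealD(3)[OF assms forms_UNIV[OF x]] by simp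
    with 1 a show "Xv j ^ q j * a \<in> fI N I (m + int (q j))" by blast }
qed (use gidealD(2)[OF assms] in \<open>auto intro: subgrp_Int subgrp_forms simp: algebra_simps\<close>)

text \<open>One factor \<open>x_j\<close> is split off a power and \<open>KH0_compose\<close>
  applied, by induction on the total excess of the exponents over 1. Leaving
  \<open>s \<ge> d\<close> free lets the induction trade excess for a larger
  \<open>s\<close>.\<close>

lemma kz_powers:
  assumes gI: "gideal N I" and kz: "\<And>s. s \<ge> d \<Longrightarrow> kz N I e (int e + s)"
    and q: "\<And>j. j \<le> N \<Longrightarrow> q j \<ge> 1" and s: "s \<ge> d"
  shows "KH0 (\<lambda>j p. Xv j ^ q j * p) {..N} (\<lambda>j. int (q j)) (fP N) (fI N I) e (int e + s + (\<Sum>j\<le>N. int (q j - 1)))"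
  using q s
proof (induction "\<Sum>j\<le>N. q j - 1" arbitrary: q s rule: less_induct)
  case less
  show ?case
  proof (cases "\<forall>j\<le>N. q j = 1")
    case True
    have eq: "KH0 (\<lambda>j p. Xv j ^ q j * p) {..N} (\<lambda>j. int (q j)) = KH0 mulX {..N} one_wt"
      by (rule KH0_cong) (use True in auto)
    show ?thesis unfolding eq using kz[OF less.prems(2)] True by (simp add: kz_def)
  next
    case False
    then obtain j where j: "j \<le> N" "q j \<noteq> 1" by blast
    with less.prems(1)[of j] obtain r where r: "q j = Suc r" "r \<ge> 1" by (cases "q j") auto
    let ?L = "{..N} - {j}"
    have ins: "{..N} = insert j ?L" using j by auto
    let ?x = "\<lambda>q j p. Xv j ^ q j * (p :: 'a mpoly)" and ?w = "\<lambda>q j. int (q j)"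
    have sum: "(\<Sum>i\<le>N. (q(j := k)) i - 1) = (\<Sum>i\<in>?L. q i - 1) + (k - 1)" for k
    proof -
      have "(\<Sum>i\<le>N. (q(j := k)) i - 1) = ((q(j := k)) j - 1) + (\<Sum>i\<in>?L. (q(j := k)) i - 1)"
        using j by (intro sum.remove) auto
      also have "(\<Sum>i\<in>?L. (q(j := k)) i - 1) = (\<Sum>i\<in>?L. q i - 1)" by (intro sum.cong) auto
      finally show ?thesis by simp
    qed
    have sum0: "(\<Sum>i\<le>N. q i - 1) = (\<Sum>i\<in>?L. q i - 1) + r" using sum[of "q j", unfolded fun_upd_triv] r by simp
    have x: "?x (q(j := k)) = (?x q)(j := \<lambda>p. Xv j ^ k * p)" for k by (auto simp: fun_eq_iff)
    have w: "?w (q(j := k)) = (?w q)(j := int k)" for k by (auto simp: fun_eq_iff)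
    have ss: "(\<Sum>i\<le>N. int (q i - 1)) = int (\<Sum>i\<le>N. q i - 1)" for q :: "nat \<Rightarrow> nat" by simp
    \<comment> \<open>The excess drops by \<open>r\<close>, so \<open>s + r\<close> in place of
      \<open>s\<close> keeps the internal degree.\<close>
    have "KH0 (?x (q(j := 1))) {..N} (?w (q(j := 1))) (fP N) (fI N I) e (int e + (s + int r) + (\<Sum>i\<le>N. int ((q(j := 1)) i - 1)))"
      by (rule less.hyps) (use sum[of 1] sum0 r less.prems in auto)
    then have u: "KH0 ((?x q)(j := \<lambda>p. Xv j ^ 1 * p)) {..N} ((?w q)(j := int 1)) (fP N) (fI N I) e (int e + s + (\<Sum>i\<le>N. int (q i - 1)))"
      unfolding x w ss sum[of 1] sum0 by (simp add: add_ac)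
    \<comment> \<open>The excess drops by one while \<open>s\<close> stays, which gives the degree
      lowered by one that the second factor requires.\<close>
    have "KH0 (?x (q(j := r))) {..N} (?w (q(j := r))) (fP N) (fI N I) e (int e + s + (\<Sum>i\<le>N. int ((q(j := r)) i - 1)))"
      by (rule less.hyps) (use sum[of r] sum0 r less.prems in auto)
    moreover have "int e + s + (\<Sum>i\<le>N. int ((q(j := r)) i - 1)) = int e + s + (\<Sum>i\<le>N. int (q i - 1)) - 1"
      unfolding ss sum[of r] sum0 using r by simp
    ultimately have v: "KH0 ((?x q)(j := \<lambda>p. Xv j ^ r * p)) {..N} ((?w q)(j := int r)) (fP N) (fI N I) e (int e + s + (\<Sum>i\<le>N. int (q i - 1)) - int 1)"
      unfolding x w by (simp only: of_nat_1)
    have "KH0 ((?x q)(j := (\<lambda>p. Xv j ^ 1 * p) \<circ> (\<lambda>p. Xv j ^ r * p))) (insert j ?L) ((?w q)(j := int 1 + int r)) (fP N) (fI N I) e (int e + s + (\<Sum>i\<le>N. int (q i - 1)))"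
    proof (rule KH0_compose)
      show "kmod ((?x q)(j := \<lambda>p. Xv j ^ 1 * p)) (insert j ?L) ((?w q)(j := int 1)) (fP N) (fI N I)"
        unfolding ins[symmetric] x[symmetric] w[symmetric] by (rule kmod_powers[OF gI])
      show "kmod ((?x q)(j := \<lambda>p. Xv j ^ r * p)) (insert j ?L) ((?w q)(j := int r)) (fP N) (fI N I)"
        unfolding ins[symmetric] x[symmetric] w[symmetric] by (rule kmod_powers[OF gI])
    qed (use u v ins in \<open>auto simp: algebra_simps simp flip: ins\<close>)
    moreover have "(?x q)(j := (\<lambda>p. Xv j ^ 1 * p) \<circ> (\<lambda>p. Xv j ^ r * p)) = ?x q" using r by (auto simp: fun_eq_iff algebra_simps)
    moreover have "(?w q)(j := int 1 + int r) = ?w q" using r by (auto simp: fun_eq_iff)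
    ultimately show ?thesis unfolding ins[symmetric] by simp
  qed
qed

text \<open>The product of the elements \<open>\<epsilon>\<^sub>j - \<Sum>\<^sub>k r\<^sub>j\<^sub>k \<epsilon>\<^sub>k\<close> for \<open>j\<close> outside \<open>H\<close> is a Koszul cycle on
  \<open>(x\<^sub>k)\<^bsub>k \<in> H\<^esub>, (x\<^sub>j\<^sup>t)\<^bsub>j \<notin> H\<^esub>\<close> modulo \<open>I\<close>, because each factor has boundary
  \<open>x\<^sub>j\<^sup>t - \<Sum>\<^sub>k r\<^sub>j\<^sub>k x\<^sub>k \<in> I\<close>. Multiplied by \<open>a\<close>, it is a boundary for degree reasons, and its leading
  coefficient gives \<open>a \<in> I + (x\<^sub>k)\<^bsub>k \<in> H\<^esub>\<close>.\<close>

lemma sop_quotient_vanishing: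
  fixes I :: "'k::comm_ring_1 mpoly set"
  assumes gI: "gideal N I" and H: "H \<subseteq> {..N}" and e: "e = card ({..N} - H)"
    and kz: "\<And>s. s \<ge> d \<Longrightarrow> kz N I e (int e + s)" and t: "t \<ge> 1"
    and r: "\<And>j k. j \<in> {..N} - H \<Longrightarrow> k \<in> H \<Longrightarrow> r j k \<in> fP N (int t - 1)"
    and rI: "\<And>j. j \<in> {..N} - H \<Longrightarrow> Xv j ^ t - (\<Sum>k\<in>H. r j k * Xv k) \<in> I"
    and s: "s \<ge> d" and a: "a \<in> fP N s"
  shows "\<exists>b. (\<forall>k\<in>H. b k \<in> fP N (s - 1)) \<and> a - (\<Sum>k\<in>H. Xv k * b k) \<in> I"
proof -
  define Y where "Y = {..N} - H"
  \<comment> \<open>Exponent \<open>t\<close> outside \<open>H\<close> and 1 on \<open>H\<close>, so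
    that the relations \<open>rI\<close> express the operators outside \<open>H\<close> through
    those on \<open>H\<close> modulo \<open>I\<close>.\<close>
  define q where "q = (\<lambda>j. if j \<in> Y then t else 1)"
  define x where "x = (\<lambda>j (p :: 'k mpoly). Xv j ^ q j * p)"
  define w where "w = (\<lambda>j. int (q j))"
  have finH: "finite H" and finY: "finite Y" using H finite_subset by (auto simp: Y_def)
  have HY: "{..N} = H \<union> Y" "H \<inter> Y = {}" using H by (auto simp: Y_def)
  interpret M: kmod x "{..N}" w "fP N" "fI N I"
    unfolding x_def w_def by (rule kmod_powers[OF gI])
  have KH: "KH0 x {..N} w (fP N) (fI N I) e (int e + s + (\<Sum>j\<le>N. int (q j - 1)))"
    unfolding x_def w_def by (rule kz_powers[OF gI kz _ s]) (use t in \<open>auto simp: q_def\<close>)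
  have "(\<Sum>j\<le>N. int (q j - 1)) = (\<Sum>j\<in>H. int (q j - 1)) + (\<Sum>j\<in>Y. int (q j - 1))"
    using HY finH finY by (simp add: sum.union_disjoint)
  also have "(\<Sum>j\<in>H. int (q j - 1)) = 0" using HY by (intro sum.neutral) (auto simp: q_def)
  also have "(\<Sum>j\<in>Y. int (q j - 1)) = int e * (int t - 1)"
    using t by (simp add: q_def e Y_def of_nat_diff)
  \<comment> \<open>The degree shift caused by the powers gives the degree of \<open>a\<close> plus
    \<open>e\<close> times the weight \<open>t\<close>, which is the degree of the cycle built
    below.\<close>
  finally have deg: "int e + s + (\<Sum>j\<le>N. int (q j - 1)) = s + int e * int t" by (simp add: algebra_simps)
  define \<omega> where "\<omega> = (\<lambda>j c. eps j c - (\<Sum>k\<in>H. app (\<lambda>p. r j k * p) (eps k c)))"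
  have subI: "subgrp I" by (rule gidealD(2)[OF gI])
  have om_in: "\<omega> j c \<in> chn {..N} w (fP N) (Suc i) (m + int t)"
    if j: "j \<in> Y" and c: "c \<in> chn {..N} w (fP N) i m" for j c i m
    unfolding \<omega>_def
  proof (intro M.chnP(2) subgrp_sum subgrp_chn subgrp_forms)
    have "c \<in> chn {..N} w (fP N) i (m + int t - w j)" using c j by (simp add: w_def q_def)
    from eps_chn[OF this subgrp_forms] j show "eps j c \<in> chn {..N} w (fP N) (Suc i) (m + int t)"
      by (simp add: insert_absorb Y_def)
  next
    fix k assume k: "k \<in> H"
    have "w k = 1" using k HY by (auto simp: w_def q_def)
    with c have "c \<in> chn {..N} w (fP N) i (m + 1 - w k)" by simp
    from eps_chn[OF this subgrp_forms] k H have "eps k c \<in> chn {..N} w (fP N) (Suc i) (m + 1)"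
      by (simp add: insert_absorb subset_iff)
    from chn_app[where f = "\<lambda>p. r j k * p" and P' = "fP N" and n = "int t - 1", OF this]
    show "app (\<lambda>p. r j k * p) (eps k c) \<in> chn {..N} w (fP N) (Suc i) (m + int t)"
      using forms_mult1[OF r[OF j[unfolded Y_def] k]] by (simp add: algebra_simps)
  qed
  have d_om: "kd x {..N} (\<omega> j c) = app (\<lambda>p. (Xv j ^ t - (\<Sum>k\<in>H. r j k * Xv k)) * p) c - \<omega> j (kd x {..N} c)"
    if j: "j \<in> Y" for j c
  proof -
    have "kd x {..N} (app (\<lambda>p. r j k * p) (eps k c)) = app (\<lambda>p. r j k * p) (app (\<lambda>p. Xv k * p) c) - app (\<lambda>p. r j k * p) (eps k (kd x {..N} c))"
      if k: "k \<in> H" for k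
    proof -
      have "kd x {..N} (app (\<lambda>p. r j k * p) (eps k c)) = app (\<lambda>p. r j k * p) (kd x {..N} (eps k c))"
        by (rule kd_app[OF M.kops_axioms]) (auto simp: x_def algebra_simps)
      moreover have "x k = (\<lambda>p. Xv k * p)" using k HY by (auto simp: x_def q_def)
      moreover have "k \<in> {..N}" using k H by auto
      ultimately show ?thesis by (simp add: M.kd_eps app_diff algebra_simps)
    qed
    then have "kd x {..N} (\<omega> j c) = kd x {..N} (eps j c) - (\<Sum>k\<in>H. app (\<lambda>p. r j k * p) (app (\<lambda>p. Xv k * p) c) - app (\<lambda>p. r j k * p) (eps k (kd x {..N} c)))"
      unfolding \<omega>_def M.kd_diff M.kd_sum by simp
    moreover have "kd x {..N} (eps j c) = app (\<lambda>p. Xv j ^ t * p) c - eps j (kd x {..N} c)"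
    proof -
      have "x j = (\<lambda>p. Xv j ^ t * p)" using j by (auto simp: x_def q_def)
      then show ?thesis using M.kd_eps[of j c] j by (simp add: Y_def)
    qed
    ultimately show ?thesis
      by (simp add: fun_eq_iff app_def \<omega>_def sum_fun_app sum_subtractf left_diff_distrib sum_distrib_right mult.assoc)
  qed
  have om_I: "\<omega> j c S \<in> I" if "\<And>S. c S \<in> I" "j \<in> Y" for j c S
  proof -
    have ei: "eps k c S \<in> I" for k using that subI by (auto simp: eps_def subgrpD intro: sgn_at_in)
    have "r j k * eps k c S \<in> I" if k: "k \<in> H" for k
      by (rule gidealD(3)[OF gI forms_UNIV[OF r[OF \<open>j \<in> Y\<close>[unfolded Y_def] k]] ei])
    then show ?thesis unfolding \<omega>_def
      by (auto simp: sum_fun_app app_def intro!: subgrpD(2)[OF subI] subgrp_sum subI ei)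
  qed
  \<comment> \<open>Exchanging an \<open>e_j\<close> for some \<open>e_k\<close> with
    \<open>k \<in> H\<close> leads out of the subsets of \<open>Y\<close>. Hence among those only
    \<open>Z\<close> can carry a nonzero coefficient, and it is \<open>a\<close> up to sign.\<close>
  have "\<exists>z \<in> chn {..N} w (fP N) (card Z) (s + int (card Z) * int t).
      (\<forall>S. kd x {..N} z S \<in> I) \<and> (\<forall>S. S \<subseteq> Y \<longrightarrow> S \<noteq> Z \<longrightarrow> z S = 0) \<and> (z Z = a \<or> z Z = - a)"
    if "Z \<subseteq> Y" for Z
    using finite_subset[OF that finY] that
  proof (induction Z)
    case empty
    define z where "z = (\<lambda>S::nat set. if S = {} then a else 0)"
    have z: "z \<in> chn {..N} w (fP N) 0 s" using a by (auto simp: chn_def z_def)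
    have "kd x {..N} z = 0" by (rule kd_chn_0[OF M.kops_axioms z])
    then show ?case using z by (intro bexI[of _ z]) (auto simp: z_def subgrpD[OF subI])
  next
    case (insert j Z)
    then obtain z where z: "z \<in> chn {..N} w (fP N) (card Z) (s + int (card Z) * int t)"
      and zI: "\<And>S. kd x {..N} z S \<in> I" and z0: "\<And>S. S \<subseteq> Y \<Longrightarrow> S \<noteq> Z \<Longrightarrow> z S = 0" and zZ: "z Z = a \<or> z Z = - a" by auto
    have j: "j \<in> Y" using insert by auto
    have "\<omega> j z \<in> chn {..N} w (fP N) (Suc (card Z)) (s + int (card Z) * int t + int t)" by (rule om_in[OF j z])
    then have 1: "\<omega> j z \<in> chn {..N} w (fP N) (card (insert j Z)) (s + int (card (insert j Z)) * int t)"
      using insert by (simp add: algebra_simps)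
    have 2: "kd x {..N} (\<omega> j z) S \<in> I" for S
    proof -
      have "(Xv j ^ t - (\<Sum>k\<in>H. r j k * Xv k)) * z S \<in> I"
      proof -
        have "z S \<in> forms {..N} UNIV" using chn_in[OF z subgrp_forms, of S] by (rule forms_UNIV)
        from gidealD(3)[OF gI this rI[OF j[unfolded Y_def]]] show ?thesis by (simp add: mult.commute)
      qed
      then show ?thesis unfolding d_om[OF j] using om_I[OF zI j] by (simp add: app_def subgrpD(2)[OF subI])
    qed
    have 3: "\<omega> j z S = eps j z S" if "S \<subseteq> Y" for S
    proof -
      have "eps k z S = 0" if "k \<in> H" for k using that \<open>S \<subseteq> Y\<close> HY by (auto simp: eps_def)
      then show ?thesis by (simp add: \<omega>_def sum_fun_app app_def)
    qed
    have 4: "\<omega> j z S = 0" if "S \<subseteq> Y" "S \<noteq> insert j Z" for S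
    proof (cases "j \<in> S")
      case True
      with that(2) have "S - {j} \<noteq> Z" by auto
      with z0[of "S - {j}"] that(1) have "z (S - {j}) = 0" by auto
      then show ?thesis unfolding 3[OF that(1)] by (simp add: eps_def)
    qed (simp add: 3[OF that(1)] eps_def)
    have "eps j z (insert j Z) = sgn_at j (insert j Z) (z Z)" using insert.hyps by (simp add: eps_def)
    then have 5: "\<omega> j z (insert j Z) = a \<or> \<omega> j z (insert j Z) = - a"
      unfolding 3[OF insert.prems] using zZ by (auto simp: sgn_at_def)
    show ?case by (rule bexI[OF _ 1]) (use 2 4 5 in auto)
  qed
  from this[of Y] obtain z where z: "z \<in> chn {..N} w (fP N) e (s + int e * int t)"
    and zI: "\<And>S. kd x {..N} z S \<in> I" and zY: "z Y = a \<or> z Y = - a"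
    by (auto simp: e Y_def)
  have kz1: "kd x {..N} z \<in> chn {..N} w (fP N) (e - 1) (s + int e * int t)"
    using z by (cases e) (auto simp: kd_chn_0[OF M.kops_axioms] M.kd_chnP)
  have "kd x {..N} z \<in> chn {..N} w (fI N I) (e - 1) (s + int e * int t)"
    by (rule chn_refine[OF kz1]) (use zI chn_in[OF kz1 subgrp_forms] in auto)
  with KH z obtain v where v: "v \<in> chn {..N} w (fP N) (Suc e) (s + int e * int t)"
    and zv: "z - kd x {..N} v \<in> chn {..N} w (fI N I) e (s + int e * int t)"
    unfolding KH0_def deg by blast
  \<comment> \<open>In a boundary the coefficient at \<open>Y\<close> gets no contribution from
    operators with index in \<open>Y\<close>, so it is a combination of the \<open>x_k\<close> with
    \<open>k \<in> H\<close>.\<close>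
  define b where "b = (\<lambda>k. iota k v Y)"
  have wY: "sum w Y = int e * int t" by (simp add: w_def q_def e Y_def)
  have b: "b k \<in> fP N (s - 1)" if k: "k \<in> H" for k
  proof -
    have "k \<notin> Y" "w k = 1" using k HY by (auto simp: w_def q_def)
    with chn_in[OF v subgrp_forms, of "insert k Y"] wY finY
    have "v (insert k Y) \<in> fP N (s - 1)" by simp
    then show ?thesis using \<open>k \<notin> Y\<close> by (simp add: b_def iota_def sgn_at_in[OF subgrp_forms])
  qed
  have "kd x {..N} v Y = (\<Sum>k\<in>H. Xv k * b k)"
  proof -
    have "kd x {..N} v Y = (\<Sum>k\<in>H. x k (iota k v Y)) + (\<Sum>k\<in>Y. x k (iota k v Y))"
      unfolding kd_def HY(1) using HY(2) finH finY by (simp add: sum.union_disjoint)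
    also have "(\<Sum>k\<in>Y. x k (iota k v Y)) = 0" by (intro sum.neutral) (auto simp: iota_def x_def)
    also have "(\<Sum>k\<in>H. x k (iota k v Y)) = (\<Sum>k\<in>H. Xv k * b k)"
      using HY by (intro sum.cong) (auto simp: x_def q_def b_def)
    finally show ?thesis by simp
  qed
  with chn_in[OF zv M.Q_grp, of Y] have zb: "z Y - (\<Sum>k\<in>H. Xv k * b k) \<in> I" by simp
  show ?thesis
  proof (cases "z Y = a")
    case True with zb b show ?thesis by blast
  next
    case False
    then have "z Y = - a" using zY by simp
    with subgrpD(3)[OF subI zb] have "a - (\<Sum>k\<in>H. Xv k * (- b k)) \<in> I" by (simp add: sum_negf add.commute)
    moreover have "\<forall>k\<in>H. - b k \<in> fP N (s - 1)" using b formsI(3) by blast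
    ultimately show ?thesis by (intro exI[of _ "\<lambda>k. - b k"]) simp
  qed
qed

section \<open>Depth\<close>

text \<open>Ungraded exactness, for quotients by inhomogeneous regular sequences; the internal
  degree is a dummy 0.\<close>

abbreviation ukz :: "nat \<Rightarrow> 'k::comm_ring_1 mpoly set \<Rightarrow> nat \<Rightarrow> bool" where
  "ukz N J i \<equiv> KH0 mulX {..N} one_wt (\<lambda>_. poly_ring N) (\<lambda>_. J) i 0"

text \<open>An ungraded primitive is replaced by its homogeneous components of the right degrees.
  This succeeds because the differential is homogeneous and \<open>I\<close> contains the components
  of its elements.\<close>

lemma ukz_kz:
  assumes gI: "gideal N I" and u: "ukz N I i"
  shows "kz N I i m"
  unfolding kz_def KH0_def
proof (intro ballI impI)
  interpret M: kmod mulX "{..N}" one_wt "fP N" "fI N I" by (rule kmod_gideal[OF gI])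
  fix z assume z: "z \<in> chn {..N} one_wt (fP N) i m" and dz: "kd mulX {..N} z \<in> chn {..N} one_wt (fI N I) (i - 1) m"
  have "z \<in> chn {..N} one_wt (\<lambda>_. poly_ring N) i 0"
    using z unfolding chn_def poly_ring_forms by (auto intro: forms_UNIV)
  moreover have "kd mulX {..N} z \<in> chn {..N} one_wt (\<lambda>_. I) (i - 1) 0"
    using dz unfolding chn_def by auto
  ultimately obtain v where v: "v \<in> chn {..N} one_wt (\<lambda>_. poly_ring N) (Suc i) 0"
    and zv: "z - kd mulX {..N} v \<in> chn {..N} one_wt (\<lambda>_. I) i 0"
    using u unfolding KH0_def by blast
  define v' where "v' = (\<lambda>S. cmp (m - int (card S)) (v S))"
  have v': "v' \<in> chn {..N} one_wt (fP N) (Suc i) m"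
    unfolding chn_def mem_Collect_eq
  proof
    fix S from chnD[OF v, of S]
    show "S \<subseteq> {..N} \<and> card S = Suc i \<and> v' S \<in> fP N (m - sum one_wt S) \<or> v' S = 0"
      by (auto simp: v'_def cmp.zero poly_ring_forms intro: cmp_forms)
  qed
  have zv': "z - kd mulX {..N} v' \<in> chn {..N} one_wt (fP N) i m" by (rule M.chnP(2)[OF z M.kd_chnP[OF v']])
  have "z - kd mulX {..N} v' \<in> chn {..N} one_wt (fI N I) i m"
  proof (rule chn_refine[OF zv'])
    fix S
    have P: "(z - kd mulX {..N} v') S \<in> fP N (m - sum one_wt S)" by (rule chn_in[OF zv' subgrp_forms])
    have "(z - kd mulX {..N} v') S \<in> I"
    proof (cases "S \<subseteq> {..N}")
      case False
      then have "(z - kd mulX {..N} v') S = 0" using chnD[OF zv', of S] by auto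
      then show ?thesis by (simp add: subgrpD(1)[OF gidealD(2)[OF gI]])
    next
      case True
      then have fS: "finite S" by (rule finite_subset) simp
      let ?m = "m - int (card S)"
      have "Xv j * iota j v' S = cmp ?m (Xv j * iota j v S)" if "j \<le> N" for j
      proof (cases "j \<in> S")
        case True then show ?thesis by (simp add: iota_def cmp.zero)
      next
        case False
        have "v (insert j S) \<in> forms {..N} UNIV"
          using chnD[OF v, of "insert j S"] by (auto simp: poly_ring_forms formsI)
        from cmp_mult[OF forms_Xv this, of j "?m - 1"] that
        have "cmp ?m (Xv j * v (insert j S)) = Xv j * cmp (?m - 1) (v (insert j S))" by simp
        moreover have "int (card (insert j S)) = 1 + int (card S)" using fS False by simp
        ultimately show ?thesis using False
          by (auto simp: iota_def v'_def sgn_at_def cmp.minus algebra_simps)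
      qed
      then have "kd mulX {..N} v' S = cmp ?m (kd mulX {..N} v S)"
        by (simp add: kd_def cmp.sum)
      moreover have "z S = cmp ?m (z S)" using chn_in[OF z subgrp_forms, of S] by (simp add: cmp_forms_same)
      ultimately have "(z - kd mulX {..N} v') S = cmp ?m ((z - kd mulX {..N} v) S)"
        by (simp add: cmp.diff)
      then show ?thesis using gidealD(4)[OF gI chn_in[OF zv gidealD(2)[OF gI]]] by simp
    qed
    with P show "(z - kd mulX {..N} v') S \<in> fI N I (m - sum one_wt S)" by simp
  qed
  with v' show "\<exists>v\<in>chn {..N} one_wt (fP N) (Suc i) m. z - kd mulX {..N} v \<in> chn {..N} one_wt (fI N I) i m" by blast
qed

lemma irrelevant_decomp_ungraded:
  assumes f: "f \<in> forms {..N} UNIV" and c: "const_coeff f = 0"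
  obtains r where "\<And>j. r j \<in> forms {..N} UNIV" "f = (\<Sum>j\<le>N. r j * Xv j)"
proof -
  have "\<exists>z. (\<forall>j. z j \<in> fP N (m - 1)) \<and> cmp m f = (\<Sum>j\<le>N. Xv j * z j)" for m
  proof -
    have "const_coeff (cmp m f) = 0" using c by (simp add: const_coeff_def cmp_def lookup_pres)
    from irrelevant_decomp[OF cmp_forms[OF f] this] show ?thesis by blast
  qed
  then obtain z where z: "\<And>m j. z m j \<in> fP N (m - 1)" "\<And>m. cmp m f = (\<Sum>j\<le>N. Xv j * z m j)" by metis
  show ?thesis
  proof (rule that[of "\<lambda>j. \<Sum>m\<in>degs f. z m j"])
    show "(\<Sum>m\<in>degs f. z m j) \<in> forms {..N} UNIV" for j
      by (intro subgrp_sum subgrp_forms forms_UNIV[OF z(1)])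
    have "f = (\<Sum>m\<in>degs f. \<Sum>j\<le>N. Xv j * z m j)"
      using sum_cmp[OF finite_degs order_refl, of f] unfolding z(2) .
    also have "\<dots> = (\<Sum>j\<le>N. \<Sum>m\<in>degs f. Xv j * z m j)" by (rule sum.swap)
    finally show "f = (\<Sum>j\<le>N. (\<Sum>m\<in>degs f. z m j) * Xv j)" by (simp add: sum_distrib_left mult.commute)
  qed
qed

definition uideal :: "nat \<Rightarrow> 'k::comm_ring_1 mpoly set \<Rightarrow> bool" where
  "uideal N I \<longleftrightarrow> I \<subseteq> forms {..N} UNIV \<and> subgrp I \<and> (\<forall>a\<in>forms {..N} UNIV. \<forall>f\<in>I. a * f \<in> I)"

lemma gideal_uideal: "gideal N I \<Longrightarrow> uideal N I"
  by (auto simp: gideal_def uideal_def poly_ring_forms)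

lemma forms_U_mult: "a \<in> forms V UNIV \<Longrightarrow> b \<in> forms V UNIV \<Longrightarrow> a * b \<in> forms V UNIV"
  by (rule forms_mult) auto

lemma kmod_uideal: assumes "uideal N J" shows "kmod mulX {..N} one_wt (\<lambda>_. poly_ring N) (\<lambda>_. J)"
proof -
  interpret kops mulX "{..N}" by (rule kops_mulX) simp
  have x: "j \<le> N \<Longrightarrow> Xv j \<in> forms {..N} UNIV" for j using forms_UNIV[OF forms_Xv, of j "{..N}"] by simp
  show ?thesis
    by standard (use assms x in \<open>auto simp: poly_ring_forms uideal_def subgrp_forms intro: forms_U_mult\<close>)
qed

lemma uideal_add:
  assumes "uideal N J" "f \<in> forms {..N} UNIV"
  shows "uideal N {q + f * p | q p. q \<in> J \<and> p \<in> forms {..N} UNIV}"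
proof -
  have J: "subgrp J" "J \<subseteq> forms {..N} UNIV" "\<And>a g. a \<in> forms {..N} UNIV \<Longrightarrow> g \<in> J \<Longrightarrow> a * g \<in> J"
    using assms(1) by (auto simp: uideal_def)
  have "subgrp {q + f * p | q p. q \<in> J \<and> p \<in> forms {..N} UNIV}"
    unfolding subgrp_def
  proof (intro conjI ballI)
    show "0 \<in> {q + f * p | q p. q \<in> J \<and> p \<in> forms {..N} UNIV}"
      using subgrpD(1)[OF J(1)] formsI(1) by force
    fix a b assume "a \<in> {q + f * p | q p. q \<in> J \<and> p \<in> forms {..N} UNIV}" "b \<in> {q + f * p | q p. q \<in> J \<and> p \<in> forms {..N} UNIV}"
    then obtain q p q' p' where *: "a = q + f * p" "q \<in> J" "p \<in> forms {..N} UNIV" "b = q' + f * p'" "q' \<in> J" "p' \<in> forms {..N} UNIV" by blast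
    then have "a - b = (q - q') + f * (p - p')" by (simp add: algebra_simps)
    with * subgrpD(2)[OF J(1)] formsI(2) show "a - b \<in> {q + f * p | q p. q \<in> J \<and> p \<in> forms {..N} UNIV}" by blast
  qed
  moreover have "c * a \<in> {q + f * p | q p. q \<in> J \<and> p \<in> forms {..N} UNIV}"
    if c: "c \<in> forms {..N} UNIV" and "a \<in> {q + f * p | q p. q \<in> J \<and> p \<in> forms {..N} UNIV}" for a c
  proof -
    from that obtain q p where *: "a = q + f * p" "q \<in> J" "p \<in> forms {..N} UNIV" by blast
    then have "c * a = c * q + f * (c * p)" by (simp add: algebra_simps)
    with * J(3)[OF c] forms_U_mult[OF c] show ?thesis by blast
  qed
  moreover have "{q + f * p | q p. q \<in> J \<and> p \<in> forms {..N} UNIV} \<subseteq> forms {..N} UNIV"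
    using J(2) assms(2) forms_U_mult formsI(4) by blast
  ultimately show ?thesis unfolding uideal_def by blast
qed

lemma ideal_plus_Nil: "ideal_plus N I [] = I"
  using formsI(1) by (force simp: ideal_plus_def poly_ring_forms)

lemma ideal_plus_take:
  assumes "k \<le> length fs"
  shows "ideal_plus N I (take k fs) = {g + (\<Sum>i<k. c i * fs ! i) | g c. g \<in> I \<and> (\<forall>i. c i \<in> poly_ring N)}"
proof -
  have "length (take k fs) = k" using assms by simp
  moreover have "(\<Sum>i<k. c i * take k fs ! i) = (\<Sum>i<k. c i * fs ! i)" for c by (intro sum.cong) auto
  ultimately show ?thesis unfolding ideal_plus_def by simp
qed

lemma ideal_plus_take_Suc:
  assumes "k < length fs"
  shows "ideal_plus N I (take (Suc k) fs) = {q + fs ! k * p | q p. q \<in> ideal_plus N I (take k fs) \<and> p \<in> poly_ring N}"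
proof -
  have k: "k \<le> length fs" "Suc k \<le> length fs" using assms by auto
  show ?thesis unfolding ideal_plus_take[OF k(1)] ideal_plus_take[OF k(2)]
  proof (intro equalityI subsetI)
    fix h assume "h \<in> {g + (\<Sum>i<Suc k. c i * fs ! i) | g c. g \<in> I \<and> (\<forall>i. c i \<in> poly_ring N)}"
    then obtain g c where h: "h = g + (\<Sum>i<Suc k. c i * fs ! i)" and g: "g \<in> I" "\<forall>i. c i \<in> poly_ring N" by blast
    have "h = (g + (\<Sum>i<k. c i * fs ! i)) + fs ! k * c k" unfolding h by (simp add: algebra_simps)
    with g show "h \<in> {q + fs ! k * p | q p. q \<in> {g + (\<Sum>i<k. c i * fs ! i) | g c. g \<in> I \<and> (\<forall>i. c i \<in> poly_ring N)} \<and> p \<in> poly_ring N}" by blast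
  next
    fix h assume "h \<in> {q + fs ! k * p | q p. q \<in> {g + (\<Sum>i<k. c i * fs ! i) | g c. g \<in> I \<and> (\<forall>i. c i \<in> poly_ring N)} \<and> p \<in> poly_ring N}"
    then obtain g c p where h: "h = g + (\<Sum>i<k. c i * fs ! i) + fs ! k * p" and g: "g \<in> I" "\<forall>i. c i \<in> poly_ring N" "p \<in> poly_ring N" by blast
    have "h = g + (\<Sum>i<Suc k. (c(k := p)) i * fs ! i)" unfolding h by (simp add: algebra_simps)
    moreover have "\<forall>i. (c(k := p)) i \<in> poly_ring N" using g by simp
    ultimately show "h \<in> {g + (\<Sum>i<Suc k. c i * fs ! i) | g c. g \<in> I \<and> (\<forall>i. c i \<in> poly_ring N)}" using g(1) by blast
  qed
qed

lemma regular_sequence_uideal: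
  assumes "uideal N I" "regular_sequence N I fs" "k \<le> length fs"
  shows "uideal N (ideal_plus N I (take k fs))"
  using assms(3)
proof (induction k)
  case 0 then show ?case using assms(1) by (simp add: ideal_plus_Nil)
next
  case (Suc k)
  then have k: "k < length fs" by simp
  have "fs ! k \<in> forms {..N} UNIV" using assms(2) k by (auto simp: regular_sequence_def poly_ring_forms)
  from uideal_add[OF _ this] Suc k show ?case
    by (simp add: ideal_plus_take_Suc[OF k] poly_ring_forms)
qed

text \<open>Depth sensitivity of the Koszul complex: by \<open>KH0_depth\<close>, dividing out one
  more element moves the homological degree up by one. When the sequence is used up, this degree
  exceeds the number \<open>N + 1\<close> of variables and no chains are left.\<close>

lemma regular_sequence_ukz:
  assumes uI: "uideal N I" and reg: "regular_sequence N I fs" and i: "i + length fs > Suc N"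
  shows "ukz N I i"
proof -
  have "ukz N (ideal_plus N I (take k fs)) i" if "k \<le> length fs" "i + length fs - k > Suc N" for k i
    using that
  proof (induction "length fs - k" arbitrary: k i)
    case 0
    then have "i > Suc N" by simp
    then have "chn {..N} one_wt (\<lambda>_. poly_ring N) i 0 = {0 :: nat set \<Rightarrow> 'a mpoly}"
      by (auto simp: chn_def fun_eq_iff) (metis card_atMost card_mono finite_atMost not_le)
    then show ?case by (auto simp: KH0_def kops.kd_zero[OF kops_mulX] intro!: bexI[of _ 0])
  next
    case (Suc l)
    then have k: "k < length fs" by simp
    let ?J = "ideal_plus N I (take k fs)" and ?f = "fs ! k"
    have IH: "ukz N (ideal_plus N I (take (Suc k) fs)) (Suc i)"
      by (rule Suc.hyps(1)) (use Suc k in auto)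
    have f: "?f \<in> forms {..N} UNIV" "const_coeff ?f = 0"
      and r: "\<And>g. g \<in> poly_ring N \<Longrightarrow> ?f * g \<in> ?J \<Longrightarrow> g \<in> ?J"
      using reg k by (auto simp: regular_sequence_def poly_ring_forms)
    obtain r where r: "\<And>j. r j \<in> forms {..N} UNIV" "?f = (\<Sum>j\<le>N. r j * Xv j)"
      using irrelevant_decomp_ungraded[OF f] by blast
    have uJ: "uideal N ?J" by (rule regular_sequence_uideal[OF uI reg]) (use k in simp)
    show ?case
    proof (rule KH0_depth[where r = "\<lambda>j p. r j * p" and f = "\<lambda>p. ?f * p"])
      show "kmod mulX {..N} one_wt (\<lambda>_. poly_ring N) (\<lambda>_. ?J)" by (rule kmod_uideal[OF uJ])
      show "?f * a = (\<Sum>j\<le>N. r j * (Xv j * a))" for a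
        by (subst r(2)) (simp add: sum_distrib_right mult.assoc)
      show "KH0 mulX {..N} one_wt (\<lambda>_. poly_ring N) (\<lambda>_. {q + ?f * p | q p. q \<in> ?J \<and> p \<in> poly_ring N}) (Suc i) 0"
        using IH unfolding ideal_plus_take_Suc[OF k] .
      show "r j * a \<in> ?J" if "a \<in> ?J" for j a using uJ r(1) that by (auto simp: uideal_def)
      show "r j * a \<in> poly_ring N" if "a \<in> poly_ring N" for j a
        using forms_U_mult[OF r(1)] that by (auto simp: poly_ring_forms)
      show "a \<in> ?J" if "a \<in> poly_ring N" "?f * a \<in> ?J" for a
        using reg k that by (auto simp: regular_sequence_def)
    qed (auto simp: algebra_simps)
  qed
  from this[of 0 i] i show ?thesis by (simp add: ideal_plus_Nil)
qed

section \<open>Existence of graded free resolutions\<close>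

text \<open>Let \<open>G\<close> work for the first \<open>k\<close> coordinates and let
  \<open>M\<close> bound its next coordinate. Elements whose next coordinate is at least
  \<open>M\<close> lie above a member of \<open>G\<close>; the finitely many smaller values are
  treated slice by slice.\<close>

lemma dickson_fun:
  "\<exists>G. finite G \<and> G \<subseteq> T \<and> (\<forall>t\<in>T. \<exists>g\<in>G. \<forall>i<k. g i \<le> t i)" for T :: "(nat \<Rightarrow> nat) set"
proof (induction k arbitrary: T)
  case 0
  show ?case
  proof (cases "T = {}")
    case False
    then obtain g where "g \<in> T" by blast
    then show ?thesis by (intro exI[of _ "{g}"]) auto
  qed auto
next
  case (Suc k)
  obtain G where G: "finite G" "G \<subseteq> T" "\<forall>t\<in>T. \<exists>g\<in>G. \<forall>i<k. g i \<le> t i" using Suc[of T] by blast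
  define M where "M = Max (insert 0 ((\<lambda>g. g k) ` G))"
  have M: "g k \<le> M" if "g \<in> G" for g using that G(1) by (simp add: M_def)
  have "\<forall>c. \<exists>H. finite H \<and> H \<subseteq> {t \<in> T. t k = c} \<and> (\<forall>t\<in>{t \<in> T. t k = c}. \<exists>g\<in>H. \<forall>i<k. g i \<le> t i)"
    using Suc by blast
  from choice[OF this] obtain H where "\<forall>c. finite (H c) \<and> H c \<subseteq> {t \<in> T. t k = c} \<and>
    (\<forall>t\<in>{t \<in> T. t k = c}. \<exists>g\<in>H c. \<forall>i<k. g i \<le> t i)" ..
  then have H: "\<And>c. finite (H c)" "\<And>c. H c \<subseteq> {t \<in> T. t k = c}"
    "\<And>c t. t \<in> T \<Longrightarrow> t k = c \<Longrightarrow> \<exists>g\<in>H c. \<forall>i<k. g i \<le> t i" by simp_all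
  show ?case
  proof (intro exI[of _ "G \<union> (\<Union>c<M. H c)"] conjI ballI)
    fix t assume t: "t \<in> T"
    show "\<exists>g\<in>G \<union> (\<Union>c<M. H c). \<forall>i<Suc k. g i \<le> t i"
    proof (cases "t k < M")
      case True
      from H(3)[OF t refl] obtain g where "g \<in> H (t k)" "\<forall>i<k. g i \<le> t i" by blast
      moreover from this H(2) have "g k = t k" by blast
      ultimately show ?thesis using True by (intro bexI[of _ g]) (auto simp: less_Suc_eq)
    next
      case False
      from G(3) t obtain g where "g \<in> G" "\<forall>i<k. g i \<le> t i" by blast
      with M[of g] False show ?thesis by (intro bexI[of _ g]) (auto simp: less_Suc_eq)
    qed
  next
    show "finite (G \<union> (\<Union>c<M. H c))" using G(1) H(1) by blast
    show "G \<union> (\<Union>c<M. H c) \<subseteq> T" using G(2) H(2) by blast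
  qed
qed

lemma dickson:
  fixes T :: "(nat \<Rightarrow>\<^sub>0 nat) set" and N :: nat
  assumes "\<And>t. t \<in> T \<Longrightarrow> mkeys t \<subseteq> {..N}"
  shows "\<exists>G. finite G \<and> G \<subseteq> T \<and> (\<forall>t\<in>T. \<exists>g\<in>G. \<exists>s. t = s + g)"
proof -
  obtain G where G: "finite G" "G \<subseteq> lk ` T" "\<forall>t\<in>lk ` T. \<exists>g\<in>G. \<forall>i<Suc N. g i \<le> t i"
    using dickson_fun[of "lk ` T" "Suc N"] by blast
  obtain G' where G': "G' \<subseteq> T" "finite G'" "G = lk ` G'" using finite_subset_image[OF G(1,2)] by blast
  have "\<exists>g\<in>G'. \<exists>s. t = s + g" if t: "t \<in> T" for t
  proof -
    from G(3) t G'(3) obtain g where g: "g \<in> G'" "\<forall>i<Suc N. lk g i \<le> lk t i" by auto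
    have "lk g i \<le> lk t i" for i
    proof (cases "i \<le> N")
      case False
      with assms[of g] g(1) G'(1) have "lk g i = 0" by (auto simp: in_keys_iff subset_iff)
      then show ?thesis by simp
    qed (use g in auto)
    then have "t = (t - g) + g" by (intro poly_mapping_eqI) (simp add: lookup_add lookup_minus)
    with g(1) show ?thesis by blast
  qed
  with G' show ?thesis by blast
qed

lemma finite_monomials: assumes "finite V" shows "finite {t :: nat \<Rightarrow>\<^sub>0 nat. mkeys t \<subseteq> V \<and> int (mon_degree t) = m}"
proof (rule finite_imageD)
  have "lk ` {t. mkeys t \<subseteq> V \<and> int (mon_degree t) = m} \<subseteq> {f. \<forall>i. (i \<in> V \<longrightarrow> f i \<in> {..nat m}) \<and> (i \<notin> V \<longrightarrow> f i = 0)}"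
  proof (safe, simp_all)
    fix t :: "nat \<Rightarrow>\<^sub>0 nat" and i
    { assume "mkeys t \<subseteq> V" "i \<notin> V" then show "lk t i = 0" by (auto simp: in_keys_iff subset_iff) }
    show "lk t i \<le> mon_degree t"
      by (cases "i \<in> mkeys t") (auto simp: mon_degree_def in_keys_iff intro: member_le_sum)
  qed
  then show "finite (lk ` {t. mkeys t \<subseteq> V \<and> int (mon_degree t) = m})"
    using finite_set_of_finite_funs[OF assms, of "{..nat m}" 0] by (rule finite_subset) simp
  show "inj_on lk {t. mkeys t \<subseteq> V \<and> int (mon_degree t) = m}" by (rule inj_onI, rule poly_mapping_eqI) (erule fun_cong)
qed

section \<open>Finite generation of graded submodules of free modules\<close>

definition smul :: "'k::comm_ring_1 mpoly \<Rightarrow> (nat \<Rightarrow> 'k mpoly) \<Rightarrow> nat \<Rightarrow> 'k mpoly" where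
  "smul p c = (\<lambda>l. p * c l)"

definition inspan :: "nat \<Rightarrow> (int \<times> (nat \<Rightarrow> 'k::comm_ring_1 mpoly)) set \<Rightarrow> int \<Rightarrow> (nat \<Rightarrow> 'k mpoly) \<Rightarrow> bool" where
  "inspan N E m u \<longleftrightarrow> (\<exists>c. (\<forall>e\<in>E. c e \<in> fP N (m - fst e)) \<and> u = (\<Sum>e\<in>E. smul (c e) (snd e)))"

lemma smul_add: "smul (p + q) c = smul p c + smul q c"
  by (simp add: smul_def fun_eq_iff algebra_simps)

lemma inspan_add: assumes "inspan N E m u" "inspan N E m v" shows "inspan N E m (u + v)"
proof -
  from assms obtain c d where "\<forall>e\<in>E. c e \<in> fP N (m - fst e)" "u = (\<Sum>e\<in>E. smul (c e) (snd e))"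
    "\<forall>e\<in>E. d e \<in> fP N (m - fst e)" "v = (\<Sum>e\<in>E. smul (d e) (snd e))" unfolding inspan_def by blast
  then show ?thesis unfolding inspan_def
    by (intro exI[of _ "\<lambda>e. c e + d e"]) (simp add: formsI smul_add sum.distrib)
qed

lemma inspan_0: "inspan N E m 0"
  unfolding inspan_def by (intro exI[of _ "\<lambda>_. 0"]) (auto simp: formsI smul_def fun_eq_iff sum_fun_app)

lemma inspan_gen: assumes "e \<in> E" "finite E" "p \<in> fP N (m - fst e)" shows "inspan N E m (smul p (snd e))"
  unfolding inspan_def
proof (intro exI[of _ "\<lambda>e'. if e' = e then p else 0"] conjI ballI)
  have "(\<Sum>e'\<in>E. smul (if e' = e then p else 0) (snd e')) = (\<Sum>e'\<in>E. if e' = e then smul p (snd e) else 0)"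
    by (intro sum.cong) (auto simp: smul_def fun_eq_iff)
  then show "smul p (snd e) = (\<Sum>e'\<in>E. smul (if e' = e then p else 0) (snd e'))" using assms by simp
qed (use assms in \<open>auto simp: formsI\<close>)

lemma lookup_single_mult: "lk (sng s c * p) (s + t) = c * lk p t" for p :: "'k::comm_ring_1 mpoly"
proof -
  have "sng s c * p = sng s 1 * (sng 0 c * p)" by (simp add: mult.assoc[symmetric] mult_single)
  moreover have "lk (sng 0 c * p) t = c * lk p t"
  proof -
    have "sng 0 c * p = (\<Sum>t\<in>mkeys p. sng t (c * lk p t))"
      by (subst poly_sum_monomials[of p]) (simp add: sum_distrib_left mult_single)
    then show ?thesis by (simp add: lookup_sum lookup_single when_def in_keys_iff)
  qed
  ultimately show ?thesis by (simp add: lookup_times_single)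
qed

lemma keys_single_mult: "mkeys (sng s c * p) \<subseteq> (+) s ` mkeys p" for p :: "'k::comm_ring_1 mpoly"
  using keys_mult[of "sng s c" p] by (auto split: if_splits)

locale gsub =
  fixes N r :: nat and a :: "nat \<Rightarrow> int" and U :: "int \<Rightarrow> (nat \<Rightarrow> 'k::field mpoly) set"
  assumes U_vP: "U m \<subseteq> vP N r a m" and U_grp: "subgrp (U m)"
    and U_smul: "p \<in> fP N d \<Longrightarrow> u \<in> U m \<Longrightarrow> smul p u \<in> U (m + d)"
begin

text \<open>A Groebner basis with respect to a position-over-term order generates.\<close>

lemma finitely_generated:
  obtains E where "finite E" "\<And>e. e \<in> E \<Longrightarrow> snd e \<in> U (fst e)" "\<And>m u. u \<in> U m \<Longrightarrow> inspan N E m u"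
proof -
  \<comment> \<open>\<open>t\<close> is the leading monomial at the first nonzero position
    \<open>l\<close>, for the linear order on exponent vectors.\<close>
  define lead where "lead = (\<lambda>l (e :: int \<times> (nat \<Rightarrow> 'k mpoly)) t. snd e \<in> U (fst e) \<and> snd e l \<noteq> 0 \<and> (\<forall>i<l. snd e i = 0) \<and> t = Max (mkeys (snd e l)))"
  have comp: "u l \<in> fP N (m - a l)" if "u \<in> U m" "l < r" for u m l using U_vP that by (auto simp: vP_def)
  have Max_in: "Max (mkeys p) \<in> mkeys p" if "p \<noteq> 0" for p :: "'k mpoly"
    using that by (intro Max_in) (auto simp: in_keys_iff intro: poly_mapping_eqI)
  have "\<forall>l. \<exists>G. l < r \<longrightarrow> finite G \<and> G \<subseteq> {t. \<exists>e. lead l e t} \<and> (\<forall>t\<in>{t. \<exists>e. lead l e t}. \<exists>g\<in>G. \<exists>s. t = s + g)"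
  proof
    fix l
    show "\<exists>G. l < r \<longrightarrow> finite G \<and> G \<subseteq> {t. \<exists>e. lead l e t} \<and> (\<forall>t\<in>{t. \<exists>e. lead l e t}. \<exists>g\<in>G. \<exists>s. t = s + g)"
    proof (cases "l < r")
      case True
      have kN: "mkeys t \<subseteq> {..N}" if "t \<in> {t. \<exists>e. lead l e t}" for t
        using that comp[OF _ True] Max_in unfolding lead_def forms_def by blast
      have "\<exists>G. finite G \<and> G \<subseteq> {t. \<exists>e. lead l e t} \<and> (\<forall>t\<in>{t. \<exists>e. lead l e t}. \<exists>g\<in>G. \<exists>s. t = s + g)"
        by (rule dickson[of _ N]) (rule kN)
      then obtain G where "finite G \<and> G \<subseteq> {t. \<exists>e. lead l e t} \<and> (\<forall>t\<in>{t. \<exists>e. lead l e t}. \<exists>g\<in>G. \<exists>s. t = s + g)" ..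
      then show ?thesis by (intro exI[of _ G] impI)
    qed auto
  qed
  from choice[OF this] obtain G where "\<forall>l. l < r \<longrightarrow> finite (G l) \<and> G l \<subseteq> {t. \<exists>e. lead l e t} \<and>
    (\<forall>t\<in>{t. \<exists>e. lead l e t}. \<exists>g\<in>G l. \<exists>s. t = s + g)" ..
  note GG = this[THEN spec, THEN mp]
  have G: "finite (G l)" "G l \<subseteq> {t. \<exists>e. lead l e t}" if "l < r" for l
    by (rule GG[OF that, THEN conjunct1], rule GG[OF that, THEN conjunct2, THEN conjunct1])
  have G3: "\<exists>g\<in>G l. \<exists>s. t = s + g" if l: "l < r" and e: "lead l e t" for l t e
  proof (rule GG[OF l, THEN conjunct2, THEN conjunct2, THEN bspec])
    show "t \<in> {t. \<exists>e. lead l e t}" using e by (intro CollectI exI)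
  qed
  define ge where "ge = (\<lambda>l g. SOME e. lead l e g)"
  have ge: "lead l (ge l g) g" if "l < r" "g \<in> G l" for l g
    unfolding ge_def by (rule someI_ex) (use G(2)[OF that(1)] that(2) in blast)
  define E where "E = (\<Union>l<r. ge l ` G l)"
  have finE: "finite E" using G(1) by (auto simp: E_def)
  have EU: "snd e \<in> U (fst e)" if "e \<in> E" for e using that ge by (auto simp: E_def lead_def)
  have red: "inspan N E m u" if "l \<le> r" "u \<in> U m" "\<forall>i<l. u i = 0" for l m u
    using that
  proof (induction "r - l" arbitrary: l u)
    case 0
    have uP: "u \<in> vP N r a m" using 0 U_vP by blast
    have "u = 0"
    proof
      fix x show "u x = 0 x" using 0 uP by (cases "x < l") (simp_all add: vP_def)
    qed
    show ?case unfolding \<open>u = 0\<close> by (rule inspan_0)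
  next
    case (Suc k)
    then have l: "l < r" by simp
    let ?M = "{t. mkeys t \<subseteq> {..N} \<and> int (mon_degree t) = m - a l}"
    \<comment> \<open>Termination measure: one degree contains finitely many monomials, and a
      reduction step strictly shrinks the set of those not above the leading one.\<close>
    let ?R = "\<lambda>u :: nat \<Rightarrow> 'k mpoly. {t'\<in>?M. \<exists>t\<in>mkeys (u l). t' \<le> t}"
    have finM: "finite ?M" by (rule finite_monomials) simp
    show ?case using Suc.prems(2,3)
    proof (induction "card (?R u)" arbitrary: u rule: less_induct)
      case less
      show ?case
      proof (cases "u l = 0")
        case True
        show ?thesis
        proof (rule Suc.hyps(1)[of "Suc l"])
          show "\<forall>i<Suc l. u i = 0" using True less.prems by (auto simp: less_Suc_eq)
        qed (use Suc less.prems l in auto)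
      next
        case False
        define t where "t = Max (mkeys (u l))"
        have tk: "t \<in> mkeys (u l)" unfolding t_def by (rule Max_in[OF False])
        have tM: "t \<in> ?M" using comp[OF less.prems(1) l] tk by (auto simp: forms_def)
        have "lead l (m, u) t" using less.prems False by (simp add: lead_def t_def)
        from G3[OF l this] obtain g s where g: "g \<in> G l" and t: "t = s + g" by blast
        define e where "e = ge l g"
        have e: "lead l e g" unfolding e_def by (rule ge[OF l g])
        have eE: "e \<in> E" using l g by (auto simp: E_def e_def)
        let ?v = "snd e"
        have v: "?v \<in> U (fst e)" "?v l \<noteq> 0" "\<forall>i<l. ?v i = 0" "g = Max (mkeys (?v l))" using e by (auto simp: lead_def)
        have gk: "g \<in> mkeys (?v l)" unfolding v(4) by (rule Max_in[OF v(2)])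
        have dg: "int (mon_degree g) = fst e - a l" using comp[OF v(1) l] gk by (auto simp: forms_def)
        have ds: "int (mon_degree s) = m - fst e" using tM dg t by (simp add: mon_degree_add)
        have ks: "mkeys s \<subseteq> {..N}" using tM t by (simp add: mkeys_add)
        define c where "c = lk (u l) t / lk (?v l) g"
        have sc: "sng s c \<in> fP N (m - fst e)" using ks ds by (intro forms_single) auto
        define u' where "u' = u - smul (sng s c) ?v"
        have sU: "smul (sng s c) ?v \<in> U m" using U_smul[OF sc v(1)] by simp
        have u'U: "u' \<in> U m" unfolding u'_def by (rule subgrpD(2)[OF U_grp less.prems(1) sU])
        have u'0: "\<forall>i<l. u' i = 0" using less.prems(2) v(3) by (simp add: u'_def smul_def)
        have u'l: "u' l = u l - sng s c * ?v l" by (simp add: u'_def smul_def)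
        have lt: "t' < t" if "t' \<in> mkeys (u' l)" for t'
        proof -
          have "lk (u' l) t = 0" unfolding u'l using gk by (simp add: t lookup_minus lookup_single_mult c_def in_keys_iff)
          then have "t' \<noteq> t" using that by (auto simp: in_keys_iff)
          moreover have "t' \<le> t"
          proof -
            have "mkeys (u' l) \<subseteq> mkeys (u l) \<union> mkeys (sng s c * ?v l)" unfolding u'l by (auto simp: in_keys_iff lookup_minus)
            with that keys_single_mult[of s c "?v l"] have "t' \<in> mkeys (u l) \<or> (\<exists>t''\<in>mkeys (?v l). t' = s + t'')" by blast
            then show ?thesis
            proof
              assume "t' \<in> mkeys (u l)" then show ?thesis by (simp add: t_def)
            next
              assume "\<exists>t''\<in>mkeys (?v l). t' = s + t''"
              then obtain t'' where "t'' \<in> mkeys (?v l)" "t' = s + t''" by blast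
              then show ?thesis unfolding t v(4) by (simp add: add_left_mono)
            qed
          qed
          ultimately show ?thesis by simp
        qed
        have "?R u' \<subset> ?R u"
        proof
          show "?R u' \<subseteq> ?R u" using lt tk by (auto intro!: bexI[of _ t]) (meson less_imp_le order_trans)
          have "t \<in> ?R u" using tM tk by blast
          moreover have "t \<notin> ?R u'" using lt by (auto simp: not_le[symmetric])
          ultimately show "?R u' \<noteq> ?R u" by blast
        qed
        then have "card (?R u') < card (?R u)" by (rule psubset_card_mono[rotated]) (rule finite_subset[OF _ finM], blast)
        from less.hyps[OF this u'U u'0] have 1: "inspan N E m u'" .
        have 2: "inspan N E m (smul (sng s c) ?v)" by (rule inspan_gen[OF eE finE sc])
        have "u = u' + smul (sng s c) ?v" by (simp add: u'_def)
        with inspan_add[OF 1 2] show ?thesis by simp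
      qed
    qed
  qed
  show ?thesis by (rule that[OF finE EU]) (use red[of 0] in auto)
qed

lemma generators:
  "\<exists>s b D. (\<forall>j<s. D j \<in> U (b j)) \<and>
    (\<forall>m. \<forall>u\<in>U m. \<exists>c\<in>vP N s b m. u = (\<Sum>j<s. smul (c j) (D j)))"
proof -
  obtain E where E: "finite E" "\<And>e. e \<in> E \<Longrightarrow> snd e \<in> U (fst e)" "\<And>m u. u \<in> U m \<Longrightarrow> inspan N E m u"
    using finitely_generated by blast
  obtain h where h: "bij_betw h {0..<card E} E" using ex_bij_betw_nat_finite[OF E(1)] by blast
  have hin: "j < card E \<Longrightarrow> h j \<in> E" for j using h by (auto simp: bij_betw_def)
  show ?thesis
  proof (intro exI conjI allI impI ballI)
    fix j assume "j < card E" then show "snd (h j) \<in> U (fst (h j))" by (intro E(2) hin)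
  next
    fix m u assume "u \<in> U m"
    from E(3)[OF this] obtain c where c: "\<forall>e\<in>E. c e \<in> fP N (m - fst e)" "u = (\<Sum>e\<in>E. smul (c e) (snd e))"
      unfolding inspan_def by blast
    have "u = (\<Sum>j<card E. smul (c (h j)) (snd (h j)))"
      unfolding c(2) using sum.reindex_bij_betw[OF h, of "\<lambda>e. smul (c e) (snd e)"] by (simp add: atLeast0LessThan)
    then show "\<exists>c\<in>vP N (card E) (\<lambda>j. fst (h j)) m. u = (\<Sum>j<card E. smul (c j) (snd (h j)))"
      using c(1) hin by (intro bexI[of _ "\<lambda>j. if j < card E then c (h j) else 0"]) (auto simp: vP_def)
  qed
qed

end

section \<open>Iterated syzygies\<close>

definition vc :: "nat \<Rightarrow> (nat \<Rightarrow> int) \<Rightarrow> int \<Rightarrow> (nat \<Rightarrow> 'k::comm_ring_1 mpoly) \<Rightarrow> nat \<Rightarrow> 'k mpoly" where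
  "vc r a m c l = (if l < r then cmp (m - a l) (c l) else 0)"

text \<open>The closure properties by which a predicate cuts out a graded submodule. With predicates
  in place of sets, the recursion treats the ideal at the start and the kernels later on
  alike.\<close>

definition gcond :: "nat \<Rightarrow> nat \<Rightarrow> (nat \<Rightarrow> int) \<Rightarrow> ((nat \<Rightarrow> 'k::comm_ring_1 mpoly) \<Rightarrow> bool) \<Rightarrow> bool" where
  "gcond N r a C \<longleftrightarrow> C 0 \<and> (\<forall>c d. C c \<longrightarrow> C d \<longrightarrow> C (c - d)) \<and>
     (\<forall>p\<in>poly_ring N. \<forall>c. C c \<longrightarrow> C (smul p c)) \<and> (\<forall>m. \<forall>c\<in>free_module N r. C c \<longrightarrow> C (vc r a m c))"

lemma gcondD:
  assumes "gcond N r a C"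
  shows "C 0" "C c \<Longrightarrow> C d \<Longrightarrow> C (c - d)" "p \<in> poly_ring N \<Longrightarrow> C c \<Longrightarrow> C (smul p c)"
    "c \<in> free_module N r \<Longrightarrow> C c \<Longrightarrow> C (vc r a m c)" "C c \<Longrightarrow> C d \<Longrightarrow> C (c + d)"
proof -
  show 0: "C 0" and d: "C c \<Longrightarrow> C d \<Longrightarrow> C (c - d)" for c d using assms by (auto simp: gcond_def)
  have "C (c - (0 - d))" if "C c" "C d" using d[OF that(1) d[OF 0 that(2)]] .
  then show "C c \<Longrightarrow> C d \<Longrightarrow> C (c + d)" by simp
qed (use assms in \<open>auto simp: gcond_def\<close>)

lemma vP_free: "c \<in> vP N r a m \<Longrightarrow> c \<in> free_module N r"
  by (auto simp: vP_def free_module_def poly_ring_forms intro: forms_UNIV)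

lemma smul_vP: "p \<in> fP N d \<Longrightarrow> u \<in> vP N r a m \<Longrightarrow> smul p u \<in> vP N r a (m + d)"
  using forms_mult1[of p "{..N}" d] by (fastforce simp: vP_def smul_def algebra_simps)

lemma gsub_gcond:
  fixes C :: "(nat \<Rightarrow> 'k::field mpoly) \<Rightarrow> bool"
  assumes "gcond N r a C" shows "gsub N r a (\<lambda>m. {c \<in> vP N r a m. C c})"
proof
  show "subgrp {c \<in> vP N r a m. C c}" for m
    using gcondD[OF assms] subgrp_vP[of N r a m] by (auto simp: subgrp_def)
  fix d m and p :: "'k mpoly" and u :: "nat \<Rightarrow> 'k mpoly" assume "p \<in> fP N d" "u \<in> {c \<in> vP N r a m. C c}"
  then show "smul p u \<in> {c \<in> vP N r a (m + d). C c}"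
    using smul_vP gcondD(3)[OF assms, of p u] by (auto simp: poly_ring_forms dest: forms_UNIV)
qed auto

lemma vc_in: "c \<in> free_module N r \<Longrightarrow> vc r a m c \<in> vP N r a m"
  by (auto simp: vP_def free_module_def poly_ring_forms vc_def intro: cmp_forms)

lemma vc_sum:
  assumes "c \<in> free_module N r"
  obtains M where "finite M" "c = (\<Sum>m\<in>M. vc r a m c)"
proof
  let ?M = "\<Union>l<r. (\<lambda>d. d + a l) ` degs (c l)"
  show "finite ?M" by (auto simp: finite_degs)
  show "c = (\<Sum>m\<in>?M. vc r a m c)"
  proof
    fix l
    show "c l = (\<Sum>m\<in>?M. vc r a m c) l"
    proof (cases "l < r")
      case False then show ?thesis using assms by (auto simp: free_module_def vc_def sum_fun_app)
    next
      case True
      have "(\<Sum>m\<in>?M. vc r a m c) l = (\<Sum>m\<in>?M. cmp (m - a l) (c l))" using True by (simp add: vc_def sum_fun_app)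
      also have "\<dots> = (\<Sum>m\<in>(\<lambda>m. m - a l) ` ?M. cmp m (c l))" by (subst sum.reindex) (auto intro: inj_onI)
      also have "\<dots> = c l"
        by (rule sum_cmp[symmetric]) (use True in \<open>auto simp: finite_degs image_image image_UN intro!: bexI[of _ l]\<close>)
      finally show ?thesis by simp
    qed
  qed
qed

lemma mat_vec_smul: "mat_vec r s (\<lambda>l j. D j l) c = (\<Sum>j<s. smul (c j) (D j))"
  if "\<And>j l. j < s \<Longrightarrow> l \<ge> r \<Longrightarrow> D j l = 0"
  using that by (auto simp: mat_vec_def fun_eq_iff sum_fun_app smul_def mult.commute)

lemma mat_vec_add: "mat_vec r s A (c + d) = mat_vec r s A c + mat_vec r s A d"
  by (auto simp: mat_vec_def fun_eq_iff sum.distrib algebra_simps)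

lemma gcond_kernel:
  assumes D: "\<And>j. j < s \<Longrightarrow> D j \<in> vP N r a (b j)"
  shows "gcond N s b (\<lambda>c. mat_vec r s (\<lambda>l j. D j l) c = 0)"
  unfolding gcond_def
proof (intro conjI allI ballI impI)
  let ?A = "\<lambda>l j. D j l"
  interpret additive "mat_vec r s ?A" by standard (rule mat_vec_add)
  show "mat_vec r s ?A 0 = 0" by (rule zero)
  show "mat_vec r s ?A c = 0 \<Longrightarrow> mat_vec r s ?A d = 0 \<Longrightarrow> mat_vec r s ?A (c - d) = 0" for c d by (simp add: diff)
  fix c assume c0: "mat_vec r s ?A c = 0"
  then have c0': "l < r \<Longrightarrow> (\<Sum>j<s. D j l * c j) = 0" for l by (auto simp: mat_vec_def fun_eq_iff) metis
  show "mat_vec r s ?A (smul p c) = 0" for p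
  proof
    fix l
    have "(\<Sum>j<s. D j l * (p * c j)) = p * (\<Sum>j<s. D j l * c j)" by (simp add: sum_distrib_left algebra_simps)
    then show "mat_vec r s ?A (smul p c) l = 0 l" using c0' by (simp add: mat_vec_def smul_def)
  qed
  assume c: "c \<in> free_module N s"
  show "mat_vec r s ?A (vc s b m c) = 0" for m
  proof
    fix l
    have "(\<Sum>j<s. D j l * vc s b m c j) = 0" if l: "l < r"
    proof -
      have "D j l * vc s b m c j = cmp (m - a l) (D j l * c j)" if j: "j < s" for j
      proof -
        have "c j \<in> forms {..N} UNIV" using c j by (auto simp: free_module_def poly_ring_forms)
        moreover have "D j l \<in> fP N (b j - a l)" using D[OF j] l by (auto simp: vP_def)
        ultimately have "cmp ((m - b j) + (b j - a l)) (D j l * c j) = D j l * cmp (m - b j) (c j)"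
          by (intro cmp_mult) auto
        then show ?thesis using j by (simp add: vc_def)
      qed
      then have "(\<Sum>j<s. D j l * vc s b m c j) = cmp (m - a l) (\<Sum>j<s. D j l * c j)" by (simp add: cmp.sum)
      then show ?thesis using c0'[OF l] by (simp add: cmp.zero)
    qed
    then show "mat_vec r s ?A (vc s b m c) l = 0 l" by (simp add: mat_vec_def)
  qed
qed

text \<open>Generation is known for homogeneous elements; by \<open>vc_sum\<close> every element is
  a finite sum of such, and the predicate passes to these components.\<close>

lemma gcond_exact:
  assumes gc: "gcond N r a C" and D: "\<And>j. j < s \<Longrightarrow> D j \<in> vP N r a (b j) \<and> C (D j)"
    and gen: "\<And>m u. u \<in> vP N r a m \<Longrightarrow> C u \<Longrightarrow> \<exists>c\<in>vP N s b m. u = (\<Sum>j<s. smul (c j) (D j))"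
  shows "{c \<in> free_module N r. C c} = mat_vec r s (\<lambda>l j. D j l) ` free_module N s"
proof -
  have D0: "\<And>j l. j < s \<Longrightarrow> l \<ge> r \<Longrightarrow> D j l = 0" using D by (auto simp: vP_def)
  note mv = mat_vec_smul[of s r D, OF D0]
  interpret additive "mat_vec r s (\<lambda>l j. D j l)" by standard (rule mat_vec_add)
  show ?thesis
  proof (intro equalityI subsetI)
    fix c assume "c \<in> {c \<in> free_module N r. C c}"
    then have c: "c \<in> free_module N r" "C c" by auto
    obtain M where M: "finite M" "c = (\<Sum>m\<in>M. vc r a m c)" by (rule vc_sum[OF c(1)])
    have "\<exists>d\<in>vP N s b m. vc r a m c = mat_vec r s (\<lambda>l j. D j l) d" for m
      using gen[OF vc_in[OF c(1)] gcondD(4)[OF gc c]] mv by auto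
    then obtain d where d: "\<And>m. d m \<in> vP N s b m" "\<And>m. vc r a m c = mat_vec r s (\<lambda>l j. D j l) (d m)" by metis
    have "c = mat_vec r s (\<lambda>l j. D j l) (\<Sum>m\<in>M. d m)" using M(2) unfolding sum d(2)[symmetric] .
    moreover have "(\<Sum>m\<in>M. d m) \<in> free_module N s"
      using d(1)[THEN vP_free] by (auto simp: free_module_def sum_fun_app poly_ring_forms intro!: subgrp_sum subgrp_forms)
    ultimately show "c \<in> mat_vec r s (\<lambda>l j. D j l) ` free_module N s" by blast
  next
    fix c assume "c \<in> mat_vec r s (\<lambda>l j. D j l) ` free_module N s"
    then obtain d where d: "d \<in> free_module N s" "c = (\<Sum>j<s. smul (d j) (D j))" using mv by auto
    have "C (\<Sum>j\<in>A. smul (d j) (D j))" if "A \<subseteq> {..<s}" for A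
      using finite_subset[OF that finite_lessThan] that
    proof (induction A)
      case empty show ?case unfolding sum.empty by (rule gcondD(1)[OF gc])
    next
      case (insert j A)
      have "C (smul (d j) (D j))" using gcondD(3)[OF gc] D insert.prems d(1) by (auto simp: free_module_def)
      with insert show ?case unfolding sum.insert[OF insert.hyps] by (intro gcondD(5)[OF gc]) auto
    qed
    moreover have "c \<in> free_module N r"
    proof -
      have j: "d j * D j l \<in> poly_ring N" "l \<ge> r \<Longrightarrow> D j l = 0" if "j < s" for j l
      proof -
        have Dj: "D j \<in> free_module N r" using vP_free conjunct1[OF D[OF that]] by blast
        then show "l \<ge> r \<Longrightarrow> D j l = 0" by (simp add: free_module_def)
        have "D j l \<in> poly_ring N"
          using Dj by (cases "l < r") (simp_all add: free_module_def poly_ring_forms formsI)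
        then show "d j * D j l \<in> poly_ring N"
          using d(1) that by (auto simp: free_module_def poly_ring_forms intro: forms_U_mult)
      qed
      have "c l = (\<Sum>j<s. d j * D j l)" for l unfolding d(2) by (simp add: sum_fun_app smul_def)
      then show ?thesis using j
        by (auto simp: free_module_def poly_ring_forms intro!: subgrp_sum[OF subgrp_forms])
    qed
    ultimately show "c \<in> {c \<in> free_module N r. C c}" using d(2) by auto
  qed
qed

definition gens :: "nat \<Rightarrow> nat \<Rightarrow> (nat \<Rightarrow> int) \<Rightarrow> ((nat \<Rightarrow> 'k::field mpoly) \<Rightarrow> bool) \<Rightarrow>
    nat \<times> (nat \<Rightarrow> int) \<times> (nat \<Rightarrow> nat \<Rightarrow> 'k mpoly) \<Rightarrow> bool" where
  "gens N r a C = (\<lambda>(s, b, D). (\<forall>j<s. D j \<in> vP N r a (b j) \<and> C (D j)) \<and>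
     (\<forall>m. \<forall>u\<in>vP N r a m. C u \<longrightarrow> (\<exists>c\<in>vP N s b m. u = (\<Sum>j<s. smul (c j) (D j)))))"

lemma gens_exist: assumes "gcond N r a C" shows "\<exists>x. gens N r a C x"
proof -
  interpret gsub N r a "\<lambda>m. {c \<in> vP N r a m. C c}" by (rule gsub_gcond[OF assms])
  from generators obtain s b D where D: "\<forall>j<s. D j \<in> {c \<in> vP N r a (b j). C c}"
    and g: "\<forall>m. \<forall>u\<in>{c \<in> vP N r a m. C c}. \<exists>c\<in>vP N s b m. u = (\<Sum>j<s. smul (c j) (D j))"
    by (elim exE conjE)
  have "gens N r a C (s, b, D)"
    unfolding gens_def prod.case
  proof (intro conjI allI ballI impI)
    fix m u assume "u \<in> vP N r a m" "C u"
    then show "\<exists>c\<in>vP N s b m. u = (\<Sum>j<s. smul (c j) (D j))" by (intro g[rule_format] CollectI conjI)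
  qed (use D in simp_all)
  then show ?thesis ..
qed

text \<open>A state holds rank, basis degrees and defining predicate of the current kernel. It
  starts with \<open>R\<close> and the kernel \<open>I\<close>; each step takes generators of the
  kernel as the next basis and their relations as the next kernel.\<close>

fun res_state :: "nat \<Rightarrow> 'k::field mpoly set \<Rightarrow> nat \<Rightarrow> nat \<times> (nat \<Rightarrow> int) \<times> ((nat \<Rightarrow> 'k mpoly) \<Rightarrow> bool)" where
  "res_state N I 0 = (1, (\<lambda>_. 0), (\<lambda>c. c 0 \<in> I))"
| "res_state N I (Suc n) = (case res_state N I n of (r, a, C) \<Rightarrow> case (SOME x. gens N r a C x) of (s, b, D) \<Rightarrow>
      (s, b, (\<lambda>c. mat_vec r s (\<lambda>l j. D j l) c = 0)))"

definition res_gens :: "nat \<Rightarrow> 'k::field mpoly set \<Rightarrow> nat \<Rightarrow> nat \<times> (nat \<Rightarrow> int) \<times> (nat \<Rightarrow> nat \<Rightarrow> 'k mpoly)" where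
  "res_gens N I n = (case res_state N I n of (r, a, C) \<Rightarrow> SOME x. gens N r a C x)"

lemma res_invariant:
  assumes gI: "gideal N I"
  shows "gcond N (fst (res_state N I n)) (fst (snd (res_state N I n))) (snd (snd (res_state N I n))) \<and>
    gens N (fst (res_state N I n)) (fst (snd (res_state N I n))) (snd (snd (res_state N I n))) (res_gens N I n)"
proof (induction n)
  case 0
  have "gcond N 1 (\<lambda>_. 0) (\<lambda>c. c 0 \<in> I)"
    using gI unfolding gcond_def gideal_def by (auto simp: smul_def vc_def subgrpD)
  then show ?case using someI_ex[OF gens_exist] by (simp add: res_gens_def)
next
  case (Suc n)
  obtain r a C where st: "res_state N I n = (r, a, C)" by (metis prod.exhaust)
  obtain s b D where g: "res_gens N I n = (s, b, D)" by (metis prod.exhaust)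
  from g have so: "(SOME x. gens N r a C x) = (s, b, D)" by (simp add: res_gens_def st)
  have st': "res_state N I (Suc n) = (s, b, (\<lambda>c. mat_vec r s (\<lambda>l j. D j l) c = 0))" by (simp add: st so)
  from Suc have "gens N r a C (s, b, D)" by (simp add: st g)
  then have gc: "gcond N s b (\<lambda>c. mat_vec r s (\<lambda>l j. D j l) c = 0)"
    by (intro gcond_kernel[of s D N r a b]) (auto simp: gens_def)
  have "res_gens N I (Suc n) = (SOME x. gens N s b (\<lambda>c. mat_vec r s (\<lambda>l j. D j l) c = 0) x)"
    unfolding res_gens_def st' by simp
  with gc someI_ex[OF gens_exist[OF gc]] show ?case unfolding st' by simp
qed

text \<open>\<open>tor_dim\<close> picks a resolution by \<open>SOME\<close>, which conveys
  something only when one exists.\<close>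

lemma graded_free_resolution_exists:
  fixes I :: "'k::field mpoly set"
  assumes gI: "gideal N I"
  shows "\<exists>F. graded_free_resolution N I F"
proof -
  define r a C where "r = (\<lambda>n. fst (res_state N I n))" and "a = (\<lambda>n. fst (snd (res_state N I n)))"
    and "C = (\<lambda>n. snd (snd (res_state N I n)))"
  define D where "D = (\<lambda>n. snd (snd (res_gens N I n)))"
  have st: "res_state N I n = (r n, a n, C n)" for n by (simp add: r_def a_def C_def)
  have sg: "res_gens N I n = (r (Suc n), a (Suc n), D n)"
    and CS: "C (Suc n) = (\<lambda>c. mat_vec (r n) (r (Suc n)) (\<lambda>l j. D n j l) c = 0)" for n
  proof -
    obtain s b E where g: "res_gens N I n = (s, b, E)" by (metis prod.exhaust)
    from g have so: "(SOME x. gens N (r n) (a n) (C n) x) = (s, b, E)" by (simp add: res_gens_def st)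
    have st': "res_state N I (Suc n) = (s, b, (\<lambda>c. mat_vec (r n) s (\<lambda>l j. E j l) c = 0))" by (simp add: st so)
    show "res_gens N I n = (r (Suc n), a (Suc n), D n)" "C (Suc n) = (\<lambda>c. mat_vec (r n) (r (Suc n)) (\<lambda>l j. D n j l) c = 0)"
      using st' g by (simp_all add: r_def a_def D_def C_def)
  qed
  have gc: "gcond N (r n) (a n) (C n)" and gn: "gens N (r n) (a n) (C n) (r (Suc n), a (Suc n), D n)" for n
    using res_invariant[OF gI, of n] unfolding st sg by simp_all
  have ex: "{c \<in> free_module N (r n). C n c} = mat_vec (r n) (r (Suc n)) (\<lambda>l j. D n j l) ` free_module N (r (Suc n))" for n
    by (rule gcond_exact[OF gc]) (use gn[of n] in \<open>auto simp: gens_def\<close>)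
  have z: "r 0 = 1" "a 0 = (\<lambda>_. 0)" "C 0 = (\<lambda>c. c 0 \<in> I)" by (simp_all add: r_def a_def C_def)
  define F :: "'k free_complex" where "F = \<lparr>rnk = r, shift = a, diff = (\<lambda>n l j. D n j l), aug = (\<lambda>_. 1)\<rparr>"
  have sel: "rnk F = r" "shift F = a" "diff F = (\<lambda>n l j. D n j l)" "aug F = (\<lambda>_. 1)" by (simp_all add: F_def)
  have "graded_free_resolution N I F"
    unfolding graded_free_resolution_def sel
  proof (intro conjI allI impI ballI)
    show "(1 :: 'k mpoly) \<in> poly_ring N" by (simp add: poly_ring_def)
    show "homogeneous (1 :: 'k mpoly) (a 0 l)" for l by (simp add: homogeneous_def z)
    fix i l m assume lm: "l < r i" "m < r (Suc i)"
    from gn[of i] lm have "D i m \<in> vP N (r i) (a i) (a (Suc i) m)" by (simp add: gens_def)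
    with lm have "D i m l \<in> fP N (a (Suc i) m - a i l)" by (simp add: vP_def)
    then show "D i m l \<in> poly_ring N" "homogeneous (D i m l) (a (Suc i) m - a i l)"
      by (auto simp flip: forms_homogeneous)
  next
    fix f :: "'k mpoly" assume "f \<in> poly_ring N"
    then show "\<exists>c\<in>free_module N (r 0). f - (\<Sum>l<r 0. c l * 1) \<in> I"
      using subgrpD(1)[OF gidealD(2)[OF gI]]
      by (intro bexI[of _ "\<lambda>l. if l = 0 then f else 0"]) (auto simp: z free_module_def)
  next
    show "{c \<in> free_module N (r 0). (\<Sum>l<r 0. c l * 1) \<in> I}
      = mat_vec (r 0) (r 1) (\<lambda>l j. D 0 j l) ` free_module N (r 1)"
      using ex[of 0] by (simp add: z)
    show "{c \<in> free_module N (r (Suc i)). mat_vec (r i) (r (Suc i)) (\<lambda>l j. D i j l) c = 0}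
      = mat_vec (r (Suc i)) (r (Suc (Suc i))) (\<lambda>l j. D (Suc i) j l) ` free_module N (r (Suc (Suc i)))" for i
      using ex[of "Suc i"] unfolding CS .
  qed
  then show ?thesis ..
qed

section \<open>Linear algebra\<close>

definition (in vector_space) fd :: "'b set \<Rightarrow> bool" where "fd V \<longleftrightarrow> subspace V \<and> (\<exists>S. finite S \<and> V \<subseteq> span S)"

context vector_space
begin

lemma fd_subset: "fd V \<Longrightarrow> subspace U \<Longrightarrow> U \<subseteq> V \<Longrightarrow> fd U"
  by (auto simp: fd_def)

lemma fd_dim_mono: "fd V \<Longrightarrow> subspace U \<Longrightarrow> U \<subseteq> V \<Longrightarrow> dim U \<le> dim V"
  by (auto simp: fd_def intro: dim_subset_fin)

lemma fd_basis: assumes "fd V" obtains B where "B \<subseteq> V" "independent B" "finite B" "span B = V" "card B = dim V"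
  using assms finite_basis unfolding fd_def by metis

lemma disjoint_spans:
  assumes "independent C" "B \<subseteq> C" "x \<in> span B" "x \<in> span (C - B)"
  shows "x = 0"
proof -
  have xC: "x \<in> span C" using span_mono[OF assms(2)] assms(3) by blast
  have 1: "representation C x = representation B x" by (rule representation_extend[OF assms(1,3,2)])
  have 2: "representation C x = representation (C - B) x" by (rule representation_extend[OF assms(1,4)]) blast
  have "representation C x b = 0" for b
    using representation_ne_zero[of B x b] representation_ne_zero[of "C - B" x b] 1 2 by auto
  then show ?thesis using sum_nonzero_representation_eq[OF assms(1) xC] by simp
qed

lemma dim_zero [simp]: "dim {0} = 0"
  using dim_span[of "{}"] dim_eq_card_independent[OF independent_empty] by simp

lemma fd_zero: "fd {0}" by (auto simp: fd_def subspace_def intro!: exI[of _ "{}"])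

end

context vector_space_pair
begin

lemma fd_image: assumes "Vector_Spaces.linear s1 s2 f" "vs1.fd V" shows "vs2.fd (f ` V)"
proof -
  obtain S where S: "finite S" "V \<subseteq> vs1.span S" "vs1.subspace V" using assms(2) by (auto simp: vs1.fd_def)
  have "f ` V \<subseteq> vs2.span (f ` S)" using linear_span_image[OF assms(1), of S] S(2) by blast
  then show ?thesis using S linear_subspace_image[OF assms(1) S(3)] by (auto simp: vs2.fd_def)
qed

lemma subspace_kernel_Int: "Vector_Spaces.linear s1 s2 f \<Longrightarrow> vs1.subspace V \<Longrightarrow> vs1.subspace {v \<in> V. f v = 0}"
  using vs1.subspace_inter[OF _ linear_subspace_kernel, of V f] by (simp add: Int_def)

lemma rank_nullity:
  assumes f: "Vector_Spaces.linear s1 s2 f" and V: "vs1.fd V"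
  shows "vs1.dim V = vs1.dim {v \<in> V. f v = 0} + vs2.dim (f ` V)"
proof -
  let ?K = "{v \<in> V. f v = 0}"
  have sV: "vs1.subspace V" using V by (simp add: vs1.fd_def)
  have sK: "vs1.subspace ?K" by (rule subspace_kernel_Int[OF f sV])
  obtain B where B: "B \<subseteq> ?K" "vs1.independent B" "finite B" "vs1.span B = ?K" "card B = vs1.dim ?K"
    using vs1.fd_basis[OF vs1.fd_subset[OF V sK]] by blast
  obtain S where S: "finite S" "V \<subseteq> vs1.span S" using V by (auto simp: vs1.fd_def)
  obtain C where C: "B \<subseteq> C" "C \<subseteq> V" "vs1.independent C" "finite C" "vs1.span C = V" "card C = vs1.dim V"
    using vs1.extend_basis[OF B(2) _ sV S(2,1)] B(1) by blast
  have sub: "vs1.span (C - B) \<subseteq> V" using C(5) vs1.span_mono[of "C - B" C] by blast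
  have inj: "inj_on f (vs1.span (C - B))"
  proof (rule linear_inj_on_iff_eq_0[OF f, THEN iffD2])
    show "\<forall>x\<in>vs1.span (C - B). f x = 0 \<longrightarrow> x = 0"
    proof (intro ballI impI)
      fix x assume x: "x \<in> vs1.span (C - B)" "f x = 0"
      with sub B(4) have "x \<in> vs1.span B" by auto
      with x C(1,3) show "x = 0" by (auto intro: vs1.disjoint_spans)
    qed
  qed auto
  have ind: "vs2.independent (f ` (C - B))"
    by (rule linear_independent_injective_image[OF f _ inj]) (rule vs1.independent_mono[OF C(3)], blast)
  have "f ` V = vs2.span (f ` (C - B))"
  proof -
    have "f ` V = vs2.span (f ` C)" using linear_span_image[OF f, of C] C(5) by simp
    also have "\<dots> = vs2.span (f ` (C - B))"
    proof (rule vs2.span_eq[THEN iffD2], intro conjI subsetI)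
      fix y assume "y \<in> f ` C"
      then obtain c where c: "c \<in> C" "y = f c" by blast
      show "y \<in> vs2.span (f ` (C - B))"
      proof (cases "c \<in> B")
        case True with B(1) c show ?thesis by (auto simp: vs2.span_zero)
      next
        case False with c show ?thesis by (auto intro: vs2.span_base)
      qed
    next
      fix y assume "y \<in> f ` (C - B)" then show "y \<in> vs2.span (f ` C)" by (auto intro: vs2.span_base)
    qed
    finally show ?thesis .
  qed
  then have "vs2.dim (f ` V) = card (f ` (C - B))" using vs2.dim_span_eq_card_independent[OF ind] by simp
  also have "\<dots> = card (C - B)" by (rule card_image) (rule inj_on_subset[OF inj], rule vs1.span_superset)
  also have "\<dots> = card C - card B" using B(3) C(1) by (rule card_Diff_subset)
  finally show ?thesis using B(5) C(6) card_mono[OF C(4,1)] by simp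
qed

lemma dim_injective_image:
  assumes f: "Vector_Spaces.linear s1 s2 f" and V: "vs1.fd V" and inj: "\<And>v. v \<in> V \<Longrightarrow> f v = 0 \<Longrightarrow> v = 0"
  shows "vs2.dim (f ` V) = vs1.dim V"
proof -
  have "0 \<in> V" using V vs1.subspace_0 by (auto simp: vs1.fd_def)
  then have "{v \<in> V. f v = 0} = {0}" using inj linear_0[OF f] by auto
  then show ?thesis using rank_nullity[OF f V] by simp
qed

end

context vector_space
begin

lemma dim_add_Int:
  assumes U: "fd U" and V: "fd V" and sum: "fd W" "W = {u + v | u v. u \<in> U \<and> v \<in> V}"
  shows "dim W + dim (U \<inter> V) = dim U + dim V"
proof -
  have sU: "subspace U" and sV: "subspace V" using U V by (auto simp: fd_def)
  have sI: "subspace (U \<inter> V)" by (rule subspace_inter[OF sU sV])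
  obtain B where B: "B \<subseteq> U \<inter> V" "independent B" "finite B" "span B = U \<inter> V" "card B = dim (U \<inter> V)"
    using fd_basis[OF fd_subset[OF U sI]] by blast
  obtain SU where SU: "finite SU" "U \<subseteq> span SU" using U by (auto simp: fd_def)
  obtain SV where SV: "finite SV" "V \<subseteq> span SV" using V by (auto simp: fd_def)
  obtain C where C: "B \<subseteq> C" "C \<subseteq> U" "independent C" "finite C" "span C = U" "card C = dim U"
    using extend_basis[OF B(2) _ sU SU(2,1)] B(1) by blast
  obtain E where E: "B \<subseteq> E" "E \<subseteq> V" "independent E" "finite E" "span E = V" "card E = dim V"
    using extend_basis[OF B(2) _ sV SV(2,1)] B(1) by blast
  have "independent (C \<union> (E - B))"
  proof -
    have key: "v \<in> span B" if "v \<in> span C" "v \<in> span (E - B)" for v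
      using that span_mono[of "E - B" E] B(4) C(5) E(5) by auto
    have "independent (C \<union> D)" if "finite D" "D \<subseteq> E - B" for D
      using that
    proof (induction D)
      case empty then show ?case using C(3) by simp
    next
      case (insert e D)
      have IH: "independent (C \<union> D)" using insert by auto
      have "e \<notin> span (C \<union> D)"
      proof
        assume "e \<in> span (C \<union> D)"
        then obtain c d where cd: "e = c + d" "c \<in> span C" "d \<in> span D" unfolding span_Un by auto
        have eD: "e \<in> E - B" "D \<subseteq> E - B" using insert by auto
        have "c = e - d" using cd by simp
        then have "c \<in> span (E - B)"
          using eD span_base[of e "E - B"] span_mono[OF eD(2)] cd(3) by (auto intro: span_diff)
        with key cd(2) have cB: "c \<in> span B" by blast
        then have "c = 0" using disjoint_spans[OF E(3,1) cB] \<open>c \<in> span (E - B)\<close> by blast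
        then have "e \<in> span D" using cd by simp
        moreover have "e \<notin> span D"
        proof
          assume "e \<in> span D"
          moreover have "span D \<subseteq> span (E - {e})" by (rule span_mono) (use eD insert.hyps in auto)
          ultimately show False using E(3) eD(1) unfolding dependent_def by blast
        qed
        ultimately show False by blast
      qed
      then show ?case using IH by (simp add: independent_insertI)
    qed
    then show ?thesis using E(4) by blast
  qed
  moreover have "span (C \<union> (E - B)) = W"
  proof (intro equalityI subsetI)
    fix x assume "x \<in> span (C \<union> (E - B))"
    then obtain c d where "x = c + d" "c \<in> span C" "d \<in> span (E - B)" unfolding span_Un by auto
    then show "x \<in> W" using sum(2) C(5) E(5) span_mono[of "E - B" E] by blast
  next
    fix x assume "x \<in> W"
    then obtain u v where x: "x = u + v" "u \<in> span C" "v \<in> span E" using sum(2) C(5) E(5) by blast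
    have "span E \<subseteq> span (C \<union> (E - B))" by (rule span_mono) (use C(1) in auto)
    moreover have "span C \<subseteq> span (C \<union> (E - B))" by (rule span_mono) auto
    ultimately show "x \<in> span (C \<union> (E - B))" unfolding x(1) using x(2,3) by (intro span_add) auto
  qed
  ultimately have "dim W = card (C \<union> (E - B))" using dim_span_eq_card_independent by metis
  also have "\<dots> = card C + card (E - B)"
  proof (rule card_Un_disjoint)
    show "C \<inter> (E - B) = {}"
    proof (rule ccontr)
      assume "C \<inter> (E - B) \<noteq> {}"
      then obtain x where x: "x \<in> C" "x \<in> E" "x \<notin> B" by blast
      then have "x \<in> span B" using B(4) C(2) E(2) by blast
      moreover have "x \<in> span (C - B)" using x by (intro span_base) auto
      ultimately have "x = 0" using disjoint_spans[OF C(3,1)] by blast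
      with x C(3) dependent_zero show False by blast
    qed
  qed (use C E in auto)
  also have "card (E - B) = card E - card B" using B(3) E(1) by (rule card_Diff_subset)
  finally show ?thesis using B(5) C(6) E(6) card_mono[OF E(4,1)] by simp
qed

end

section \<open>Counting monomials and differences\<close>

definition chain_scale :: "'k \<Rightarrow> (nat set \<Rightarrow> 'k::comm_ring_1 mpoly) \<Rightarrow> nat set \<Rightarrow> 'k mpoly" where
  "chain_scale c z = (\<lambda>S. poly_scale c (z S))"

lemma vector_space_chain_scale: "vector_space (chain_scale :: 'k::field \<Rightarrow> (nat set \<Rightarrow> 'k mpoly) \<Rightarrow> _)"
proof -
  interpret vector_space "poly_scale :: 'k \<Rightarrow> 'k mpoly \<Rightarrow> 'k mpoly" by (rule vector_space_poly_scale)
  show ?thesis by standard (simp_all add: chain_scale_def fun_eq_iff scale_right_distrib scale_left_distrib)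
qed

global_interpretation ps: vector_space "poly_scale :: 'k::field \<Rightarrow> 'k mpoly \<Rightarrow> 'k mpoly"
  by (rule vector_space_poly_scale)
global_interpretation cs: vector_space "chain_scale :: 'k::field \<Rightarrow> (nat set \<Rightarrow> 'k mpoly) \<Rightarrow> _"
  by (rule vector_space_chain_scale)
global_interpretation pp: vector_space_pair "poly_scale :: 'k::field \<Rightarrow> 'k mpoly \<Rightarrow> 'k mpoly" "poly_scale :: 'k::field \<Rightarrow> 'k mpoly \<Rightarrow> 'k mpoly"
  by unfold_locales
global_interpretation cp: vector_space_pair "chain_scale :: 'k::field \<Rightarrow> (nat set \<Rightarrow> 'k mpoly) \<Rightarrow> _" "poly_scale :: 'k::field \<Rightarrow> 'k mpoly \<Rightarrow> 'k mpoly"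
  by unfold_locales
global_interpretation cc: vector_space_pair "chain_scale :: 'k::field \<Rightarrow> (nat set \<Rightarrow> 'k mpoly) \<Rightarrow> _" "chain_scale :: 'k::field \<Rightarrow> (nat set \<Rightarrow> 'k mpoly) \<Rightarrow> _"
  by unfold_locales

lemma linearI:
  assumes "vector_space s1" "vector_space s2" "\<And>a b. f (a + b) = f a + f b" "\<And>c a. f (s1 c a) = s2 c (f a)"
  shows "Vector_Spaces.linear s1 s2 f"
  by (intro Vector_Spaces.linear.intro module_hom.intro module_hom_axioms.intro assms)
    (use assms(1,2) in \<open>simp_all add: vector_space_def module_def\<close>)

lemma lookup_poly_scale: "lk (poly_scale c p) t = c * lk p t"
  using lookup_single_mult[of 0 c p t] by (simp add: poly_scale_def)

lemma subspace_keys: "ps.subspace {p. mkeys p \<subseteq> T}"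
proof -
  have *: "mkeys p \<subseteq> T \<longleftrightarrow> (\<forall>t. t \<notin> T \<longrightarrow> lk p t = 0)" for p :: "'a mpoly" by (auto simp: in_keys_iff)
  show ?thesis unfolding * by (auto simp: ps.subspace_def lookup_add lookup_poly_scale)
qed

lemma single_poly_scale: "sng t c = poly_scale c (sng t 1)"
  by (simp add: poly_scale_def mult_single)

lemma keys_in_span: assumes "mkeys p \<subseteq> T" shows "p \<in> ps.span ((\<lambda>t. sng t 1) ` T)"
proof -
  have "p = (\<Sum>t\<in>mkeys p. poly_scale (lk p t) (sng t 1))"
    by (subst poly_sum_monomials) (simp flip: single_poly_scale)
  also have "\<dots> \<in> ps.span ((\<lambda>t. sng t 1) ` T)"
    by (intro ps.span_sum ps.span_scale ps.span_base imageI) (use assms in blast)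
  finally show ?thesis .
qed

lemma mkeys_empty: "mkeys p = {} \<longleftrightarrow> p = 0"
  by (auto simp: in_keys_iff set_eq_iff intro: poly_mapping_eqI)

lemma dim_keys: assumes "finite T" shows "ps.fd {p :: 'k::field mpoly. mkeys p \<subseteq> T} \<and> ps.dim {p :: 'k mpoly. mkeys p \<subseteq> T} = card T"
proof
  have fd: "ps.fd {p :: 'k mpoly. mkeys p \<subseteq> T}" if "finite T" for T
    unfolding ps.fd_def using subspace_keys that keys_in_span
    by (intro conjI exI[of _ "(\<lambda>t. sng t 1) ` T"]) auto
  show "ps.fd {p :: 'k mpoly. mkeys p \<subseteq> T}" by (rule fd[OF assms])
  show "ps.dim {p :: 'k mpoly. mkeys p \<subseteq> T} = card T"
    using assms
  proof (induction T)
    case empty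
    have "{p :: 'k mpoly. mkeys p \<subseteq> {}} = {0}" by (auto intro: poly_mapping_eqI simp: in_keys_iff set_eq_iff)
    then show ?case by simp
  next
    case (insert t T)
    let ?f = "pres {t} :: 'k mpoly \<Rightarrow> 'k mpoly"
    have lin: "Vector_Spaces.linear poly_scale poly_scale ?f"
      by (rule linearI) (auto intro!: vector_space_poly_scale poly_mapping_eqI simp: lookup_pres lookup_add lookup_poly_scale)
    have ker: "{p \<in> {p. mkeys p \<subseteq> insert t T}. ?f p = 0} = {p. mkeys p \<subseteq> T}"
    proof -
      have "?f p = 0 \<longleftrightarrow> t \<notin> mkeys p" for p
        unfolding mkeys_empty[symmetric] keys_pres by auto
      then show ?thesis using insert.hyps by auto
    qed
    have im: "?f ` {p. mkeys p \<subseteq> insert t T} = ps.span {sng t 1}"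
    proof (intro equalityI subsetI)
      fix q assume "q \<in> ?f ` {p. mkeys p \<subseteq> insert t T}"
      then have "mkeys q \<subseteq> {t}" by (auto simp: keys_pres)
      from keys_in_span[OF this] show "q \<in> ps.span {sng t 1}" by simp
    next
      fix q :: "'k mpoly" assume "q \<in> ps.span {sng t 1}"
      then obtain c where "q = poly_scale c (sng t 1)" by (auto simp: ps.span_singleton)
      then have q: "mkeys q \<subseteq> {t}" by (simp flip: single_poly_scale)
      then have "q = ?f q" by (simp add: pres_id)
      with q show "q \<in> ?f ` {p. mkeys p \<subseteq> insert t T}" by blast
    qed
    have "sng t (1::'k) \<noteq> 0" by (metis lookup_single_eq lookup_zero one_neq_zero)
    then have "ps.dim (ps.span {sng t (1::'k)}) = 1"
      by (subst ps.dim_span_eq_card_independent) (auto simp: ps.independent_insert)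
    moreover have "ps.dim {p :: 'k mpoly. mkeys p \<subseteq> insert t T} = ps.dim {p :: 'k mpoly. mkeys p \<subseteq> T} + ps.dim (ps.span {sng t (1::'k)})"
      unfolding ker[symmetric] im[symmetric] by (rule pp.rank_nullity[OF lin fd]) (use insert.hyps in simp)
    ultimately have "ps.dim {p :: 'k mpoly. mkeys p \<subseteq> insert t T} = card T + 1" using insert.IH by simp
    then show ?case using insert.hyps by simp
  qed
qed

lemma forms_keys: "forms V {m} = {p. mkeys p \<subseteq> {t. mkeys t \<subseteq> V \<and> int (mon_degree t) = m}}"
  by (auto simp: forms_def)

text \<open>Counts monomials of degree \<open>m\<close> in \<open>k\<close> variables, splitting by
  whether a fixed variable occurs. The clauses for \<open>k = 0\<close> cover the ring without
  variables.\<close>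

fun mcf :: "nat \<Rightarrow> nat \<Rightarrow> nat" where
  "mcf 0 0 = 1" | "mcf 0 (Suc m) = 0" | "mcf (Suc k) 0 = 1"
| "mcf (Suc k) (Suc m) = mcf (Suc k) m + mcf k (Suc m)"

lemma mcf_0 [simp]: "mcf k 0 = 1" by (cases k) auto

lemma mcf_binomial: "mcf (Suc k) m = (m + k) choose k"
proof (induction k arbitrary: m)
  case 0 show ?case by (induction m) auto
next
  case (Suc k)
  show ?case
  proof (induction m)
    case (Suc m) then show ?case using Suc.IH \<open>\<And>m. mcf (Suc k) m = (m + k) choose k\<close>[of "Suc m"] by simp
  qed simp
qed

text \<open>Summing over the degrees below \<open>d\<close> amounts to homogenizing with one more
  variable; with \<open>mcf_binomial\<close> this becomes the binomial coefficient of the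
  theorem.\<close>

lemma sum_mcf: "(\<Sum>j<d. mcf e j) = (if d = 0 then 0 else mcf (Suc e) (d - 1))"
proof (induction d)
  case (Suc d) then show ?case by (cases d) auto
qed simp

lemma card_monomials:
  assumes "finite V" shows "card {t :: nat \<Rightarrow>\<^sub>0 nat. mkeys t \<subseteq> V \<and> mon_degree t = m} = mcf (card V) m"
  using assms
proof (induction V arbitrary: m)
  case empty
  have "{t :: nat \<Rightarrow>\<^sub>0 nat. mkeys t \<subseteq> {} \<and> mon_degree t = m} = (if m = 0 then {0} else {})"
    by (auto simp: mon_degree_def)
  then show ?case by (cases m) auto
next
  case (insert j V)
  let ?M = "\<lambda>V m. {t :: nat \<Rightarrow>\<^sub>0 nat. mkeys t \<subseteq> V \<and> mon_degree t = m}"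
  have fin: "finite (?M W m)" if "finite W" for W m using finite_monomials[OF that, of "int m"] by simp
  show ?case
  proof (induction m)
    case 0
    have "?M (insert j V) 0 = {0}" by auto
    then show ?case by simp
  next
    case (Suc m)
    have eq: "?M (insert j V) (Suc m) = ?M V (Suc m) \<union> (+) (sng j 1) ` ?M (insert j V) m"
    proof (intro equalityI subsetI)
      fix t assume t: "t \<in> ?M (insert j V) (Suc m)"
      show "t \<in> ?M V (Suc m) \<union> (+) (sng j 1) ` ?M (insert j V) m"
      proof (cases "j \<in> mkeys t")
        case False with t show ?thesis by auto
      next
        case True
        have tt: "t = sng j 1 + (t - sng j 1)"
          using True by (intro poly_mapping_eqI) (auto simp: lookup_add lookup_minus lookup_single when_def in_keys_iff)
        have "mon_degree t = 1 + mon_degree (t - sng j 1)" by (subst tt) (simp add: mon_degree_add)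
        moreover have "mkeys (t - sng j 1) \<subseteq> mkeys t" by (auto simp: in_keys_iff lookup_minus)
        ultimately have "t - sng j 1 \<in> ?M (insert j V) m" using t by auto
        with tt show ?thesis by blast
      qed
    next
      fix t assume "t \<in> ?M V (Suc m) \<union> (+) (sng j 1) ` ?M (insert j V) m"
      then show "t \<in> ?M (insert j V) (Suc m)" by (auto simp: mkeys_add mon_degree_add)
    qed
    have "card (?M (insert j V) (Suc m)) = card (?M V (Suc m)) + card ((+) (sng j 1) ` ?M (insert j V) m)"
      unfolding eq
    proof (rule card_Un_disjoint)
      show "?M V (Suc m) \<inter> (+) (sng j 1) ` ?M (insert j V) m = {}" using insert.hyps by (auto simp: mkeys_add)
    qed (use fin insert.hyps in auto)
    also have "card ((+) (sng j 1) ` ?M (insert j V) m) = card (?M (insert j V) m)" by (rule card_image) (auto intro: inj_onI)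
    finally show ?case using Suc insert.hyps insert.IH[of "Suc m"] by simp
  qed
qed

text \<open>Hilbert function of the polynomial ring in \<open>k\<close> variables, extended by zero
  to negative degrees so that twists and differences need no case distinction.\<close>

definition Dm :: "nat \<Rightarrow> int \<Rightarrow> int" where "Dm k m = (if m < 0 then 0 else int (mcf k (nat m)))"

lemma card_monomials_int:
  assumes "finite V" shows "int (card {t :: nat \<Rightarrow>\<^sub>0 nat. mkeys t \<subseteq> V \<and> int (mon_degree t) = m}) = Dm (card V) m"
proof (cases "m < 0")
  case True
  then have "{t :: nat \<Rightarrow>\<^sub>0 nat. mkeys t \<subseteq> V \<and> int (mon_degree t) = m} = {}" by auto
  then show ?thesis using True by (simp add: Dm_def)
next
  case False
  then have "{t :: nat \<Rightarrow>\<^sub>0 nat. mkeys t \<subseteq> V \<and> int (mon_degree t) = m} = {t. mkeys t \<subseteq> V \<and> mon_degree t = nat m}" by auto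
  then show ?thesis using False card_monomials[OF assms] by (simp add: Dm_def)
qed

lemma dim_forms: assumes "finite V"
  shows "ps.fd (forms V {m} :: 'k::field mpoly set)" "int (ps.dim (forms V {m} :: 'k mpoly set)) = Dm (card V) m"
  using dim_keys[OF finite_monomials[OF assms], where 'k = 'k] card_monomials_int[OF assms, of m] by (simp_all add: forms_keys)

section \<open>Backward differences of integer functions\<close>

definition dl :: "(int \<Rightarrow> int) \<Rightarrow> int \<Rightarrow> int" where "dl f m = f m - f (m - 1)"

text \<open>A difference multiplies the generating series by \<open>1 - t\<close>, which removes one
  variable.\<close>

lemma dl_Dm: "dl (Dm (Suc k)) = Dm k"
proof
  fix m
  consider "m < 0" | "m = 0" | j where "m = int (Suc j)" by (metis int_cases2 of_nat_Suc not_less0 nat.exhaust linorder_neqE_linordered_idom int_one_le_iff_zero_less zero_less_imp_eq_int old.nat.exhaust of_nat_0_less_iff)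
  then show "dl (Dm (Suc k)) m = Dm k m"
  proof cases
    case 3
    then have "nat m = Suc j" "nat (m - 1) = j" "m \<ge> 1" by auto
    then show ?thesis by (simp add: dl_def Dm_def)
  qed (auto simp: dl_def Dm_def)
qed

lemma dl_pow_Dm: "(dl ^^ j) (Dm (k + j)) = Dm k"
  by (induction j) (simp_all add: funpow_Suc_right dl_Dm del: funpow.simps)

lemma dl_diff: "dl (\<lambda>m. f m - g m) = (\<lambda>m. dl f m - dl g m)" by (auto simp: dl_def)
lemma dl_cmul: "dl (\<lambda>m. c * f m) = (\<lambda>m. c * dl f m)" by (auto simp: dl_def algebra_simps)
lemma dl_shift: "dl (\<lambda>m. f (m - c)) = (\<lambda>m. dl f (m - c))" by (auto simp: dl_def algebra_simps)
lemma dl_sum: "dl (\<lambda>m. \<Sum>a\<in>A. f a m) = (\<lambda>m. \<Sum>a\<in>A. dl (f a) m)" by (auto simp: dl_def sum_subtractf)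

lemma dlp_diff: "(dl ^^ k) (\<lambda>m. f m - g m) = (\<lambda>m. (dl ^^ k) f m - (dl ^^ k) g m)"
  by (induction k) (simp_all add: dl_diff)
lemma dlp_cmul: "(dl ^^ k) (\<lambda>m. c * f m) = (\<lambda>m. c * (dl ^^ k) f m)"
  by (induction k) (simp_all add: dl_cmul)
lemma dlp_shift: "(dl ^^ k) (\<lambda>m. f (m - c)) = (\<lambda>m. (dl ^^ k) f (m - c))"
  by (induction k) (simp_all add: dl_shift)
lemma dlp_sum: "(dl ^^ k) (\<lambda>m. \<Sum>a\<in>A. f a m) = (\<lambda>m. \<Sum>a\<in>A. (dl ^^ k) (f a) m)"
  by (induction k) (simp_all add: dl_sum)

lemma dlp_binomial: "(dl ^^ k) f m = (\<Sum>i\<le>k. (-1) ^ i * int (k choose i) * f (m - int i))"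
proof (induction k arbitrary: m)
  case 0 then show ?case by simp
next
  case (Suc k)
  let ?t = "\<lambda>k i. (-1) ^ i * int (k choose i) * f (m - int i)"
  have "(dl ^^ Suc k) f m = (dl ^^ k) f m - (dl ^^ k) f (m - 1)" by (simp add: dl_def)
  also have "(dl ^^ k) f (m - 1) = - (\<Sum>i\<le>k. (-1) ^ Suc i * int (k choose i) * f (m - int (Suc i)))"
    by (simp add: Suc sum_negf algebra_simps)
  also have "(dl ^^ k) f m = ?t k 0 + (\<Sum>i<k. ?t k (Suc i))"
    unfolding Suc by (subst sum.atMost_shift) simp
  also have "(\<Sum>i<k. ?t k (Suc i)) = (\<Sum>i\<le>k. ?t k (Suc i))"
    by (simp add: lessThan_Suc_atMost[symmetric])
  finally have "(dl ^^ Suc k) f m = ?t k 0 + ((\<Sum>i\<le>k. ?t k (Suc i)) + (\<Sum>i\<le>k. (-1) ^ Suc i * int (k choose i) * f (m - int (Suc i))))"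
    by linarith
  also have "\<dots> = ?t k 0 + (\<Sum>i\<le>k. ?t k (Suc i) + (-1) ^ Suc i * int (k choose i) * f (m - int (Suc i)))"
    by (simp only: sum.distrib)
  also have "\<dots> = ?t (Suc k) 0 + (\<Sum>i\<le>k. ?t (Suc k) (Suc i))"
    by (simp add: algebra_simps)
  also have "\<dots> = (\<Sum>i\<le>Suc k. ?t (Suc k) i)"
    by (subst sum.atMost_Suc_shift) simp
  finally show ?case .
qed

text \<open>A function whose difference is eventually at most \<open>-1\<close> tends to minus
  infinity; iterate.\<close>

lemma dl_negative: "(\<forall>m\<ge>m0. (dl ^^ n) f m \<le> -1) \<Longrightarrow> \<exists>m1. \<forall>m\<ge>m1. f m \<le> -1"
proof (induction n arbitrary: f)
  case 0 then show ?case by auto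
next
  case (Suc n)
  have "\<forall>m\<ge>m0. (dl ^^ n) (dl f) m \<le> -1" using Suc.prems by (simp add: funpow_swap1)
  from Suc.IH[OF this] obtain m1 where m1: "\<And>m. m \<ge> m1 \<Longrightarrow> dl f m \<le> -1" by blast
  have "f (m1 + int k) \<le> f m1 - int k" for k
  proof (induction k)
    case (Suc k) then show ?case using m1[of "m1 + int (Suc k)"] by (simp add: dl_def algebra_simps)
  qed simp
  from this have *: "f m \<le> f m1 - (m - m1)" if "m \<ge> m1" for m
    using that by (metis add.commute diff_add_cancel nonneg_int_cases diff_ge_0_iff_ge)
  show ?case
  proof (intro exI[of _ "m1 + \<bar>f m1\<bar> + 1"] allI impI)
    fix m assume "m1 + \<bar>f m1\<bar> + 1 \<le> m"
    with *[of m] show "f m \<le> -1" by linarith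
  qed
qed

text \<open>The eventual value of an iterated difference plays the role of a leading coefficient. It
  is an integer and makes sense before any polynomial is known.\<close>

definition ev_const :: "(int \<Rightarrow> int) \<Rightarrow> int \<Rightarrow> bool" where "ev_const f c \<longleftrightarrow> (\<exists>m0. \<forall>m\<ge>m0. f m = c)"

text \<open>The device that turns inequalities between Hilbert functions into inequalities between
  degrees.\<close>

lemma ev_const_nonneg:
  assumes "\<And>m. m \<ge> m0 \<Longrightarrow> f m \<ge> 0" "ev_const ((dl ^^ n) f) c" shows "c \<ge> 0"
proof (rule ccontr)
  assume "\<not> 0 \<le> c"
  moreover obtain m2 where "\<forall>m\<ge>m2. (dl ^^ n) f m = c" using assms(2) by (auto simp: ev_const_def)
  ultimately have "\<forall>m\<ge>m2. (dl ^^ n) f m \<le> -1" by auto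
  from dl_negative[OF this] obtain m1 where "\<forall>m\<ge>m1. f m \<le> -1" by blast
  then have "f (max m0 m1) \<le> -1" by simp
  moreover have "f (max m0 m1) \<ge> 0" by (rule assms(1)) simp
  ultimately show False by simp
qed

lemma ev_const_op:
  assumes "ev_const f c" "ev_const g d" shows "ev_const (\<lambda>m. h (f m) (g m)) (h c d)"
proof -
  from assms obtain m1 m2 where "\<forall>m\<ge>m1. f m = c" "\<forall>m\<ge>m2. g m = d" by (auto simp: ev_const_def)
  then have "\<forall>m\<ge>max m1 m2. h (f m) (g m) = h c d" by simp
  then show ?thesis unfolding ev_const_def ..
qed

lemmas ev_const_add = ev_const_op[where h = "(+)"]
lemmas ev_const_diff = ev_const_op[where h = "(-)"]
lemma ev_const_cmul: "ev_const f c \<Longrightarrow> ev_const (\<lambda>m. a * f m) (a * c)"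
  unfolding ev_const_def by metis
lemma ev_const_shift: "ev_const f c \<Longrightarrow> ev_const (\<lambda>m. f (m - a)) c"
  unfolding ev_const_def
proof (elim exE, intro exI allI impI)
  fix m0 m assume "\<forall>m\<ge>m0. f m = c" "m0 + a \<le> m"
  then show "f (m - a) = c" by simp
qed
lemma ev_const_const: "ev_const (\<lambda>m. c) c"
  unfolding ev_const_def by blast
lemma ev_const_sum: "finite A \<Longrightarrow> (\<And>a. a \<in> A \<Longrightarrow> ev_const (f a) (c a)) \<Longrightarrow> ev_const (\<lambda>m. \<Sum>a\<in>A. f a m) (\<Sum>a\<in>A. c a)"
  by (induction A rule: finite_induct) (auto intro: ev_const_add ev_const_const)
lemma ev_const_unique: assumes "ev_const f c" "ev_const f d" shows "c = d"
proof -
  from assms obtain m1 m2 where 1: "\<forall>m\<ge>m1. f m = c" and 2: "\<forall>m\<ge>m2. f m = d" by (auto simp: ev_const_def)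
  from 1 have "f (max m1 m2) = c" by simp
  moreover from 2 have "f (max m1 m2) = d" by simp
  ultimately show ?thesis by simp
qed
lemma ev_const_dl: "ev_const f c \<Longrightarrow> ev_const (dl f) 0"
  using ev_const_diff[OF _ ev_const_shift[of f c 1], of f c] by (simp add: dl_def[abs_def])
lemma ev_const_dlp: "ev_const ((dl ^^ n) f) 0 \<Longrightarrow> n \<le> k \<Longrightarrow> ev_const ((dl ^^ k) f) 0"
proof (induction k)
  case (Suc k) then show ?case by (cases "n = Suc k") (auto intro: ev_const_dl)
qed simp

lemma ev_const_Dm: "ev_const ((dl ^^ n) (Dm (Suc n))) 1" "k \<le> n \<Longrightarrow> ev_const ((dl ^^ n) (Dm k)) 0"
proof -
  have "mcf (Suc 0) m = 1" for m using mcf_binomial[of 0 m] by simp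
  then show "ev_const ((dl ^^ n) (Dm (Suc n))) 1"
    using dl_pow_Dm[of n "Suc 0"] by (auto simp: ev_const_def Dm_def intro!: exI[of _ 0])
  have "ev_const (Dm 0) 0" unfolding ev_const_def
  proof (intro exI[of _ 1] allI impI)
    fix m :: int assume "1 \<le> m"
    then show "Dm 0 m = 0" by (cases "nat m") (auto simp: Dm_def)
  qed
  then show "ev_const ((dl ^^ n) (Dm k)) 0" if "k \<le> n"
    using ev_const_dlp[of k "Dm k" n] dl_pow_Dm[of k 0] that by simp
qed

section \<open>Functions that are eventually polynomial\<close>

definition pd :: "rat poly \<Rightarrow> rat poly" where "pd p = p - pcompose p [:-1, 1:]"

lemma poly_pd: "poly (pd p) x = poly p x - poly p (x - 1)"
  by (simp add: pd_def poly_pcompose algebra_simps)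

lemma pd_add: "pd (p + q) = pd p + pd q"
  by (simp add: pd_def pcompose_add)

lemma pd_pCons: "pd (pCons a p) = pCons 0 (pd p) + pcompose p [:-1, 1:]"
  by (simp add: pd_def pcompose_pCons algebra_simps)

lemma pd_const [simp]: "pd [:c:] = 0"
  by (simp add: pd_def)

lemma pd_0 [simp]: "pd 0 = 0"
  by (simp add: pd_def)

text \<open>Each difference multiplies the leading coefficient by the old degree, which accounts for
  the factorial in \<open>proj_degree\<close>.\<close>

lemma pd_coeff: "degree p \<le> Suc k \<Longrightarrow> degree (pd p) \<le> k \<and> coeff (pd p) k = of_nat (Suc k) * coeff p (Suc k)"
proof (induction p arbitrary: k)
  case 0 show ?case by (simp add: pd_def)
next
  case (pCons a p)
  have dp: "degree p \<le> k" using pCons by (cases "p = 0") (auto split: if_splits)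
  let ?c = "pcompose p [:-1, 1:]"
  have dc: "degree ?c = degree p" by (simp add: degree_pcompose)
  have cc: "coeff ?c k = coeff p k"
  proof (cases "degree p = k")
    case True
    have "lead_coeff ?c = lead_coeff p" by (subst lead_coeff_comp) auto
    with True dc show ?thesis by simp
  next
    case False
    with dp dc show ?thesis by (simp add: coeff_eq_0)
  qed
  show ?case
  proof (cases k)
    case 0
    with dp obtain b where b: "p = [:b:]" by (metis degree_eq_zeroE le_zero_eq)
    show ?thesis by (simp add: b 0 pd_pCons)
  next
    case (Suc l)
    from pCons.IH[of l] dp Suc have IH: "degree (pd p) \<le> l" "coeff (pd p) l = of_nat (Suc l) * coeff p (Suc l)" by auto
    have "degree (pCons 0 (pd p)) \<le> k" using IH(1) Suc by (simp add: degree_pCons_eq_if)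
    then have "degree (pd (pCons a p)) \<le> k" unfolding pd_pCons using dc dp by (intro degree_add_le) auto
    moreover have "coeff (pd (pCons a p)) k = of_nat (Suc k) * coeff (pCons a p) (Suc k)"
      unfolding pd_pCons using cc IH(2) Suc by (simp add: algebra_simps)
    ultimately show ?thesis by simp
  qed
qed

lemma pd_surj: "degree p \<le> k \<Longrightarrow> \<exists>q. pd q = p"
proof (induction k arbitrary: p)
  case 0
  then obtain c where "p = [:c:]" by (metis degree_eq_zeroE le_zero_eq)
  then have "pd [:0, c:] = p" by (simp add: pd_pCons)
  then show ?case ..
next
  case (Suc k)
  define q where "q = monom (coeff p (Suc k) / of_nat (Suc (Suc k))) (Suc (Suc k))"
  have "degree q \<le> Suc (Suc k)" by (simp add: q_def degree_monom_le)
  from pd_coeff[OF this] have q: "degree (pd q) \<le> Suc k" "coeff (pd q) (Suc k) = coeff p (Suc k)"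
    by (simp_all add: q_def del: of_nat_Suc)
  have "degree (p - pd q) \<le> k"
  proof (rule degree_le, intro allI impI)
    fix i assume "k < i"
    then consider "i = Suc k" | "i > Suc k" by linarith
    then show "coeff (p - pd q) i = 0"
      by cases (use q Suc.prems in \<open>auto simp: coeff_eq_0\<close>)
  qed
  from Suc.IH[OF this] obtain r where "pd r = p - pd q" by blast
  then have "pd (q + r) = p" by (simp add: pd_add)
  then show ?case ..
qed

definition ev_poly :: "(int \<Rightarrow> int) \<Rightarrow> rat poly \<Rightarrow> bool" where
  "ev_poly f P \<longleftrightarrow> (\<exists>m0. \<forall>m\<ge>m0. of_int (f m) = poly P (of_int m))"

text \<open>Discrete integration: \<open>pd\<close> is onto, and a function whose difference
  eventually agrees with that of a polynomial differs from this polynomial by a constant.\<close>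

lemma ev_poly_exists: "ev_const ((dl ^^ k) f) 0 \<Longrightarrow> \<exists>P. ev_poly f P"
proof (induction k arbitrary: f)
  case 0 then show ?case by (intro exI[of _ 0]) (auto simp: ev_poly_def ev_const_def)
next
  case (Suc k)
  from Suc.prems have "ev_const ((dl ^^ k) (dl f)) 0" by (simp add: funpow_swap1)
  from Suc.IH[OF this] obtain P :: "rat poly" and m0 where "\<forall>m\<ge>m0. of_int (dl f m) = poly P (of_int m)" unfolding ev_poly_def by blast
  then have P: "\<And>m. m \<ge> m0 \<Longrightarrow> of_int (dl f m) = poly P (of_int m)" by blast
  obtain q where q: "pd q = P" using pd_surj[of P "degree P"] by auto
  define c where "c = of_int (f m0) - poly q (of_int m0)"
  have "of_int (f (m0 + int k)) - poly q (of_int (m0 + int k)) = c" for k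
  proof (induction k)
    case 0 show ?case by (simp add: c_def)
  next
    case (Suc k)
    have "of_int (dl f (m0 + int (Suc k))) = poly (pd q) (of_int (m0 + int (Suc k)))" using P q by simp
    then show ?case using Suc by (simp add: dl_def poly_pd algebra_simps)
  qed
  then have "of_int (f m) = poly (q + [:c:]) (of_int m)" if "m \<ge> m0" for m
    using that zle_iff_zadd[of m0 m] by (auto simp: algebra_simps)
  then show ?case unfolding ev_poly_def by blast
qed

lemma ev_poly_dl: assumes "ev_poly f P" shows "ev_poly (dl f) (pd P)"
proof -
  from assms obtain m0 where "\<And>m. m \<ge> m0 \<Longrightarrow> of_int (f m) = poly P (of_int m)" by (auto simp: ev_poly_def)
  then have "of_int (dl f m) = poly (pd P) (of_int m)" if "m \<ge> m0 + 1" for m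
    using that by (simp add: dl_def poly_pd)
  then show ?thesis unfolding ev_poly_def by blast
qed

lemma ev_poly_dlp:
  assumes "ev_poly f P" "degree P \<le> n"
  obtains c where "ev_const ((dl ^^ n) f) c" "of_int c = fact n * coeff P n"
proof -
  have "\<exists>m0. \<forall>m\<ge>m0. of_int ((dl ^^ n) f m) = fact n * coeff P n"
    using assms
  proof (induction n arbitrary: f P)
    case 0
    then obtain b where "P = [:b:]" by (metis degree_eq_zeroE le_zero_eq)
    with 0 show ?case by (auto simp: ev_poly_def)
  next
    case (Suc n)
    from pd_coeff[OF Suc.prems(2)] Suc.IH[OF ev_poly_dl[OF Suc.prems(1)]]
    show ?case by (simp add: funpow_swap1 algebra_simps)
  qed
  then obtain m0 where m0: "\<And>m. m \<ge> m0 \<Longrightarrow> of_int ((dl ^^ n) f m) = fact n * coeff P n" by blast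
  have "(dl ^^ n) f m = (dl ^^ n) f m0" if "m \<ge> m0" for m
    using m0[OF that] m0[OF order_refl] by (metis of_int_eq_iff)
  then have "ev_const ((dl ^^ n) f) ((dl ^^ n) f m0)" unfolding ev_const_def by blast
  with m0[OF order_refl] that show ?thesis by blast
qed

lemma ev_poly_unique:
  fixes P Q :: "rat poly"
  assumes "\<And>m. m \<ge> m0 \<Longrightarrow> poly P (of_nat m) = poly Q (of_nat m)" shows "P = Q"
proof (rule ccontr)
  assume "P \<noteq> Q"
  then have "finite {x. poly (P - Q) x = 0}" by (intro poly_roots_finite) simp
  moreover have "of_nat ` {m0..} \<subseteq> {x. poly (P - Q) x = 0}" using assms by auto
  ultimately have "finite (of_nat ` {m0..} :: rat set)" by (rule finite_subset[rotated])
  then have "finite {m0..}" by (rule finite_imageD) (auto intro: inj_onI)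
  then show False by (simp add: infinite_Ici)
qed

section \<open>The Hilbert function\<close>

text \<open>Integer-valued and defined in all degrees, unlike \<open>hilbert_function\<close>, so
  that differences are not truncated and may reach negative degrees.\<close>

definition hf :: "nat \<Rightarrow> 'k::field mpoly set \<Rightarrow> int \<Rightarrow> int" where
  "hf N I m = int (ps.dim (fP N m :: 'k mpoly set)) - int (ps.dim (fI N I m))"

lemma poly_scale_mult: "poly_scale c p = sng 0 c * p" by (simp add: poly_scale_def)

lemma const_U: "sng 0 c \<in> forms V UNIV" by (rule forms_const) simp

lemma subspace_gideal: "gideal N I \<Longrightarrow> ps.subspace I"
  using gidealD(2,3)[of N I] const_U by (auto simp: ps.subspace_def subgrpD poly_scale_mult)

lemma subspace_forms: "ps.subspace (forms V D)"
  by (auto simp: ps.subspace_def formsI poly_scale_mult intro: forms_mult[OF forms_const[of "{0}"]])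

lemma subspace_fI: "gideal N I \<Longrightarrow> ps.subspace (fI N I m)"
  by (intro ps.subspace_inter subspace_gideal subspace_forms)

lemma fd_fP: "ps.fd (fP N m :: 'k::field mpoly set)" by (rule dim_forms) simp

lemma fd_fI: "gideal N I \<Longrightarrow> ps.fd (fI N I m)"
  by (rule ps.fd_subset[OF fd_fP subspace_fI]) auto

lemma hf_nonneg: "gideal N I \<Longrightarrow> hf N I m \<ge> 0"
  using ps.fd_dim_mono[OF fd_fP subspace_fI, of N I m] by (simp add: hf_def)

lemma hf_neg: "m < 0 \<Longrightarrow> hf N I m = 0"
proof -
  assume m: "m < 0"
  have "(fP N m :: 'a mpoly set) = {0}" using forms_neg[OF _ m] formsI(1) by blast
  moreover have "I \<inter> {0} = {0} \<or> I \<inter> {0} = {}" by auto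
  moreover have "ps.dim ({} :: 'a mpoly set) = 0" using ps.dim_span[of "{}"] by (simp del: ps.dim_span)
  ultimately show ?thesis by (auto simp: hf_def)
qed

lemma hilbert_function_hf:
  fixes I :: "'k::field mpoly set"
  assumes "gideal N I" shows "int (hilbert_function N I m) = hf N I (int m)"
proof -
  have 1: "{f :: 'k mpoly. f \<in> poly_ring N \<and> homogeneous f (int m)} = fP N (int m)" by (rule forms_homogeneous)
  have "I \<subseteq> poly_ring N" using assms by (simp add: gideal_def)
  then have 2: "{f \<in> I. homogeneous f (int m)} = fI N I (int m)" using forms_homogeneous[of N "int m"] by blast
  show ?thesis unfolding hilbert_function_def 1 2 hf_def
    using ps.fd_dim_mono[OF fd_fP subspace_fI[OF assms], of "int m"] by simp
qed

lemma hilbert_poly_eq: assumes gI: "gideal N I" and P: "ev_poly (hf N I) P" shows "hilbert_poly N I = P"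
proof -
  from P obtain m0 where m0: "\<And>m. m \<ge> m0 \<Longrightarrow> of_int (hf N I m) = poly P (of_int m)" by (auto simp: ev_poly_def)
  have P': "poly P (of_nat m) = of_nat (hilbert_function N I m)" if "m \<ge> nat m0" for m
  proof -
    have "of_int (int (hilbert_function N I m)) = poly P (of_int (int m))"
      unfolding hilbert_function_hf[OF gI] by (rule m0) (use that in linarith)
    then show ?thesis by simp
  qed
  show ?thesis unfolding hilbert_poly_def
  proof (rule the_equality)
    show "\<exists>m0. \<forall>m\<ge>m0. poly P (of_nat m) = of_nat (hilbert_function N I m)" using P' by blast
  next
    fix Q :: "rat poly" assume "\<exists>m0. \<forall>m\<ge>m0. poly Q (of_nat m) = of_nat (hilbert_function N I m)"
    then obtain m1 where "\<forall>m\<ge>m1. poly Q (of_nat m) = of_nat (hilbert_function N I m)" ..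
    with P' show "Q = P" by (intro ev_poly_unique[of "max (nat m0) m1"]) auto
  qed
qed

lemma linear_kd: "Vector_Spaces.linear chain_scale chain_scale (kd mulX {..N} :: (nat set \<Rightarrow> 'k::field mpoly) \<Rightarrow> _)"
proof (rule linearI)
  interpret kops mulX "{..N}" by (rule kops_mulX) simp
  show "kd mulX {..N} (a + b) = kd mulX {..N} a + kd mulX {..N} b" for a b :: "nat set \<Rightarrow> 'k mpoly" by (rule kd_add)
  show "kd mulX {..N} (chain_scale c a) = chain_scale c (kd mulX {..N} a)" for c and a :: "nat set \<Rightarrow> 'k mpoly"
  proof -
    have e: "chain_scale c = app (\<lambda>p. sng 0 c * p)" by (auto simp: fun_eq_iff chain_scale_def app_def poly_scale_def)
    show ?thesis unfolding e by (rule kd_app[OF kops_axioms]) (auto simp: algebra_simps)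
  qed
qed (rule vector_space_chain_scale)+

text \<open>With all weights equal to 1, the chains of one homological and one internal degree are
  families in a single graded piece, indexed by the sets of one size; this gives their
  dimension.\<close>

definition funs :: "nat set set \<Rightarrow> 'k::field mpoly set \<Rightarrow> (nat set \<Rightarrow> 'k mpoly) set" where
  "funs \<S> W = {c. \<forall>S. (S \<in> \<S> \<and> c S \<in> W) \<or> c S = 0}"

lemma dim_funs:
  assumes W: "ps.fd W" and "finite \<S>"
  shows "cs.fd (funs \<S> W) \<and> cs.dim (funs \<S> W) = card \<S> * ps.dim W"
  using assms(2)
proof (induction \<S>)
  case empty
  have "funs {} W = {0}" by (auto simp: funs_def fun_eq_iff)
  then show ?case by (simp add: cs.fd_zero)
next
  case (insert S \<S>)
  have sW: "ps.subspace W" using W by (simp add: ps.fd_def)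
  let ?f = "\<lambda>c :: nat set \<Rightarrow> 'a mpoly. c S"
  have lin: "Vector_Spaces.linear chain_scale poly_scale ?f"
    by (rule linearI[OF vector_space_chain_scale vector_space_poly_scale]) (auto simp: chain_scale_def)
  have sub: "cs.subspace (funs \<T> W)" for \<T>
    unfolding cs.subspace_def
  proof (intro conjI ballI allI)
    fix a b :: "nat set \<Rightarrow> 'a mpoly" and c assume ab: "a \<in> funs \<T> W"
    { assume "b \<in> funs \<T> W"
      show "a + b \<in> funs \<T> W" unfolding funs_def mem_Collect_eq
      proof
        fix T show "T \<in> \<T> \<and> (a + b) T \<in> W \<or> (a + b) T = 0"
          using ab \<open>b \<in> funs \<T> W\<close> ps.subspace_add[OF sW, of "a T" "b T"]
          unfolding funs_def by (cases "a T = 0"; cases "b T = 0") (auto dest!: spec[of _ T])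
      qed }
    show "chain_scale c a \<in> funs \<T> W" unfolding funs_def mem_Collect_eq
    proof
      fix T show "T \<in> \<T> \<and> chain_scale c a T \<in> W \<or> chain_scale c a T = 0"
        using ab ps.subspace_scale[OF sW, of "a T" c]
        unfolding funs_def chain_scale_def by (cases "a T = 0") (auto dest!: spec[of _ T])
    qed
  qed (simp add: funs_def)
  obtain B where B: "finite B" "W \<subseteq> ps.span B" using W by (auto simp: ps.fd_def)
  obtain C where C: "finite C" "funs \<S> W \<subseteq> cs.span C" using insert.IH by (auto simp: cs.fd_def)
  define E where "E = C \<union> (\<lambda>b. (\<lambda>T. if T = S then b else 0)) ` B"
  have single: "(\<lambda>T. if T = S then w else 0) \<in> cs.span E" if "w \<in> ps.span B" for w
    using that
  proof (induction rule: ps.span_induct_alt)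
    case base
    have "(\<lambda>T. if T = S then 0 else 0) = (0 :: nat set \<Rightarrow> 'a mpoly)" by (auto simp: fun_eq_iff)
    then show ?case by (simp only: cs.span_zero)
  next
    case (step c x y)
    have "(\<lambda>T. if T = S then poly_scale c x + y else 0) = chain_scale c (\<lambda>T. if T = S then x else 0) + (\<lambda>T. if T = S then y else 0)"
      by (auto simp: fun_eq_iff chain_scale_def)
    moreover have "(\<lambda>T. if T = S then x else 0) \<in> cs.span E" using step by (intro cs.span_base) (auto simp: E_def)
    ultimately show ?case using step by (auto intro: cs.span_add cs.span_scale)
  qed
  have fd: "cs.fd (funs (insert S \<S>) W)"
    unfolding cs.fd_def
  proof (intro conjI exI[of _ E] subsetI)
    fix c assume c: "c \<in> funs (insert S \<S>) W"
    have "c(S := 0) \<in> funs \<S> W" using c by (auto simp: funs_def)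
    then have 1: "c(S := 0) \<in> cs.span E" using C(2) cs.span_mono[of C E] by (auto simp: E_def)
    have "c S \<in> W" using c ps.subspace_0[OF sW] by (auto simp: funs_def dest: spec[of _ S])
    then have 2: "(\<lambda>T. if T = S then c S else 0) \<in> cs.span E" using B(2) by (intro single) auto
    have "c = c(S := 0) + (\<lambda>T. if T = S then c S else 0)" by (auto simp: fun_eq_iff)
    with cs.span_add[OF 1 2] show "c \<in> cs.span E" by simp
  qed (use sub B(1) C(1) in \<open>auto simp: E_def\<close>)
  have ker: "{c \<in> funs (insert S \<S>) W. ?f c = 0} = funs \<S> W"
    using insert.hyps by (auto simp: funs_def)
  have im: "?f ` funs (insert S \<S>) W = W"
  proof (intro equalityI subsetI)
    fix y assume "y \<in> ?f ` funs (insert S \<S>) W"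
    then show "y \<in> W" using ps.subspace_0[OF sW] by (auto simp: funs_def dest: spec[of _ S])
  next
    fix y assume "y \<in> W"
    then have "(\<lambda>T. if T = S then y else 0) \<in> funs (insert S \<S>) W" by (auto simp: funs_def)
    then show "y \<in> ?f ` funs (insert S \<S>) W" by (rule image_eqI[rotated]) simp
  qed
  have "cs.dim (funs (insert S \<S>) W) = cs.dim (funs \<S> W) + ps.dim W"
    using cp.rank_nullity[OF lin fd] unfolding ker im .
  with insert fd show ?case by simp
qed

lemma chn_funs: "chn {..N} one_wt A i m = funs {S. S \<subseteq> {..N} \<and> card S = i} (A (m - int i))"
  by (auto simp: chn_def funs_def)

lemma dim_chn:
  assumes "\<And>m. ps.fd (A m)"
  shows "cs.fd (chn {..N} one_wt A i m)" "cs.dim (chn {..N} one_wt A i m) = (Suc N choose i) * ps.dim (A (m - int i))"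
proof -
  have "finite {S. S \<subseteq> {..N} \<and> card S = i}" by (rule finite_subset[of _ "Pow {..N}"]) auto
  from dim_funs[OF assms this] n_subsets[of "{..N}" i]
  show "cs.fd (chn {..N} one_wt A i m)" "cs.dim (chn {..N} one_wt A i m) = (Suc N choose i) * ps.dim (A (m - int i))"
    by (simp_all add: chn_funs)
qed

text \<open>The \<open>i\<close>-th Koszul term in degree \<open>m\<close> consists of
  \<open>Suc N choose i\<close> copies of \<open>A (m - i)\<close>. Hence the alternating sum of
  dimensions, zero by exactness, is the binomial expansion of the iterated difference.\<close>

lemma euler_characteristic:
  assumes fd: "\<And>m. ps.fd (A m)" and sg: "\<And>m. subgrp (A m)" and X: "\<And>j m a. j \<le> N \<Longrightarrow> a \<in> A m \<Longrightarrow> Xv j * a \<in> A (m + 1)"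
    and ex: "\<And>i. KH0 mulX {..N} one_wt A (\<lambda>_. {0}) i m"
  shows "(dl ^^ Suc N) (\<lambda>m. int (ps.dim (A m))) m = 0"
proof -
  let ?d = "kd mulX {..N} :: (nat set \<Rightarrow> 'a mpoly) \<Rightarrow> _" and ?V = "\<lambda>i. chn {..N} one_wt A i m"
  interpret kops mulX "{..N}" by (rule kops_mulX) simp
  have ch0: "chn {..N} one_wt (\<lambda>_. {0}) k n = {0 :: nat set \<Rightarrow> 'a mpoly}" for k n
    by (auto simp: chn_def fun_eq_iff)
  have dV: "?d v \<in> ?V i" if "v \<in> ?V (Suc i)" for v i
    by (rule kd_chn[OF kops_axioms that sg]) (use X in auto)
  have exact: "\<exists>u\<in>?V (Suc i). v = ?d u" if "v \<in> ?V i" "?d v = 0" for v i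
  proof -
    have "?d v \<in> chn {..N} one_wt (\<lambda>_. {0}) (i - 1) m" using that(2) ch0 by simp
    with ex[of i] that(1) show ?thesis unfolding KH0_def ch0 by fastforce
  qed
  \<comment> \<open>Dimension of the boundaries in homological degree \<open>i\<close>. Every term
    of positive degree has dimension \<open>zz i + zz (i - 1)\<close>, so the alternating sum
    telescopes.\<close>
  define zz where "zz = (\<lambda>i. int (cs.dim (?d ` ?V (Suc i))))"
  have ker: "{v \<in> ?V (Suc i). ?d v = 0} = ?d ` ?V (Suc (Suc i))" for i
    using exact[of _ "Suc i"] dV[of _ "Suc i"] kd_kd[OF kops_axioms] by blast
  have d0: "?d v = 0" if "v \<in> ?V 0" for v by (rule kd_chn_0[OF kops_axioms that])
  have V0: "?V 0 = ?d ` ?V (Suc 0)" using exact[of _ 0] dV[of _ 0] d0 by blast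
  have fdV: "cs.fd (?V i)" for i by (rule dim_chn(1)) (rule fd)
  have dimS: "int (cs.dim (?V (Suc i))) = zz (Suc i) + zz i" for i
    using cc.rank_nullity[OF linear_kd[of N] fdV[of "Suc i"]] unfolding ker zz_def by simp
  have dim0: "int (cs.dim (?V 0)) = zz 0" unfolding zz_def V0 ..
  have "(\<Sum>i\<le>n. (-1) ^ i * int (cs.dim (?V i))) = (-1) ^ n * zz n" for n
    by (induction n) (simp_all add: dim0 dimS algebra_simps)
  moreover have "zz (Suc N) = 0"
  proof -
    have "cs.dim (?V (Suc (Suc N))) = 0" by (simp add: dim_chn(2)[OF fd] binomial_eq_0)
    then show ?thesis using dimS[of "Suc N"] unfolding zz_def by simp
  qed
  ultimately have "(\<Sum>i\<le>Suc N. (-1) ^ i * int (cs.dim (?V i))) = 0" by simp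
  then show ?thesis unfolding dlp_binomial by (simp add: dim_chn(2)[OF fd] mult.assoc del: sum.atMost_Suc)
qed

lemma mulX_fP: "j \<le> N \<Longrightarrow> a \<in> fP N m \<Longrightarrow> Xv j * a \<in> fP N (m + 1)"
  using forms_mult1[OF forms_Xv, of j "{..N}" a m] by (simp add: add.commute)

text \<open>The homology of the Koszul complex of \<open>R\<close> is \<open>k\<close> in bidegree
  zero, whence the exclusion of \<open>m = 0\<close>.\<close>

lemma KH0_polynomial_ring:
  assumes "m \<noteq> 0" shows "KH0 mulX {..N} one_wt (fP N :: int \<Rightarrow> 'k::field mpoly set) (\<lambda>_. {0}) i m"
proof (cases i)
  case (Suc j) then show ?thesis by (simp add: koszul_acyclic)
next
  case 0
  have ch0: "chn {..N} one_wt (\<lambda>_. {0}) k n = {0 :: nat set \<Rightarrow> 'k mpoly}" for k n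
    by (auto simp: chn_def fun_eq_iff)
  show ?thesis unfolding KH0_def ch0 0
  proof (intro ballI impI)
    fix z :: "nat set \<Rightarrow> 'k mpoly" assume z: "z \<in> chn {..N} one_wt (fP N) 0 m"
    have z0: "z {} \<in> fP N m" using chn_in[OF z subgrp_forms, of "{}"] by simp
    have "const_coeff (z {}) = 0" by (rule const_coeff_forms[OF z0 assms])
    then obtain y where y: "\<And>j. y j \<in> fP N (m - 1)" "z {} = (\<Sum>j\<le>N. Xv j * y j)"
      using irrelevant_decomp[OF z0] by metis
    define v where "v = (\<lambda>S. if \<exists>j\<le>N. S = {j} then y (THE j. S = {j}) else 0)"
    have v1: "v {j} = y j" if "j \<le> N" for j using that by (auto simp: v_def)
    have v: "v \<in> chn {..N} one_wt (fP N) (Suc 0) m"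
      unfolding chn_def mem_Collect_eq
    proof
      fix S show "S \<subseteq> {..N} \<and> card S = Suc 0 \<and> v S \<in> fP N (m - sum one_wt S) \<or> v S = 0"
        by (cases "\<exists>j\<le>N. S = {j}") (use v1 y(1) in \<open>auto simp: v_def\<close>)
    qed
    have "z = kd mulX {..N} v"
    proof
      fix S show "z S = kd mulX {..N} v S"
      proof (cases "S = {}")
        case True
        then show ?thesis using y(2) v1 by (simp add: kd_def iota_def sgn_at_def)
      next
        case False
        have "kd mulX {..N} v \<in> chn {..N} one_wt (fP N) 0 m"
          by (rule kd_chn[OF kops_mulX v subgrp_forms])
            (auto intro: mulX_fP)
        with z False show ?thesis using chnD[of _ "{..N}" one_wt "fP N" 0 m S] by (metis card_0_eq finite_atMost finite_subset)
      qed
    qed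
    with v show "\<exists>v\<in>chn {..N} one_wt (fP N) (Suc 0) m. z - kd mulX {..N} v \<in> {0}" by (intro bexI[of _ v]) auto
  qed
qed

lemma kz_trivial: "i > Suc N \<Longrightarrow> kz N I i m"
proof -
  assume i: "i > Suc N"
  have "chn {..N} one_wt (fP N) i m = {0 :: nat set \<Rightarrow> 'a mpoly}"
    using i by (auto simp: chn_def fun_eq_iff) (metis card_atMost card_mono finite_atMost not_le)
  then show ?thesis by (auto simp: kz_def KH0_def kops.kd_zero[OF kops_mulX] intro!: bexI[of _ 0])
qed

text \<open>The \<open>(N+1)\<close>-th difference at \<open>m\<close> is the coefficient of
  \<open>t^m\<close> in the numerator of the Hilbert series, an alternating sum of Tor dimensions.
  It is computed for \<open>R\<close> and for \<open>I\<close> separately; exactness for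
  \<open>I\<close> follows from that for \<open>R/I\<close> by \<open>KH0_shift\<close>.\<close>

lemma hf_difference:
  fixes I :: "'k::field mpoly set"
  assumes gI: "gideal N I" and m: "m \<noteq> 0" and kz: "\<And>i. i \<le> N \<Longrightarrow> kz N I (Suc i) m"
  shows "(dl ^^ Suc N) (hf N I) m = 0"
proof -
  have kz': "kz N I (Suc i) m" for i using kz[of i] kz_trivial[of N "Suc i"] by (cases "i \<le> N") auto
  have P: "(dl ^^ Suc N) (\<lambda>m. int (ps.dim (fP N m :: 'k mpoly set))) m = 0"
    by (rule euler_characteristic) (auto intro: fd_fP subgrp_forms mulX_fP KH0_polynomial_ring[OF m])
  have "KH0 mulX {..N} one_wt (fI N I) (\<lambda>_. {0}) i m" for i
    using KH0_shift[OF kmod_gideal[OF gI] KH0_polynomial_ring[OF m] KH0_polynomial_ring[OF m], of i] kz'[of i]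
    unfolding kz_def by simp
  then have I: "(dl ^^ Suc N) (\<lambda>m. int (ps.dim (fI N I m))) m = 0"
    by (intro euler_characteristic fd_fI[OF gI] Xv_mult_fI[OF gI] subgrp_Int gidealD(2)[OF gI] subgrp_forms)
  have "hf N I = (\<lambda>m. int (ps.dim (fP N m :: 'k mpoly set)) - int (ps.dim (fI N I m)))" by (auto simp: hf_def)
  then show ?thesis using P I by (simp only: dlp_diff)
qed

section \<open>Changes of coordinates\<close>

definition msub :: "(nat \<Rightarrow> 'k::comm_ring_1 mpoly) \<Rightarrow> (nat \<Rightarrow>\<^sub>0 nat) \<Rightarrow> 'k mpoly" where
  "msub \<sigma> t = (\<Prod>i\<in>mkeys t. \<sigma> i ^ lk t i)"

definition psub :: "(nat \<Rightarrow> 'k::comm_ring_1 mpoly) \<Rightarrow> 'k mpoly \<Rightarrow> 'k mpoly" where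
  "psub \<sigma> p = (\<Sum>t\<in>mkeys p. sng 0 (lk p t) * msub \<sigma> t)"

lemma msub_superset: "finite A \<Longrightarrow> mkeys t \<subseteq> A \<Longrightarrow> msub \<sigma> t = (\<Prod>i\<in>A. \<sigma> i ^ lk t i)"
  unfolding msub_def by (rule prod.mono_neutral_left) (auto simp: in_keys_iff)

lemma msub_add: "msub \<sigma> (s + t) = msub \<sigma> s * msub \<sigma> t"
proof -
  let ?A = "mkeys s \<union> mkeys t"
  show ?thesis
    using msub_superset[of ?A s \<sigma>] msub_superset[of ?A t \<sigma>] msub_superset[of ?A "s + t" \<sigma>]
    by (simp add: mkeys_add lookup_add power_add prod.distrib)
qed

lemma psub_superset: "finite A \<Longrightarrow> mkeys p \<subseteq> A \<Longrightarrow> psub \<sigma> p = (\<Sum>t\<in>A. sng 0 (lk p t) * msub \<sigma> t)"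
  unfolding psub_def by (rule sum.mono_neutral_left) (auto simp: in_keys_iff)

lemma psub_add: "psub \<sigma> (p + q) = psub \<sigma> p + psub \<sigma> q"
proof -
  let ?A = "mkeys p \<union> mkeys q"
  have "mkeys (p + q) \<subseteq> ?A" by (auto simp: in_keys_iff lookup_add)
  then show ?thesis
    using psub_superset[of ?A p \<sigma>] psub_superset[of ?A q \<sigma>] psub_superset[of ?A "p + q" \<sigma>]
    by (simp add: lookup_add single_add algebra_simps sum.distrib)
qed

lemma additive_psub: "additive (psub \<sigma>)"
  by standard (rule psub_add)

lemma psub_single: "psub \<sigma> (sng t c) = sng 0 c * msub \<sigma> t"
  by (cases "c = 0") (simp_all add: psub_def)

lemma psub_mult: "psub \<sigma> (p * q) = psub \<sigma> p * psub \<sigma> q"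
proof -
  interpret additive "psub \<sigma>" by (rule additive_psub)
  have "p * q = (\<Sum>s\<in>mkeys p. \<Sum>t\<in>mkeys q. sng (s + t) (lk p s * lk q t))"
    by (subst (1) poly_sum_monomials[of p], subst (1) poly_sum_monomials[of q])
      (simp add: sum_product mult_single)
  then have "psub \<sigma> (p * q) = (\<Sum>s\<in>mkeys p. \<Sum>t\<in>mkeys q. psub \<sigma> (sng (s + t) (lk p s * lk q t)))"
    by (simp add: sum)
  also have "\<dots> = (\<Sum>s\<in>mkeys p. \<Sum>t\<in>mkeys q. (sng 0 (lk p s) * msub \<sigma> s) * (sng 0 (lk q t) * msub \<sigma> t))"
  proof (intro sum.cong refl)
    fix s t
    have "sng 0 (lk p s * lk q t) = sng 0 (lk p s) * sng (0 :: nat \<Rightarrow>\<^sub>0 nat) (lk q t)" by (simp add: mult_single)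
    then show "psub \<sigma> (sng (s + t) (lk p s * lk q t)) = (sng 0 (lk p s) * msub \<sigma> s) * (sng 0 (lk q t) * msub \<sigma> t)"
      by (simp add: psub_single msub_add algebra_simps)
  qed
  also have "\<dots> = psub \<sigma> p * psub \<sigma> q" by (simp add: psub_def sum_product)
  finally show ?thesis .
qed

lemma psub_const: "psub \<sigma> (sng 0 c) = sng 0 c"
  by (simp add: psub_single msub_def)

lemma psub_Xv: "psub \<sigma> (Xv i) = \<sigma> i"
  by (simp add: Xv_def psub_single msub_def)

lemma psub_power: "psub \<sigma> (p ^ n) = psub \<sigma> p ^ n"
  using psub_const[of \<sigma> 1] by (induction n) (simp_all add: psub_mult)

lemma psub_prod: "psub \<sigma> (\<Prod>i\<in>A. f i) = (\<Prod>i\<in>A. psub \<sigma> (f i))"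
  using psub_const[of \<sigma> 1] by (induction A rule: infinite_finite_induct) (simp_all add: psub_mult)

lemma psub_psub: "psub \<sigma> (psub \<tau> p) = psub (\<lambda>i. psub \<sigma> (\<tau> i)) p"
proof -
  interpret additive "psub \<sigma>" by (rule additive_psub)
  show ?thesis
    unfolding psub_def[of \<tau>] psub_def[of "\<lambda>i. psub \<sigma> (\<tau> i)"] sum
    by (intro sum.cong refl) (simp add: psub_mult psub_const msub_def psub_prod psub_power)
qed

lemma Xv_power: "Xv i ^ n = sng (sng i n) 1"
  by (induction n) (simp_all add: Xv_def mult_single single_add[symmetric])

lemma sum_single_lookup: "(\<Sum>i\<in>mkeys t. sng i (lk t i)) = (t :: nat \<Rightarrow>\<^sub>0 nat)"
  by (rule poly_mapping_eqI) (auto simp: lookup_sum lookup_single when_def in_keys_iff)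

lemma msub_Xv: "msub Xv t = sng t (1 :: 'k::comm_ring_1)"
proof -
  have "(\<Prod>i\<in>A. sng (sng i (lk t i)) (1 :: 'k)) = sng (\<Sum>i\<in>A. sng i (lk t i)) 1" if "finite A" for A
    using that by (induction A) (simp_all add: mult_single)
  then show ?thesis by (simp add: msub_def Xv_power sum_single_lookup)
qed

lemma psub_id: "psub Xv p = p"
  using poly_sum_monomials[of p] by (simp add: psub_def msub_Xv mult_single)

lemma psub_forms:
  assumes "\<And>i. i \<in> V \<Longrightarrow> \<sigma> i \<in> forms W {1}" "p \<in> forms V {m}"
  shows "psub \<sigma> p \<in> forms W {m}"
  unfolding psub_def
proof (intro subgrp_sum subgrp_forms)
  fix t assume "t \<in> mkeys p"
  then have t: "mkeys t \<subseteq> V" "int (mon_degree t) = m" using assms(2) by (auto simp: forms_def)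
  have "(\<Prod>i\<in>A. \<sigma> i ^ lk t i) \<in> forms W {int (\<Sum>i\<in>A. lk t i)}" if "finite A" "A \<subseteq> V" for A
    using that
  proof (induction A)
    case empty show ?case using forms_const[of "{0}" 1 W] by simp
  next
    case (insert i A)
    have "\<sigma> i ^ lk t i \<in> forms W {int (lk t i)}" using forms_power[OF assms(1), of i "lk t i"] insert by simp
    from forms_mult1[OF this insert.IH] insert show ?case by simp
  qed
  from this[of "mkeys t"] t have "msub \<sigma> t \<in> forms W {m}" by (simp add: msub_def mon_degree_def)
  from forms_mult1[OF forms_const[of "{0}" "lk p t" W] this] show "sng 0 (lk p t) * msub \<sigma> t \<in> forms W {m}" by simp
qed

text \<open>Automorphisms act on the polynomial ring in all variables and respect the grading of
  \<open>k[x_0, ..., x_N]\<close>. The inverse is part of the data, so that transport works both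
  ways.\<close>

definition gaut :: "nat \<Rightarrow> ('k::comm_ring_1 mpoly \<Rightarrow> 'k mpoly) \<Rightarrow> ('k mpoly \<Rightarrow> 'k mpoly) \<Rightarrow> bool" where
  "gaut N \<phi> \<psi> \<longleftrightarrow> (\<forall>p q. \<phi> (p + q) = \<phi> p + \<phi> q) \<and> (\<forall>p q. \<phi> (p * q) = \<phi> p * \<phi> q) \<and> (\<forall>c. \<phi> (sng 0 c) = sng 0 c) \<and>
     (\<forall>m. \<forall>p\<in>fP N m. \<phi> p \<in> fP N m) \<and> (\<forall>m. \<forall>p\<in>fP N m. \<psi> p \<in> fP N m) \<and> (\<forall>p. \<psi> (\<phi> p) = p) \<and> (\<forall>p. \<phi> (\<psi> p) = p)"

lemma gaut_sym: assumes "gaut N \<phi> \<psi>" shows "gaut N \<psi> \<phi>"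
proof -
  have inj: "\<phi> a = \<phi> b \<Longrightarrow> a = b" for a b using assms unfolding gaut_def by metis
  show ?thesis unfolding gaut_def
  proof (intro conjI allI ballI)
    show "\<psi> (p + q) = \<psi> p + \<psi> q" for p q by (rule inj) (use assms in \<open>simp add: gaut_def\<close>)
    show "\<psi> (p * q) = \<psi> p * \<psi> q" for p q by (rule inj) (use assms in \<open>simp add: gaut_def\<close>)
    show "\<psi> (sng 0 c) = sng 0 c" for c by (rule inj) (use assms in \<open>simp add: gaut_def\<close>)
  qed (use assms in \<open>auto simp: gaut_def\<close>)
qed

lemma gaut_id: "gaut N id id" by (simp add: gaut_def)

lemma gaut_comp: "gaut N \<phi> \<psi> \<Longrightarrow> gaut N \<phi>' \<psi>' \<Longrightarrow> gaut N (\<phi>' \<circ> \<phi>) (\<psi> \<circ> \<psi>')"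
  by (simp add: gaut_def)

locale graut =
  fixes N :: nat and \<phi> \<psi> :: "'k::field mpoly \<Rightarrow> 'k mpoly"
  assumes ga: "gaut N \<phi> \<psi>"
begin

lemma add: "\<phi> (p + q) = \<phi> p + \<phi> q" and mult: "\<phi> (p * q) = \<phi> p * \<phi> q" and const: "\<phi> (sng 0 c) = sng 0 c"
  and forms: "p \<in> fP N m \<Longrightarrow> \<phi> p \<in> fP N m" and forms': "p \<in> fP N m \<Longrightarrow> \<psi> p \<in> fP N m"
  and inv: "\<psi> (\<phi> p) = p" "\<phi> (\<psi> p) = p"
  using ga by (auto simp: gaut_def)

sublocale additive \<phi> by standard (rule add)

lemma one: "\<phi> 1 = 1" using const[of 1] by simp

lemma formsU: "p \<in> forms {..N} UNIV \<Longrightarrow> \<phi> p \<in> forms {..N} UNIV"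
proof -
  assume p: "p \<in> forms {..N} UNIV"
  have "\<phi> p = (\<Sum>m\<in>degs p. \<phi> (cmp m p))" by (subst sum_cmp[OF finite_degs order_refl, of p]) (rule sum)
  also have "\<dots> \<in> forms {..N} UNIV" by (intro subgrp_sum subgrp_forms forms_UNIV[OF forms[OF cmp_forms[OF p]]])
  finally show ?thesis .
qed

lemma cmp: assumes p: "p \<in> forms {..N} UNIV" shows "cmp m (\<phi> p) = \<phi> (cmp m p)"
proof -
  have "\<phi> p = (\<Sum>n\<in>degs p. \<phi> (cmp n p))" by (subst sum_cmp[OF finite_degs order_refl, of p]) (rule sum)
  then have "cmp m (\<phi> p) = (\<Sum>n\<in>degs p. cmp m (\<phi> (cmp n p)))" by (simp add: cmp.sum)
  also have "\<dots> = (\<Sum>n\<in>degs p. if n = m then \<phi> (cmp m p) else 0)"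
    by (intro sum.cong refl) (use cmp_forms_if[OF forms[OF cmp_forms[OF p]], of m] in auto)
  also have "\<dots> = \<phi> (cmp m p)" by (simp add: finite_degs cmp_notin_degs zero)
  finally show ?thesis .
qed

lemma const_coeff: assumes p: "p \<in> forms {..N} UNIV" shows "const_coeff (\<phi> p) = const_coeff p"
proof -
  have c: "const_coeff (cmp 0 q) = const_coeff q" for q :: "'k mpoly" by (simp add: const_coeff_def cmp_def lookup_pres)
  have "cmp 0 p = sng 0 (const_coeff p)" using forms_0_const[OF cmp_forms[OF p]] by (simp add: c)
  then have "cmp 0 (\<phi> p) = sng 0 (const_coeff p)" by (simp add: cmp[OF p] const)
  then show ?thesis using c[of "\<phi> p"] by simp
qed

lemma gideal: assumes "gideal N I" shows "gideal N (\<phi> ` I)"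
  unfolding gideal_def poly_ring_forms
proof (intro conjI ballI allI)
  note I = gidealD[OF assms]
  show "\<phi> ` I \<subseteq> forms {..N} UNIV" using I(1) formsU by blast
  show "subgrp (\<phi> ` I)" unfolding subgrp_def
    using subgrpD[OF I(2)] by (auto simp: diff[symmetric]) (metis image_eqI zero)
  fix f assume "f \<in> \<phi> ` I"
  then obtain g where g: "g \<in> I" "f = \<phi> g" by blast
  show "cmp m f \<in> \<phi> ` I" for m using I(4)[OF g(1), of m] cmp[OF I(1)[OF g(1)], of m] g(2) by auto
  fix a :: "'k mpoly" assume a: "a \<in> forms {..N} UNIV"
  interpret s: graut N \<psi> \<phi> by standard (rule gaut_sym[OF ga])
  have "a * f = \<phi> (\<psi> a * g)" by (simp add: mult inv g(2))
  then show "a * f \<in> \<phi> ` I" using I(3)[OF s.formsU[OF a] g(1)] by blast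
qed

lemma linear: "Vector_Spaces.linear poly_scale poly_scale \<phi>"
  by (rule linearI[OF vector_space_poly_scale vector_space_poly_scale]) (auto simp: add poly_scale_def mult const)

lemma hf: assumes gI: "gideal N I" shows "hf N (\<phi> ` I) = hf N I"
proof
  fix m
  have "fI N (\<phi> ` I) m = \<phi> ` fI N I m"
  proof (intro equalityI subsetI)
    fix f assume "f \<in> fI N (\<phi> ` I) m"
    then obtain g where g: "g \<in> I" "f = \<phi> g" "f \<in> fP N m" by blast
    have "g \<in> fP N m" using forms'[OF g(3)] by (simp add: g(2) inv)
    with g show "f \<in> \<phi> ` fI N I m" by blast
  qed (use forms in auto)
  moreover have "ps.dim (\<phi> ` fI N I m) = ps.dim (fI N I m)"
    by (rule pp.dim_injective_image[OF linear fd_fI[OF gI]]) (metis inv(1) zero)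
  ultimately show "hf N (\<phi> ` I) m = hf N I m" by (simp add: hf_def)
qed

definition vphi :: "(nat \<Rightarrow> 'k mpoly) \<Rightarrow> nat \<Rightarrow> 'k mpoly" where "vphi c l = \<phi> (c l)"

lemma vphi_free: "c \<in> free_module N r \<Longrightarrow> vphi c \<in> free_module N r"
  by (auto simp: free_module_def vphi_def zero poly_ring_forms intro: formsU)

lemma vphi_mat_vec: "vphi (mat_vec r s A c) = mat_vec r s (\<lambda>l m. \<phi> (A l m)) (vphi c)"
  by (auto simp: vphi_def mat_vec_def fun_eq_iff sum mult zero)

lemma vphi_surj: assumes "c \<in> free_module N r" obtains c' where "c' \<in> free_module N r" "c = vphi c'"
proof
  interpret s: graut N \<psi> \<phi> by standard (rule gaut_sym[OF ga])
  show "s.vphi c \<in> free_module N r" by (rule s.vphi_free[OF assms])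
  show "c = vphi (s.vphi c)" by (simp add: vphi_def s.vphi_def inv fun_eq_iff)
qed

lemma resolution:
  assumes "graded_free_resolution N I F"
  shows "graded_free_resolution N (\<phi> ` I) (F\<lparr>diff := (\<lambda>i l m. \<phi> (diff F i l m)), aug := (\<lambda>l. \<phi> (aug F l))\<rparr>)"
proof -
  have inj: "\<phi> a \<in> \<phi> ` I \<longleftrightarrow> a \<in> I" for a by (metis imageE image_eqI inv(1))
  have z: "vphi c = 0 \<longleftrightarrow> c = 0" for c by (auto simp: vphi_def fun_eq_iff zero) (metis inv(1) zero)
  have hom: "p \<in> poly_ring N \<and> homogeneous p m \<longleftrightarrow> p \<in> fP N m" for p :: "'k mpoly" and m using forms_homogeneous by blast
  have hom': "\<phi> p \<in> poly_ring N \<and> homogeneous (\<phi> p) m" if "p \<in> poly_ring N \<and> homogeneous p m" for p m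
    using that forms unfolding hom by blast
  have au: "(\<Sum>l<r. vphi c l * \<phi> (a l)) = \<phi> (\<Sum>l<r. c l * a l)" for r a and c :: "nat \<Rightarrow> 'k mpoly"
    by (simp add: vphi_def sum mult)
  have tr: "{c \<in> free_module N r. P' c} = mat_vec r s (\<lambda>l m. \<phi> (A l m)) ` free_module N s"
    if eq: "{c \<in> free_module N r. P c} = mat_vec r s A ` free_module N s" and PP: "\<And>c. P' (vphi c) \<longleftrightarrow> P c"
    for r s A P P'
  proof (intro equalityI subsetI)
    fix c assume c: "c \<in> {c \<in> free_module N r. P' c}"
    then obtain c' where c': "c' \<in> free_module N r" "c = vphi c'" using vphi_surj by blast
    with c PP have "c' \<in> {c \<in> free_module N r. P c}" by auto
    then obtain d where "d \<in> free_module N s" "c' = mat_vec r s A d" unfolding eq by blast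
    then show "c \<in> mat_vec r s (\<lambda>l m. \<phi> (A l m)) ` free_module N s"
      unfolding c'(2) using vphi_free by (auto simp: vphi_mat_vec)
  next
    fix c assume "c \<in> mat_vec r s (\<lambda>l m. \<phi> (A l m)) ` free_module N s"
    then obtain d where d: "d \<in> free_module N s" "c = mat_vec r s (\<lambda>l m. \<phi> (A l m)) d" by blast
    from vphi_surj[OF d(1)] obtain d' where d': "d' \<in> free_module N s" "d = vphi d'" by blast
    have c: "c = vphi (mat_vec r s A d')" unfolding vphi_mat_vec d(2) d'(2) ..
    have "mat_vec r s A d' \<in> {c \<in> free_module N r. P c}" unfolding eq using d'(1) by blast
    then show "c \<in> {c \<in> free_module N r. P' c}" unfolding c using PP vphi_free by auto
  qed
  note R = assms[unfolded graded_free_resolution_def]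
  note R1 = R[THEN conjunct1]
    and R2 = R[THEN conjunct2, THEN conjunct1]
    and R3 = R[THEN conjunct2, THEN conjunct2, THEN conjunct1]
    and R4 = R[THEN conjunct2, THEN conjunct2, THEN conjunct2, THEN conjunct1]
    and R5 = R[THEN conjunct2, THEN conjunct2, THEN conjunct2, THEN conjunct2]
  define F' where "F' = F\<lparr>diff := (\<lambda>i l m. \<phi> (diff F i l m)), aug := (\<lambda>l. \<phi> (aug F l))\<rparr>"
  have sel: "rnk F' = rnk F" "shift F' = shift F" "diff F' = (\<lambda>i l m. \<phi> (diff F i l m))" "aug F' = (\<lambda>l. \<phi> (aug F l))"
    by (simp_all add: F'_def)
  show ?thesis
    unfolding F'_def[symmetric] graded_free_resolution_def sel
  proof (intro conjI allI impI ballI)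
    fix l :: nat assume "l < rnk F 0"
    with R1 have "aug F l \<in> poly_ring N \<and> homogeneous (aug F l) (shift F 0 l)" by simp
    from hom'[OF this] show "\<phi> (aug F l) \<in> poly_ring N" "homogeneous (\<phi> (aug F l)) (shift F 0 l)" by blast+
  next
    fix i l m assume "l < rnk F i" "m < rnk F (Suc i)"
    with R2 have "diff F i l m \<in> poly_ring N \<and> homogeneous (diff F i l m) (shift F (Suc i) m - shift F i l)" by simp
    from hom'[OF this] show "\<phi> (diff F i l m) \<in> poly_ring N" "homogeneous (\<phi> (diff F i l m)) (shift F (Suc i) m - shift F i l)" by simp_all
  next
    fix f :: "'k mpoly" assume f: "f \<in> poly_ring N"
    interpret s: graut N \<psi> \<phi> by standard (rule gaut_sym[OF ga])
    have "\<psi> f \<in> poly_ring N" using s.formsU f by (simp add: poly_ring_forms)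
    with R3 obtain c where c: "c\<in>free_module N (rnk F 0)" "\<psi> f - (\<Sum>l<rnk F 0. c l * aug F l) \<in> I" by blast
    have "f - (\<Sum>l<rnk F 0. vphi c l * \<phi> (aug F l)) = \<phi> (\<psi> f - (\<Sum>l<rnk F 0. c l * aug F l))"
      unfolding au diff inv ..
    with c vphi_free show "\<exists>c\<in>free_module N (rnk F 0). f - (\<Sum>l<rnk F 0. c l * \<phi> (aug F l)) \<in> \<phi> ` I" by blast
  next
    show "{c \<in> free_module N (rnk F 0). (\<Sum>l<rnk F 0. c l * \<phi> (aug F l)) \<in> \<phi> ` I}
      = mat_vec (rnk F 0) (rnk F 1) (\<lambda>l m. \<phi> (diff F 0 l m)) ` free_module N (rnk F 1)"
      by (rule tr[OF R4]) (simp add: au inj)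
    show "{c \<in> free_module N (rnk F (Suc i)). mat_vec (rnk F i) (rnk F (Suc i)) (\<lambda>l m. \<phi> (diff F i l m)) c = 0}
      = mat_vec (rnk F (Suc i)) (rnk F (Suc (Suc i))) (\<lambda>l m. \<phi> (diff F (Suc i) l m))
          ` free_module N (rnk F (Suc (Suc i)))" for i
      by (rule tr[OF R5[THEN spec]]) (simp only: vphi_mat_vec[symmetric] z)
  qed
qed

text \<open>An automorphism need not commute with multiplication by the individual variables, so the
  two Koszul complexes are not compared directly. The resolution is transported instead: ranks,
  degrees and constant coefficients of the matrices stay the same, and the complex tensored with
  \<open>k\<close> is literally unchanged.\<close>

lemma kz: assumes gI: "gideal N I" shows "kz N (\<phi> ` I) (Suc i) m \<longleftrightarrow> kz N I (Suc i) m"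
proof -
  obtain F where F: "graded_free_resolution N I F" using graded_free_resolution_exists[OF gI] by blast
  define F' where "F' = F\<lparr>diff := (\<lambda>i l m. \<phi> (diff F i l m)), aug := (\<lambda>l. \<phi> (aug F l))\<rparr>"
  interpret g: gres N I F by standard (rule gI, rule F)
  interpret g': gres N "\<phi> ` I" F' by standard (rule gideal[OF gI], unfold F'_def, rule resolution[OF F])
  have piece: "tensor_piece F' = tensor_piece F" by (auto simp: fun_eq_iff tensor_piece_def F'_def)
  have "tensor_diff F' i v = tensor_diff F i v" for i v
  proof -
    have "const_coeff (\<phi> (diff F i l m)) = const_coeff (diff F i l m)" if "l < rnk F i" "m < rnk F (Suc i)" for l m
      by (rule const_coeff[OF forms_UNIV[OF g.diff_in[OF that]]])
    then show ?thesis by (auto simp: fun_eq_iff tensor_diff_def F'_def mat_vec_def intro!: sum.cong)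
  qed
  then have "tensor_diff F' = tensor_diff F" by (simp add: fun_eq_iff)
  with piece show ?thesis unfolding g.kz_tensor g'.kz_tensor
    by (simp add: tensor_cycles_def[abs_def] tensor_boundaries_def[abs_def])
qed

lemma ideal_plus: "ideal_plus N (\<phi> ` I) (map \<phi> fs) = \<phi> ` ideal_plus N I fs"
proof (intro equalityI subsetI)
  interpret s: graut N \<psi> \<phi> by standard (rule gaut_sym[OF ga])
  fix h assume "h \<in> ideal_plus N (\<phi> ` I) (map \<phi> fs)"
  then obtain g c where h: "h = \<phi> g + (\<Sum>i<length fs. c i * \<phi> (fs ! i))" "g \<in> I" "\<forall>i. c i \<in> poly_ring N"
    unfolding ideal_plus_def by auto
  have "h = \<phi> (g + (\<Sum>i<length fs. \<psi> (c i) * fs ! i))" unfolding h(1) by (simp add: add sum mult inv)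
  moreover have "\<forall>i. \<psi> (c i) \<in> poly_ring N" using h(3) s.formsU by (simp add: poly_ring_forms)
  ultimately have "h = \<phi> (g + (\<Sum>i<length fs. \<psi> (c i) * fs ! i))" "g + (\<Sum>i<length fs. \<psi> (c i) * fs ! i) \<in> ideal_plus N I fs"
    using h(2) unfolding ideal_plus_def by (blast, intro CollectI exI[of _ g] exI[of _ "\<lambda>i. \<psi> (c i)"] conjI) simp_all
  then show "h \<in> \<phi> ` ideal_plus N I fs" by (rule image_eqI)
next
  fix h assume "h \<in> \<phi> ` ideal_plus N I fs"
  then obtain g c where h: "h = \<phi> (g + (\<Sum>i<length fs. c i * fs ! i))" "g \<in> I" "\<forall>i. c i \<in> poly_ring N"
    unfolding ideal_plus_def by blast
  have "h = \<phi> g + (\<Sum>i<length (map \<phi> fs). \<phi> (c i) * map \<phi> fs ! i)" unfolding h(1) by (simp add: add sum mult)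
  moreover have "\<forall>i. \<phi> (c i) \<in> poly_ring N" using h(3) formsU by (simp add: poly_ring_forms)
  ultimately show "h \<in> ideal_plus N (\<phi> ` I) (map \<phi> fs)"
    using h(2) unfolding ideal_plus_def by (intro CollectI exI[of _ "\<phi> g"] exI[of _ "\<lambda>i. \<phi> (c i)"] conjI) simp_all
qed

lemma poly_ring_image: "\<phi> ` poly_ring N = poly_ring N"
proof -
  interpret s: graut N \<psi> \<phi> by standard (rule gaut_sym[OF ga])
  show ?thesis using formsU s.formsU inv unfolding poly_ring_forms by (metis image_eqI subsetI subset_antisym image_subsetI)
qed

lemma regular_sequence:
  assumes "regular_sequence N I fs" shows "regular_sequence N (\<phi> ` I) (map \<phi> fs)"
  unfolding regular_sequence_def
proof (intro conjI ballI allI impI)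
  have inj: "\<phi> a \<in> \<phi> ` A \<longleftrightarrow> a \<in> A" for a A by (metis imageE image_eqI inv(1))
  note R = assms[unfolded regular_sequence_def]
  fix f assume "f \<in> set (map \<phi> fs)"
  then obtain g where "g \<in> set fs" "f = \<phi> g" by auto
  with R formsU const_coeff show "f \<in> poly_ring N" "const_coeff f = 0" by (auto simp: poly_ring_forms)
next
  have inj: "\<phi> a \<in> \<phi> ` A \<longleftrightarrow> a \<in> A" for a A by (metis imageE image_eqI inv(1))
  note R = assms[unfolded regular_sequence_def]
  fix k g assume k: "k < length (map \<phi> fs)" and g: "g \<in> poly_ring N" and m: "map \<phi> fs ! k * g \<in> ideal_plus N (\<phi> ` I) (take k (map \<phi> fs))"
  from g obtain g' where g': "g' \<in> poly_ring N" "g = \<phi> g'" using poly_ring_image by blast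
  have "\<phi> (fs ! k * g') \<in> \<phi> ` ideal_plus N I (take k fs)"
    using m k unfolding take_map ideal_plus g'(2) by (simp add: mult)
  then have "fs ! k * g' \<in> ideal_plus N I (take k fs)" unfolding inj .
  with R g'(1) k have "g' \<in> ideal_plus N I (take k fs)" by auto
  then show "g \<in> ideal_plus N (\<phi> ` I) (take k (map \<phi> fs))" unfolding take_map ideal_plus g'(2) inj .
next
  have injA: "\<phi> ` A = \<phi> ` B \<Longrightarrow> A = B" for A B by (metis (no_types) inj_image_eq_iff injI inv(1))
  show "ideal_plus N (\<phi> ` I) (map \<phi> fs) \<noteq> poly_ring N"
    unfolding ideal_plus using injA[of "ideal_plus N I fs" "poly_ring N"] assms poly_ring_image by (auto simp: regular_sequence_def)
qed

end

lemma digits_unique: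
  assumes "\<And>i. i < k \<Longrightarrow> f i < B" "\<And>i. i < k \<Longrightarrow> g i < B" "(\<Sum>i<k. f i * B ^ i) = (\<Sum>i<k. g i * B ^ i)" "i < k"
  shows "f i = (g i :: nat)"
  using assms
proof (induction k arbitrary: f g i)
  case (Suc k)
  have e: "(\<Sum>i<Suc k. h i * B ^ i) = h 0 + B * (\<Sum>i<k. h (Suc i) * B ^ i)" for h :: "nat \<Rightarrow> nat"
    by (subst sum.lessThan_Suc_shift) (simp add: sum_distrib_left algebra_simps)
  have eq: "f 0 + B * (\<Sum>i<k. f (Suc i) * B ^ i) = g 0 + B * (\<Sum>i<k. g (Suc i) * B ^ i)"
    using Suc.prems(3) unfolding e .
  have f0: "f 0 < B" and g0: "g 0 < B" using Suc.prems(1,2)[of 0] by auto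
  have "f 0 = (f 0 + B * (\<Sum>i<k. f (Suc i) * B ^ i)) mod B" using f0 by simp
  also have "\<dots> = g 0" unfolding eq using g0 by simp
  finally have 0: "f 0 = g 0" .
  with eq f0 have s: "(\<Sum>i<k. f (Suc i) * B ^ i) = (\<Sum>i<k. g (Suc i) * B ^ i)" by simp
  show ?case
  proof (cases i)
    case (Suc j)
    have "f (Suc j) = g (Suc j)"
      by (rule Suc.IH[of "\<lambda>i. f (Suc i)" "\<lambda>i. g (Suc i)"]) (use Suc.prems Suc s in auto)
    with Suc show ?thesis by simp
  qed (simp add: 0)
qed simp

text \<open>Kronecker substitution: the point \<open>(s, s\<^sup>B, s\<^bsup>B\<^sup>2\<^esup>, \<dots>)\<close> separates the monomials of \<open>f\<close>.\<close>

lemma nonvanishing_point: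
  fixes f :: "'k::field mpoly"
  assumes inf: "infinite (UNIV :: 'k set)" and f: "f \<in> forms {..<k} {m}" "f \<noteq> 0"
  obtains a :: "nat \<Rightarrow> 'k" where "\<And>i. a i \<noteq> 0" "(\<Sum>t\<in>mkeys f. lk f t * (\<Prod>i\<in>mkeys t. a i ^ lk t i)) \<noteq> 0"
proof -
  \<comment> \<open>\<open>B\<close> exceeds every exponent in \<open>f\<close>, so that
    \<open>w\<close> reads exponent vectors as numerals in base \<open>B\<close>.\<close>
  define B where "B = Suc (nat m)"
  define w where "w = (\<lambda>t :: nat \<Rightarrow>\<^sub>0 nat. \<Sum>i\<in>mkeys t. lk t i * B ^ i)"
  have k: "mkeys t \<subseteq> {..<k}" "\<And>i. lk t i < B" if "t \<in> mkeys f" for t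
  proof -
    from that f have t: "mkeys t \<subseteq> {..<k}" "int (mon_degree t) = m" by (auto simp: forms_def)
    show "mkeys t \<subseteq> {..<k}" by (rule t)
    have "lk t i \<le> mon_degree t" for i
      by (cases "i \<in> mkeys t") (auto simp: mon_degree_def in_keys_iff intro: member_le_sum)
    with t(2) show "lk t i < B" for i by (metis B_def less_Suc_eq_le nat_int)
  qed
  have wk: "w t = (\<Sum>i<k. lk t i * B ^ i)" if "t \<in> mkeys f" for t
    unfolding w_def by (rule sum.mono_neutral_left) (use k[OF that] in \<open>auto simp: in_keys_iff\<close>)
  have inj: "inj_on w (mkeys f)"
  proof (rule inj_onI, rule poly_mapping_eqI)
    fix s t i assume st: "s \<in> mkeys f" "t \<in> mkeys f" "w s = w t"
    show "lk s i = lk t i"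
    proof (cases "i < k")
      case True
      show ?thesis by (rule digits_unique[OF _ _ _ True, of "lk s" B "lk t"]) (use st k wk in auto)
    next
      case False
      then have "i \<notin> mkeys s" "i \<notin> mkeys t" using k st by auto
      then show ?thesis by (simp add: in_keys_iff)
    qed
  qed
  define P where "P = (\<Sum>t\<in>mkeys f. monom (lk f t) (w t))"
  obtain t0 where t0: "t0 \<in> mkeys f" using f(2) mkeys_empty by blast
  have "coeff P (w t0) = (\<Sum>t\<in>mkeys f. if t = t0 then lk f t else 0)"
    unfolding P_def coeff_sum by (intro sum.cong refl) (use inj t0 in \<open>auto simp: inj_on_def\<close>)
  also have "\<dots> \<noteq> 0" using t0 by (simp add: in_keys_iff)
  finally have "P \<noteq> 0" by auto
  \<comment> \<open>The factor \<open>[:0, 1:]\<close> excludes \<open>s = 0\<close> and thereby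
    keeps every coordinate nonzero.\<close>
  then have "finite {s. poly ([:0, 1:] * P) s = 0}" by (intro poly_roots_finite) simp
  then obtain s where s: "s \<notin> {s. poly ([:0, 1:] * P) s = 0}" using inf by (metis finite_subset subset_UNIV subsetI UNIV_eq_I)
  show ?thesis
  proof (rule that[of "\<lambda>i. s ^ (B ^ i)"])
    show "s ^ (B ^ i) \<noteq> 0" for i using s by simp
    have "(\<Prod>i\<in>mkeys t. (s ^ (B ^ i)) ^ lk t i) = s ^ w t" for t
      unfolding w_def by (simp add: power_sum power_mult[symmetric] mult.commute)
    then have "(\<Sum>t\<in>mkeys f. lk f t * (\<Prod>i\<in>mkeys t. (s ^ (B ^ i)) ^ lk t i)) = poly P s"
      by (simp add: P_def poly_sum poly_monom)
    then show "(\<Sum>t\<in>mkeys f. lk f t * (\<Prod>i\<in>mkeys t. (s ^ (B ^ i)) ^ lk t i)) \<noteq> 0" using s by simp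
  qed
qed

section \<open>Noether normalization\<close>

text \<open>Says that \<open>R/I\<close> is finite over the first \<open>k\<close> variables. One
  positive degree is enough, since the condition propagates upwards, see
  \<open>sop_cov\<close>.\<close>

definition sop :: "nat \<Rightarrow> nat \<Rightarrow> 'k::field mpoly set \<Rightarrow> bool" where
  "sop N k I \<longleftrightarrow> (\<exists>t\<ge>1. \<forall>p\<in>fP N (int t). \<exists>q\<in>I. p - q \<in> monid N k {int t})"

lemma uideal_mult: "uideal N J \<Longrightarrow> a \<in> forms {..N} UNIV \<Longrightarrow> f \<in> J \<Longrightarrow> a * f \<in> J"
  by (simp add: uideal_def)

lemma power_diff_in:
  assumes J: "uideal N J" and x: "x \<in> forms {..N} UNIV" "y \<in> forms {..N} UNIV" "x - y \<in> J"
  shows "x ^ n \<in> forms {..N} UNIV \<and> y ^ n \<in> forms {..N} UNIV \<and> x ^ n - y ^ n \<in> J"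
proof (induction n)
  case 0
  have "(1 :: 'a mpoly) \<in> forms {..N} UNIV" using const_U[of 1] by simp
  then show ?case using J by (simp add: uideal_def subgrpD)
next
  case (Suc n)
  have "x ^ Suc n - y ^ Suc n = x * (x ^ n - y ^ n) + y ^ n * (x - y)" by (simp add: algebra_simps)
  moreover have "x * (x ^ n - y ^ n) \<in> J" "y ^ n * (x - y) \<in> J" using J Suc x by (auto simp: uideal_def)
  ultimately show ?case using J Suc x forms_U_mult by (auto simp: uideal_def intro: subgrpD(4))
qed

lemma prod_diff_in:
  assumes J: "uideal N J" and "finite A"
    and x: "\<And>i. i \<in> A \<Longrightarrow> x i \<in> forms {..N} UNIV" "\<And>i. i \<in> A \<Longrightarrow> y i \<in> forms {..N} UNIV" "\<And>i. i \<in> A \<Longrightarrow> x i - y i \<in> J"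
  shows "prod x A \<in> forms {..N} UNIV \<and> prod y A \<in> forms {..N} UNIV \<and> prod x A - prod y A \<in> J"
  using assms(2) x
proof (induction A)
  case empty
  have "(1 :: 'a mpoly) \<in> forms {..N} UNIV" using const_U[of 1] by simp
  then show ?case using J by (simp add: uideal_def subgrpD)
next
  case (insert i A)
  then have IH: "prod x A \<in> forms {..N} UNIV" "prod y A \<in> forms {..N} UNIV" "prod x A - prod y A \<in> J" by auto
  have "prod x (insert i A) - prod y (insert i A) = x i * (prod x A - prod y A) + prod y A * (x i - y i)"
    using insert.hyps by (simp add: algebra_simps)
  moreover have "x i * (prod x A - prod y A) \<in> J" "prod y A * (x i - y i) \<in> J" using J IH insert.prems by (auto simp: uideal_def)
  ultimately have "prod x (insert i A) - prod y (insert i A) \<in> J" using J by (auto simp: uideal_def intro: subgrpD(4))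
  then show ?case using insert.hyps IH insert.prems by (auto intro: forms_U_mult)
qed

lemma psub_cong_mod:
  assumes J: "uideal N J" and s: "\<And>i. i \<in> V \<Longrightarrow> \<sigma> i \<in> forms {..N} UNIV" "\<And>i. i \<in> V \<Longrightarrow> \<tau> i \<in> forms {..N} UNIV" "\<And>i. i \<in> V \<Longrightarrow> \<sigma> i - \<tau> i \<in> J"
    and f: "f \<in> forms V D"
  shows "psub \<sigma> f - psub \<tau> f \<in> J"
proof -
  have "sng 0 (lk f t) * (msub \<sigma> t - msub \<tau> t) \<in> J" if "t \<in> mkeys f" for t
  proof -
    have V: "mkeys t \<subseteq> V" using that f by (auto simp: forms_def)
    have "msub \<sigma> t - msub \<tau> t \<in> J" unfolding msub_def
      using prod_diff_in[OF J, of "mkeys t" "\<lambda>i. \<sigma> i ^ lk t i" "\<lambda>i. \<tau> i ^ lk t i"] power_diff_in[OF J s(1) s(2) s(3)] V by auto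
    then show ?thesis by (rule uideal_mult[OF J const_U])
  qed
  then have "(\<Sum>t\<in>mkeys f. sng 0 (lk f t) * (msub \<sigma> t - msub \<tau> t)) \<in> J"
    using J by (auto simp: uideal_def intro!: subgrp_sum)
  then show ?thesis by (simp add: psub_def sum_subtractf right_diff_distrib)
qed

lemma uideal_monid: "uideal N (monid N k UNIV)"
  unfolding uideal_def
proof (intro conjI ballI)
  fix a f :: "'a mpoly" assume a: "a \<in> forms {..N} UNIV" and f: "f \<in> monid N k UNIV"
  have "\<exists>i<k. i \<in> mkeys t" if "t \<in> mkeys (a * f)" for t
  proof -
    from that keys_mult[of a f] obtain u v where "u \<in> mkeys a" "v \<in> mkeys f" "t = u + v" by blast
    with f show ?thesis by (auto simp: monid_def mkeys_add)
  qed
  with a f show "a * f \<in> monid N k UNIV" by (auto simp: monid_def intro: forms_U_mult)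
qed (auto simp: monid_def intro: subgrp_monid[unfolded monid_def])

lemma uideal_plus:
  fixes I J :: "'a::comm_ring_1 mpoly set"
  assumes "uideal N I" "uideal N J" shows "uideal N {q + j | q j. q \<in> I \<and> j \<in> J}"
proof -
  have I: "I \<subseteq> forms {..N} UNIV" "subgrp I" "\<And>a f. a \<in> forms {..N} UNIV \<Longrightarrow> f \<in> I \<Longrightarrow> a * f \<in> I"
    and J: "J \<subseteq> forms {..N} UNIV" "subgrp J" "\<And>a f. a \<in> forms {..N} UNIV \<Longrightarrow> f \<in> J \<Longrightarrow> a * f \<in> J"
    using assms by (auto simp: uideal_def)
  show ?thesis unfolding uideal_def subgrp_def
  proof (intro conjI ballI subsetI)
    fix x assume "x \<in> {q + j | q j. q \<in> I \<and> j \<in> J}" then show "x \<in> forms {..N} UNIV" using I(1) J(1) formsI(4) by blast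
  next
    show "0 \<in> {q + j | q j. q \<in> I \<and> j \<in> J}" using subgrpD(1)[OF I(2)] subgrpD(1)[OF J(2)] by force
  next
    fix a b assume "a \<in> {q + j | q j. q \<in> I \<and> j \<in> J}" "b \<in> {q + j | q j. q \<in> I \<and> j \<in> J}"
    then obtain q j q' j' where *: "a = q + j" "q \<in> I" "j \<in> J" "b = q' + j'" "q' \<in> I" "j' \<in> J" by blast
    then have "a - b = (q - q') + (j - j')" by simp
    with * subgrpD(2)[OF I(2)] subgrpD(2)[OF J(2)] show "a - b \<in> {q + j | q j. q \<in> I \<and> j \<in> J}" by blast
  next
    fix c a :: "'a mpoly" assume c: "c \<in> forms {..N} UNIV" and "a \<in> {q + j | q j. q \<in> I \<and> j \<in> J}"
    then obtain q j where *: "a = q + j" "q \<in> I" "j \<in> J" by blast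
    then have "c * a = c * q + c * j" by (simp add: algebra_simps)
    with * I(3)[OF c] J(3)[OF c] show "c * a \<in> {q + j | q j. q \<in> I \<and> j \<in> J}" by blast
  qed
qed

text \<open>If \<open>f \<noteq> 0\<close> in \<open>k[x\<^sub>0,\<dots>,x\<^sub>k]\<close> lies in \<open>I\<close>, a linear change of coordinates makes \<open>f\<close> monic in
  \<open>x\<^sub>k\<close>, so that \<open>x\<^sub>k\<close> becomes nilpotent modulo \<open>I + (x\<^sub>0,\<dots>,x\<^bsub>k-1\<^esub>)\<close>.\<close>

lemma noether_step:
  fixes I :: "'k::field mpoly set"
  assumes inf: "infinite (UNIV :: 'k set)" and gI: "gideal N I" and k: "k \<le> N" and sop: "sop N (Suc k) I"
    and f: "f \<in> I" "f \<in> forms {..<Suc k} {m}" "f \<noteq> 0" and I0: "\<And>g. g \<in> I \<Longrightarrow> g \<in> fP N 0 \<Longrightarrow> g = 0"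
  obtains \<phi> \<psi> where "gaut N \<phi> \<psi>" "sop N k (\<phi> ` I)"
proof -
  obtain a where a: "\<And>i. a i \<noteq> 0" and fa: "(\<Sum>t\<in>mkeys f. lk f t * (\<Prod>i\<in>mkeys t. a i ^ lk t i)) \<noteq> 0"
    using nonvanishing_point[OF inf f(2,3)] by blast
  define c where "c = (\<Sum>t\<in>mkeys f. lk f t * (\<Prod>i\<in>mkeys t. a i ^ lk t i))"
  let ?C = "\<lambda>c. sng (0 :: nat \<Rightarrow>\<^sub>0 nat) (c :: 'k)"
  \<comment> \<open>Modulo the variables below \<open>k\<close>, each \<open>x_i\<close> with
    \<open>i \<le> k\<close> becomes \<open>a_i x_k\<close>, so a form \<open>f\<close> of degree
    \<open>D\<close> in them becomes \<open>f(a) x_k^D\<close>. The substitution is invertible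
    because \<open>a_k\<close> is nonzero.\<close>
  define \<sigma> where "\<sigma> = (\<lambda>i. if i < k then Xv i + ?C (a i) * Xv k else if i = k then ?C (a k) * Xv k else Xv i)"
  define \<sigma>' where "\<sigma>' = (\<lambda>i. if i < k then Xv i - ?C (a i / a k) * Xv k else if i = k then ?C (1 / a k) * Xv k else Xv i)"
  define \<phi> where "\<phi> = psub \<sigma>"
  define \<psi> where "\<psi> = psub \<sigma>'"
  have CC: "?C x * (?C y * p) = ?C (x * y) * p" for x y p by (simp add: mult.assoc[symmetric] mult_single)
  have C1: "?C 1 * p = p" for p by simp
  have s1: "psub \<sigma> (\<sigma>' i) = Xv i" for i
    using a[of k] unfolding \<sigma>'_def
    by (auto simp: additive.diff[OF additive_psub] psub_mult psub_const psub_Xv \<sigma>_def CC C1 simp del: single_one)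
  have s2: "psub \<sigma>' (\<sigma> i) = Xv i" for i
    using a[of k] unfolding \<sigma>_def
    by (auto simp: psub_add psub_mult psub_const psub_Xv \<sigma>'_def CC C1 simp del: single_one)
  have CX: "?C x * Xv k \<in> fP N 1" for x
    using forms_mult1[OF forms_const[of "{0}" x "{..N}"] forms_Xv[of k "{..N}"]] k by simp
  have sf: "\<sigma> i \<in> fP N 1" "\<sigma>' i \<in> fP N 1" if "i \<in> {..N}" for i
    using that CX forms_Xv[of i "{..N}"] by (auto simp: \<sigma>_def \<sigma>'_def intro!: formsI(2,4))
  have ga: "gaut N \<phi> \<psi>"
    unfolding gaut_def
  proof (intro conjI allI ballI)
    show "\<psi> (\<phi> p) = p" for p unfolding \<phi>_def \<psi>_def psub_psub s2 by (rule psub_id)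
    show "\<phi> (\<psi> p) = p" for p unfolding \<phi>_def \<psi>_def psub_psub s1 by (rule psub_id)
    show "\<phi> p \<in> fP N n" "\<psi> p \<in> fP N n" if "p \<in> fP N n" for p n
      unfolding \<phi>_def \<psi>_def using psub_forms[OF _ that] sf by blast+
  qed (simp_all add: \<phi>_def psub_add psub_mult psub_const)
  interpret g: graut N \<phi> \<psi> by standard (rule ga)
  let ?J = "monid N k UNIV :: 'k mpoly set" and ?I = "\<phi> ` I"
  define K where "K = {q + j | q j. q \<in> ?I \<and> j \<in> ?J}"
  have gI': "gideal N ?I" by (rule g.gideal[OF gI])
  have uK: "uideal N K" unfolding K_def by (rule uideal_plus[OF gideal_uideal[OF gI'] uideal_monid])
  have Kg: "subgrp K" and Km: "\<And>a f. a \<in> forms {..N} UNIV \<Longrightarrow> f \<in> K \<Longrightarrow> a * f \<in> K" using uK by (auto simp: uideal_def)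
  have IK: "p \<in> K" if "p \<in> ?I" for p
  proof -
    have "p = p + 0" "0 \<in> ?J" using subgrpD(1)[OF subgrp_monid] by simp_all
    with that show ?thesis unfolding K_def by blast
  qed
  have JK: "p \<in> K" if "p \<in> ?J" for p
  proof -
    have "p = 0 + p" "0 \<in> ?I" using subgrpD(1)[OF gidealD(2)[OF gI']] by simp_all
    with that show ?thesis unfolding K_def by blast
  qed
  have XJ: "Xv i \<in> ?J" if "i < k" for i
    using that k forms_UNIV[OF forms_Xv[of i "{..N}"]] by (auto simp: monid_def) (auto simp: Xv_def split: if_splits)
  have m0: "m > 0"
  proof (rule ccontr)
    assume "\<not> m > 0"
    then have "m = 0" using forms_neg[OF f(2)] f(3) by (cases "m < 0") auto
    have "{..<Suc k} \<subseteq> {..N}" using k by auto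
    from subsetD[OF forms_mono[OF this order_refl] f(2)] have "f \<in> fP N 0" unfolding \<open>m = 0\<close> .
    with I0 f show False by blast
  qed
  define D where "D = nat m"
  have XD: "Xv k ^ D \<in> K"
  proof -
    define \<tau> where "\<tau> = (\<lambda>i. ?C (a i) * Xv k)"
    have "psub \<sigma> f - psub \<tau> f \<in> K"
    proof (rule psub_cong_mod[OF uK _ _ _ f(2)])
      fix i assume i: "i \<in> {..<Suc k}"
      show "\<sigma> i \<in> forms {..N} UNIV" using sf(1)[of i] i k by (intro forms_UNIV) auto
      show "\<tau> i \<in> forms {..N} UNIV" unfolding \<tau>_def by (rule forms_UNIV[OF CX])
      show "\<sigma> i - \<tau> i \<in> K"
        using i JK[OF XJ, of i] subgrpD(1)[OF Kg] by (cases "i = k") (auto simp: \<sigma>_def \<tau>_def)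
    qed
    moreover have "psub \<sigma> f \<in> K" using IK f(1) by (auto simp: \<phi>_def)
    ultimately have "psub \<sigma> f - (psub \<sigma> f - psub \<tau> f) \<in> K" by (rule subgrpD(2)[OF Kg, rotated])
    then have t: "psub \<tau> f \<in> K" by simp
    have ms: "msub \<tau> t = ?C (\<Prod>i\<in>mkeys t. a i ^ lk t i) * Xv k ^ D" if "t \<in> mkeys f" for t
    proof -
      have d: "mon_degree t = D" using f(2) that by (auto simp: forms_def D_def)
      have C_pow: "?C x ^ n = ?C (x ^ n)" for x n by (induction n) (simp_all add: mult_single)
      have C_prod: "(\<Prod>i\<in>A. ?C (h i)) = ?C (\<Prod>i\<in>A. h i)" for A and h :: "nat \<Rightarrow> 'k"
        by (induction A rule: infinite_finite_induct) (simp_all add: mult_single)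
      have "msub \<tau> t = (\<Prod>i\<in>mkeys t. ?C (a i ^ lk t i)) * (\<Prod>i\<in>mkeys t. Xv k ^ lk t i)"
        by (simp add: msub_def \<tau>_def power_mult_distrib prod.distrib C_pow)
      also have "(\<Prod>i\<in>mkeys t. Xv k ^ lk t i) = (Xv k ^ D :: 'k mpoly)" unfolding d[symmetric] mon_degree_def power_sum ..
      finally show ?thesis by (simp add: C_prod)
    qed
    have "psub \<tau> f = (\<Sum>t\<in>mkeys f. ?C (lk f t * (\<Prod>i\<in>mkeys t. a i ^ lk t i)) * Xv k ^ D)"
      unfolding psub_def by (intro sum.cong refl) (simp add: ms CC)
    also have "\<dots> = ?C c * Xv k ^ D"
      unfolding c_def sum_distrib_right[symmetric]
    proof (rule arg_cong[where f = "\<lambda>x. x * Xv k ^ D"])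
      show "(\<Sum>t\<in>mkeys f. ?C (h t)) = ?C (\<Sum>t\<in>mkeys f. h t)" for h
        by (rule poly_mapping_eqI) (simp add: lookup_sum lookup_single when_def)
    qed
    finally have "?C (1 / c) * (?C c * Xv k ^ D) \<in> K" using Km[OF const_U t, of "1 / c"] by simp
    then show ?thesis using fa by (simp add: CC c_def[symmetric])
  qed
  obtain t where t: "t \<ge> 1" "\<And>p. p \<in> fP N (int t) \<Longrightarrow> \<exists>q\<in>I. p - q \<in> monid N (Suc k) {int t}"
    using sop by (auto simp: sop_def)
  \<comment> \<open>Before the change of coordinates such a form lies in
    \<open>I + (x_0, ..., x_k)\<close>; afterwards all these variables are multiples of
    \<open>x_k\<close> modulo \<open>K\<close>.\<close>
  have A: "\<exists>r\<in>fP N (int (t + n) - 1). p - Xv k * r \<in> K" if "p \<in> fP N (int (t + n))" for p n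
    using that
  proof (induction n arbitrary: p)
    case 0
    then have "\<psi> p \<in> fP N (int t)" using g.forms' by simp
    from t(2)[OF this] obtain q where q: "q \<in> I" "\<psi> p - q \<in> monid N (Suc k) {int t}" by blast
    from monid_decomp[OF q(2)] k obtain z where z: "\<forall>j. z j \<in> fP N (int t - 1)" "\<psi> p - q = (\<Sum>j<Suc k. Xv j * z j)" by auto
    define r where "r = (\<Sum>j<Suc k. ?C (a j) * \<phi> (z j))"
    have Cz: "?C x * \<phi> (z j) \<in> fP N (int t - 1)" for x j
      using forms_mult1[OF forms_const[of "{0}" x "{..N}"] g.forms[OF z(1)[rule_format, of j]]] by simp
    have r: "r \<in> fP N (int t - 1)" unfolding r_def by (intro subgrp_sum subgrp_forms Cz)
    have "\<phi> (\<psi> p - q) = (\<Sum>j<Suc k. \<sigma> j * \<phi> (z j))"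
      unfolding z(2) g.sum g.mult by (simp add: \<phi>_def psub_Xv)
    then have "p - \<phi> q - Xv k * r = (\<Sum>j<Suc k. \<sigma> j * \<phi> (z j)) - (\<Sum>j<Suc k. (?C (a j) * Xv k) * \<phi> (z j))"
      by (simp add: g.diff g.inv r_def sum_distrib_left distrib_left mult_ac)
    also have "\<dots> = (\<Sum>j<Suc k. (\<sigma> j - ?C (a j) * Xv k) * \<phi> (z j))" by (simp add: sum_subtractf[symmetric] left_diff_distrib)
    also have "\<dots> \<in> K"
    proof (intro subgrp_sum Kg)
      fix j assume j: "j \<in> {..<Suc k}"
      have "\<sigma> j - ?C (a j) * Xv k \<in> K"
        using j JK[OF XJ, of j] subgrpD(1)[OF Kg] by (cases "j = k") (auto simp: \<sigma>_def)
      from Km[OF forms_UNIV[OF g.forms[OF z(1)[rule_format, of j]]] this]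
      show "(\<sigma> j - ?C (a j) * Xv k) * \<phi> (z j) \<in> K" by (simp add: mult.commute)
    qed
    finally have "p - \<phi> q - Xv k * r + \<phi> q \<in> K" using IK q(1) by (intro subgrpD(4)[OF Kg]) auto
    then show ?case using r by (intro bexI[of _ r]) (auto simp: algebra_simps)
  next
    case (Suc n)
    have "const_coeff p = 0" by (rule const_coeff_forms[OF Suc.prems]) simp
    from irrelevant_decomp[OF Suc.prems this] obtain y where y: "\<And>j. y j \<in> fP N (int (t + n))" "p = (\<Sum>j\<le>N. Xv j * y j)" by auto
    from Suc.IH[OF y(1)] obtain r where r: "\<And>j. r j \<in> fP N (int (t + n) - 1)" "\<And>j. y j - Xv k * r j \<in> K" by metis
    have "(\<Sum>j\<le>N. Xv j * r j) \<in> fP N (int (t + Suc n) - 1)"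
    proof (intro subgrp_sum subgrp_forms)
      fix j assume "j \<in> {..N}"
      then have "j \<le> N" by simp
      from mulX_fP[OF this r(1)] show "Xv j * r j \<in> fP N (int (t + Suc n) - 1)" by simp
    qed
    moreover have "p - Xv k * (\<Sum>j\<le>N. Xv j * r j) \<in> K"
    proof -
      have "p - Xv k * (\<Sum>j\<le>N. Xv j * r j) = (\<Sum>j\<le>N. Xv j * (y j - Xv k * r j))"
        unfolding y(2) by (simp add: sum_subtractf[symmetric] sum_distrib_left right_diff_distrib mult_ac)
      also have "\<dots> \<in> K" by (intro subgrp_sum Kg Km r(2) forms_UNIV[OF forms_Xv])
      finally show ?thesis .
    qed
    ultimately show ?case by blast
  qed
  \<comment> \<open>Each use of \<open>A\<close> extracts one factor \<open>x_k\<close>, lowers the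
    degree by one and requires degree at least \<open>t\<close>. From degree
    \<open>t - 1 + n\<close> this can be done exactly \<open>n\<close> times; taking
    \<open>n = D\<close> reaches the power of \<open>x_k\<close> that lies in
    \<open>K\<close>.\<close>
  have B: "\<exists>r\<in>forms {..N} UNIV. p - Xv k ^ n * r \<in> K" if "p \<in> fP N (int (t - 1 + n))" for p n
    using that
  proof (induction n arbitrary: p)
    case 0 then show ?case using subgrpD(1)[OF Kg] by (intro bexI[of _ p]) (auto intro: forms_UNIV)
  next
    case (Suc n)
    then have "p \<in> fP N (int (t + n))" using t(1) by simp
    from A[OF this] obtain r where r: "r \<in> fP N (int (t + n) - 1)" "p - Xv k * r \<in> K" by blast
    have "r \<in> fP N (int (t - 1 + n))" using r(1) t(1) by (simp add: of_nat_diff algebra_simps)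
    from Suc.IH[OF this] obtain s where s: "s \<in> forms {..N} UNIV" "r - Xv k ^ n * s \<in> K" by blast
    have "p - Xv k ^ Suc n * s = (p - Xv k * r) + Xv k * (r - Xv k ^ n * s)" by (simp add: algebra_simps)
    moreover have "Xv k * (r - Xv k ^ n * s) \<in> K" using s(2) forms_UNIV[OF forms_Xv, of k "{..N}"] k by (intro Km) auto
    ultimately have "p - Xv k ^ Suc n * s \<in> K" using r(2) subgrpD(4)[OF Kg] by metis
    with s(1) show ?case by blast
  qed
  have "sop N k ?I"
    unfolding sop_def
  proof (intro exI[of _ "t - 1 + D"] conjI ballI)
    show "1 \<le> t - 1 + D" using m0 by (simp add: D_def)
    fix p :: "'k mpoly" assume p: "p \<in> fP N (int (t - 1 + D))"
    from B[OF p] obtain r where r: "r \<in> forms {..N} UNIV" "p - Xv k ^ D * r \<in> K" by blast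
    have "Xv k ^ D * r \<in> K" using Km[OF r(1) XD] by (simp add: mult.commute)
    from subgrpD(4)[OF Kg r(2) this] have "p \<in> K" by simp
    then obtain q j where qj: "p = q + j" "q \<in> ?I" "j \<in> ?J" by (auto simp: K_def)
    let ?T = "int (t - 1 + D)"
    have "p = cmp ?T q + cmp ?T j" using cmp_forms_same[OF p] unfolding qj(1) by (simp add: cmp_add)
    moreover have "cmp ?T q \<in> ?I" by (rule gidealD(4)[OF gI' qj(2)])
    moreover have "cmp ?T j \<in> monid N k {?T}"
      using qj(3) cmp_forms[of j "{..N}" UNIV ?T] by (auto simp: monid_def cmp_def keys_pres)
    ultimately show "\<exists>q\<in>?I. p - q \<in> monid N k {?T}" by (intro bexI[of _ "cmp ?T q"]) (simp_all add: algebra_simps)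
  qed
  with ga that show ?thesis by blast
qed

text \<open>Starting from all \<open>N + 1\<close> variables, which satisfy \<open>sop\<close> with
  \<open>t = 1\<close>, \<open>noether_step\<close> drops one as long as \<open>I\<close> contains a
  nonzero form in the remaining ones. The process ends with variables that are independent modulo
  \<open>I\<close>.\<close>

lemma noether_normalization:
  fixes I :: "'k::field mpoly set"
  assumes inf: "infinite (UNIV :: 'k set)" and gI: "gideal N I" and I0: "\<And>g. g \<in> I \<Longrightarrow> g \<in> fP N 0 \<Longrightarrow> g = 0"
  shows "\<exists>\<phi> \<psi> k. gaut N \<phi> \<psi> \<and> k \<le> Suc N \<and> sop N k (\<phi> ` I) \<and> (\<forall>m. \<forall>f\<in>\<phi> ` I. f \<in> forms {..<k} {m} \<longrightarrow> f = 0)"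
proof -
  have main: "\<exists>\<phi> \<psi> k'. gaut N \<phi> \<psi> \<and> k' \<le> Suc N \<and> sop N k' (\<phi> ` I) \<and> (\<forall>m. \<forall>f\<in>\<phi> ` I. f \<in> forms {..<k'} {m} \<longrightarrow> f = 0)"
    if "gideal N I" "sop N k I" "k \<le> Suc N" "\<And>g. g \<in> I \<Longrightarrow> g \<in> fP N 0 \<Longrightarrow> g = 0" for k and I :: "'k mpoly set"
    using that
  proof (induction k arbitrary: I)
    case 0
    have "f = 0" if "f \<in> I" "f \<in> forms {..<0} {m}" for f m
    proof -
      have "f \<in> fP N 0" using that(2) by (auto simp: forms_def mon_degree_def)
      with 0(4) that(1) show ?thesis by blast
    qed
    then have "gaut N id id \<and> 0 \<le> Suc N \<and> sop N 0 (id ` I) \<and> (\<forall>m. \<forall>f\<in>id ` I. f \<in> forms {..<0} {m} \<longrightarrow> f = 0)"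
      using 0(2) by (intro conjI gaut_id) simp_all
    then show ?case by blast
  next
    case (Suc k)
    show ?case
    proof (cases "\<exists>f\<in>I. \<exists>m. f \<in> forms {..<Suc k} {m} \<and> f \<noteq> 0")
      case False
      then have "gaut N id id \<and> Suc k \<le> Suc N \<and> sop N (Suc k) (id ` I) \<and> (\<forall>m. \<forall>f\<in>id ` I. f \<in> forms {..<Suc k} {m} \<longrightarrow> f = 0)"
        using Suc.prems by (intro conjI gaut_id) auto
      then show ?thesis by blast
    next
      case True
      then obtain f m where f: "f \<in> I" "f \<in> forms {..<Suc k} {m}" "f \<noteq> 0" by blast
      have kN: "k \<le> N" using Suc.prems by simp
      obtain \<phi> \<psi> where g: "gaut N \<phi> \<psi>" "sop N k (\<phi> ` I)"
        using noether_step[OF inf Suc.prems(1) kN Suc.prems(2) f Suc.prems(4)] by blast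
      interpret g: graut N \<phi> \<psi> by standard (rule g)
      have "h = 0" if "h \<in> \<phi> ` I" "h \<in> fP N 0" for h
      proof -
        from that(1) obtain h' where h': "h' \<in> I" "h = \<phi> h'" by blast
        have "h' \<in> fP N 0" using g.forms'[OF that(2)] by (simp add: h'(2) g.inv)
        then have "h' = 0" by (rule Suc.prems(4)[OF h'(1)])
        then show ?thesis by (simp only: h'(2) g.zero)
      qed
      from Suc.IH[OF g.gideal[OF Suc.prems(1)] g(2) _ this] kN
      obtain \<phi>' \<psi>' k' where h: "gaut N \<phi>' \<psi>'" "k' \<le> Suc N" "sop N k' (\<phi>' ` \<phi> ` I)"
        "\<forall>m. \<forall>f\<in>\<phi>' ` \<phi> ` I. f \<in> forms {..<k'} {m} \<longrightarrow> f = 0" by auto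
      show ?thesis
        by (intro exI[of _ "\<phi>' \<circ> \<phi>"] exI[of _ "\<psi> \<circ> \<psi>'"] exI[of _ k'] conjI gaut_comp g(1) h(1,2))
          (use h in \<open>simp_all add: image_comp\<close>)
    qed
  qed
  have "sop N (Suc N) I"
    unfolding sop_def
  proof (intro exI[of _ 1] conjI ballI)
    fix p :: "'k mpoly" assume p: "p \<in> fP N (int 1)"
    have "\<exists>i<Suc N. i \<in> mkeys t" if "t \<in> mkeys p" for t
    proof -
      have t: "mon_degree t = 1" "mkeys t \<subseteq> {..N}" using p that by (auto simp: forms_def)
      then have "mkeys t \<noteq> {}" by (auto simp: mon_degree_def)
      with t(2) show ?thesis by (metis atMost_iff ex_in_conv less_Suc_eq_le subset_iff)
    qed
    with p have "p - 0 \<in> monid N (Suc N) {int 1}" by (simp add: monid_def)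
    moreover have "0 \<in> I" by (rule subgrpD(1)[OF gidealD(2)[OF gI]])
    ultimately show "\<exists>q\<in>I. p - q \<in> monid N (Suc N) {int 1}" by blast
  qed simp
  from main[OF gI this _ I0] show ?thesis by simp
qed

section \<open>Bounds for the Hilbert function\<close>

text \<open>By the graded Nakayama lemma this amounts to generation of \<open>R/I\<close> over the
  first \<open>k\<close> variables in degrees less than \<open>d\<close>.\<close>

definition cov :: "nat \<Rightarrow> nat \<Rightarrow> 'k::field mpoly set \<Rightarrow> int \<Rightarrow> bool" where
  "cov N k I d \<longleftrightarrow> (\<forall>s\<ge>d. \<forall>p\<in>fP N s. \<exists>b. (\<forall>i<k. b i \<in> fP N (s - 1)) \<and> p - (\<Sum>i<k. Xv i * b i) \<in> I)"

text \<open>A form of higher degree is a combination of the variables with coefficients one degree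
  lower, to which the relation already known applies.\<close>

lemma sop_cov:
  assumes gI: "gideal N I" and sop: "sop N k I" and k: "k \<le> Suc N"
  obtains t where "t \<ge> 1" "cov N k I (int t)"
proof -
  obtain t where t: "t \<ge> 1" "\<And>p. p \<in> fP N (int t) \<Longrightarrow> \<exists>q\<in>I. p - q \<in> monid N k {int t}"
    using sop by (auto simp: sop_def)
  have "\<exists>b. (\<forall>i<k. b i \<in> fP N (int (t + n) - 1)) \<and> p - (\<Sum>i<k. Xv i * b i) \<in> I" if "p \<in> fP N (int (t + n))" for n p
    using that
  proof (induction n arbitrary: p)
    case 0
    then obtain q where q: "q \<in> I" "p - q \<in> monid N k {int t}" using t(2) by auto
    from monid_decomp[OF q(2) k] obtain z where z: "\<forall>j. z j \<in> fP N (int t - 1)" "p - q = (\<Sum>j<k. Xv j * z j)" by blast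
    have "p - (\<Sum>j<k. Xv j * z j) = q" unfolding z(2)[symmetric] by simp
    with z(1) q(1) show ?case by (intro exI[of _ z]) simp
  next
    case (Suc n)
    have "const_coeff p = 0" by (rule const_coeff_forms[OF Suc.prems]) simp
    from irrelevant_decomp[OF Suc.prems this] obtain y where y: "\<And>j. y j \<in> fP N (int (t + n))" "p = (\<Sum>j\<le>N. Xv j * y j)" by auto
    have "\<forall>j. \<exists>b. (\<forall>i<k. b i \<in> fP N (int (t + n) - 1)) \<and> y j - (\<Sum>i<k. Xv i * b i) \<in> I"
      using Suc.IH[OF y(1)] by blast
    from choice[OF this] obtain b where b: "\<And>j i. i < k \<Longrightarrow> b j i \<in> fP N (int (t + n) - 1)" "\<And>j. y j - (\<Sum>i<k. Xv i * b j i) \<in> I" by blast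
    have "(\<Sum>j\<le>N. Xv j * b j i) \<in> fP N (int (t + Suc n) - 1)" if "i < k" for i
    proof (intro subgrp_sum subgrp_forms)
      fix j assume "j \<in> {..N}"
      then have "j \<le> N" by simp
      from mulX_fP[OF this b(1)[OF that]] show "Xv j * b j i \<in> fP N (int (t + Suc n) - 1)" by simp
    qed
    moreover have "p - (\<Sum>i<k. Xv i * (\<Sum>j\<le>N. Xv j * b j i)) \<in> I"
    proof -
      have "(\<Sum>i<k. Xv i * (\<Sum>j\<le>N. Xv j * b j i)) = (\<Sum>i<k. \<Sum>j\<le>N. Xv j * (Xv i * b j i))"
        by (simp add: sum_distrib_left mult_ac)
      also have "\<dots> = (\<Sum>j\<le>N. \<Sum>i<k. Xv j * (Xv i * b j i))" by (rule sum.swap)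
      finally have "p - (\<Sum>i<k. Xv i * (\<Sum>j\<le>N. Xv j * b j i)) = (\<Sum>j\<le>N. Xv j * (y j - (\<Sum>i<k. Xv i * b j i)))"
        unfolding y(2) by (simp add: sum_subtractf right_diff_distrib sum_distrib_left)
      also have "\<dots> \<in> I"
        by (intro subgrp_sum gidealD(2)[OF gI] gidealD(3)[OF gI forms_UNIV[OF forms_Xv]] b(2))
      finally show ?thesis .
    qed
    ultimately show ?case by (intro exI[of _ "\<lambda>i. \<Sum>j\<le>N. Xv j * b j i"]) simp
  qed
  then have "cov N k I (int t)"
    unfolding cov_def
  proof (intro allI impI ballI)
    fix s and p :: "'a mpoly" assume s: "int t \<le> s" and p: "p \<in> fP N s"
    then obtain n where "s = int (t + n)" by (metis zle_iff_zadd of_nat_add)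
    with p \<open>\<And>p n. p \<in> fP N (int (t + n)) \<Longrightarrow> _\<close> show "\<exists>b. (\<forall>i<k. b i \<in> fP N (s - 1)) \<and> p - (\<Sum>i<k. Xv i * b i) \<in> I" by blast
  qed
  with t(1) that show ?thesis by blast
qed

section \<open>The free module on monomials of bounded degree in the last variables\<close>

definition ydeg :: "nat \<Rightarrow> (nat \<Rightarrow>\<^sub>0 nat) \<Rightarrow> nat" where
  "ydeg k t = (\<Sum>i\<in>mkeys t - {..<k}. lk t i)"

text \<open>The free module over the first \<open>k\<close> variables with basis the monomials of
  degree less than \<open>d\<close> in the others; it is the candidate for \<open>R/I\<close> in the
  extremal case.\<close>

definition Lam :: "nat \<Rightarrow> nat \<Rightarrow> nat \<Rightarrow> int set \<Rightarrow> 'k::field mpoly set" where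
  "Lam N k d D = {p \<in> forms {..N} D. \<forall>t\<in>mkeys p. ydeg k t < d}"

lemma ydeg_superset: "finite A \<Longrightarrow> mkeys t - {..<k} \<subseteq> A \<Longrightarrow> A \<inter> {..<k} = {} \<Longrightarrow> ydeg k t = (\<Sum>i\<in>A. lk t i)"
  unfolding ydeg_def by (rule sum.mono_neutral_left) (auto simp: in_keys_iff)

lemma ydeg_add: "ydeg k (s + t) = ydeg k s + ydeg k t"
proof -
  let ?A = "mkeys s \<union> mkeys t - {..<k}"
  have A: "finite ?A" "?A \<inter> {..<k} = {}" "mkeys s - {..<k} \<subseteq> ?A" "mkeys t - {..<k} \<subseteq> ?A" "mkeys (s + t) - {..<k} \<subseteq> ?A"
    by (auto simp: mkeys_add)
  show ?thesis
    unfolding ydeg_superset[OF A(1,3,2)] ydeg_superset[OF A(1,4,2)] ydeg_superset[OF A(1,5,2)]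
    by (simp add: lookup_add sum.distrib)
qed

lemma ydeg_le: "ydeg k t \<le> mon_degree t"
  unfolding ydeg_def mon_degree_def by (rule sum_mono2) auto

lemma ydeg_low: "mkeys t \<subseteq> {..<k} \<Longrightarrow> ydeg k t = 0"
  by (auto simp: ydeg_def)

lemma ydeg_high: "mkeys t \<inter> {..<k} = {} \<Longrightarrow> ydeg k t = mon_degree t"
proof -
  assume "mkeys t \<inter> {..<k} = {}"
  then have "mkeys t - {..<k} = mkeys t" by auto
  then show ?thesis by (simp add: ydeg_def mon_degree_def)
qed

lemma subgrp_Lam: "subgrp (Lam N k d D)"
proof -
  have "subgrp {p :: 'a::field mpoly. \<forall>t\<in>mkeys p. ydeg k t < d}"
    by (auto simp: subgrp_def in_keys_iff lookup_minus)
  from subgrp_Int[OF subgrp_forms this] show ?thesis by (simp add: Lam_def Int_def)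
qed

lemma Lam_mulX: "i < k \<Longrightarrow> i \<le> N \<Longrightarrow> p \<in> Lam N k d {m} \<Longrightarrow> Xv i * p \<in> Lam N k d {m + 1}"
proof -
  assume i: "i < k" "i \<le> N" and p: "p \<in> Lam N k d {m}"
  have "ydeg k (sng i 1 + t) = ydeg k t" for t using i by (simp add: ydeg_add ydeg_low)
  with i p mulX_fP[of i N p m] show ?thesis by (auto simp: Lam_def Xv_def keys_times_single)
qed

lemma Lam_mulX_U: "i < k \<Longrightarrow> i \<le> N \<Longrightarrow> p \<in> Lam N k d UNIV \<Longrightarrow> Xv i * p \<in> Lam N k d UNIV"
proof -
  assume i: "i < k" "i \<le> N" and p: "p \<in> Lam N k d UNIV"
  have "ydeg k (sng i 1 + t) = ydeg k t" for t using i by (simp add: ydeg_add ydeg_low)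
  with p forms_U_mult[OF forms_UNIV[OF forms_Xv[of i "{..N}"]], of p] i show ?thesis
    by (auto simp: Lam_def Xv_def keys_times_single)
qed

text \<open>Graded Nakayama: a form of degree at least \<open>d\<close> is rewritten through
  coefficients of smaller degree, and below \<open>d\<close> every form lies in
  \<open>Lam\<close>.\<close>

lemma cov_low:
  assumes gI: "gideal N I" and cov: "cov N k I (int d)" and k: "k \<le> Suc N" and p: "p \<in> fP N m"
  shows "\<exists>q\<in>fI N I m. p - q \<in> Lam N k d {m}"
proof (cases "m < 0")
  case True
  then have "p = 0" by (rule forms_neg[OF p])
  then show ?thesis using subgrpD(1)[OF subgrp_Int[OF gidealD(2)[OF gI] subgrp_forms]] subgrpD(1)[OF subgrp_Lam]
    by (intro bexI[of _ 0]) auto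
next
  case False
  have zI: "0 \<in> fI N I m" for m using subgrpD(1)[OF subgrp_Int[OF gidealD(2)[OF gI] subgrp_forms]] .
  have "\<exists>q\<in>fI N I (int n). p - q \<in> Lam N k d {int n}" if "p \<in> fP N (int n)" for n p
    using that
  proof (induction n arbitrary: p rule: less_induct)
    case (less n)
    show ?case
    proof (cases "n < d")
      case True
      have "ydeg k t < d" if "t \<in> mkeys p" for t
      proof -
        have "mon_degree t = n" using less.prems that by (auto simp: forms_def)
        then show ?thesis using ydeg_le[of k t] True by simp
      qed
      with less.prems have "p - 0 \<in> Lam N k d {int n}" by (simp add: Lam_def)
      with zI show ?thesis by blast
    next
      case False
      then obtain b where b: "\<And>i. i < k \<Longrightarrow> b i \<in> fP N (int n - 1)" "p - (\<Sum>i<k. Xv i * b i) \<in> I"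
        using cov less.prems unfolding cov_def by (meson linorder_not_less of_nat_le_iff)
      have "\<exists>q\<in>fI N I (int n - 1). b i - q \<in> Lam N k d {int n - 1}" if i: "i < k" for i
      proof (cases n)
        case 0
        then have "b i = 0" using forms_neg[OF b(1)[OF i]] by simp
        then show ?thesis using zI[of "int n - 1"] subgrpD(1)[OF subgrp_Lam] by (intro bexI[of _ 0]) auto
      next
        case (Suc n')
        have "b i \<in> fP N (int n')" using b(1)[OF i] Suc by simp
        from less.IH[OF _ this] Suc show ?thesis by simp
      qed
      then obtain q where q: "\<And>i. i < k \<Longrightarrow> q i \<in> fI N I (int n - 1)" "\<And>i. i < k \<Longrightarrow> b i - q i \<in> Lam N k d {int n - 1}" by metis
      let ?q = "p - (\<Sum>i<k. Xv i * (b i - q i))"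
      have l: "(\<Sum>i<k. Xv i * (b i - q i)) \<in> Lam N k d {int n}"
      proof (intro subgrp_sum subgrp_Lam)
        fix i assume i: "i \<in> {..<k}"
        then have ik: "i < k" "i \<le> N" using k by auto
        from Lam_mulX[OF ik q(2)[OF ik(1)]] show "Xv i * (b i - q i) \<in> Lam N k d {int n}" by simp
      qed
      have e: "?q = (p - (\<Sum>i<k. Xv i * b i)) + (\<Sum>i<k. Xv i * q i)" by (simp add: right_diff_distrib sum_subtractf)
      have "(\<Sum>i<k. Xv i * q i) \<in> I"
      proof (intro subgrp_sum gidealD(2)[OF gI])
        fix i assume "i \<in> {..<k}"
        then show "Xv i * q i \<in> I" using q(1)[of i] k by (intro gidealD(3)[OF gI forms_UNIV[OF forms_Xv]]) auto
      qed
      then have "?q \<in> I" unfolding e by (rule subgrpD(4)[OF gidealD(2)[OF gI] b(2)])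
      moreover have "?q \<in> fP N (int n)" using l by (intro formsI(2) less.prems) (simp add: Lam_def)
      moreover have "p - ?q \<in> Lam N k d {int n}" using l by simp
      ultimately show ?thesis by blast
    qed
  qed
  from this[of p "nat m"] p False show ?thesis by simp
qed

text \<open>Hilbert function of \<open>Lam\<close>: there are \<open>mcf (Suc N - k) a\<close> basis
  elements of degree \<open>a\<close>, each contributing a shifted polynomial ring in
  \<open>k\<close> variables.\<close>

definition WW :: "nat \<Rightarrow> nat \<Rightarrow> nat \<Rightarrow> int \<Rightarrow> int" where
  "WW N k d m = (\<Sum>a<d. int (mcf (Suc N - k) a) * Dm k (m - int a))"

lemma card_low_monomials:
  assumes k: "k \<le> Suc N"
  shows "finite {t :: nat \<Rightarrow>\<^sub>0 nat. mkeys t \<subseteq> {..N} \<and> int (mon_degree t) = m \<and> ydeg k t < d}" (is "finite ?T")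
    and "int (card {t :: nat \<Rightarrow>\<^sub>0 nat. mkeys t \<subseteq> {..N} \<and> int (mon_degree t) = m \<and> ydeg k t < d}) = WW N k d m"
proof -
  let ?A = "\<lambda>a. {t :: nat \<Rightarrow>\<^sub>0 nat. mkeys t \<subseteq> {k..N} \<and> mon_degree t = a}"
  let ?B = "\<lambda>a. {t :: nat \<Rightarrow>\<^sub>0 nat. mkeys t \<subseteq> {..<k} \<and> int (mon_degree t) = m - int a}"
  let ?f = "\<lambda>(s, u). s + u :: nat \<Rightarrow>\<^sub>0 nat"
  show "finite ?T" by (rule finite_subset[OF _ finite_monomials[of "{..N}" m]]) auto
  have finA: "finite (?A a)" for a using finite_monomials[of "{k..N}" "int a"] by simp
  have finB: "finite (?B a)" for a by (rule finite_monomials) simp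
  have img: "?T = ?f ` (\<Union>a<d. ?A a \<times> ?B a)"
  proof (intro equalityI subsetI)
    fix t assume t: "t \<in> ?T"
    define s where "s = (\<Sum>i\<in>mkeys t - {..<k}. sng i (lk t i))"
    define u where "u = (\<Sum>i\<in>mkeys t \<inter> {..<k}. sng i (lk t i))"
    have ls: "lk s i = (if i < k then 0 else lk t i)" "lk u i = (if i < k then lk t i else 0)" for i
      by (auto simp: s_def u_def lookup_sum lookup_single when_def in_keys_iff)
    have tsu: "t = s + u" by (rule poly_mapping_eqI) (simp add: lookup_add ls)
    have ks: "mkeys s \<subseteq> {k..N}" and ku: "mkeys u \<subseteq> {..<k}" using t by (auto simp: in_keys_iff ls subset_iff split: if_splits)
    have "mon_degree s = ydeg k t"
      unfolding tsu ydeg_add ydeg_low[OF ku] using ks by (subst ydeg_high) auto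
    moreover have "mon_degree t = mon_degree s + mon_degree u" by (simp add: tsu mon_degree_add)
    ultimately have "(s, u) \<in> (\<Union>a<d. ?A a \<times> ?B a)" using t ks ku by auto
    then show "t \<in> ?f ` (\<Union>a<d. ?A a \<times> ?B a)" using tsu by (intro image_eqI[of _ _ "(s, u)"]) auto
  next
    fix t assume "t \<in> ?f ` (\<Union>a<d. ?A a \<times> ?B a)"
    then obtain a s u where *: "a < d" "mkeys s \<subseteq> {k..N}" "mon_degree s = a" "mkeys u \<subseteq> {..<k}" "int (mon_degree u) = m - int a" "t = s + u" by auto
    have "ydeg k s = a" using *(2,3) by (subst ydeg_high) auto
    moreover have "mkeys t \<subseteq> {..N}" unfolding *(6) mkeys_add using *(2,4) k by auto
    ultimately show "t \<in> ?T" using * by (auto simp: ydeg_add ydeg_low mon_degree_add)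
  qed
  have inj: "inj_on ?f (\<Union>a<d. ?A a \<times> ?B a)"
  proof (rule inj_onI, clarify)
    fix s u s' u' a a' assume *: "mkeys s \<subseteq> {k..N}" "mkeys u \<subseteq> {..<k}" "mkeys s' \<subseteq> {k..N}" "mkeys u' \<subseteq> {..<k}" and e: "s + u = s' + u'"
    have l: "lk s i + lk u i = lk s' i + lk u' i" for i using e by (metis lookup_add)
    have z: "i < k \<Longrightarrow> lk s i = 0 \<and> lk s' i = 0" "\<not> i < k \<Longrightarrow> lk u i = 0 \<and> lk u' i = 0" for i
      using * by (auto simp: in_keys_iff subset_iff)
    have "lk s i = lk s' i \<and> lk u i = lk u' i" for i using l[of i] z[of i] by (cases "i < k") auto
    then show "s = s' \<and> u = u'" by (auto intro: poly_mapping_eqI)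
  qed
  have "card ?T = card (\<Union>a<d. ?A a \<times> ?B a)" unfolding img by (rule card_image[OF inj])
  also have "\<dots> = (\<Sum>a<d. card (?A a \<times> ?B a))"
    by (rule card_UN_disjoint) (use finA finB in auto)
  also have "\<dots> = (\<Sum>a<d. card (?A a) * card (?B a))" by (simp only: card_cartesian_product)
  finally have "int (card ?T) = (\<Sum>a<d. int (card (?A a)) * int (card (?B a)))" by simp
  also have "\<dots> = WW N k d m"
    unfolding WW_def by (intro sum.cong refl) (simp add: card_monomials card_monomials_int)
  finally show "int (card ?T) = WW N k d m" .
qed

lemma dim_Lam:
  assumes "k \<le> Suc N"
  shows "ps.fd (Lam N k d {m} :: 'k::field mpoly set)" "int (ps.dim (Lam N k d {m} :: 'k mpoly set)) = WW N k d m"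
proof -
  let ?T = "{t :: nat \<Rightarrow>\<^sub>0 nat. mkeys t \<subseteq> {..N} \<and> int (mon_degree t) = m \<and> ydeg k t < d}"
  have L: "(Lam N k d {m} :: 'k mpoly set) = {p. mkeys p \<subseteq> ?T}" by (auto simp: Lam_def forms_def)
  from dim_keys[OF card_low_monomials(1)[OF assms, of m d], where 'k = 'k] card_low_monomials(2)[OF assms, of m d]
  show "ps.fd (Lam N k d {m} :: 'k mpoly set)" "int (ps.dim (Lam N k d {m} :: 'k mpoly set)) = WW N k d m"
    unfolding L by simp_all
qed

lemma dim_sum_subspace:
  assumes gI: "gideal N I" and V: "ps.fd V" "V \<subseteq> fP N m"
  shows "ps.fd {u + v | u v. u \<in> fI N I m \<and> v \<in> V}"
    "ps.dim {u + v | u v. u \<in> fI N I m \<and> v \<in> V} + ps.dim (fI N I m \<inter> V) = ps.dim (fI N I m) + ps.dim V"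
proof -
  have sV: "ps.subspace V" using V by (simp add: ps.fd_def)
  show fd: "ps.fd {u + v | u v. u \<in> fI N I m \<and> v \<in> V}"
  proof (rule ps.fd_subset[OF fd_fP])
    show "ps.subspace {u + v | u v. u \<in> fI N I m \<and> v \<in> V}" by (rule ps.subspace_sums[OF subspace_fI[OF gI] sV])
    show "{u + v | u v. u \<in> fI N I m \<and> v \<in> V} \<subseteq> fP N m" using V(2) formsI(4) by blast
  qed
  show "ps.dim {u + v | u v. u \<in> fI N I m \<and> v \<in> V} + ps.dim (fI N I m \<inter> V) = ps.dim (fI N I m) + ps.dim V"
    by (rule ps.dim_add_Int[OF fd_fI[OF gI] V(1) fd refl])
qed

text \<open>\<open>Lam\<close> maps onto \<open>R/I\<close> with kernel
  \<open>I \<inter> Lam\<close>. The upper bound on the degree discards this kernel; the equality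
  case is about its vanishing.\<close>

lemma hf_Lam:
  assumes gI: "gideal N I" and cov: "cov N k I (int d)" and k: "k \<le> Suc N"
  shows "hf N I m = WW N k d m - int (ps.dim (fI N I m \<inter> Lam N k d {m}))"
proof -
  have LP: "Lam N k d {m} \<subseteq> fP N m" by (auto simp: Lam_def)
  have "fP N m = {u + v | u v. u \<in> fI N I m \<and> v \<in> Lam N k d {m}}"
  proof (intro equalityI subsetI)
    fix p :: "'a mpoly" assume "p \<in> fP N m"
    from cov_low[OF gI cov k this] obtain q where "q \<in> fI N I m" "p - q \<in> Lam N k d {m}" by blast
    moreover have "p = q + (p - q)" by simp
    ultimately show "p \<in> {u + v | u v. u \<in> fI N I m \<and> v \<in> Lam N k d {m}}" by blast
  next
    fix p assume "p \<in> {u + v | u v. u \<in> fI N I m \<and> v \<in> Lam N k d {m}}"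
    with LP show "p \<in> fP N m" using formsI(4) by blast
  qed
  with dim_sum_subspace(2)[OF gI dim_Lam(1)[OF k] LP] dim_Lam(2)[OF k, of d m, where 'k = 'a]
  show ?thesis unfolding hf_def by simp
qed

lemma hf_lower:
  assumes gI: "gideal N I" and k: "k \<le> Suc N" and z: "\<And>f. f \<in> I \<Longrightarrow> f \<in> forms {..<k} {m} \<Longrightarrow> f = 0"
  shows "Dm k m \<le> hf N I m"
proof -
  let ?V = "forms {..<k} {m} :: 'a mpoly set"
  have V: "?V \<subseteq> fP N m" by (rule forms_mono) (use k in auto)
  have fdV: "ps.fd ?V" "int (ps.dim ?V) = Dm k m" using dim_forms[of "{..<k}" m, where 'k = 'a] by auto
  have "fI N I m \<inter> ?V = {0}"
    using z subgrpD(1)[OF gidealD(2)[OF gI]] formsI(1) by blast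
  then have "ps.dim {u + v | u v. u \<in> fI N I m \<and> v \<in> ?V} = ps.dim (fI N I m) + ps.dim ?V"
    using dim_sum_subspace(2)[OF gI fdV(1) V] by simp
  moreover have "ps.dim {u + v | u v. u \<in> fI N I m \<and> v \<in> ?V} \<le> ps.dim (fP N m :: 'a mpoly set)"
  proof (rule ps.fd_dim_mono[OF fd_fP])
    show "ps.subspace {u + v | u v. u \<in> fI N I m \<and> v \<in> ?V}" using dim_sum_subspace(1)[OF gI fdV(1) V] by (simp add: ps.fd_def)
    show "{u + v | u v. u \<in> fI N I m \<and> v \<in> ?V} \<subseteq> fP N m" using V formsI(4) by blast
  qed
  ultimately show ?thesis using fdV(2) by (simp add: hf_def)
qed

lemma ev_const_WW: "ev_const ((dl ^^ n) (WW N (Suc n) d)) (\<Sum>a<d. int (mcf (N - n) a))"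
proof -
  have e: "(dl ^^ n) (WW N (Suc n) d) = (\<lambda>m. \<Sum>a<d. int (mcf (N - n) a) * (dl ^^ n) (Dm (Suc n)) (m - int a))"
    unfolding WW_def dlp_sum dlp_cmul dlp_shift by simp
  have "ev_const (\<lambda>m. \<Sum>a<d. int (mcf (N - n) a) * (dl ^^ n) (Dm (Suc n)) (m - int a)) (\<Sum>a<d. int (mcf (N - n) a) * 1)"
    by (intro ev_const_sum ev_const_cmul ev_const_shift ev_const_Dm) simp
  then show ?thesis unfolding e by simp
qed

lemma ev_const_WW_low: "k \<le> n \<Longrightarrow> ev_const ((dl ^^ n) (WW N k d)) 0"
proof -
  assume k: "k \<le> n"
  have e: "(dl ^^ n) (WW N k d) = (\<lambda>m. \<Sum>a<d. int (mcf (Suc N - k) a) * (dl ^^ n) (Dm k) (m - int a))"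
    unfolding WW_def dlp_sum dlp_cmul dlp_shift by simp
  have "ev_const (\<lambda>m. \<Sum>a<d. int (mcf (Suc N - k) a) * (dl ^^ n) (Dm k) (m - int a)) (\<Sum>a<d. int (mcf (Suc N - k) a) * 0)"
    by (intro ev_const_sum ev_const_cmul ev_const_shift ev_const_Dm(2) k) simp
  then show ?thesis unfolding e by simp
qed

lemma hf_le_WW:
  assumes "gideal N I" "cov N k I (int d)" "k \<le> Suc N" shows "hf N I m \<le> WW N k d m"
  using hf_Lam[OF assms, of m] by simp

text \<open>Independence bounds the Hilbert function below by that of a polynomial ring in
  \<open>k\<close> variables, and finiteness bounds it above by that of a free module of finite rank
  over this ring. Both grow with order \<open>k - 1\<close>, whereas a nonzero
  \<open>\<delta>\<close> means growth of order \<open>n\<close>.\<close>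

lemma sop_dimension:
  assumes gI: "gideal N I" and k: "k \<le> Suc N" and sop: "sop N k I"
    and z: "\<And>m f. f \<in> I \<Longrightarrow> f \<in> forms {..<k} {m} \<Longrightarrow> f = 0"
    and ev: "ev_const ((dl ^^ n) (hf N I)) \<delta>" "\<delta> \<noteq> 0"
  shows "k = Suc n"
proof (rule antisym)
  have pos: "\<delta> \<ge> 0" by (rule ev_const_nonneg[OF hf_nonneg[OF gI] ev(1)])
  show "k \<le> Suc n"
  proof (rule ccontr)
    assume "\<not> k \<le> Suc n"
    then obtain l where l: "k = Suc l" "n < l" by (cases k) auto
    have "ev_const ((dl ^^ Suc n) (hf N I)) 0" using ev_const_dl[OF ev(1)] by simp
    then have "ev_const ((dl ^^ l) (hf N I)) 0" by (rule ev_const_dlp) (use l in simp)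
    from ev_const_diff[OF this ev_const_Dm(1)[of l]]
    have "ev_const ((dl ^^ l) (\<lambda>m. hf N I m - Dm k m)) (-1)" unfolding dlp_diff l by simp
    from ev_const_nonneg[OF _ this] hf_lower[OF gI k z] show False by force
  qed
  show "Suc n \<le> k"
  proof (rule ccontr)
    assume "\<not> Suc n \<le> k"
    then have kn: "k \<le> n" by simp
    obtain t where "cov N k I (int t)" using sop_cov[OF gI sop k] by blast
    from hf_le_WW[OF gI this k] have le: "0 \<le> WW N k t m - hf N I m" for m by simp
    from ev_const_diff[OF ev_const_WW_low[OF kn, of N t] ev(1)]
    have "ev_const ((dl ^^ n) (\<lambda>m. WW N k t m - hf N I m)) (- \<delta>)" unfolding dlp_diff by simp
    from ev_const_nonneg[OF le this] pos ev(2) show False by simp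
  qed
qed

text \<open>Turns vanishing in the single homological degree \<open>e\<close>, the number of
  variables outside the system of parameters, into the degree bound for generators.\<close>

lemma kz_cov:
  assumes gI: "gideal N I" and sop: "sop N (Suc n) I" and n: "n \<le> N" and e: "e = N - n"
    and kz: "\<And>s. s \<ge> d \<Longrightarrow> kz N I e (int e + s)"
  shows "cov N (Suc n) I d"
proof -
  obtain t where t: "t \<ge> 1" "cov N (Suc n) I (int t)" using sop_cov[OF gI sop] n by auto
  \<comment> \<open>Finiteness expresses each \<open>x_j^t\<close> modulo \<open>I\<close> through
    the first \<open>n + 1\<close> variables; these are the relations from which the Koszul cycle is
    built.\<close>
  have "\<forall>j. \<exists>b. j \<in> {..N} \<longrightarrow> (\<forall>i<Suc n. b i \<in> fP N (int t - 1)) \<and> Xv j ^ t - (\<Sum>i<Suc n. Xv i * b i) \<in> I"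
    using t(2) forms_power[OF forms_Xv, of _ "{..N}" t] unfolding cov_def by auto
  from choice[OF this] obtain r where r: "\<And>j. j \<in> {..N} \<Longrightarrow> (\<forall>i<Suc n. r j i \<in> fP N (int t - 1)) \<and> Xv j ^ t - (\<Sum>i<Suc n. Xv i * r j i) \<in> I" by blast
  show ?thesis unfolding cov_def
  proof (intro allI impI ballI)
    fix s and p :: "'a mpoly" assume s: "d \<le> s" and p: "p \<in> fP N s"
    have H: "{..<Suc n} \<subseteq> {..N}" using n by auto
    have "{..N} - {..<Suc n} = {Suc n..N}" by auto
    then have ce: "e = card ({..N} - {..<Suc n})" using e by simp
    have "\<exists>b. (\<forall>k\<in>{..<Suc n}. b k \<in> fP N (s - 1)) \<and> p - (\<Sum>k\<in>{..<Suc n}. Xv k * b k) \<in> I"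
      by (rule sop_quotient_vanishing[OF gI H ce kz t(1), where r = r]) (use r s p in \<open>auto simp: mult.commute\<close>)
    then show "\<exists>b. (\<forall>i<Suc n. b i \<in> fP N (s - 1)) \<and> p - (\<Sum>i<Suc n. Xv i * b i) \<in> I" by auto
  qed
qed

text \<open>A longer sequence would kill Koszul homology in degree \<open>N - n\<close> altogether,
  so that \<open>kz_cov\<close> applies with \<open>d = 0\<close>. Then \<open>1\<close> is, modulo
  \<open>I\<close>, a combination of variables with coefficients of degree \<open>-1\<close>, hence
  lies in \<open>I\<close>.\<close>

lemma regular_sequence_bound:
  assumes gI: "gideal N I" and sop: "sop N (Suc n) I" and n: "n \<le> N"
    and I0: "\<And>g. g \<in> I \<Longrightarrow> g \<in> fP N 0 \<Longrightarrow> g = 0" and reg: "regular_sequence N I fs"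
  shows "length fs \<le> Suc n"
proof (rule ccontr)
  assume "\<not> length fs \<le> Suc n"
  then have "(N - n) + length fs > Suc N" using n by simp
  from regular_sequence_ukz[OF gideal_uideal[OF gI] reg this] have "kz N I (N - n) m" for m by (rule ukz_kz[OF gI])
  then have "cov N (Suc n) I 0" by (intro kz_cov[OF gI sop n refl])
  moreover have "(1 :: 'a mpoly) \<in> fP N 0" using forms_const[of "{0}" 1 "{..N}"] by simp
  ultimately obtain b where b: "\<And>i. i < Suc n \<Longrightarrow> b i \<in> fP N (0 - 1)" "1 - (\<Sum>i<Suc n. Xv i * b i) \<in> I"
    unfolding cov_def by blast
  have "(\<Sum>i<Suc n. Xv i * b i) = 0" using forms_neg[OF b(1)] by (intro sum.neutral) auto
  with b(2) have "1 \<in> I" by simp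
  with I0 \<open>1 \<in> fP N 0\<close> show False by force
qed

section \<open>The extremal case\<close>

lemma multiplicity_bound:
  assumes gI: "gideal N I" and cov: "cov N (Suc n) I (int d)" and n: "n \<le> N"
    and ev: "ev_const ((dl ^^ n) (hf N I)) \<delta>"
  shows "\<delta> \<le> (\<Sum>a<d. int (mcf (N - n) a))"
proof -
  have le: "0 \<le> WW N (Suc n) d m - hf N I m" for m using hf_le_WW[OF gI cov, of m] n by simp
  from ev_const_diff[OF ev_const_WW[of n N d] ev]
  have "ev_const ((dl ^^ n) (\<lambda>m. WW N (Suc n) d m - hf N I m)) ((\<Sum>a<d. int (mcf (N - n) a)) - \<delta>)"
    unfolding dlp_diff by simp
  from ev_const_nonneg[OF le this] show ?thesis by simp
qed

text \<open>The multiples of a nonzero \<open>f\<close> by forms in \<open>x_0, ..., x_n\<close>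
  stay in the intersection and form a free module of rank one, of multiplicity 1. The quotient of
  \<open>Lam\<close> would then have multiplicity at least one below the assumed maximum.\<close>

lemma fI_Int_Lam:
  fixes I :: "'k::field mpoly set"
  assumes gI: "gideal N I" and cov: "cov N (Suc n) I (int d)" and n: "n \<le> N"
    and ev: "ev_const ((dl ^^ n) (hf N I)) (\<Sum>a<d. int (mcf (N - n) a))"
    and f: "f \<in> fI N I c" "f \<in> Lam N (Suc n) d {c}"
  shows "f = 0"
proof (rule ccontr)
  assume f0: "f \<noteq> 0"
  have dim: "Dm (Suc n) (m - c) \<le> int (ps.dim (fI N I m \<inter> Lam N (Suc n) d {m}))" for m
  proof -
    let ?V = "forms {..<Suc n} {m - c} :: 'k mpoly set"
    have V: "ps.fd ?V" "int (ps.dim ?V) = Dm (Suc n) (m - c)"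
      using dim_forms[of "{..<Suc n}" "m - c", where 'k = 'k] by auto
    have lin: "Vector_Spaces.linear poly_scale poly_scale ((*) f)"
      by (rule linearI[OF vector_space_poly_scale vector_space_poly_scale])
        (auto simp: distrib_left poly_scale_def mult.left_commute)
    have e: "ps.dim ((*) f ` ?V) = ps.dim ?V"
      by (rule pp.dim_injective_image[OF lin V(1)]) (use f0 in auto)
    have sub: "(*) f ` ?V \<subseteq> fI N I m \<inter> Lam N (Suc n) d {m}"
    proof (rule image_subsetI)
      fix p assume p: "p \<in> ?V"
      have p': "p \<in> fP N (m - c)" by (rule subsetD[OF forms_mono p]) (use n in auto)
      have "f * p \<in> fP N m" using forms_mult1[of f "{..N}" c p "m - c"] f(1) p' by simp
      moreover have "f * p \<in> I" using gidealD(3)[OF gI forms_UNIV[OF p'], of f] f(1) by (simp add: mult.commute)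
      moreover have "ydeg (Suc n) t < d" if t: "t \<in> mkeys (f * p)" for t
      proof -
        obtain a b where ab: "t = a + b" "a \<in> mkeys f" "b \<in> mkeys p" using t keys_mult[of f p] by blast
        have "ydeg (Suc n) b = 0" by (rule ydeg_low) (use ab(3) p in \<open>auto simp: forms_def\<close>)
        with ab f(2) show ?thesis by (simp add: ydeg_add Lam_def)
      qed
      ultimately show "f * p \<in> fI N I m \<inter> Lam N (Suc n) d {m}" by (auto simp: Lam_def)
    qed
    have L: "ps.fd (Lam N (Suc n) d {m} :: 'k mpoly set)" by (rule dim_Lam) (use n in simp)
    have "ps.fd (fI N I m \<inter> Lam N (Suc n) d {m})"
      by (rule ps.fd_subset[OF L]) (use L in \<open>auto simp: ps.fd_def intro!: ps.subspace_inter subspace_fI[OF gI]\<close>)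
    from ps.fd_dim_mono[OF this _ sub] pp.fd_image[OF lin V(1)] e V(2) show ?thesis by (simp add: ps.fd_def)
  qed
  have le: "0 \<le> WW N (Suc n) d m - hf N I m - Dm (Suc n) (m - c)" for m
    using hf_Lam[OF gI cov, of m] dim[of m] n by simp
  have "ev_const ((dl ^^ n) (\<lambda>m. WW N (Suc n) d m - hf N I m - Dm (Suc n) (m - c))) (-1)"
    using ev_const_diff[OF ev_const_diff[OF ev_const_WW[of n N d] ev] ev_const_shift[OF ev_const_Dm(1)[of n], of c]]
    unfolding dlp_diff dlp_shift by simp
  from ev_const_nonneg[OF le this] show False by simp
qed

lemma Lam_UNIV:
  fixes I :: "'k::field mpoly set"
  assumes gI: "gideal N I" and Z: "\<And>c f. f \<in> fI N I c \<Longrightarrow> f \<in> Lam N k d {c} \<Longrightarrow> f = 0"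
    and p: "p \<in> I" "p \<in> Lam N k d UNIV"
  shows "p = 0"
proof -
  have "cmp m p = 0" for m
  proof (rule Z)
    have "cmp m p \<in> fP N m" using p(2) by (auto simp: Lam_def intro: cmp_forms)
    then show "cmp m p \<in> fI N I m" "cmp m p \<in> Lam N k d {m}"
      using gidealD(4)[OF gI p(1)] p(2) by (auto simp: Lam_def cmp_def keys_pres)
  qed
  then show ?thesis using sum_cmp[OF finite_degs order_refl, of p] by simp
qed

lemma cov_low_UNIV:
  fixes I :: "'k::field mpoly set"
  assumes gI: "gideal N I" and cov: "cov N k I (int d)" and k: "k \<le> Suc N" and p: "p \<in> forms {..N} UNIV"
  shows "\<exists>q. q \<in> I \<and> p - q \<in> Lam N k d UNIV"
proof -
  have "\<exists>q. q \<in> fI N I m \<and> cmp m p - q \<in> Lam N k d {m}" for m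
    using cov_low[OF gI cov k cmp_forms[OF p]] by blast
  then have "\<forall>m. \<exists>q. q \<in> fI N I m \<and> cmp m p - q \<in> Lam N k d {m}" by blast
  from choice[OF this] obtain q where q: "\<And>m. q m \<in> fI N I m \<and> cmp m p - q m \<in> Lam N k d {m}" by blast
  have "(\<Sum>m\<in>degs p. q m) \<in> I" by (rule subgrp_sum[OF gidealD(2)[OF gI]]) (use q in blast)
  moreover have "(\<Sum>m\<in>degs p. cmp m p - q m) \<in> Lam N k d UNIV"
    by (rule subgrp_sum[OF subgrp_Lam]) (use q in \<open>auto simp: Lam_def intro: forms_UNIV\<close>)
  then have "p - (\<Sum>m\<in>degs p. q m) \<in> Lam N k d UNIV"
    using sum_cmp[OF finite_degs order_refl, of p] by (simp add: sum_subtractf)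
  ultimately show ?thesis by blast
qed

lemma cmp_monid: "p \<in> monid N k UNIV \<Longrightarrow> cmp m p \<in> monid N k {m}"
  by (auto simp: monid_def cmp_def keys_pres cmp_forms[unfolded cmp_def])

lemma monid_decomp_UNIV:
  fixes p :: "'k::comm_ring_1 mpoly"
  assumes p: "p \<in> monid N k UNIV" and k: "k \<le> Suc N"
  shows "\<exists>z. (\<forall>j. z j \<in> forms {..N} UNIV) \<and> p = (\<Sum>j<k. Xv j * z j)"
proof -
  have "\<forall>m. \<exists>z. (\<forall>j. z j \<in> fP N (m - 1)) \<and> cmp m p = (\<Sum>j<k. Xv j * z j)"
    using monid_decomp[OF cmp_monid[OF p] k] by blast
  from choice[OF this] obtain z where z: "\<And>m. (\<forall>j. z m j \<in> fP N (m - 1)) \<and> cmp m p = (\<Sum>j<k. Xv j * z m j)" by blast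
  have "p = (\<Sum>m\<in>degs p. \<Sum>j<k. Xv j * z m j)" using sum_cmp[OF finite_degs order_refl, of p] z by simp
  also have "\<dots> = (\<Sum>j<k. Xv j * (\<Sum>m\<in>degs p. z m j))" unfolding sum_distrib_left by (rule sum.swap)
  finally have "p = (\<Sum>j<k. Xv j * (\<Sum>m\<in>degs p. z m j))" .
  moreover have "(\<Sum>m\<in>degs p. z m j) \<in> forms {..N} UNIV" for j
    by (rule subgrp_sum[OF subgrp_forms]) (use z in \<open>auto intro: forms_UNIV\<close>)
  ultimately show ?thesis by (intro exI[of _ "\<lambda>j. \<Sum>m\<in>degs p. z m j"]) simp
qed

lemma Xv_mult_monid: "i < k \<Longrightarrow> k \<le> Suc N \<Longrightarrow> a \<in> forms {..N} UNIV \<Longrightarrow> Xv i * a \<in> monid N k UNIV"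
  using forms_U_mult[OF forms_UNIV[OF forms_Xv[of i "{..N}"]], of a]
  by (auto simp: monid_def Xv_def keys_times_single mkeys_add)

text \<open>Over \<open>k[x\<^sub>0, \<dots>, x\<^sub>n]\<close> the quotient \<open>R/I\<close> is free on the monomials of degree less than \<open>d\<close> in
  the other variables, so that \<open>x\<^sub>0, \<dots>, x\<^sub>n\<close> is regular on it.\<close>

lemma variable_nonzerodivisor:
  fixes I :: "'k::field mpoly set"
  assumes gI: "gideal N I" and n: "n \<le> N" and cov: "cov N (Suc n) I (int d)"
    and Z: "\<And>p. p \<in> I \<Longrightarrow> p \<in> Lam N (Suc n) d UNIV \<Longrightarrow> p = 0"
    and k: "k \<le> n" and g: "g \<in> forms {..N} UNIV"
    and Xg: "Xv k * g = q0 + j0" "q0 \<in> I" "j0 \<in> monid N k UNIV"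
  obtains q j where "g = q + j" "q \<in> I" "j \<in> monid N k UNIV"
proof -
  let ?L = "Lam N (Suc n) d UNIV"
  let ?A = "{t. \<exists>i<k. i \<in> mkeys t}"
  have nN: "Suc n \<le> Suc N" using n by simp
  note low = cov_low_UNIV[OF gI cov nN]
  note I = subgrpD[OF gidealD(2)[OF gI]] and L = subgrpD[OF subgrp_Lam] and M = subgrpD[OF subgrp_monid]
  from low[OF g] obtain q where q: "q \<in> I" "g - q \<in> ?L" by blast
  \<comment> \<open>The terms of the normal form divisible by an earlier variable are already in the
    ideal; it remains to show that the others, \<open>l2\<close>, vanish.\<close>
  define l1 where "l1 = pres ?A (g - q)"
  define l2 where "l2 = pres (- ?A) (g - q)"
  have gq: "g = q + l1 + l2" using pres_split[of "g - q" ?A] by (simp add: l1_def l2_def algebra_simps)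
  have l1: "l1 \<in> monid N k UNIV" using q(2) by (auto simp: l1_def monid_def Lam_def keys_pres intro!: forms_pres)
  have l2: "l2 \<in> ?L" using q(2) by (auto simp: l2_def Lam_def keys_pres intro!: forms_pres)
  have X: "Xv k \<in> forms {..N} UNIV" using forms_UNIV[OF forms_Xv[of k "{..N}"]] k n by simp
  have "j0 - Xv k * l1 \<in> monid N k UNIV" by (rule M(2)[OF Xg(3) uideal_mult[OF uideal_monid X l1]])
  from monid_decomp_UNIV[OF this] k n obtain z
    where z: "\<And>j. z j \<in> forms {..N} UNIV" "j0 - Xv k * l1 = (\<Sum>j<k. Xv j * z j)" by auto
  have "\<forall>j. \<exists>r. r \<in> I \<and> z j - r \<in> ?L" using low[OF z(1)] by blast
  from choice[OF this] obtain r where r: "\<And>j. r j \<in> I \<and> z j - r j \<in> ?L" by blast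
  \<comment> \<open>Replacing the \<open>z j\<close> by normal forms puts \<open>x_k l2 - s\<close>
    into \<open>Lam\<close> as well as into \<open>I\<close>, where it must be zero.\<close>
  define s where "s = (\<Sum>j<k. Xv j * (z j - r j))"
  have sL: "s \<in> ?L" unfolding s_def
    by (rule subgrp_sum[OF subgrp_Lam]) (use r k n in \<open>auto intro!: Lam_mulX_U\<close>)
  have sM: "s \<in> monid N k UNIV" unfolding s_def
    by (rule subgrp_sum[OF subgrp_monid]) (use r k n in \<open>auto simp: Lam_def intro!: Xv_mult_monid\<close>)
  have "Xv k * l2 = (q0 - Xv k * q) + (j0 - Xv k * l1)" using Xg(1) unfolding gq by (simp add: algebra_simps)
  then have eq: "Xv k * l2 - s = (q0 - Xv k * q) + (\<Sum>j<k. Xv j * r j)"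
    unfolding z(2) s_def by (simp add: algebra_simps sum_subtractf)
  have "(\<Sum>j<k. Xv j * r j) \<in> I"
    by (rule subgrp_sum[OF gidealD(2)[OF gI]]) (use r k n in \<open>auto intro!: gidealD(3)[OF gI] forms_UNIV[OF forms_Xv]\<close>)
  then have "Xv k * l2 - s \<in> I" unfolding eq using I(2)[OF Xg(2) gidealD(3)[OF gI X q(1)]] by (intro I(4))
  moreover have "Xv k * l2 - s \<in> ?L" by (rule L(2)[OF Lam_mulX_U sL]) (use k n l2 in auto)
  ultimately have s: "Xv k * l2 = s" using Z[of "Xv k * l2 - s"] by simp
  \<comment> \<open>Every monomial of \<open>s\<close> contains some \<open>x_i\<close> with
    \<open>i < k\<close>, while no monomial of \<open>x_k l2\<close> does.\<close>
  have "l2 = 0"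
  proof (rule ccontr)
    assume "l2 \<noteq> 0"
    then obtain t where t: "t \<in> mkeys l2" using mkeys_empty[of l2] by blast
    then have "sng k 1 + t \<in> mkeys s" unfolding s[symmetric] by (simp add: Xv_def keys_times_single)
    then obtain i where "i < k" "i \<in> mkeys (sng k 1 + t)" using sM by (auto simp: monid_def)
    then have "\<exists>i<k. i \<in> mkeys t" by (auto simp: mkeys_add)
    with t show False by (auto simp: l2_def keys_pres)
  qed
  with gq q(1) l1 show ?thesis using that by simp
qed

section \<open>The variables as a regular sequence\<close>

definition quotU :: "nat \<Rightarrow> 'k::comm_ring_1 mpoly set \<Rightarrow> nat \<Rightarrow> 'k mpoly set" where
  "quotU N I k = {q + j | q j. q \<in> I \<and> j \<in> monid N k UNIV}"

lemma regular_variables: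
  fixes I :: "'k::field mpoly set"
  assumes gI: "gideal N I" and n: "n \<le> N" and I0: "\<And>g. g \<in> I \<Longrightarrow> g \<in> fP N 0 \<Longrightarrow> g = 0"
    and reg: "\<And>k g. k \<le> n \<Longrightarrow> g \<in> forms {..N} UNIV \<Longrightarrow> Xv k * g \<in> quotU N I k \<Longrightarrow> g \<in> quotU N I k"
  shows "regular_sequence N I (map Xv [0..<Suc n])"
proof -
  let ?fs = "map Xv [0..<Suc n] :: 'k mpoly list"
  have len: "length ?fs = Suc n" by simp
  have nth: "?fs ! i = Xv i" if "i < Suc n" for i using that by (simp del: upt_Suc)
  have ip: "ideal_plus N I (take k ?fs) = quotU N I k" if k: "k \<le> Suc n" for k
  proof -
    have kl: "k \<le> length ?fs" using k len by simp
    have s: "(\<Sum>i<k. c i * ?fs ! i) = (\<Sum>i<k. Xv i * c i)" for c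
      using k by (intro sum.cong refl) (simp add: nth mult.commute del: upt_Suc)
    show ?thesis unfolding ideal_plus_take[OF kl] s quotU_def
    proof (intro equalityI subsetI)
      fix x assume "x \<in> {g + (\<Sum>i<k. Xv i * c i) | g c. g \<in> I \<and> (\<forall>i. c i \<in> poly_ring N)}"
      then obtain g c where x: "x = g + (\<Sum>i<k. Xv i * c i)" "g \<in> I" "\<forall>i. c i \<in> poly_ring N" by blast
      have "(\<Sum>i<k. Xv i * c i) \<in> monid N k UNIV"
        by (rule subgrp_sum[OF subgrp_monid]) (use x(3) k n in \<open>auto simp: poly_ring_forms intro!: Xv_mult_monid\<close>)
      with x(1,2) show "x \<in> {q + j | q j. q \<in> I \<and> j \<in> monid N k UNIV}" by blast
    next
      fix x assume "x \<in> {q + j | q j. q \<in> I \<and> j \<in> monid N k UNIV}"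
      then obtain q j where x: "x = q + j" "q \<in> I" "j \<in> monid N k UNIV" by blast
      from monid_decomp_UNIV[OF x(3)] k n obtain z
        where "\<forall>j. z j \<in> forms {..N} UNIV" "j = (\<Sum>i<k. Xv i * z i)" by auto
      with x show "x \<in> {g + (\<Sum>i<k. Xv i * c i) | g c. g \<in> I \<and> (\<forall>i. c i \<in> poly_ring N)}"
        unfolding poly_ring_forms by blast
    qed
  qed
  show ?thesis unfolding regular_sequence_def
  proof (intro conjI allI ballI impI)
    fix f assume "f \<in> set ?fs"
    then obtain i where "i < Suc n" "f = Xv i" unfolding set_map set_upt by auto
    then show "f \<in> poly_ring N" "const_coeff f = 0"
      using forms_UNIV[OF forms_Xv[of i "{..N}"]] n by (auto simp: poly_ring_forms)
  next
    fix k g assume k: "k < length ?fs" and g: "g \<in> poly_ring N" and h: "?fs ! k * g \<in> ideal_plus N I (take k ?fs)"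
    have k': "k \<le> n" "k < Suc n" "k \<le> Suc n" using k len by auto
    show "g \<in> ideal_plus N I (take k ?fs)"
      using reg[OF k'(1)] g h unfolding ip[OF k'(3)] nth[OF k'(2)] poly_ring_forms by blast
  next
    have "ideal_plus N I ?fs = quotU N I (Suc n)" using ip[of "Suc n"] len by (simp only: take_all order_refl)
    moreover have "(1 :: 'k mpoly) \<notin> quotU N I (Suc n)"
    proof
      assume "1 \<in> quotU N I (Suc n)"
      then obtain q j where qj: "1 = q + j" "q \<in> I" "j \<in> monid N (Suc n) UNIV" by (auto simp: quotU_def)
      have one: "(1 :: 'k mpoly) \<in> fP N 0" using forms_const[of "{0}" 1 "{..N}"] by simp
      \<comment> \<open>An element of the ideal of variables has no constant term, so the degree 0
        component would put \<open>1\<close> into \<open>I\<close>.\<close>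
      have "mkeys (cmp 0 j) = {}" using qj(3) by (auto simp: cmp_def keys_pres monid_def)
      then have "cmp 0 j = 0" by (simp only: mkeys_empty)
      then have "cmp 0 q = 1" using cmp_forms_same[OF one] cmp_add[of 0 q j] qj(1) by simp
      with gidealD(4)[OF gI qj(2), of 0] I0 one show False by force
    qed
    moreover have "(1 :: 'k mpoly) \<in> poly_ring N" using forms_const[of UNIV 1 "{..N}"] by (simp add: poly_ring_forms)
    ultimately show "ideal_plus N I ?fs \<noteq> poly_ring N" by blast
  qed
qed

section \<open>Koszul homology off the linear strand\<close>

definition quotG :: "nat \<Rightarrow> 'k::comm_ring_1 mpoly set \<Rightarrow> nat \<Rightarrow> int \<Rightarrow> 'k mpoly set" where
  "quotG N I k m = {q + j | q j. q \<in> fI N I m \<and> j \<in> monid N k {m}}"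

lemma subgrp_plus: assumes "subgrp A" "subgrp B" shows "subgrp {a + b | a b. a \<in> A \<and> b \<in> B}"
  unfolding subgrp_def
proof (intro conjI ballI)
  show "0 \<in> {a + b | a b. a \<in> A \<and> b \<in> B}" using subgrpD(1)[OF assms(1)] subgrpD(1)[OF assms(2)] by force
  fix x y assume "x \<in> {a + b | a b. a \<in> A \<and> b \<in> B}" "y \<in> {a + b | a b. a \<in> A \<and> b \<in> B}"
  then obtain a b c d where "x = a + b" "y = c + d" "a \<in> A" "b \<in> B" "c \<in> A" "d \<in> B" by blast
  then have "x - y = (a - c) + (b - d)" "a - c \<in> A" "b - d \<in> B"
    using subgrpD(2)[OF assms(1)] subgrpD(2)[OF assms(2)] by (simp_all add: algebra_simps)
  then show "x - y \<in> {a + b | a b. a \<in> A \<and> b \<in> B}" by blast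
qed

text \<open>Peeling off the regular variables leaves the Koszul complex of
  \<open>R/(I + (x_0, ..., x_n))\<close> on the remaining ones. This ring vanishes from degree
  \<open>d\<close> on, and the coefficients of an \<open>(i+1)\<close>-chain have degree
  \<open>m - (i+1) \<ge> d\<close>, so every chain is zero modulo the ideal.\<close>

lemma kz_above_strand:
  fixes I :: "'k::field mpoly set"
  assumes gI: "gideal N I" and n: "n \<le> N" and cov: "cov N (Suc n) I (int d)"
    and reg: "\<And>k g. k \<le> n \<Longrightarrow> g \<in> forms {..N} UNIV \<Longrightarrow> Xv k * g \<in> quotU N I k \<Longrightarrow> g \<in> quotU N I k"
    and m: "m \<ge> int (Suc i) + int d"
  shows "kz N I (Suc i) m"
proof -
  have sgI: "subgrp (fI N I m)" for m by (rule subgrp_Int[OF gidealD(2)[OF gI] subgrp_forms])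
  have sg: "subgrp (quotG N I k m)" for k m unfolding quotG_def by (rule subgrp_plus[OF sgI subgrp_monid])
  have GP: "quotG N I k m \<subseteq> fP N m" for k m
    by (auto simp: quotG_def monid_def intro: formsI(4))
  have GX: "Xv j * a \<in> quotG N I k (m + 1)" if j: "j \<le> N" and a: "a \<in> quotG N I k m" for j a k m
  proof -
    from a obtain q b where qb: "a = q + b" "q \<in> fI N I m" "b \<in> monid N k {m}" unfolding quotG_def by blast
    have "Xv j * a = Xv j * q + Xv j * b" by (simp add: qb(1) distrib_left)
    with Xv_mult_fI[OF gI j qb(2)] monid_mulX[OF j qb(3)] show ?thesis unfolding quotG_def by blast
  qed
  have "KH0 mulX {k..N} one_wt (fP N) (quotG N I k) (Suc i) m" if "k \<le> Suc n" for k
    using that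
  proof (induction rule: inc_induct)
    case base
    have "z \<in> chn {Suc n..N} one_wt (quotG N I (Suc n)) (Suc i) m" if z: "z \<in> chn {Suc n..N} one_wt (fP N) (Suc i) m" for z
      unfolding chn_def
    proof (intro CollectI allI)
      fix S
      show "S \<subseteq> {Suc n..N} \<and> card S = Suc i \<and> z S \<in> quotG N I (Suc n) (m - sum one_wt S) \<or> z S = 0"
      proof (cases "z S = 0")
        case False
        with chnD[OF z, of S] have S: "S \<subseteq> {Suc n..N}" "card S = Suc i" "z S \<in> fP N (m - sum one_wt S)" by auto
        define s where "s = m - sum one_wt S"
        have zs: "z S \<in> fP N s" using S(3) by (simp add: s_def)
        have "s \<ge> int d" using S(2) m by (simp add: s_def)
        with cov zs obtain b where b: "\<And>i. i < Suc n \<Longrightarrow> b i \<in> fP N (s - 1)" "z S - (\<Sum>i<Suc n. Xv i * b i) \<in> I"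
          unfolding cov_def by blast
        have mon: "(\<Sum>i<Suc n. Xv i * b i) \<in> monid N (Suc n) {s}"
        proof (rule subgrp_sum[OF subgrp_monid])
          fix i assume i: "i \<in> {..<Suc n}"
          have "Xv i * b i \<in> fP N s" using mulX_fP[of i N "b i" "s - 1"] b(1)[of i] i n by auto
          moreover have "Xv i * b i \<in> monid N (Suc n) UNIV"
            by (rule Xv_mult_monid) (use i n b(1)[of i] in \<open>auto intro: forms_UNIV\<close>)
          ultimately show "Xv i * b i \<in> monid N (Suc n) {s}" by (auto simp: monid_def)
        qed
        then have "z S - (\<Sum>i<Suc n. Xv i * b i) \<in> fI N I s"
          using b(2) formsI(2)[OF zs] by (auto simp: monid_def)
        with mon have "(z S - (\<Sum>i<Suc n. Xv i * b i)) + (\<Sum>i<Suc n. Xv i * b i) \<in> quotG N I (Suc n) s"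
          unfolding quotG_def by blast
        with S(1,2) show ?thesis by (simp add: s_def)
      qed simp
    qed
    moreover have "kd mulX {Suc n..N} (0 :: nat set \<Rightarrow> 'k mpoly) = 0" by (rule kops.kd_zero[OF kops_mulX]) simp
    ultimately show ?case unfolding KH0_def by (intro ballI impI bexI[of _ 0]) simp_all
  next
    case (step k)
    then have k: "k \<le> n" by simp
    have ins: "{k..N} = insert k {Suc k..N}" using k n by auto
    have Q: "(\<lambda>m. {q + Xv k * p | q p. q \<in> quotG N I k m \<and> p \<in> fP N (m - one_wt k)}) = quotG N I (Suc k)"
    proof (intro ext equalityI subsetI)
      fix m and x :: "'k mpoly" assume "x \<in> {q + Xv k * p | q p. q \<in> quotG N I k m \<and> p \<in> fP N (m - one_wt k)}"
      then obtain q j p where x: "x = q + (j + Xv k * p)" "q \<in> fI N I m" "j \<in> monid N k {m}" "p \<in> fP N (m - 1)"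
        unfolding quotG_def mem_Collect_eq by (elim exE conjE) (simp only: add.assoc)
      have "j + Xv k * p \<in> monid N (Suc k) {m}" using x(3,4) k n by (subst monid_Suc) auto
      with x(1,2) show "x \<in> quotG N I (Suc k) m" unfolding quotG_def by blast
    next
      fix m and x :: "'k mpoly" assume "x \<in> quotG N I (Suc k) m"
      then obtain q j where x: "x = q + j" "q \<in> fI N I m" "j \<in> monid N (Suc k) {m}" unfolding quotG_def by blast
      have "k \<le> N" using k n by simp
      from x(3)[unfolded monid_Suc[OF this]] obtain b p where "j = b + Xv k * p" "b \<in> monid N k {m}" "p \<in> fP N (m - 1)"
        by blast
      with x have "x = (q + b) + Xv k * p" "q + b \<in> quotG N I k m" "p \<in> fP N (m - one_wt k)"
        unfolding quotG_def by (simp only: add.assoc, blast, simp)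
      then show "x \<in> {q + Xv k * p | q p. q \<in> quotG N I k m \<and> p \<in> fP N (m - one_wt k)}" by blast
    qed
    show ?case unfolding ins
    proof (rule KH0_regular)
      show "kmod mulX (insert k {Suc k..N}) one_wt (fP N) (quotG N I k)"
        by (rule kmod_mulX[OF _ sg GP GX]) (use k n in auto)
      show "k \<notin> {Suc k..N}" by simp
      show "KH0 mulX {Suc k..N} one_wt (fP N) (\<lambda>m. {q + Xv k * p | q p. q \<in> quotG N I k m \<and> p \<in> fP N (m - one_wt k)}) (Suc i) m"
        unfolding Q by (rule step.IH)
      fix g m assume g: "g \<in> fP N m" and Xg: "Xv k * g \<in> quotG N I k (m + one_wt k)"
      obtain b c where bc: "Xv k * g = b + c" "b \<in> fI N I (m + 1)" "c \<in> monid N k {m + 1}"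
        using Xg unfolding quotG_def by blast
      have "c \<in> monid N k UNIV" using bc(3) forms_UNIV[of c "{..N}" "{m + 1}"] unfolding monid_def by simp
      then have "Xv k * g \<in> quotU N I k" using bc(1,2) unfolding quotU_def by blast
      from reg[OF k forms_UNIV[OF g] this] obtain q j where qj: "g = q + j" "q \<in> I" "j \<in> monid N k UNIV"
        unfolding quotU_def by blast
      have "g = cmp m q + cmp m j" using cmp_forms_same[OF g] by (simp add: qj(1) cmp_add)
      moreover have "cmp m q \<in> fI N I m" using gidealD(4)[OF gI qj(2)] cmp_forms[OF gidealD(1)[OF gI qj(2)]] by blast
      ultimately show "g \<in> quotG N I k m" using cmp_monid[OF qj(3)] unfolding quotG_def by blast
    qed
  qed
  from this[of 0] have "KH0 mulX {0..N} one_wt (fP N) (quotG N I 0) (Suc i) m" by simp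
  moreover have "quotG N I 0 m = fI N I m" for m
  proof -
    have "p = 0" if "p \<in> monid N 0 {m}" for p :: "'k mpoly"
      using that mkeys_empty[of p] by (auto simp: monid_def)
    then have "monid N 0 {m} = {0 :: 'k mpoly}" using subgrpD(1)[OF subgrp_monid, of N 0 "{m}"] by blast
    then show ?thesis unfolding quotG_def by (simp add: Int_def)
  qed
  then have "quotG N I 0 = fI N I" by (rule ext)
  moreover have "{0..N} = {..N}" by auto
  ultimately show ?thesis unfolding kz_def by simp
qed

text \<open>The boundary has coefficients of degree \<open>m - i < d\<close>, where \<open>I\<close>
  is zero. So a cycle modulo \<open>I\<close> is a cycle over \<open>R\<close>, and
  \<open>koszul_acyclic\<close> applies.\<close>

lemma kz_below_strand:
  fixes I :: "'k::field mpoly set"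
  assumes gI: "gideal N I" and Z: "\<And>c f. f \<in> fI N I c \<Longrightarrow> c < int d \<Longrightarrow> f = 0" and m: "m < int i + int d"
  shows "kz N I (Suc i) m"
  unfolding kz_def KH0_def
proof (intro ballI impI)
  fix z assume z: "z \<in> chn {..N} one_wt (fP N) (Suc i) m"
    and dz: "kd mulX {..N} z \<in> chn {..N} one_wt (fI N I) (Suc i - 1) m"
  have "kd mulX {..N} z S = 0" for S
  proof (rule ccontr)
    assume "kd mulX {..N} z S \<noteq> 0"
    with chnD[OF dz, of S] have "card S = i" and h: "kd mulX {..N} z S \<in> fI N I (m - sum one_wt S)" by auto
    then have "m - sum one_wt S < int d" using m by simp
    from Z[OF h this] \<open>kd mulX {..N} z S \<noteq> 0\<close> show False by simp
  qed
  then have "kd mulX {..N} z \<in> chn {..N} one_wt (\<lambda>_. {0}) (Suc i - 1) m" by (auto simp: chn_def)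
  with koszul_acyclic[of N i m, where 'k = 'k] z obtain v
    where v: "v \<in> chn {..N} one_wt (fP N) (Suc (Suc i)) m" "z - kd mulX {..N} v \<in> chn {..N} one_wt (\<lambda>_. {0}) (Suc i) m"
    unfolding KH0_def by blast
  have "chn {..N} one_wt (\<lambda>_. {0}) (Suc i) m \<subseteq> chn {..N} one_wt (fI N I) (Suc i) m"
    by (rule chn_mono) (use subgrpD(1)[OF subgrp_Int[OF gidealD(2)[OF gI] subgrp_forms]] in auto)
  with v show "\<exists>v\<in>chn {..N} one_wt (fP N) (Suc (Suc i)) m. z - kd mulX {..N} v \<in> chn {..N} one_wt (fI N I) (Suc i) m" by blast
qed

text \<open>Both conclusions rest on \<open>I \<inter> Lam = 0\<close>: freeness of
  \<open>R/I\<close> over the first variables gives regularity, and since all forms of degree below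
  \<open>d\<close> lie in \<open>Lam\<close>, the ideal has none. Vanishing above and below then
  leaves only the degrees \<open>i + d\<close>.\<close>

lemma extremal_multiplicity:
  fixes I :: "'k::field mpoly set"
  assumes gI: "gideal N I" and cov: "cov N (Suc n) I (int d)" and n: "n \<le> N"
    and ev: "ev_const ((dl ^^ n) (hf N I)) (\<Sum>a<d. int (mcf (N - n) a))"
    and I0: "\<And>g. g \<in> I \<Longrightarrow> g \<in> fP N 0 \<Longrightarrow> g = 0"
  shows "regular_sequence N I (map Xv [0..<Suc n])" "m \<noteq> int i + int d \<Longrightarrow> kz N I (Suc i) m"
proof -
  note Z = fI_Int_Lam[OF gI cov n ev]
  have reg: "g \<in> quotU N I k" if kg: "k \<le> n" "g \<in> forms {..N} UNIV" "Xv k * g \<in> quotU N I k" for k g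
  proof -
    from kg(3) obtain q j where qj: "Xv k * g = q + j" "q \<in> I" "j \<in> monid N k UNIV" unfolding quotU_def by blast
    obtain q' j' where "g = q' + j'" "q' \<in> I" "j' \<in> monid N k UNIV"
      by (rule variable_nonzerodivisor[OF gI n cov Lam_UNIV[OF gI Z] kg(1,2) qj])
    then show ?thesis unfolding quotU_def by blast
  qed
  show "regular_sequence N I (map Xv [0..<Suc n])" by (rule regular_variables[OF gI n I0 reg])
  assume m: "m \<noteq> int i + int d"
  show "kz N I (Suc i) m"
  proof (cases "m < int i + int d")
    case True
    show ?thesis
    proof (rule kz_below_strand[OF gI _ True])
      fix c and f :: "'k mpoly" assume f: "f \<in> fI N I c" and c: "c < int d"
      have "ydeg (Suc n) t < d" if "t \<in> mkeys f" for t
        using f c ydeg_le[of "Suc n" t] that by (auto simp: forms_def)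
      with f show "f = 0" by (intro Z) (auto simp: Lam_def)
    qed
  next
    case False
    with m show ?thesis by (intro kz_above_strand[OF gI n cov reg]) auto
  qed
qed

section \<open>Cohen-Macaulay ideals with linear resolution\<close>

text \<open>Differences are undone by summing upwards from the negative degrees, where everything
  vanishes.\<close>

lemma eq_0_from_below:
  assumes "\<And>m. m < 0 \<Longrightarrow> f m = 0" "\<And>m. m < b \<Longrightarrow> (dl ^^ e) f m = 0" "m < b"
  shows "f m = 0"
  using assms
proof (induction e arbitrary: f m)
  case (Suc e)
  have 1: "dl f m = 0" if "m < 0" for m using that Suc.prems(1) by (simp add: dl_def)
  have 2: "(dl ^^ e) (dl f) m = 0" if "m < b" for m using Suc.prems(2)[OF that] by (simp only: funpow_Suc_right comp_apply)
  have D: "dl f m = 0" if "m < b" for m by (rule Suc.IH[of "dl f" m, OF 1 2 that])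
  have f: "f m = f (m - 1)" if "m < b" for m using D[OF that] by (simp add: dl_def)
  have "f (int k) = 0" if "int k < b" for k
    using that
  proof (induction k)
    case 0 then show ?case using f[of 0] Suc.prems(1)[of "-1"] by simp
  next
    case (Suc k) then show ?case using f[of "int (Suc k)"] by simp
  qed
  from this[of "nat m"] Suc.prems(1,3) show ?case by (cases "m < 0") auto
qed simp

text \<open>Differences are undone downwards from large degrees. As the difference at
  \<open>m\<close> involves \<open>m - 1\<close>, each of the \<open>e\<close> steps gains one
  degree, from \<open>b + e\<close> down to \<open>b\<close>.\<close>

lemma eq_0_from_above:
  assumes "ev_const f 0" "\<And>m. m \<ge> b + int e \<Longrightarrow> (dl ^^ e) f m = 0" "m \<ge> b"
  shows "f m = 0"
  using assms
proof (induction e arbitrary: f b m)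
  case (Suc e)
  have D: "dl f m = 0" if "m \<ge> b + 1" for m
  proof (rule Suc.IH[of "dl f" "b + 1" m, OF ev_const_dl[OF Suc.prems(1)] _ that])
    fix m assume "b + 1 + int e \<le> m"
    then have "(dl ^^ Suc e) f m = 0" by (intro Suc.prems(2)) simp
    then show "(dl ^^ e) (dl f) m = 0" by (simp only: funpow_Suc_right comp_apply)
  qed
  have f: "f (m - 1) = f m" if "m \<ge> b + 1" for m using D[OF that] by (simp add: dl_def)
  have step: "f m = f (m + int k)" if "m \<ge> b" for m k
  proof (induction k)
    case (Suc k)
    have "f (m + int (Suc k) - 1) = f (m + int (Suc k))" by (rule f) (use that in simp)
    moreover have "m + int (Suc k) - 1 = m + int k" by simp
    ultimately show ?case using Suc.IH by simp
  qed simp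
  obtain m0 where m0: "\<And>m. m \<ge> m0 \<Longrightarrow> f m = 0" using Suc.prems(1) by (auto simp: ev_const_def)
  show ?case using step[OF Suc.prems(3), of "nat (m0 - m)"] m0[of "m + int (nat (m0 - m))"] by simp
qed simp

text \<open>The numerator of the Hilbert series is 1 in degree 0 and otherwise confined to degrees
  from \<open>d\<close> to \<open>d + e - 1\<close>: homology of index \<open>i + 1\<close> sits in
  degree \<open>i + d\<close>, and depth forces \<open>i < e\<close>. Hence the
  \<open>(n+1)\<close>-th difference \<open>r\<close> agrees with the Hilbert function of a
  polynomial ring in \<open>e\<close> variables below \<open>d\<close> and vanishes from
  \<open>d\<close> on; its sum is the degree.\<close>

lemma linear_strand_multiplicity:
  fixes I :: "'k::field mpoly set"
  assumes gI: "gideal N I" and I0: "\<And>g. g \<in> I \<Longrightarrow> g \<in> fP N 0 \<Longrightarrow> g = 0"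
    and n: "N = n + e" and d: "d \<ge> 1"
    and reg: "regular_sequence N I fs" "length fs \<ge> Suc n"
    and lin: "\<And>i m. m \<noteq> int i + int d \<Longrightarrow> kz N I (Suc i) m"
    and ev: "ev_const ((dl ^^ n) (hf N I)) \<delta>"
  shows "\<delta> = (\<Sum>a<d. int (mcf e a))"
proof -
  \<comment> \<open>Auslander-Buchsbaum in Koszul form: depth at least \<open>n + 1\<close> leaves
    no homology beyond index \<open>e\<close>.\<close>
  have high: "kz N I (Suc i) m" if "i \<ge> e" for i m
    by (rule ukz_kz[OF gI regular_sequence_ukz[OF gideal_uideal[OF gI] reg(1)]]) (use that reg(2) n in simp)
  define u where "u = (dl ^^ n) (hf N I)"
  define r where "r = dl u"
  have h: "(dl ^^ Suc N) (hf N I) = (dl ^^ e) r"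
    using funpow_add[of e "Suc n" dl] by (simp add: n r_def u_def add.commute)
  have h0: "(dl ^^ e) r m = 0" if "m \<noteq> 0" "m < int d \<or> m \<ge> int d + int e" for m
    unfolding h[symmetric]
  proof (rule hf_difference[OF gI that(1)])
    fix i show "kz N I (Suc i) m"
      using lin[of m i] high[of i m] that(2) by (cases "m = int i + int d") auto
  qed
  have neg: "(dl ^^ k) (hf N I) m = 0" if "m < 0" for k m
    unfolding dlp_binomial by (rule sum.neutral) (use that in \<open>auto intro!: hf_neg\<close>)
  have u_neg: "u m = 0" and r_neg: "r m = 0" if "m < 0" for m
    using neg[OF that, of n] neg[OF that, of "Suc n"] by (simp_all add: u_def r_def)
  have hf0: "hf N I 0 = 1"
  proof -
    have "fI N I 0 = {0}" using I0 subgrpD(1)[OF subgrp_Int[OF gidealD(2)[OF gI] subgrp_forms]] by blast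
    moreover have "int (ps.dim (fP N 0 :: 'k mpoly set)) = Dm (Suc N) 0" using dim_forms(2)[of "{..N}" 0, where 'k = 'k] by simp
    ultimately show ?thesis by (simp add: hf_def Dm_def)
  qed
  have one: "(dl ^^ Suc N) (hf N I) 0 = 1"
  proof -
    have "(dl ^^ Suc N) (hf N I) 0 = (\<Sum>i\<in>{0}. (-1) ^ i * int (Suc N choose i) * hf N I (0 - int i))"
      unfolding dlp_binomial by (rule sum.mono_neutral_right) (auto intro: hf_neg)
    then show ?thesis by (simp add: hf0)
  qed
  have DmE: "(dl ^^ e) (Dm e) m = (if m = 0 then 1 else 0)" for m
  proof -
    have "(dl ^^ e) (Dm e) = Dm 0" using dl_pow_Dm[of e 0] by simp
    moreover have "Dm 0 m = (if m = 0 then 1 else 0)"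
    proof (cases "m > 0")
      case True
      then obtain k where "nat m = Suc k" by (cases "nat m") auto
      with True show ?thesis by (simp add: Dm_def)
    qed (auto simp: Dm_def)
    ultimately show ?thesis by simp
  qed
  have low: "r m = Dm e m" if "m < int d" for m
  proof -
    have "(\<lambda>m. r m - Dm e m) m = 0"
    proof (rule eq_0_from_below[OF _ _ that])
      show "r m - Dm e m = 0" if "m < 0" for m using that r_neg by (simp add: Dm_def)
      show "(dl ^^ e) (\<lambda>m. r m - Dm e m) m = 0" if "m < int d" for m
        unfolding dlp_diff DmE using h0[of m] one that unfolding h by auto
    qed
    then show ?thesis by simp
  qed
  have "ev_const r 0" unfolding r_def u_def by (rule ev_const_dl[OF ev])
  from eq_0_from_above[OF this, of "int d" e] h0 d have high0: "r m = 0" if "m \<ge> int d" for m using that by auto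
  have u: "u (int k - 1) = (\<Sum>j<k. r (int j))" for k
  proof (induction k)
    case (Suc k) then show ?case by (simp add: r_def dl_def)
  qed (simp add: u_neg)
  obtain m0 where m0: "\<And>m. m \<ge> m0 \<Longrightarrow> u m = \<delta>" using ev by (auto simp: ev_const_def u_def)
  define k where "k = max d (nat (m0 + 1))"
  have "\<delta> = (\<Sum>j<k. r (int j))" using m0[of "int k - 1"] u[of k] by (simp add: k_def)
  also have "\<dots> = (\<Sum>j<d. r (int j))"
    by (rule sum.mono_neutral_right) (auto simp: k_def high0)
  also have "\<dots> = (\<Sum>a<d. int (mcf e a))" by (rule sum.cong) (auto simp: low Dm_def)
  finally show ?thesis .
qed

section \<open>Hilbert polynomial, Betti numbers and the vanishing ideal\<close>

lemma ev_poly_hf: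
  fixes I :: "'k::field mpoly set"
  assumes gI: "gideal N I" shows "ev_poly (hf N I) (hilbert_poly N I)"
proof -
  obtain F where F: "graded_free_resolution N I F" using graded_free_resolution_exists[OF gI] by blast
  interpret gres N I F by standard (rule gI, rule F)
  have "\<forall>i. \<exists>m0. \<forall>m\<ge>m0. kz N I (Suc i) m" by (intro allI kz_large)
  then have "\<exists>f. \<forall>i. \<forall>m\<ge>f i. kz N I (Suc i) m" by (rule choice)
  then obtain f where f: "\<forall>i. \<forall>m\<ge>f i. kz N I (Suc i) m" by (rule exE)
  \<comment> \<open>A common threshold for the indices that matter, with 1 added to stay clear of
    degree 0; beyond it the \<open>(N+1)\<close>-th difference vanishes, so the Hilbert function is
    eventually polynomial.\<close>
  define M where "M = 1 + (\<Sum>i\<le>N. \<bar>f i\<bar>)"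
  have "(dl ^^ Suc N) (hf N I) m = 0" if "m \<ge> M" for m
  proof (rule hf_difference[OF gI])
    have "0 \<le> (\<Sum>i\<le>N. \<bar>f i\<bar>)" by (rule sum_nonneg) simp
    with that show "m \<noteq> 0" unfolding M_def by linarith
    fix i assume "i \<le> N"
    then have "\<bar>f i\<bar> \<le> (\<Sum>i\<le>N. \<bar>f i\<bar>)" by (intro member_le_sum) auto
    with that show "kz N I (Suc i) m" by (intro f[rule_format]) (simp add: M_def)
  qed
  then have "ev_const ((dl ^^ Suc N) (hf N I)) 0" unfolding ev_const_def by blast
  from ev_poly_exists[OF this] obtain P where P: "ev_poly (hf N I) P" by (rule exE)
  with hilbert_poly_eq[OF gI P] show ?thesis by simp
qed

text \<open>\<open>kz\<close> mentions no resolution, which makes the choice hidden in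
  \<open>tor_dim\<close> immaterial for its vanishing.\<close>

lemma tor_dim_kz:
  fixes I :: "'k::field mpoly set"
  assumes gI: "gideal N I" shows "tor_dim N I (Suc i) m = 0 \<longleftrightarrow> kz N I (Suc i) m"
proof -
  interpret gres N I "SOME F. graded_free_resolution N I F"
    by standard (rule gI, rule someI_ex[OF graded_free_resolution_exists[OF gI]])
  show ?thesis unfolding tor_dim_def Let_def kz_betti ..
qed

lemma single_0_power: "sng 0 (c :: 'k::comm_ring_1) ^ n = (sng 0 (c ^ n) :: 'k mpoly)"
  by (induction n) (simp_all add: mult_single)

lemma single_0_prod: "(\<Prod>i\<in>A. sng 0 (f i)) = (sng 0 (\<Prod>i\<in>A. f i :: 'k::comm_ring_1) :: 'k mpoly)"
  by (induction A rule: infinite_finite_induct) (simp_all add: mult_single)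

text \<open>As a substitution of constants, evaluation inherits multiplicativity from
  \<open>psub\<close> and \<open>const_coeff\<close>.\<close>

lemma poly_eval_psub: "poly_eval v p = const_coeff (psub (\<lambda>i. sng 0 (v i)) p)"
  unfolding poly_eval_def psub_def msub_def const_coeff_sum
  by (simp add: single_0_power single_0_prod const_coeff_mult)

lemma poly_eval_zero: "poly_eval v 0 = 0" by (simp add: poly_eval_def)

lemma poly_eval_diff: "poly_eval v (p - q) = poly_eval v p - poly_eval v q"
  unfolding poly_eval_psub additive.diff[OF additive_psub] const_coeff_diff ..

lemma poly_eval_mult: "poly_eval v (p * q) = poly_eval v p * poly_eval v q"
  unfolding poly_eval_psub psub_mult const_coeff_mult ..

lemma vanishing_ideal_cmp:
  fixes X :: "(nat \<Rightarrow> 'k::field) set set"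
  shows "vanishing_ideal N X = {f \<in> forms {..N} UNIV. \<forall>m. \<forall>P\<in>X. \<forall>v\<in>P. poly_eval v (cmp m f) = 0}"
proof (intro equalityI subsetI)
  fix f assume f: "f \<in> vanishing_ideal N X"
  have "poly_eval v (cmp m f) = 0" if "P \<in> X" "v \<in> P" for m P v
  proof (cases "m < 0")
    case True then show ?thesis by (simp add: cmp_neg poly_eval_zero)
  next
    case False
    have "hom_component (nat m) f \<in> ideal_sections N X (nat m)" using f by (simp add: vanishing_ideal_def)
    with that False show ?thesis by (simp add: ideal_sections_def vanishes_at_def hom_component_cmp)
  qed
  with f show "f \<in> {f \<in> forms {..N} UNIV. \<forall>m. \<forall>P\<in>X. \<forall>v\<in>P. poly_eval v (cmp m f) = 0}"
    by (simp add: vanishing_ideal_def poly_ring_forms)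
next
  fix f :: "'k mpoly" assume f: "f \<in> {f \<in> forms {..N} UNIV. \<forall>m. \<forall>P\<in>X. \<forall>v\<in>P. poly_eval v (cmp m f) = 0}"
  then have "cmp (int m) f \<in> {p \<in> poly_ring N. homogeneous p (int m)}" for m
    unfolding forms_homogeneous by (auto intro: cmp_forms)
  with f show "f \<in> vanishing_ideal N X"
    by (auto simp: vanishing_ideal_def ideal_sections_def vanishes_at_def hom_component_cmp poly_ring_forms)
qed

lemma gideal_vanishing_ideal:
  fixes X :: "(nat \<Rightarrow> 'k::field) set set"
  shows "gideal N (vanishing_ideal N X)"
proof -
  let ?I = "vanishing_ideal N X"
  have sg: "subgrp ?I"
    unfolding vanishing_ideal_cmp subgrp_def by (auto simp: poly_eval_diff poly_eval_zero cmp.diff cmp.zero intro: formsI)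
  have hom: "a * f \<in> ?I" if a: "a \<in> fP N b" and f: "f \<in> ?I" for a f b
  proof -
    have fU: "f \<in> forms {..N} UNIV" using f by (simp add: vanishing_ideal_cmp)
    have "cmp m (a * f) = a * cmp (m - b) f" for m using cmp_mult[OF a fU, of "m - b"] by simp
    with f forms_U_mult[OF forms_UNIV[OF a] fU] show ?thesis
      by (simp add: vanishing_ideal_cmp poly_eval_mult)
  qed
  show ?thesis unfolding gideal_def
  proof (intro conjI ballI allI)
    show "?I \<subseteq> poly_ring N" by (auto simp: vanishing_ideal_def)
    show "subgrp ?I" by (rule sg)
    fix f assume f: "f \<in> ?I"
    have fU: "f \<in> forms {..N} UNIV" using f by (simp add: vanishing_ideal_cmp)
    show "cmp m f \<in> ?I" for m
      using f forms_UNIV[OF cmp_forms[OF fU]] cmp_forms_if[OF cmp_forms[OF fU]]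
      by (auto simp: vanishing_ideal_cmp poly_eval_zero)
    fix a :: "'k mpoly" assume a: "a \<in> poly_ring N"
    then have aU: "a \<in> forms {..N} UNIV" by (simp add: poly_ring_forms)
    have "(\<Sum>b\<in>degs a. cmp b a * f) \<in> ?I" by (rule subgrp_sum[OF sg]) (rule hom[OF cmp_forms[OF aU] f])
    then show "a * f \<in> ?I" using sum_cmp[OF finite_degs order_refl, of a] by (simp add: sum_distrib_right[symmetric])
  qed
qed

lemma sum_mcf_binomial: "d \<ge> 1 \<Longrightarrow> (\<Sum>a<d. int (mcf e a)) = int ((d - 1 + e) choose e)"
  using sum_mcf[of e d] mcf_binomial[of e "d - 1"] by (simp flip: of_nat_sum)

theorem corollary3p4:
  fixes X :: "(nat \<Rightarrow> 'k::{alg_closed_field, field_char_0}) set set"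
    and n e d :: nat
  assumes "algebraic_set (n + e) X"
    and "nondegenerate (n + e) X"
    and "proj_dim (n + e) X = int n"
    and "e \<ge> 1"
    and "d \<ge> 2"
    and "property_N (n + e) X d e"
  shows "proj_degree (n + e) X \<le> of_nat ((d - 1 + e) choose e) \<and>
    (proj_degree (n + e) X = of_nat ((d - 1 + e) choose e) \<longleftrightarrow>
      arith_CM (n + e) X \<and> linear_resolution (n + e) X d)"
proof -
  define N where "N = n + e"
  define I where "I = vanishing_ideal N X"
  define P where "P = hilbert_poly N I"
  define B where "B = (d - 1 + e) choose e"
  have nN: "n \<le> N" "N - n = e" by (simp_all add: N_def)
  have B: "(\<Sum>a<d. int (mcf e a)) = int B" using sum_mcf_binomial[of d e] assms(5) by (simp add: B_def)
  have gI: "gideal N I" unfolding I_def by (rule gideal_vanishing_ideal)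
  have evP: "ev_poly (hf N I) P" unfolding P_def by (rule ev_poly_hf[OF gI])
  have P: "P \<noteq> 0" "degree P = n"
    using assms(3) by (auto simp: proj_dim_def Let_def P_def I_def N_def split: if_splits)
  \<comment> \<open>\<open>\<delta>\<close> is the degree of \<open>X\<close> as an integer, the
    eventual value of the \<open>n\<close>-th difference.\<close>
  obtain \<delta> where \<delta>: "ev_const ((dl ^^ n) (hf N I)) \<delta>" "of_int \<delta> = fact n * coeff P n"
    using ev_poly_dlp[OF evP, of n] P(2) by auto
  have deg: "proj_degree N X = of_int \<delta>"
    using P \<delta>(2) by (simp add: proj_degree_def Let_def flip: P_def I_def)
  have "coeff P n \<noteq> 0" using P leading_coeff_neq_0[of P] by simp
  then have \<delta>0: "\<delta> \<noteq> 0" using \<delta>(2) by auto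
  \<comment> \<open>A nonzero constant in \<open>I\<close> would make \<open>R/I\<close> zero, and
    with it the Hilbert function, against \<open>\<delta> \<noteq> 0\<close>.\<close>
  have I0: "g = 0" if g: "g \<in> I" "g \<in> fP N 0" for g
  proof (rule ccontr)
    assume "g \<noteq> 0"
    have gc: "g = sng 0 (const_coeff g)" by (rule forms_0_const[OF g(2)])
    have c: "const_coeff g \<noteq> 0"
    proof
      assume "const_coeff g = 0"
      with gc have "g = sng 0 0" by simp
      with \<open>g \<noteq> 0\<close> show False by simp
    qed
    have "sng 0 (inverse (const_coeff g)) * g = sng 0 (inverse (const_coeff g) * const_coeff g)"
      by (subst (2) gc) (simp add: mult_single)
    then have "1 = sng 0 (inverse (const_coeff g)) * g" using c by simp
    also have "\<dots> \<in> I" by (rule gidealD(3)[OF gI forms_const g(1)]) simp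
    finally have one: "1 \<in> I" .
    have "p \<in> I" if "p \<in> fP N m" for p m using gidealD(3)[OF gI forms_UNIV[OF that] one] by simp
    then have "fI N I m = fP N m" for m by blast
    then have "hf N I m = 0" for m by (simp add: hf_def)
    then have "(dl ^^ n) (hf N I) m = 0" for m by (simp add: dlp_binomial)
    then have "ev_const ((dl ^^ n) (hf N I)) 0" by (simp add: ev_const_def)
    with ev_const_unique[OF \<delta>(1)] \<delta>0 show False by simp
  qed
  have betti: "betti N X (Suc i) j = 0 \<longleftrightarrow> kz N I (Suc i) (int (Suc i) + j)" for i j
    unfolding betti_def I_def[symmetric] by (rule tor_dim_kz[OF gI])
  have lin: "linear_resolution N X d \<longleftrightarrow> (\<forall>i m. m \<noteq> int i + int d \<longrightarrow> kz N I (Suc i) m)"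
  proof
    assume L: "linear_resolution N X d"
    show "\<forall>i m. m \<noteq> int i + int d \<longrightarrow> kz N I (Suc i) m"
    proof (intro allI impI)
      fix i m assume "m \<noteq> int i + int d"
      then have "m - int (Suc i) \<noteq> int d - 1" by simp
      with L have "betti N X (Suc i) (m - int (Suc i)) = 0" unfolding linear_resolution_def by simp
      then show "kz N I (Suc i) m" unfolding betti by simp
    qed
  next
    assume K: "\<forall>i m. m \<noteq> int i + int d \<longrightarrow> kz N I (Suc i) m"
    show "linear_resolution N X d" unfolding linear_resolution_def
    proof (intro allI impI)
      fix i :: nat and j assume "1 \<le> i" "j \<noteq> int d - 1"
      then obtain i' where i: "i = Suc i'" by (cases i) auto
      have "int (Suc i') + j \<noteq> int i' + int d" using \<open>j \<noteq> int d - 1\<close> by simp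
      with K show "betti N X i j = 0" unfolding i betti by blast
    qed
  qed
  have CM: "arith_CM N X \<longleftrightarrow> quotient_depth N I = enat (Suc n)"
  proof -
    have "proj_dim N X = int n" using assms(3) by (simp add: N_def)
    moreover have "nat (int n + 1) = Suc n" by simp
    ultimately show ?thesis by (simp add: arith_CM_def I_def)
  qed
  \<comment> \<open>The change of coordinates needs a point off a hypersurface, hence enough
    scalars; characteristic 0 provides them.\<close>
  have "infinite (UNIV :: 'k set)" by (rule infinite_UNIV_char_0)
  from noether_normalization[OF this gI I0] obtain \<phi> \<psi> k
    where ga: "gaut N \<phi> \<psi>" and k: "k \<le> Suc N" and sop: "sop N k (\<phi> ` I)"
      and free: "\<And>m f. f \<in> \<phi> ` I \<Longrightarrow> f \<in> forms {..<k} {m} \<Longrightarrow> f = 0"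
    by blast
  interpret g: graut N \<phi> \<psi> by standard (rule ga)
  interpret s: graut N \<psi> \<phi> by standard (rule gaut_sym[OF ga])
  define J where "J = \<phi> ` I"
  have JI: "\<psi> ` J = I" by (auto simp: J_def image_image g.inv)
  have gJ: "gideal N J" unfolding J_def by (rule g.gideal[OF gI])
  have hJ: "hf N J = hf N I" unfolding J_def by (rule g.hf[OF gI])
  have kzJ: "kz N J (Suc i) m \<longleftrightarrow> kz N I (Suc i) m" for i m unfolding J_def by (rule g.kz[OF gI])
  have evJ: "ev_const ((dl ^^ n) (hf N J)) \<delta>" unfolding hJ by (rule \<delta>(1))
  \<comment> \<open>The dimension of \<open>X\<close> fixes how many variables remain after
    normalization.\<close>
  have "k = Suc n" by (rule sop_dimension[OF gJ k sop[folded J_def] free[folded J_def] evJ \<delta>0])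
  with sop have sopJ: "sop N (Suc n) J" by (simp add: J_def)
  have J0: "f = 0" if f: "f \<in> J" "f \<in> fP N 0" for f
  proof -
    obtain h where h: "h \<in> I" "f = \<phi> h" using f(1) unfolding J_def by blast
    have "\<psi> f = h" by (simp add: h(2) g.inv)
    with g.forms'[OF f(2)] have "h \<in> fP N 0" by simp
    from I0[OF h(1) this] show ?thesis by (simp add: h(2) g.zero)
  qed
  \<comment> \<open>Tor and Koszul homology were matched in positive homological degrees, and
    \<open>e \<ge> 1\<close> puts \<open>e\<close> among them.\<close>
  obtain e' where e': "e = Suc e'" using assms(4) by (cases e) auto
  have "kz N J e (int e + j)" if "j \<ge> int d" for j
  proof -
    have "betti N X e j = 0" using assms(6) that by (simp add: property_N_def N_def)
    then show ?thesis unfolding e' betti kzJ .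
  qed
  from kz_cov[OF gJ sopJ nN(1) nN(2)[symmetric] this] have cov: "cov N (Suc n) J (int d)" .
  from multiplicity_bound[OF gJ cov nN(1) evJ] have le: "\<delta> \<le> int B" unfolding nN(2) B .
  have "\<delta> = int B \<longleftrightarrow> arith_CM N X \<and> linear_resolution N X d"
  proof
    assume eq: "\<delta> = int B"
    have ev': "ev_const ((dl ^^ n) (hf N J)) (\<Sum>a<d. int (mcf (N - n) a))"
      unfolding nN(2) B using evJ eq by simp
    note ext = extremal_multiplicity[OF gJ cov nN(1) ev' J0]
    have "linear_resolution N X d" unfolding lin kzJ[symmetric] using ext(2) by blast
    moreover have "quotient_depth N I = enat (Suc n)"
      unfolding quotient_depth_def
    proof (rule antisym)
      show "(SUP fs\<in>{fs. regular_sequence N I fs}. enat (length fs)) \<le> enat (Suc n)"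
      proof (rule SUP_least)
        fix fs assume "fs \<in> {fs. regular_sequence N I fs}"
        then have "regular_sequence N J (map \<phi> fs)" unfolding J_def by (intro g.regular_sequence) simp
        from regular_sequence_bound[OF gJ sopJ nN(1) J0 this] show "enat (length fs) \<le> enat (Suc n)" by simp
      qed
      \<comment> \<open>The variables pulled back along the change of coordinates are
        \<open>n + 1\<close> linear forms regular on the original \<open>R/I\<close>.\<close>
      have "regular_sequence N I (map \<psi> (map Xv [0..<Suc n]))"
        using s.regular_sequence[OF ext(1)] unfolding JI .
      then have "enat (length (map \<psi> (map Xv [0..<Suc n]))) \<le> (SUP fs\<in>{fs. regular_sequence N I fs}. enat (length fs))"
        by (intro SUP_upper) simp
      then show "enat (Suc n) \<le> (SUP fs\<in>{fs. regular_sequence N I fs}. enat (length fs))" by simp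
    qed
    ultimately show "arith_CM N X \<and> linear_resolution N X d" unfolding CM by blast
  next
    assume b: "arith_CM N X \<and> linear_resolution N X d"
    \<comment> \<open>Depth is a supremum of lengths; if all lengths were at most \<open>n\<close>,
      the supremum would be too.\<close>
    have "\<exists>fs. regular_sequence N I fs \<and> Suc n \<le> length fs"
    proof (rule ccontr)
      assume "\<not> ?thesis"
      then have "length fs \<le> n" if "regular_sequence N I fs" for fs using that by (meson not_less_eq_eq)
      then have "quotient_depth N I \<le> enat n" unfolding quotient_depth_def by (intro SUP_least) simp
      with b show False unfolding CM by simp
    qed
    then obtain fs where fs: "regular_sequence N I fs" "Suc n \<le> length fs" by blast
    have kzI: "kz N I (Suc i) m" if "m \<noteq> int i + int d" for i m using b that unfolding lin by blast
    have "d \<ge> 1" using assms(5) by simp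
    from linear_strand_multiplicity[OF gI I0 N_def this fs kzI \<delta>(1)] show "\<delta> = int B" unfolding B .
  qed
  moreover have c: "(of_nat B :: rat) = of_int (int B)" by simp
  ultimately show ?thesis using le unfolding N_def[symmetric] B_def[symmetric] deg c of_int_le_iff of_int_eq_iff by blast
qed

end
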